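(* Let $\gamma\in W^{1,\infty}(\mathbb{R}^2)$ with $\gamma(x')\in(-1,0)$ for all $x'$. There exists a constant $\varepsilon^{(3)}\in(0,1)$ depending on $\|\gamma\|_{W^{1,\infty}(\mathbb{R}^2)}$ such that for all $\varepsilon\in(0,\varepsilon^{(3)}]$ and $r\in[\varepsilon/\varepsilon^{(3)},1]$, any weak solution $u^\varepsilon\in H^1(B^\varepsilon_{1,+}(0))^3$ of the Stokes problem $$-\Delta u^\varepsilon+\nabla p^\varepsilon=0,\quad\nabla\cdot u^\varepsilon=0\ \text{ in }B^\varepsilon_{1,+}(0),\qquad u^\varepsilon=0\ \text{ on }\Gamma^\varepsilon_1(0)$$ satisfies $$\Big(\frac{1}{|B^\varepsilon_{r,+}(0)|}\int_{B^\varepsilon_{r,+}(0)}|u^\varepsilon|^2\Big)^{1/2}\le C^{(3)}r\Big(\frac{1}{|B^\varepsilon_{1,+}(0)|}\int_{B^\varepsilon_{1,+}(0)}|u^\varepsilon|^2\Big)^{1/2},$$ where $C^{(3)}$ is independent of $\varepsilon$ and $r$ and depends on $\|\gamma\|_{W^{1,\infty}(\mathbb{R}^2)}$.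
   Context: $B^\varepsilon_{r,+}(0)=\{x\in\mathbb{R}^3: x'\in(-r,r)^2,\ \varepsilon\gamma(x'/\varepsilon)<x_3<\varepsilon\gamma(x'/\varepsilon)+r\}$, $\Gamma^\varepsilon_r(0)=\{x: x'\in(-r,r)^2,\ x_3=\varepsilon\gamma(x'/\varepsilon)\}$. A weak solution is $u^\varepsilon\in H^1(B^\varepsilon_{1,+}(0))^3$, divergence-free, with zero trace on $\Gamma^\varepsilon_1(0)$, and $\int\nabla u^\varepsilon\cdot\nabla\varphi=0$ for all divergence-free $\varphi\in C^\infty_0(B^\varepsilon_{1,+}(0))^3$. *)

theory Defs
  imports "HOL-Analysis.Analysis"
begin

definition hor :: "real^3 \<Rightarrow> real^2" where
  "hor x = (\<chi> i. if i = 1 then x $ 1 else x $ 2)"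

definition Bplus :: "real \<Rightarrow> (real^2 \<Rightarrow> real) \<Rightarrow> real \<Rightarrow> (real^3) set" where
  "Bplus \<epsilon> \<gamma> r = {x. \<bar>x $ 1\<bar> < r \<and> \<bar>x $ 2\<bar> < r \<and>
      \<epsilon> * \<gamma> ((1/\<epsilon>) *\<^sub>R hor x) < x $ 3 \<and> x $ 3 < \<epsilon> * \<gamma> ((1/\<epsilon>) *\<^sub>R hor x) + r}"

text \<open>Region below the top of B^eps_{1,+}(0), extending across the rough boundary
  Gamma^eps_1(0) down to x3 = -2; used to express the zero trace on Gamma.\<close>
definition Bext :: "real \<Rightarrow> (real^2 \<Rightarrow> real) \<Rightarrow> (real^3) set" where
  "Bext \<epsilon> \<gamma> = {x. \<bar>x $ 1\<bar> < 1 \<and> \<bar>x $ 2\<bar> < 1 \<and>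
      -2 < x $ 3 \<and> x $ 3 < \<epsilon> * \<gamma> ((1/\<epsilon>) *\<^sub>R hor x) + 1}"

definition pd :: "3 \<Rightarrow> (real^3 \<Rightarrow> real) \<Rightarrow> real^3 \<Rightarrow> real" where
  "pd j f x = deriv (\<lambda>t. f (x + t *\<^sub>R axis j 1)) 0"

definition smooth3 :: "(real^3 \<Rightarrow> real) \<Rightarrow> bool" where
  "smooth3 f \<longleftrightarrow> (\<exists>D :: 3 list \<Rightarrow> real^3 \<Rightarrow> real.
      D [] = f \<and> (\<forall>\<alpha>. continuous_on UNIV (D \<alpha>)) \<and>
      (\<forall>\<alpha> j x. ((\<lambda>t. D \<alpha> (x + t *\<^sub>R axis j 1)) has_real_derivative D (j # \<alpha>) x) (at 0)))"

definition test_fun :: "(real^3) set \<Rightarrow> (real^3 \<Rightarrow> real) \<Rightarrow> bool" where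
  "test_fun \<Omega> \<psi> \<longleftrightarrow> smooth3 \<psi> \<and> compact (closure {x. \<psi> x \<noteq> 0}) \<and> closure {x. \<psi> x \<noteq> 0} \<subseteq> \<Omega>"

definition test_vfun :: "(real^3) set \<Rightarrow> (real^3 \<Rightarrow> real^3) \<Rightarrow> bool" where
  "test_vfun \<Omega> \<phi> \<longleftrightarrow> (\<forall>k. test_fun \<Omega> (\<lambda>x. \<phi> x $ k))"

definition L2 :: "(real^3) set \<Rightarrow> (real^3 \<Rightarrow> real) \<Rightarrow> bool" where
  "L2 \<Omega> v \<longleftrightarrow> set_borel_measurable lebesgue \<Omega> v \<and>
      set_integrable lebesgue \<Omega> (\<lambda>x. (v x)\<^sup>2)"

definition weak_deriv :: "(real^3) set \<Rightarrow> 3 \<Rightarrow> (real^3 \<Rightarrow> real) \<Rightarrow> (real^3 \<Rightarrow> real) \<Rightarrow> bool" where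
  "weak_deriv \<Omega> j v g \<longleftrightarrow> (\<forall>\<psi>. test_fun \<Omega> \<psi> \<longrightarrow>
      (LINT x:\<Omega>|lebesgue. v x * pd j \<psi> x) = - (LINT x:\<Omega>|lebesgue. g x * \<psi> x))"

definition H1 :: "(real^3) set \<Rightarrow> (real^3 \<Rightarrow> real) \<Rightarrow> bool" where
  "H1 \<Omega> v \<longleftrightarrow> L2 \<Omega> v \<and> (\<forall>j. \<exists>g. L2 \<Omega> g \<and> weak_deriv \<Omega> j v g)"

text \<open>Weak solution of the Stokes problem in B^eps_{1,+}(0) with no-slip on Gamma^eps_1(0).
  G k j is the weak derivative d_j u_k.  Zero trace on Gamma: the extension by zero
  across Gamma is in H^1 of Bext.\<close>
definition weak_stokes_sol :: "real \<Rightarrow> (real^2 \<Rightarrow> real) \<Rightarrow> (real^3 \<Rightarrow> real^3) \<Rightarrow> bool" where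
  "weak_stokes_sol \<epsilon> \<gamma> u \<longleftrightarrow> (let B = Bplus \<epsilon> \<gamma> 1 in
     (\<exists>G :: 3 \<Rightarrow> 3 \<Rightarrow> real^3 \<Rightarrow> real.
        (\<forall>k. L2 B (\<lambda>x. u x $ k)) \<and>
        (\<forall>k j. L2 B (G k j) \<and> weak_deriv B j (\<lambda>x. u x $ k) (G k j)) \<and>
        (AE x in lebesgue. x \<in> B \<longrightarrow> (\<Sum>k\<in>UNIV. G k k x) = 0) \<and>
        (\<forall>k. H1 (Bext \<epsilon> \<gamma>) (\<lambda>x. if x \<in> B then u x $ k else 0)) \<and>
        (\<forall>\<phi>. test_vfun B \<phi> \<longrightarrow>
            (\<forall>x. (\<Sum>k\<in>UNIV. pd k (\<lambda>y. \<phi> y $ k) x) = 0) \<longrightarrow>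
            (LINT x:B|lebesgue. (\<Sum>k\<in>UNIV. \<Sum>j\<in>UNIV. G k j x * pd j (\<lambda>y. \<phi> y $ k) x)) = 0)))"

definition mean_L2 :: "(real^3) set \<Rightarrow> (real^3 \<Rightarrow> real^3) \<Rightarrow> real" where
  "mean_L2 S u = sqrt ((1 / measure lebesgue S) * (LINT x:S|lebesgue. (norm (u x))\<^sup>2))"

end

(*
Blow-up and compactness. A weak solution extends by zero below the graph, where it is compared with the solutions
a * max 0 (x $ 3), a $ 3 = 0, of the flat half space. A Caccioppoli estimate that does not refer to the pressure comes
from testing with the divergence of an antisymmetric matrix potential of u, cut off: the potential is a convolution of u
with kernels supported in a narrow vertical cone, so it vanishes near the graph. Interior regularity is replaced by a
mean value formula: every component is weakly biharmonic, hence equal to its convolution with one rescaled kernel KK.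
Bounded rescaled solutions over flattening graphs are therefore precompact in L^2, and their limits are solutions in the
half space. Such a limit of polynomial growth less than quadratic is linear in x $ 3 (tangential differences decay, then
a fourth derivative vanishes). A contradiction argument at the radius where the ratio of the excess to the gauge om is
maximal gives geometric decay of the excess, so the coefficients of the linear profiles stay bounded on all scales above
eps / eps3, which is the Lipschitz estimate.
*)
theory Submission
  imports Defs "HOL-Complex_Analysis.Great_Picard" "HOL-Computational_Algebra.Polynomial" "HOL-Library.Diagonal_Subsequence"
begin

section \<open>Smooth functions and partial derivatives\<close>

text \<open>The obstacle is that the flat profile does not vanish on the graph: subtracting
  \<open>a * max 0 (x $ 3)\<close> leaves a flux in a layer of height eps. Seen from radius 2^-i
  this layer has relative height eps 2^i, whence the second term of \<open>om\<close>; the first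
  term, 2^(-i/2), is a decay rate slow enough to be reached by compactness. Square roots of both
  terms have bounded sums over the admissible scales, and these control the increments of the
  coefficients a. A one-step improvement of the excess would need bounded coefficients beforehand,
  because they multiply the flux. The radius of maximal ratio N supplies this: all larger radii obey
  the same ratio, so the squared coefficients are at most a multiple of N, and after normalization
  the flux tends to zero. In L^2 mass, linear functions grow by 32 per doubling of the radius and
  quadratic ones by 128. Maximality yields growth 32 sqrt 2, which lies in between, so the blow-up
  limit must be linear. Orthogonality to the profile makes it zero, against its unit mass. The
  condition \<open>a $ 3 = 0\<close> reflects that x_3 e_3 is not solenoidal.\<close>

abbreviation Lint (binder "LL " 60) where "Lint f \<equiv> integral\<^sup>L lborel f"
abbreviation sum3 (binder "S3 " 10) where "sum3 f \<equiv> sum f UNIV"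
abbreviation AElb (binder "AE3 " 10) where "AElb P \<equiv> eventually P (ae_filter lborel)"
abbreviation evseq (binder "EV " 10) where "evseq P \<equiv> eventually P sequentially"
abbreviation lims (infix "~~>" 60) where "f ~~> l \<equiv> f \<longlonglongrightarrow> l"
abbreviation scR (infixr "*R" 75) where "a *R x \<equiv> a *\<^sub>R x"
abbreviation ind where "ind \<equiv> indicator"
abbreviation BM where "BM \<equiv> borel_measurable borel"

lemmas icong = Bochner_Integration.integral_cong[OF refl]
lemmas LLsum = Bochner_Integration.integral_sum
lemmas p2eq = power2_eq_square

abbreviation ax :: "3 => real^3" where "ax j \<equiv> axis j 1"

definition hasp :: "3 => (real^3 => real) => (real^3 => real) => bool" where
 "hasp j f f' \<longleftrightarrow> (\<forall>x. ((%t. f (x + t *R ax j)) has_real_derivative f' x) (at 0))"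

lemma hasp_pd: "hasp j f f' ==> pd j f = f'"
 unfolding hasp_def pd_def using DERIV_imp_deriv by blast

lemma hasp_line:
 assumes "hasp j f f'"
 shows "((%t. f (x + t *R ax j)) has_real_derivative f' (x + s *R ax j)) (at s)"
proof -
 have "((%t. f ((x + s *R ax j) + t *R ax j)) has_real_derivative f' (x + s *R ax j)) (at 0)"
  using assms unfolding hasp_def by blast
 then have "((%t. f (x + (t + s) *R ax j)) has_real_derivative f' (x + s *R ax j)) (at 0)"
  by (simp add: algebra_simps)
 then show ?thesis
  using DERIV_shift[of "%t. f (x + t *R ax j)" "f' (x + s *R ax j)" 0 s] by simp
qed

lemma hasp_add: "hasp j f f' ==> hasp j g g' ==> hasp j (%x. f x + g x) (%x. f' x + g' x)"
 unfolding hasp_def by (auto intro: DERIV_add)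

lemma hasp_mult: "hasp j f f' ==> hasp j g g' ==> hasp j (%x. f x * g x) (%x. f' x * g x + f x * g' x)"
 unfolding hasp_def
proof
 fix x assume a: "\<forall>x. ((%t. f (x + t *R ax j)) has_real_derivative f' x) (at 0)"
  "\<forall>x. ((%t. g (x + t *R ax j)) has_real_derivative g' x) (at 0)"
 show "((%t. f (x + t *R ax j) * g (x + t *R ax j)) has_real_derivative f' x * g x + f x * g' x) (at 0)"
  using DERIV_mult[OF a(1)[rule_format, of x] a(2)[rule_format, of x]] by (simp add: algebra_simps)
qed

lemma hasp_const: "hasp j (%x. c) (%x. 0)"
 unfolding hasp_def by simp

lemma hasp_affine:
 assumes "hasp j f f'"
 shows "hasp j (%x. f (c *R x + a)) (%x. c * f' (c *R x + a))"
 unfolding hasp_def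
proof
 fix x
 have "((%t. f ((c *R x + a) + t *R ax j)) has_real_derivative f' (c *R x + a)) (at (c * 0))"
  using assms unfolding hasp_def by simp
 moreover have "((%t::real. c * t) has_real_derivative c) (at 0)"
  by (auto intro!: derivative_eq_intros)
 ultimately have "((%t. f ((c *R x + a) + (c * t) *R ax j)) has_real_derivative f' (c *R x + a) * c) (at 0)"
  by (rule DERIV_chain2)
 then show "((%t. f (c *R (x + t *R ax j) + a)) has_real_derivative c * f' (c *R x + a)) (at 0)"
  by (simp add: algebra_simps)
qed

lemma hasp_coord: "hasp j (%x. x$i) (%x. if i = j then 1 else 0)"
 unfolding hasp_def by (auto simp: axis_def intro!: derivative_eq_intros)

lemma hasp_cong: "hasp j f f' ==> (!!x. f x = g x) ==> (!!x. f' x = g' x) ==> hasp j g g'"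
 unfolding hasp_def by simp

text \<open>The product rule turns one product into a sum of two, so a class of products is not
  closed under differentiation, but its additive closure is.\<close>

inductive_set addcl :: "(real^3 => real) set => (real^3 => real) set" for S where
 base: "f \<in> S ==> f \<in> addcl S"
| add: "f \<in> addcl S ==> g \<in> addcl S ==> (%x. f x + g x) \<in> addcl S"

text \<open>Choosing for each member of the additive closure a partial derivative that lies in the
  closure again, and iterating along a list of directions, produces the family \<open>D\<close> that
  \<open>smooth3\<close> asks for. Smoothness proofs thus need only one differentiation and no
  induction on the order.\<close>

lemma smooth3_class:
 assumes S: "!!f. f \<in> S ==> continuous_on UNIV f & (\<forall>j. \<exists>g\<in>addcl S. hasp j f g)"
  and f: "f \<in> addcl S"
 shows "smooth3 f"
proof -
 have A: "continuous_on UNIV f & (\<forall>j. \<exists>g\<in>addcl S. hasp j f g)" if "f \<in> addcl S" for f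
  using that
 proof induction
  case (base f) then show ?case using S by blast
 next
  case (add f g)
  show ?case
  proof (intro conjI allI)
   show "continuous_on UNIV (%x. f x + g x)" using add by (intro continuous_on_add) auto
   fix j
   obtain f' g' where "f' \<in> addcl S" "hasp j f f'" "g' \<in> addcl S" "hasp j g g'"
    using add by metis
   then show "\<exists>h\<in>addcl S. hasp j (%x. f x + g x) h"
    using addcl.add hasp_add by metis
  qed
 qed
 define nx where "nx j f = (SOME g. g \<in> addcl S & hasp j f g)" for j f
 have nx: "nx j f \<in> addcl S & hasp j f (nx j f)" if "f \<in> addcl S" for j f
  unfolding nx_def using A[OF that] by (metis (mono_tags, lifting) someI)
 define D where "D al = foldr nx al f" for al
 have D: "D al \<in> addcl S" for al
  by (induction al) (auto simp: D_def f nx)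
 show ?thesis unfolding smooth3_def
 proof (intro exI[of _ D] conjI allI)
  show "D [] = f" by (simp add: D_def)
  show "continuous_on UNIV (D al)" for al using A[OF D] by blast
  fix al j x
  have "D (j # al) = nx j (D al)" by (simp add: D_def)
  then show "((%t. D al (x + t *R ax j)) has_real_derivative D (j # al) x) (at 0)"
   using nx[OF D[of al], of j] unfolding hasp_def by metis
 qed
qed

lemma smooth3_imp:
 assumes "smooth3 f"
 shows "continuous_on UNIV f" "hasp j f (pd j f)" "smooth3 (pd j f)"
proof -
 obtain D where D: "D [] = f" "!!al. continuous_on UNIV (D al)"
  "!!al j x. ((%t. D al (x + t *R ax j)) has_real_derivative D (j # al) x) (at 0)"
  using assms unfolding smooth3_def by blast
 show "continuous_on UNIV f" using D(1,2) by metis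
 have h: "hasp j f (D [j])" unfolding hasp_def using D(3)[of "[]"] D(1) by simp
 then have p: "pd j f = D [j]" by (rule hasp_pd)
 then show "hasp j f (pd j f)" using h by simp
 show "smooth3 (pd j f)" unfolding smooth3_def p
 proof (intro exI[of _ "%al. D (al @ [j])"] conjI allI)
  show "continuous_on UNIV (D (al @ [j]))" for al using D(2) .
  fix al i x
  show "((%t. D (al @ [j]) (x + t *R ax i)) has_real_derivative D ((i # al) @ [j]) x) (at 0)"
   using D(3)[of "al @ [j]" x i] by simp
 qed simp
qed

lemma smooth3_step:
 assumes "continuous_on UNIV f" "!!j. \<exists>g. smooth3 g & hasp j f g"
 shows "smooth3 f"
proof (rule smooth3_class[of "insert f {g. smooth3 g}"])
 fix h assume h: "h \<in> insert f {g. smooth3 g}"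
 show "continuous_on UNIV h & (\<forall>j. \<exists>g\<in>addcl (insert f {g. smooth3 g}). hasp j h g)"
 proof (cases "h = f")
  case True then show ?thesis using assms by (blast intro: addcl.base)
 next
  case False
  then have s: "smooth3 h" using h by simp
  have "pd j h \<in> addcl (insert f {g. smooth3 g})" for j
   using smooth3_imp(3)[OF s] by (auto intro: addcl.base)
  then show ?thesis using smooth3_imp(1,2)[OF s] by blast
 qed
qed (auto intro: addcl.base)

lemma smooth3_const[simp]: "smooth3 (%x. c)"
proof -
 have "smooth3 f" if "f \<in> addcl (range (%c x. c))" for f
  using that
 proof (rule smooth3_class[rotated])
  fix f :: "real^3 => real" assume "f \<in> range (%c x. c)"
  then obtain c where f: "f = (%x. c)" by blast
  have "(%x. 0) \<in> addcl (range (%c x. c))" by (rule addcl.base) simp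
  then show "continuous_on UNIV f & (\<forall>j. \<exists>g\<in>addcl (range (%c x. c)). hasp j f g)"
   unfolding f using hasp_const[of _ c] by (intro conjI allI bexI[of _ "%x. 0"]) auto
 qed
 then show ?thesis by (simp add: addcl.base)
qed

lemma smooth3_coord[simp]: "smooth3 (%x. x$i)"
 by (rule smooth3_step) (use hasp_coord smooth3_const in \<open>auto intro!: continuous_intros exI\<close>)

lemma smooth3_add[simp, intro]:
 assumes "smooth3 f" "smooth3 g" shows "smooth3 (%x. f x + g x)"
proof (rule smooth3_class[of "{f. smooth3 f}"])
 show "(%x. f x + g x) \<in> addcl {f. smooth3 f}"
  using assms by (intro addcl.add addcl.base) auto
 fix f assume "f \<in> {f. smooth3 f}"
 then have s: "smooth3 f" by simp
 have "pd j f \<in> addcl {f. smooth3 f}" for j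
  using smooth3_imp(3)[OF s] by (auto intro: addcl.base)
 then show "continuous_on UNIV f & (\<forall>j. \<exists>g\<in>addcl {f. smooth3 f}. hasp j f g)"
  using smooth3_imp(1,2)[OF s] by blast
qed

lemma smooth3_mult[simp, intro]:
 assumes "smooth3 f" "smooth3 g" shows "smooth3 (%x. f x * g x)"
proof (rule smooth3_class[of "{%x. f x * g x |f g. smooth3 f & smooth3 g}"])
 let ?S = "{%x. f x * g x |f g. smooth3 f & smooth3 g}"
 show "(%x. f x * g x) \<in> addcl ?S"
  using assms by (intro addcl.base) auto
 fix h assume "h \<in> ?S"
 then obtain f g where h: "h = (%x. f x * g x)" and s: "smooth3 f" "smooth3 g" by blast
 have "(%x. pd j f x * g x + f x * pd j g x) \<in> addcl ?S" for j
  using s smooth3_imp(3) by (intro addcl.add addcl.base) blast+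
 moreover have "hasp j h (%x. pd j f x * g x + f x * pd j g x)" for j
  unfolding h using s smooth3_imp(2) by (intro hasp_mult) auto
 ultimately show "continuous_on UNIV h & (\<forall>j. \<exists>g\<in>addcl ?S. hasp j h g)"
  using smooth3_imp(1)[OF s(1)] smooth3_imp(1)[OF s(2)] unfolding h
  by (blast intro: continuous_on_mult)
qed

lemma smooth3_cmult[simp, intro]: "smooth3 f ==> smooth3 (%x. c * f x)"
 by (intro smooth3_mult smooth3_const)

lemma smooth3_uminus[simp, intro]: "smooth3 f ==> smooth3 (%x. - f x)"
 using smooth3_cmult[of f "-1"] by simp

lemma smooth3_diff[simp, intro]: "smooth3 f ==> smooth3 g ==> smooth3 (%x. f x - g x)"
 using smooth3_add[of f "%x. - g x"] by simp

lemma smooth3_sum[simp, intro]: "(!!i. i \<in> A ==> smooth3 (f i)) ==> smooth3 (%x. \<Sum>i\<in>A. f i x)"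
 by (induction A rule: infinite_finite_induct) auto

lemma smooth3_pd[simp, intro]: "smooth3 f ==> smooth3 (pd j f)"
 by (rule smooth3_imp(3))

lemma smooth3_affine[intro]:
 assumes "smooth3 f" shows "smooth3 (%x. f (c *R x + a))"
proof (rule smooth3_class[of "{%x. b * f (c *R x + a) |b f. smooth3 f}"])
 let ?S = "{%x. b * f (c *R x + a) |b f. smooth3 f}"
 show "(%x. f (c *R x + a)) \<in> addcl ?S"
  using assms by (intro addcl.base) (auto intro!: exI[of _ 1])
 fix h assume "h \<in> ?S"
 then obtain b f where h: "h = (%x. b * f (c *R x + a))" and s: "smooth3 f" by blast
 have "(%x. (b * c) * pd j f (c *R x + a)) \<in> addcl ?S" for j
  using s smooth3_imp(3) by (intro addcl.base) blast
 moreover have "hasp j h (%x. (b * c) * pd j f (c *R x + a))" for j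
  by (rule hasp_cong[OF hasp_mult[OF hasp_const[of j b] hasp_affine[OF smooth3_imp(2)[OF s], of j c a]]])
   (auto simp: h)
 moreover have "continuous_on UNIV h" unfolding h
  by (intro continuous_intros continuous_on_compose2[OF smooth3_imp(1)[OF s]]) auto
 ultimately show "continuous_on UNIV h & (\<forall>j. \<exists>g\<in>addcl ?S. hasp j h g)" by blast
qed

lemma pd_add: "smooth3 f ==> smooth3 g ==> pd j (%x. f x + g x) = (%x. pd j f x + pd j g x)"
 by (intro hasp_pd hasp_add smooth3_imp)
lemma pd_mult: "smooth3 f ==> smooth3 g ==> pd j (%x. f x * g x) = (%x. pd j f x * g x + f x * pd j g x)"
 by (intro hasp_pd hasp_mult smooth3_imp)
lemma pd_const[simp]: "pd j (%x. c) = (%x. 0)"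
 by (intro hasp_pd hasp_const)
lemma pd_cmult: "smooth3 f ==> pd j (%x. c * f x) = (%x. c * pd j f x)"
 using pd_mult[OF smooth3_const, of f j c] by simp
lemma pd_uminus: "smooth3 f ==> pd j (%x. - f x) = (%x. - pd j f x)"
 using pd_cmult[of f j "-1"] by simp
lemma pd_diff: "smooth3 f ==> smooth3 g ==> pd j (%x. f x - g x) = (%x. pd j f x - pd j g x)"
 using pd_add[of f "%x. - g x" j] by (simp add: pd_uminus)
lemma pd_coord: "pd j (%x. x$i) = (%x. if i = j then 1 else 0)"
 by (intro hasp_pd hasp_coord)
lemma pd_affine: "smooth3 f ==> pd j (%x. f (c *R x + a)) = (%x. c * pd j f (c *R x + a))"
 by (intro hasp_pd hasp_affine smooth3_imp)
lemma pd_sum: "(!!i. i \<in> A ==> smooth3 (f i)) ==> pd j (%x. \<Sum>i\<in>A. f i x) = (%x. \<Sum>i\<in>A. pd j (f i) x)"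
 by (induction A rule: infinite_finite_induct) (auto simp: pd_add)

lemma smooth3_cont: "smooth3 f ==> continuous_on S f"
 using smooth3_imp(1) continuous_on_subset by blast

text \<open>\<open>pd\<close> is the total operator \<open>deriv\<close> along a line, so it depends
  only on the germ of the function. This is what allows derivatives of solutions that are smooth
  only on part of the space.\<close>

lemma pd_local:
 assumes "e > 0" "!!y. y \<in> ball x e ==> f y = g y"
 shows "pd j f x = pd j g x"
proof -
 have "\<forall>\<^sub>F t in nhds (0::real). f (x + t *R ax j) = g (x + t *R ax j)"
  unfolding eventually_nhds_metric
  by (intro exI[of _ e] conjI allI impI assms) (auto simp: dist_norm norm_axis_1 assms)
 then show ?thesis unfolding pd_def by (rule deriv_cong_ev) simp
qed

lemma pd_eq_open:
 assumes "open U" "x \<in> U" "!!y. y \<in> U ==> f y = g y"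
 shows "pd j f x = pd j g x"
 using assms pd_local[of _ x f g j] by (metis open_contains_ball subsetD)

text \<open>Two mean value theorems express the second difference over a square of side h as a mixed
  derivative at an interior point, in either order of the directions. The second difference is
  symmetric in the directions, so continuity of both mixed derivatives forces them to agree as h
  shrinks.\<close>

lemma pd_commute:
 assumes "smooth3 f"
 shows "pd i (pd j f) = pd j (pd i f)"
proof (cases "i = j")
 case False
 have dd: "\<exists>s t. 0 < s & s < h & 0 < t & t < h &
  f (x + h *R ax i + h *R ax j) - f (x + h *R ax i) - f (x + h *R ax j) + f x
   = h * h * pd j (pd i f) (x + s *R ax i + t *R ax j)" if hp: "h > 0" for h x i j
 proof -
  define ph where "ph s = f ((x + h *R ax j) + s *R ax i) - f (x + s *R ax i)" for s
  have d: "(ph has_real_derivative (pd i f ((x + h *R ax j) + s *R ax i) - pd i f (x + s *R ax i))) (at s)" for s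
   unfolding ph_def by (intro DERIV_diff hasp_line smooth3_imp assms)
  obtain s where s: "0 < s" "s < h" "ph h - ph 0 = (h - 0) * (pd i f ((x + h *R ax j) + s *R ax i) - pd i f (x + s *R ax i))"
   using MVT2[OF hp, of ph "%s. pd i f ((x + h *R ax j) + s *R ax i) - pd i f (x + s *R ax i)"] d by blast
  have "((%t. pd i f ((x + s *R ax i) + t *R ax j)) has_real_derivative pd j (pd i f) ((x + s *R ax i) + t *R ax j)) (at t)" for t
   by (intro hasp_line smooth3_imp assms)
  then obtain t where t: "0 < t" "t < h" "pd i f ((x + s *R ax i) + h *R ax j) - pd i f ((x + s *R ax i) + 0 *R ax j)
   = (h - 0) * pd j (pd i f) ((x + s *R ax i) + t *R ax j)"
   using MVT2[OF hp, of "%t. pd i f ((x + s *R ax i) + t *R ax j)" "%t. pd j (pd i f) ((x + s *R ax i) + t *R ax j)"] by blast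
  have "ph h - ph 0 = h * h * pd j (pd i f) (x + s *R ax i + t *R ax j)"
   using s(3) t(3) by (simp add: algebra_simps)
  then show ?thesis using s t
   by (intro exI[of _ s] exI[of _ t]) (simp add: ph_def algebra_simps)
 qed
 show ?thesis
 proof (rule ext, rule ccontr)
  fix x assume ne: "pd i (pd j f) x ~= pd j (pd i f) x"
  define e where "e = abs(pd i (pd j f) x - pd j (pd i f) x)/2"
  have near: "\<exists>d>0. \<forall>s t. 0 < s & s < d & 0 < t & t < d --> abs(pd j (pd i f) (x + s *R ax i + t *R ax j) - pd j (pd i f) x) < e" for i j
  proof -
   have "isCont (pd j (pd i f)) x" using smooth3_imp(1)[OF smooth3_pd[OF smooth3_pd[OF assms]]] by (simp add: continuous_on_eq_continuous_at)
   moreover have "e > 0" using ne by (simp add: e_def)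
   ultimately obtain d where d: "d > 0" "!!y. dist y x < d ==> abs(pd j (pd i f) y - pd j (pd i f) x) < e"
    unfolding continuous_at_eps_delta dist_real_def by metis
   have "dist (x + s *R ax i + t *R ax j) x < d" if "0 < s" "s < d/2" "0 < t" "t < d/2" for s t
    using norm_triangle_ineq[of "s *R ax i" "t *R ax j"] that by (simp add: dist_norm)
   then show ?thesis using d by (intro exI[of _ "d/2"]) auto
  qed
  obtain c d where c: "c > 0" "!!s t. 0 < s & s < c & 0 < t & t < c ==> abs(pd j (pd i f) (x + s *R ax i + t *R ax j) - pd j (pd i f) x) < e"
   and d: "d > 0" "!!s t. 0 < s & s < d & 0 < t & t < d ==> abs(pd i (pd j f) (x + s *R ax j + t *R ax i) - pd i (pd j f) x) < e"
   using near[of i j] near[of j i] by blast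
  define h where "h = min c d"
  have h: "h > 0" "h <= c" "h <= d" using c d by (auto simp: h_def)
  obtain s t where 1: "0 < s" "s < h" "0 < t" "t < h" "f (x + h *R ax i + h *R ax j) - f (x + h *R ax i) - f (x + h *R ax j) + f x
   = h * h * pd j (pd i f) (x + s *R ax i + t *R ax j)" using dd[OF h(1)] by blast
  obtain s' t' where 2: "0 < s'" "s' < h" "0 < t'" "t' < h" "f (x + h *R ax j + h *R ax i) - f (x + h *R ax j) - f (x + h *R ax i) + f x
   = h * h * pd i (pd j f) (x + s' *R ax j + t' *R ax i)" using dd[OF h(1)] by blast
  have "h * h * pd j (pd i f) (x + s *R ax i + t *R ax j) = h * h * pd i (pd j f) (x + s' *R ax j + t' *R ax i)"
   using 1(5) 2(5) by (simp add: algebra_simps)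
  then have "pd j (pd i f) (x + s *R ax i + t *R ax j) = pd i (pd j f) (x + s' *R ax j + t' *R ax i)" using h by simp
  then show False using c(2)[of s t] d(2)[of s' t'] 1 2 h unfolding e_def by argo
 qed
qed simp

section \<open>Square integrable functions\<close>

lemma nn_integral_affine3:
 fixes f :: "real^3 => ennreal"
 assumes [measurable]: "f \<in> BM" and c: "c ~= 0"
 shows "(\<integral>\<^sup>+x. f x \<partial>lborel) = ennreal (abs(c)^3) * (\<integral>\<^sup>+x. f (t + c *R x) \<partial>lborel)"
 by (subst lborel_affine[OF c, of t])
  (simp add: nn_integral_density nn_integral_distr nn_integral_cmult)

lemma integrable_affine3:
 fixes f :: "real^3 => real"
 assumes "c ~= 0" "integrable lborel f"
 shows "integrable lborel (%x. f (t + c *R x))"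
proof -
 have [measurable]: "f \<in> BM" using assms(2) by auto
 have "(\<integral>\<^sup>+x. ennreal (norm (f x)) \<partial>lborel) = ennreal (abs(c)^3) * (\<integral>\<^sup>+x. ennreal (norm (f (t + c *R x))) \<partial>lborel)"
  by (rule nn_integral_affine3) (use assms in auto)
 moreover have "(\<integral>\<^sup>+x. ennreal (norm (f x)) \<partial>lborel) < \<infinity>"
  using assms(2) by (simp add: integrable_iff_bounded)
 ultimately have "(\<integral>\<^sup>+x. ennreal (norm (f (t + c *R x))) \<partial>lborel) < \<infinity>"
  using assms(1) by (auto simp: ennreal_mult_less_top)
 then show ?thesis by (simp add: integrable_iff_bounded)
qed

lemma integrable_affine3_iff:
 fixes f :: "real^3 => real"
 assumes "c ~= 0"
 shows "integrable lborel (%x. f (t + c *R x)) \<longleftrightarrow> integrable lborel f"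
proof
 assume "integrable lborel (%x. f (t + c *R x))"
 from integrable_affine3[OF _ this, of "1/c" "- ((1/c) *R t)"] assms
 show "integrable lborel f" by (simp add: algebra_simps)
qed (use integrable_affine3 assms in blast)

lemma integral_affine3:
 fixes f :: "real^3 => real"
 assumes c: "c ~= 0"
 shows "(LL x. f x) = abs(c)^3 * (LL x. f (t + c *R x))"
proof (cases "integrable lborel f")
 case True
 then have [measurable]: "f \<in> BM" by auto
 show ?thesis
  by (subst lborel_affine[OF c, of t]) (simp add: integral_density integral_distr)
next
 case False
 then show ?thesis using integrable_affine3_iff[OF c, of f t] by (simp add: not_integrable_integral_eq)
qed

lemma integral_shift3: "(LL x. f (x + t)) = (LL x. (f :: real^3 => real) x)"
 using integral_affine3[of 1 f t] by (simp add: add.commute)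

lemma integral_reflect3: "(LL x. f (t - x)) = (LL x. (f :: real^3 => real) x)"
 using integral_affine3[of "-1" f t] by simp

lemma integrable_shift3: "integrable lborel (f :: real^3 => real) ==> integrable lborel (%x. f (x + t))"
 using integrable_affine3[of 1 f t] by (simp add: add.commute)

definition l2 :: "(real^3 => real) => bool" where
 "l2 f \<longleftrightarrow> f \<in> BM & integrable lborel (%x. (f x)^2)"

text \<open>Functions stay global and only the square norm is localized, so that shifts, extensions
  by zero and convolutions never leave the class \<open>l2\<close>.\<close>

definition sq :: "(real^3) set => (real^3 => real) => real" where
 "sq S f = (LL x. ind S x * (f x)^2)"

lemma l2_meas[measurable_dest]: "l2 f ==> f \<in> BM"
 by (simp add: l2_def)

lemma l2_prod:
 assumes "l2 f" "l2 g" shows "integrable lborel (%x. f x * g x)"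
proof (rule Bochner_Integration.integrable_bound[of _ "%x. (f x)^2 + (g x)^2"])
 show "integrable lborel (%x. (f x)^2 + (g x)^2)" using assms by (auto simp: l2_def)
 have "abs(a * b) <= a^2 + b^2" for a b :: real
 proof -
  have "0 <= (abs(a) - abs(b))^2" by simp
  then have "2 * (abs(a) * abs(b)) <= a^2 + b^2" by (simp add: p2eq algebra_simps)
  moreover have "0 <= abs(a) * abs(b)" by simp
  ultimately show ?thesis unfolding abs_mult by linarith
 qed
 then show "AE3 x. norm (f x * g x) <= norm ((f x)^2 + (g x)^2)" by (simp add: abs_of_nonneg)
qed (use assms in \<open>auto simp: l2_def\<close>)

lemma l2_bounded_mult:
 assumes "l2 f" and [measurable]: "g \<in> BM" and b: "!!x. abs(g x) <= B"
 shows "l2 (%x. g x * f x)"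
 unfolding l2_def
proof
 have [measurable]: "f \<in> BM" using assms by (simp add: l2_def)
 show "(%x. g x * f x) \<in> BM" by measurable
 show "integrable lborel (%x. (g x * f x)^2)"
 proof (rule Bochner_Integration.integrable_bound[of _ "%x. B^2 * (f x)^2"])
  show "integrable lborel (%x. B^2 * (f x)^2)" using assms by (auto simp: l2_def)
  have "(g x)^2 <= B^2" for x using b[of x] power_mono[of "abs(g x)" B 2] by simp
  then show "AE3 x. norm ((g x * f x)^2) <= norm (B^2 * (f x)^2)"
   by (simp add: power_mult_distrib mult_right_mono)
 qed measurable
qed

lemma l2_cmult: "l2 f ==> l2 (%x. c * f x)"
 by (rule l2_bounded_mult[of f "%x. c" "abs(c)"]) auto

lemma l2_add:
 assumes "l2 f" "l2 g" shows "l2 (%x. f x + g x)"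
proof -
 have "integrable lborel (%x. (f x)^2 + 2 * (f x * g x) + (g x)^2)"
  using assms l2_prod[OF assms] by (auto simp: l2_def)
 then show ?thesis using assms by (auto simp: l2_def power2_sum algebra_simps)
qed

lemma l2_uminus: "l2 f ==> l2 (%x. - f x)"
 using l2_cmult[of f "-1"] by simp

lemma l2_diff: "l2 f ==> l2 g ==> l2 (%x. f x - g x)"
 using l2_add[of f "%x. - g x"] by (simp add: l2_uminus)

lemma l2_0[simp]: "l2 (%x. 0)" by (simp add: l2_def)

lemma l2_sum: "(!!i. i \<in> A ==> l2 (f i)) ==> l2 (%x. \<Sum>i\<in>A. f i x)"
 by (induction A rule: infinite_finite_induct) (auto intro: l2_add)

lemma l2_affine: "l2 f ==> c ~= 0 ==> l2 (%x. f (t + c *R x))"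
 unfolding l2_def using integrable_affine3[of c "%x. (f x)^2" t] by auto

lemma l2_shift: "l2 f ==> l2 (%x. f (x + t))"
 using l2_affine[of f 1 t] by (simp add: add.commute)

lemma l2_indicator: "l2 f ==> S \<in> sets borel ==> l2 (%x. ind S x * f x)"
 by (rule l2_bounded_mult[of _ _ 1]) (auto simp: indicator_def)

lemma l2_cont:
 assumes f: "continuous_on UNIV f" and b: "!!x. r < norm x ==> f x = 0"
 shows "l2 f"
 unfolding l2_def
proof
 show "f \<in> BM" using f by (rule borel_measurable_continuous_onI)
 have "integrable lborel (%x. ind (cball 0 r) x *R (f x)^2)"
  by (intro borel_integrable_compact compact_cball continuous_intros continuous_on_subset[OF f]) auto
 moreover have "(%x. ind (cball 0 r) x *R (f x)^2) = (%x. (f x)^2)"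
  using b by (auto simp: indicator_def fun_eq_iff not_le)
 ultimately show "integrable lborel (%x. (f x)^2)" by simp
qed

lemma integrable_cont:
 fixes f :: "real^3 => real"
 assumes f: "continuous_on UNIV f" and b: "!!x. r < norm x ==> f x = 0"
 shows "integrable lborel f"
proof -
 have "integrable lborel (%x. ind (cball 0 r) x *R f x)"
  by (intro borel_integrable_compact compact_cball continuous_on_subset[OF f]) auto
 moreover have "(%x. ind (cball 0 r) x *R f x) = f"
  using b by (auto simp: indicator_def fun_eq_iff not_le)
 ultimately show ?thesis by simp
qed

lemma l2_indicator_bounded:
 assumes "S \<in> sets borel" "bounded S" shows "l2 (ind S)"
proof -
 obtain r where r: "!!x. x \<in> S ==> norm x <= r" using assms(2) bounded_iff by blast
 have "S \<subseteq> cball 0 r" using r by auto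
 then have "emeasure lborel S <= emeasure lborel (cball (0::real^3) r)"
  by (intro emeasure_mono) auto
 also have "... < \<infinity>" using emeasure_bounded_finite[OF bounded_cball] by auto
 finally have "emeasure lborel S < \<infinity>" .
 then have "integrable lborel (ind S :: real^3 => real)"
  using assms(1) by (intro integrable_real_indicator) auto
 moreover have "(%x. (ind S x :: real)^2) = ind S" by (auto simp: indicator_def)
 ultimately show ?thesis using assms(1) by (simp add: l2_def)
qed

lemma sq_integrable: "l2 f ==> S \<in> sets borel ==> integrable lborel (%x. ind S x * (f x)^2)"
 using l2_prod[OF l2_indicator[of f S], of f] by (simp add: p2eq mult.assoc)

lemma sq_nonneg[simp]: "0 <= sq S f"
 unfolding sq_def by (rule integral_nonneg_AE) (auto simp: indicator_def)

lemma sq_mono: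
 assumes "l2 f" "S \<in> sets borel" "T \<in> sets borel" "S \<subseteq> T" shows "sq S f <= sq T f"
 unfolding sq_def by (rule integral_mono[OF sq_integrable sq_integrable])
  (use assms in \<open>auto simp: indicator_def\<close>)

lemma sq_le:
 assumes "l2 f" "l2 g" "S \<in> sets borel" "!!x. x \<in> S ==> abs(f x) <= abs(g x)" shows "sq S f <= sq S g"
 unfolding sq_def by (rule integral_mono[OF sq_integrable sq_integrable])
  (use assms abs_le_square_iff in \<open>auto simp: indicator_def\<close>)

lemma sq_cong: "(!!x. x \<in> S ==> f x = g x) ==> sq S f = sq S g"
 unfolding sq_def by (rule Bochner_Integration.integral_cong) (auto simp: indicator_def)

lemma sq_cong_AE: "l2 f ==> l2 g ==> S \<in> sets borel ==> (AE3 x. x \<in> S --> f x = g x) ==> sq S f = sq S g"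
 unfolding sq_def by (rule integral_cong_AE) (auto simp: indicator_def l2_def)

lemma sq_cmult: "sq S (%x. c * f x) = c^2 * sq S f"
proof -
 have "sq S (%x. c * f x) = (LL x. c^2 * (ind S x * (f x)^2))"
  unfolding sq_def by (simp add: power_mult_distrib algebra_simps)
 then show ?thesis by (simp add: sq_def)
qed

lemma sq_0[simp]: "sq S (%x. 0) = 0" by (simp add: sq_def)

lemma sq_add_le:
 assumes "l2 f" "l2 g" "S \<in> sets borel" shows "sq S (%x. f x + g x) <= 2 * sq S f + 2 * sq S g"
proof -
 have "sq S (%x. f x + g x) <= (LL x. 2 * (ind S x * (f x)^2) + 2 * (ind S x * (g x)^2))"
  unfolding sq_def
 proof (rule integral_mono[OF sq_integrable])
  have "(a + b)^2 <= 2 * a^2 + 2 * b^2" for a b :: real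
   using sum_squares_ge_zero[of "a-b" 0] by (simp add: p2eq algebra_simps)
  then show "ind S x * (f x + g x)^2 <= 2 * (ind S x * (f x)^2) + 2 * (ind S x * (g x)^2)" for x
   by (auto simp: indicator_def)
  show "integrable lborel (%x. 2 * (ind S x * (f x)^2) + 2 * (ind S x * (g x)^2))"
   using assms by (intro Bochner_Integration.integrable_add integrable_mult_right sq_integrable)
 qed (use assms in \<open>auto intro: l2_add\<close>)
 also have "... = 2 * sq S f + 2 * sq S g"
  unfolding sq_def using assms by (subst Bochner_Integration.integral_add) (auto intro!: integrable_mult_right sq_integrable)
 finally show ?thesis .
qed

lemma sq_diff_le:
 assumes "l2 f" "l2 g" "S \<in> sets borel" shows "sq S (%x. f x - g x) <= 2 * sq S f + 2 * sq S g"
 using sq_add_le[OF assms(1) l2_uminus[OF assms(2)] assms(3)] sq_cmult[of S "-1" g] by simp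

lemma sq_sum3_le:
 fixes f :: "3 => real^3 => real"
 assumes "!!i. l2 (f i)" "S \<in> sets borel"
 shows "sq S (%x. S3 i. f i x) <= 4 * (S3 i. sq S (f i))"
proof -
 have "sq S (%x. (f 1 x + f 2 x) + f 3 x) <= 2 * sq S (%x. f 1 x + f 2 x) + 2 * sq S (f 3)"
  by (intro sq_add_le l2_add assms)
 also have "sq S (%x. f 1 x + f 2 x) <= 2 * sq S (f 1) + 2 * sq S (f 2)"
  by (intro sq_add_le l2_add assms)
 finally have "sq S (%x. (f 1 x + f 2 x) + f 3 x) <= 2 * (2 * sq S (f 1) + 2 * sq S (f 2)) + 2 * sq S (f 3)"
  by simp
 moreover have "a <= 2 * (2 * b + 2 * c) + 2 * d ==> 0 <= d ==> a <= 4 * (b + c + d)" for a b c d :: real by argo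
 ultimately show ?thesis unfolding sum_3 using sq_nonneg by blast
qed

lemma sq_affine:
 assumes "c ~= 0"
 shows "sq S f = abs(c)^3 * sq ((%x. t + c *R x) -` S) (%x. f (t + c *R x))"
 unfolding sq_def using integral_affine3[OF assms, of "%x. ind S x * (f x)^2" t]
 by (simp add: indicator_def vimage_def)

lemma nn_bound:
 fixes f :: "real^3 => real"
 assumes [measurable]: "f \<in> BM" and "!!x. 0 <= f x"
  and "(\<integral>\<^sup>+x. ennreal (f x) \<partial>lborel) <= ennreal c" "0 <= c"
 shows "integrable lborel f" "(LL x. f x) <= c"
proof -
 have "(\<integral>\<^sup>+x. ennreal (f x) \<partial>lborel) < \<infinity>" using assms(3) by (simp add: le_less_trans)
 then show i: "integrable lborel f" using assms by (intro integrableI_nonneg) auto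
 have "ennreal (LL x. f x) <= ennreal c"
  using nn_integral_eq_integral[OF i] assms by simp
 then show "(LL x. f x) <= c" using assms(4) by simp
qed

text \<open>The integral of \<open>w * (f - t)^2\<close> is nonnegative; expand it at
  \<open>t = ?B/c\<close>. An upper bound c for the mass of w is the form in which L^1 norms of
  kernels enter.\<close>

lemma CS_weight:
 fixes w f :: "'a => real"
 assumes "integrable M w" "integrable M (%x. w x * f x)" "integrable M (%x. w x * (f x)^2)"
  and w: "!!x. 0 <= w x" and c: "(LINT x|M. w x) <= c" "c > 0"
 shows "(LINT x|M. w x * f x)^2 <= c * (LINT x|M. w x * (f x)^2)"
proof -
 let ?B = "LINT x|M. w x * f x" let ?A = "LINT x|M. w x * (f x)^2"
 define t where "t = ?B/c"
 have "0 <= (LINT x|M. w x * (f x - t)^2)" using w by (intro integral_nonneg_AE) auto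
 also have "... = (LINT x|M. w x * (f x)^2 - 2 * t * (w x * f x) + t^2 * w x)"
  by (intro Bochner_Integration.integral_cong) (auto simp: p2eq algebra_simps)
 also have "... = ?A - 2 * t * ?B + t^2 * (LINT x|M. w x)"
  using assms by simp
 also have "... <= ?A - 2 * t * ?B + t^2 * c" using c by (simp add: mult_left_mono)
 also have "... = ?A - ?B^2/c" using c unfolding t_def by (simp add: p2eq field_simps)
 finally show ?thesis using c by (simp add: field_simps)
qed

lemma CS:
 assumes "l2 f" "l2 g"
 shows "(LL x. f x * g x)^2 <= (LL x. (f x)^2) * (LL x. (g x)^2)"
proof -
 let ?A = "LL x. (f x)^2" let ?B = "LL x. f x * g x" let ?C = "LL x. (g x)^2"
 have i: "integrable lborel (%x. (f x)^2)" "integrable lborel (%x. (g x)^2)" "integrable lborel (%x. f x * g x)"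
  using assms l2_prod by (auto simp: l2_def)
 have q: "0 <= ?A - 2 * t * ?B + t^2 * ?C" for t
 proof -
  have "0 <= (LL x. (f x - t * g x)^2)" by (intro integral_nonneg_AE) auto
  also have "... = (LL x. (f x)^2 - 2 * t * (f x * g x) + t^2 * (g x)^2)"
   by (intro Bochner_Integration.integral_cong) (auto simp: p2eq algebra_simps)
  also have "... = ?A - 2 * t * ?B + t^2 * ?C" using i by simp
  finally show ?thesis .
 qed
 have C0: "0 <= ?C" by (intro integral_nonneg_AE) auto
 show ?thesis
 proof (cases "?C = 0")
  case True
  have "?B = 0"
  proof (rule ccontr)
   assume "?B ~= 0"
   then have "2 * ((?A + 1)/(2 * ?B)) * ?B = ?A + 1" by simp
   then show False using q[of "(?A + 1)/(2 * ?B)"] True by simp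
  qed
  then show ?thesis using True by simp
 next
  case False
  then have "?C > 0" using C0 by (simp only: less_le) simp
  then show ?thesis using q[of "?B/?C"] by (simp add: p2eq field_simps)
 qed
qed

section \<open>Convolution with smooth kernels\<close>

definition csm :: "(real^3 => real) => bool" where
 "csm k \<longleftrightarrow> smooth3 k & (\<exists>r. \<forall>x. r < norm x --> k x = 0)"

lemma csm_smooth: "csm k ==> smooth3 k" by (simp add: csm_def)

lemma csm_cont: "csm k ==> continuous_on S k" by (simp add: csm_def smooth3_cont)

lemma csm_l2: "csm k ==> l2 k"
 unfolding csm_def by (elim conjE exE, rule l2_cont, erule smooth3_imp(1), blast)

lemma csm_integrable: "csm k ==> integrable lborel k"
 unfolding csm_def by (elim conjE exE, rule integrable_cont, erule smooth3_imp(1), blast)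

lemma csm_pd:
 assumes "csm k" shows "csm (pd j k)"
proof -
 obtain r where r: "!!x. r < norm x ==> k x = 0" using assms unfolding csm_def by blast
 have "pd j k x = 0" if "r < norm x" for x
 proof -
  have "open {x::real^3. r < norm x}" by (intro open_Collect_less continuous_intros)
  then have "pd j k x = pd j (%x. 0) x"
   by (rule pd_eq_open) (use that r in auto)
  then show ?thesis by simp
 qed
 then show ?thesis using assms unfolding csm_def by auto
qed

lemma csm_mult: "csm k ==> smooth3 f ==> csm (%x. k x * f x)"
 unfolding csm_def by auto
lemma csm_mult2: "csm k ==> smooth3 f ==> csm (%x. f x * k x)"
 unfolding csm_def by auto
lemma csm_add:
 assumes "csm f" "csm g" shows "csm (%x. f x + g x)"
proof -
 obtain r s where "!!x. r < norm x ==> f x = 0" "!!x. s < norm x ==> g x = 0"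
  using assms unfolding csm_def by metis
 then have "\<forall>x. max r s < norm x --> f x + g x = 0" by auto
 then show ?thesis using assms unfolding csm_def by blast
qed
lemma csm_cmult: "csm k ==> csm (%x. c * k x)" by (rule csm_mult2) auto
lemma csm_0[simp]: "csm (%x. 0)" by (simp add: csm_def)
lemma csm_diff: "csm f ==> csm g ==> csm (%x. f x - g x)"
 using csm_add[of f "%x. -1 * g x"] csm_cmult[of g "-1"] by simp
lemma csm_sum: "(!!i. i \<in> A ==> csm (f i)) ==> csm (%x. \<Sum>i\<in>A. f i x)"
 by (induction A rule: infinite_finite_induct) (auto intro: csm_add)

lemma csm_affine:
 assumes "csm k" "c ~= 0" shows "csm (%x. k (c *R x + a))"
proof -
 obtain r where r: "!!x. r < norm x ==> k x = 0" using assms unfolding csm_def by blast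
 have "k (c *R x + a) = 0" if "(r + norm a)/abs(c) < norm x" for x
 proof (rule r)
  have "r + norm a < abs(c) * norm x" using that assms(2) by (simp add: field_simps)
  also have "abs(c) * norm x <= norm (c *R x + a) + norm a"
   using norm_triangle_ineq4[of "c *R x + a" a] by simp
  finally show "r < norm (c *R x + a)" by simp
 qed
 then show ?thesis using assms unfolding csm_def by blast
qed

lemma csm_refl: "csm k ==> csm (%y. k (x - y))"
 using csm_affine[of k "-1" x] by simp

lemma csm_bounded:
 assumes "csm k" obtains B where "B > 0" "!!x. abs(k x) <= B"
proof -
 obtain r where r: "!!x. r < norm x ==> k x = 0" using assms unfolding csm_def by blast
 have "compact (k ` cball 0 r)"
  by (intro compact_continuous_image csm_cont assms compact_cball)
 then obtain B where B: "!!y. y \<in> k ` cball 0 r ==> norm y <= B"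
  using compact_imp_bounded bounded_iff by metis
 have "abs(k x) <= max B 1" for x
 proof (cases "r < norm x")
  case True then show ?thesis using r by simp
 next
  case False then have "k x \<in> k ` cball 0 r" by simp
  then show ?thesis using B[of "k x"] by simp
 qed
 then show ?thesis using that[of "max B 1"] by simp
qed

lemma test_fun_csm:
 assumes "test_fun Om ps" shows "csm ps"
proof -
 have "bounded {x. ps x ~= 0}"
  using assms unfolding test_fun_def using bounded_subset[OF compact_imp_bounded closure_subset] by blast
 then obtain r where "\<forall>x\<in>{x. ps x ~= 0}. norm x <= r" using bounded_iff by blast
 then have "\<forall>x. r < norm x --> ps x = 0" by (metis mem_Collect_eq not_less)
 then show ?thesis using assms unfolding csm_def test_fun_def by blast
qed

text \<open>A closed set S squeezed between the support and the domain avoids any computation of the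
  closure in \<open>test_fun\<close>.\<close>

lemma csm_test_fun:
 assumes "csm ps" "closed S" "{x. ps x ~= 0} \<subseteq> S" "S \<subseteq> Om"
 shows "test_fun Om ps"
proof -
 obtain r where r: "!!x. r < norm x ==> ps x = 0" using assms(1) unfolding csm_def by blast
 have "{x. ps x ~= 0} \<subseteq> cball 0 r" using r by (force simp: not_less)
 then have "bounded {x. ps x ~= 0}" using bounded_cball bounded_subset by blast
 then have "compact (closure {x. ps x ~= 0})" by (simp add: compact_closure)
 moreover have "closure {x. ps x ~= 0} \<subseteq> Om"
  using closure_minimal[OF assms(3,2)] assms(4) by blast
 ultimately show ?thesis using assms(1) by (simp add: test_fun_def csm_def)
qed

lemma test_fun_support:
 assumes "test_fun Om ps" shows "ps x ~= 0 ==> x \<in> Om"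
proof -
 assume "ps x ~= 0"
 then have "x \<in> closure {x. ps x ~= 0}" by (intro subsetD[OF closure_subset]) simp
 then show ?thesis using assms unfolding test_fun_def by (elim conjE) (erule (1) subsetD)
qed

lemma test_fun_mono: "test_fun Om ps ==> Om \<subseteq> Om' ==> test_fun Om' ps"
 unfolding test_fun_def by (elim conjE) (intro conjI, assumption+, erule (1) subset_trans)

lemma test_fun_pd:
 assumes "test_fun Om ps" shows "test_fun Om (pd j ps)"
proof (rule csm_test_fun[of _ "closure {x. ps x ~= 0}"])
 show "csm (pd j ps)" using test_fun_csm[OF assms] by (rule csm_pd)
 show "{x. pd j ps x ~= 0} \<subseteq> closure {x. ps x ~= 0}"
 proof
  fix x assume x: "x \<in> {x. pd j ps x ~= 0}"
  show "x \<in> closure {x. ps x ~= 0}"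
  proof (rule ccontr)
   assume n: "x \<notin> closure {x. ps x ~= 0}"
   define U where "U = - closure {x. ps x ~= 0}"
   have U: "open U" "x \<in> U" using n unfolding U_def by (auto simp: open_Compl)
   have z: "ps y = (%_. 0) y" if "y \<in> U" for y
    using that closure_subset[of "{x. ps x ~= 0}"] unfolding U_def by blast
   have "pd j ps x = pd j (%_. 0) x" by (rule pd_eq_open[OF U z])
   then show False using x by simp
  qed
 qed
 show "closed (closure {x. ps x ~= 0})" by (rule closed_closure)
 show "closure {x. ps x ~= 0} \<subseteq> Om" using assms unfolding test_fun_def by (elim conjE)
qed

section \<open>Convolution: differentiation and localized Young inequality\<close>

definition conv :: "(real^3 => real) => (real^3 => real) => real^3 => real" where
 "conv f k x = (LL y. k (x - y) * f y)"

lemma conv_integrable: "l2 f ==> csm k ==> integrable lborel (%y. k (x - y) * f y)"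
 by (rule l2_prod[OF csm_l2[OF csm_refl]])

lemma conv_alt: "conv f k x = (LL p. k p * f (x - p))"
 unfolding conv_def using integral_reflect3[of "%p. k p * f (x - p)" x] by simp

lemma conv_cont:
 assumes f: "l2 f" and k: "csm k" shows "continuous_on UNIV (conv f k)"
proof -
 have "isCont (conv f k) x" for x
  unfolding continuous_at_sequentially
 proof (intro allI impI)
  fix X assume X: "X ~~> x"
  obtain B where B: "B > 0" "!!x. abs(k x) <= B" using csm_bounded[OF k] by blast
  obtain r where r: "!!x. r < norm x ==> k x = 0" using k unfolding csm_def by blast
  obtain m where m: "!!n. norm (X n) <= m"
   using convergent_imp_Bseq[of X] X unfolding convergent_def Bseq_def by metis
  have fm: "f \<in> BM" using f by (simp add: l2_def)
  have km: "k \<in> BM" using csm_l2[OF k] by (simp add: l2_def)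
  show "(conv f k \<circ> X) ~~> conv f k x"
   unfolding o_def conv_def
  proof (rule integral_dominated_convergence[where w = "%y. B * (ind (cball 0 (r + m)) y * abs(f y))"])
   have "l2 (%x. abs(f x))" using f by (auto simp: l2_def)
   then show "integrable lborel (%y. B * (ind (cball 0 (r + m)) y * abs(f y)))"
    by (intro integrable_mult_right l2_prod l2_indicator_bounded) auto
   show "AE3 y. (%i. k (X i - y) * f y) ~~> k (x - y) * f y"
   proof (rule AE_I2)
    fix y
    have "isCont k (x - y)" using csm_cont[OF k, of UNIV] by (simp add: continuous_on_eq_continuous_at)
    moreover have "(%i. X i - y) ~~> x - y" by (intro tendsto_intros X)
    ultimately have "(%i. k (X i - y)) ~~> k (x - y)" by (rule isCont_tendsto_compose)
    then show "(%i. k (X i - y) * f y) ~~> k (x - y) * f y" by (intro tendsto_intros)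
   qed
   show "AE3 y. norm (k (X i - y) * f y) <= B * (ind (cball 0 (r + m)) y * abs(f y))" for i
   proof (rule AE_I2)
    fix y
    show "norm (k (X i - y) * f y) <= B * (ind (cball 0 (r + m)) y * abs(f y))"
    proof (cases "norm y <= r + m")
     case True then show ?thesis using B(2)[of "X i - y"] by (simp add: abs_mult mult_right_mono)
    next
     case False
     have "norm y <= norm (X i - y) + norm (X i)" using norm_triangle_ineq4[of "X i" "X i - y"] by simp
     then have "r < norm (X i - y)" using False m[of i] by linarith
     then show ?thesis using r B by simp
    qed
   qed
  qed (use fm km in measurable)
 qed
 then show ?thesis by (simp add: continuous_on_eq_continuous_at)
qed

lemma conv_hasp:
 assumes f: "l2 f" and k: "csm k" shows "hasp j (conv f k) (conv f (pd j k))"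
 unfolding hasp_def
proof
 fix x
 have kj: "csm (pd j k)" using k by (rule csm_pd)
 obtain B where B: "B > 0" "!!x. abs(pd j k x) <= B" using csm_bounded[OF kj] by blast
 obtain r where r: "!!x. r < norm x ==> k x = 0" using k unfolding csm_def by blast
 have fm: "f \<in> BM" using f by (simp add: l2_def)
 have km: "k \<in> BM" "pd j k \<in> BM" using csm_l2[OF k] csm_l2[OF kj] by (auto simp: l2_def)
 show "((%t. conv f k (x + t *R ax j)) has_real_derivative conv f (pd j k) x) (at 0)"
  unfolding has_field_derivative_iff tendsto_at_iff_sequentially
 proof (intro allI impI)
  fix X :: "nat => real" assume X0: "\<forall>i. X i \<in> UNIV - {0}" and X: "X ~~> 0"
  have nz: "X i ~= 0" for i using X0 by simp
  obtain m where m: "!!n. abs(X n) <= m"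
   using convergent_imp_Bseq[of X] X unfolding convergent_def Bseq_def real_norm_def by metis
  have mvt: "abs((k (z + t *R ax j) - k z)/t) <= B" if "t ~= 0" for z t
  proof -
   have d: "((%t. k (z + t *R ax j)) has_real_derivative pd j k (z + t *R ax j)) (at t)" for t
    by (intro hasp_line smooth3_imp csm_smooth k)
   have "norm (k (z + t *R ax j) - k (z + 0 *R ax j)) <= B * norm (t - 0)"
    by (rule field_differentiable_bound[of UNIV "%t. k (z + t *R ax j)"]) (use d B in auto)
   then show ?thesis using that by (simp add: field_simps)
  qed
  have eq: "(conv f k (x + X i *R ax j) - conv f k (x + 0 *R ax j))/(X i - 0)
   = (LL y. (k (x - y + X i *R ax j) - k (x - y))/X i * f y)" for i
  proof -
   have "(LL y. (k (x - y + X i *R ax j) - k (x - y))/X i * f y) =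
    (LL y. (k (x + X i *R ax j - y) * f y - k (x - y) * f y)/X i)"
    by (intro Bochner_Integration.integral_cong) (auto simp: field_simps)
   also have "... = (conv f k (x + X i *R ax j) - conv f k x)/X i"
    unfolding conv_def using conv_integrable[OF f k] by simp
   finally have A: "(LL y. (k (x - y + X i *R ax j) - k (x - y))/X i * f y) = (conv f k (x + X i *R ax j) - conv f k x)/X i" .
   show ?thesis unfolding scaleR_zero_left add_0_right diff_zero by (rule A[symmetric])
  qed
  have "(%i. LL y. (k (x - y + X i *R ax j) - k (x - y))/X i * f y) ~~> (LL y. pd j k (x - y) * f y)"
  proof (rule integral_dominated_convergence[where w = "%y. B * (ind (cball 0 (r + norm x + m)) y * abs(f y))"])
   have "l2 (%x. abs(f x))" using f by (auto simp: l2_def)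
   then show "integrable lborel (%y. B * (ind (cball 0 (r + norm x + m)) y * abs(f y)))"
    by (intro integrable_mult_right l2_prod l2_indicator_bounded) auto
   show "AE3 y. (%i. (k (x - y + X i *R ax j) - k (x - y))/X i * f y) ~~> pd j k (x - y) * f y"
   proof (rule AE_I2)
    fix y
    have "((%t. k (x - y + t *R ax j)) has_real_derivative pd j k (x - y)) (at 0)"
     using smooth3_imp(2)[OF csm_smooth[OF k]] unfolding hasp_def by blast
    then have "((%t. (k (x - y + t *R ax j) - k (x - y))/t) \<longlongrightarrow> pd j k (x - y)) (at 0)"
     unfolding has_field_derivative_iff by simp
    then have "((%t. (k (x - y + t *R ax j) - k (x - y))/t) \<circ> X) ~~> pd j k (x - y)"
     unfolding tendsto_at_iff_sequentially using X0 X by blast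
    then show "(%i. (k (x - y + X i *R ax j) - k (x - y))/X i * f y) ~~> pd j k (x - y) * f y"
     unfolding o_def by (intro tendsto_intros)
   qed
   show "AE3 y. norm ((k (x - y + X i *R ax j) - k (x - y))/X i * f y) <= B * (ind (cball 0 (r + norm x + m)) y * abs(f y))" for i
   proof (rule AE_I2)
    fix y
    show "norm ((k (x - y + X i *R ax j) - k (x - y))/X i * f y) <= B * (ind (cball 0 (r + norm x + m)) y * abs(f y))"
    proof (cases "norm y <= r + norm x + m")
     case True
     have "norm ((k (x - y + X i *R ax j) - k (x - y))/X i * f y) = abs((k (x - y + X i *R ax j) - k (x - y))/X i) * abs(f y)"
      by (simp only: real_norm_def abs_mult)
     also have "... <= B * abs(f y)" by (intro mult_right_mono mvt nz) auto
     finally show ?thesis using True by simp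
    next
     case False
     have "norm y <= norm (x - y) + norm x" using norm_triangle_ineq4[of x "x - y"] by simp
     moreover have "norm (x - y) <= norm (x - y + X i *R ax j) + abs(X i)"
      using norm_triangle_ineq4[of "x - y + X i *R ax j" "X i *R ax j"] by (simp add: norm_axis_1)
     ultimately have "r < norm (x - y + X i *R ax j)" "r < norm (x - y)" using False m[of i] by linarith+
     then show ?thesis using r B by simp
    qed
   qed
  qed (use fm km in measurable)
  then show "((%y. (conv f k (x + y *R ax j) - conv f k (x + 0 *R ax j))/(y - 0)) \<circ> X) ~~> conv f (pd j k) x"
   by (simp only: o_def eq conv_def[of f "pd j k"])
 qed
qed

lemma conv_pd: "l2 f ==> csm k ==> pd j (conv f k) = conv f (pd j k)"
 by (intro hasp_pd conv_hasp)

lemma conv_smooth: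
 assumes f: "l2 f" and k: "csm k" shows "smooth3 (conv f k)"
proof (rule smooth3_class[of "{conv f k|k. csm k}"])
 show "conv f k \<in> addcl {conv f k|k. csm k}" using k by (blast intro: addcl.base)
 fix g assume "g \<in> {conv f k|k. csm k}"
 then obtain k where g: "g = conv f k" and k: "csm k" by blast
 have "conv f (pd j k) \<in> addcl {conv f k|k. csm k}" for j using csm_pd[OF k] by (blast intro: addcl.base)
 then show "continuous_on UNIV g & (\<forall>j. \<exists>h\<in>addcl {conv f k|k. csm k}. hasp j g h)"
  unfolding g using conv_cont[OF f k] conv_hasp[OF f k] by blast
qed

lemma csm_abs_integrable: "csm k ==> integrable lborel (%x. abs(k x))"
 using csm_integrable by (rule integrable_abs)

text \<open>Schur test: Cauchy-Schwarz with weight |k| gives one factor c, exchanging the integrals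
  gives the other. T has to contain every point that is reached from S through the support of k;
  later estimates keep track of domains in this way.\<close>

lemma conv_bound:
 assumes f: "l2 f" and k: "csm k" and c: "(LL p. abs(k p)) <= c" "c > 0"
  and S[measurable]: "S \<in> sets borel" "T \<in> sets borel"
  and ST: "!!x y. x \<in> S ==> k (x - y) ~= 0 ==> y \<in> T"
 shows "integrable lborel (%x. ind S x * (conv f k x)^2)" "sq S (conv f k) <= c^2 * sq T f"
proof -
 have fm[measurable]: "f \<in> BM" using f by (simp add: l2_def)
 have km[measurable]: "k \<in> BM" using csm_l2[OF k] by (simp add: l2_def)
 have cm[measurable]: "conv f k \<in> BM"
  using conv_cont[OF f k] by (rule borel_measurable_continuous_onI)
 obtain B where B: "B > 0" "!!x. abs(k x) <= B" using csm_bounded[OF k] by blast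
 have kx: "csm (%y. k (x - y))" for x using k by (rule csm_refl)
 define g where "g y = ind T y * abs(f y)" for y
 have g: "l2 g" unfolding g_def by (intro l2_indicator) (use f in \<open>auto simp: l2_def\<close>)
 have gm[measurable]: "g \<in> BM" using g by (simp add: l2_def)
 have l2a: "l2 (%y. abs(k (x - y)))" for x using csm_l2[OF kx[of x]] by (auto simp: l2_def)
 have i2: "integrable lborel (%y. abs(k (x - y)) * (g y)^2)" for x
 proof (rule Bochner_Integration.integrable_bound[of _ "%y. B * (g y)^2"])
  show "integrable lborel (%y. B * (g y)^2)" using g by (simp add: l2_def)
  show "AE3 y. norm (abs(k (x - y)) * (g y)^2) <= norm (B * (g y)^2)"
   using B by (auto simp: abs_mult intro!: mult_right_mono)
 qed measurable
 have pw: "(conv f k x)^2 <= c * (LL y. abs(k (x - y)) * (g y)^2)" if x: "x \<in> S" for x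
 proof -
  have "abs(conv f k x) <= (LL y. abs(k (x - y) * f y))"
   unfolding conv_def by (rule integral_abs_bound)
  also have "... = (LL y. abs(k (x - y)) * g y)"
   by (rule icong) (use ST[OF x] in \<open>auto simp: g_def indicator_def abs_mult\<close>)
  finally have "(conv f k x)^2 <= (LL y. abs(k (x - y)) * g y)^2"
   by (metis abs_ge_zero power2_abs power_mono)
  also have "... <= c * (LL y. abs(k (x - y)) * (g y)^2)"
  proof (rule CS_weight)
   show "(LL y. abs(k (x - y))) <= c" using integral_reflect3[of "%p. abs(k p)" x] c by simp
  qed (use c i2 l2_prod[OF l2a g] csm_abs_integrable[OF kx] in auto)
  finally show ?thesis .
 qed
 have "(\<integral>\<^sup>+x. ennreal (ind S x * (conv f k x)^2) \<partial>lborel)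
  <= (\<integral>\<^sup>+x. (\<integral>\<^sup>+y. ennreal (c * (abs(k (x - y)) * (g y)^2)) \<partial>lborel) \<partial>lborel)"
 proof (rule nn_integral_mono)
  fix x
  have "ind S x * (conv f k x)^2 <= (LL y. c * (abs(k (x - y)) * (g y)^2))"
  proof (cases "x \<in> S")
   case True then show ?thesis using pw by simp
  next
   case False
   have "0 <= (LL y. c * (abs(k (x - y)) * (g y)^2))" using c(2) by (intro integral_nonneg_AE) auto
   then show ?thesis using False by simp
  qed
  then have "ennreal (ind S x * (conv f k x)^2) <= ennreal (LL y. c * (abs(k (x - y)) * (g y)^2))"
   by (rule ennreal_leI)
  also have "... = (\<integral>\<^sup>+y. ennreal (c * (abs(k (x - y)) * (g y)^2)) \<partial>lborel)"
   by (rule nn_integral_eq_integral[symmetric]) (use i2 c in auto)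
  finally show "ennreal (ind S x * (conv f k x)^2) <= (\<integral>\<^sup>+y. ennreal (c * (abs(k (x - y)) * (g y)^2)) \<partial>lborel)" .
 qed
 also have "... = (\<integral>\<^sup>+y. (\<integral>\<^sup>+x. ennreal (c * (abs(k (x - y)) * (g y)^2)) \<partial>lborel) \<partial>lborel)"
  by (rule lborel_pair.Fubini'[symmetric]) measurable
 also have "... <= (\<integral>\<^sup>+y. ennreal (c^2 * (g y)^2) \<partial>lborel)"
 proof (rule nn_integral_mono)
  fix y
  have ii: "integrable lborel (%x. abs(k (x - y)))"
   using integrable_shift3[OF csm_abs_integrable[OF k], of "-y"] by simp
  have "(\<integral>\<^sup>+x. ennreal (c * (abs(k (x - y)) * (g y)^2)) \<partial>lborel) = (\<integral>\<^sup>+x. ennreal ((c * (g y)^2) * abs(k (x - y))) \<partial>lborel)"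
   by (simp add: algebra_simps)
  also have "... = ennreal (LL x. (c * (g y)^2) * abs(k (x - y)))"
   by (rule nn_integral_eq_integral) (use ii c in auto)
  also have "(LL x. (c * (g y)^2) * abs(k (x - y))) = (c * (g y)^2) * (LL p. abs(k p))"
   using integral_shift3[of "%x. abs(k x)" "-y"] by simp
  also have "... <= (c * (g y)^2) * c" using c by (intro mult_left_mono) auto
  also have "... = c^2 * (g y)^2" by (simp add: p2eq)
  finally show "(\<integral>\<^sup>+x. ennreal (c * (abs(k (x - y)) * (g y)^2)) \<partial>lborel) <= ennreal (c^2 * (g y)^2)"
   by (simp add: ennreal_leI)
 qed
 also have "... = ennreal (LL y. c^2 * (g y)^2)"
  by (rule nn_integral_eq_integral) (use g in \<open>auto simp: l2_def\<close>)
 also have "(LL y. c^2 * (g y)^2) = c^2 * sq T f"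
  unfolding sq_def g_def by (simp add: power_mult_distrib) (intro disjI2 Bochner_Integration.integral_cong refl, auto simp: indicator_def)
 finally have *: "(\<integral>\<^sup>+x. ennreal (ind S x * (conv f k x)^2) \<partial>lborel) <= ennreal (c^2 * sq T f)" .
 show "integrable lborel (%x. ind S x * (conv f k x)^2)"
  by (rule nn_bound(1)[OF _ _ *]) auto
 show "sq S (conv f k) <= c^2 * sq T f" unfolding sq_def[of S]
  by (rule nn_bound(2)[OF _ _ *]) auto
qed

lemma csm_conv_l2:
 assumes f: "l2 f" and k: "csm k" shows "l2 (conv f k)"
proof -
 have "integrable lborel (%x. ind UNIV x * (conv f k x)^2)"
  by (rule conv_bound(1)[OF f k, of "(LL p. abs(k p)) + 1" UNIV UNIV])
   (auto intro: add_nonneg_pos integral_nonneg_AE)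
 moreover have "conv f k \<in> BM"
  using conv_cont[OF f k] by (rule borel_measurable_continuous_onI)
 ultimately show ?thesis by (simp add: l2_def)
qed

text \<open>Dilation normalized in L^1: integral and L^1 norm do not change, and each derivative
  costs a factor 1/s.\<close>

definition ks :: "real => (real^3 => real) => real^3 => real" where
 "ks s k p = k ((1/s) *R p)/s^3"

lemma csm_ks: "csm k ==> s > 0 ==> csm (ks s k)"
 using csm_cmult[OF csm_affine[of k "1/s" 0], of "1/s^3"] unfolding ks_def[abs_def] by simp

lemma pd_ks:
 assumes "csm k" "s > 0" shows "pd j (ks s k) = (%x. ks s (pd j k) x/s)"
proof -
 have e: "ks s k = (%x. (1/s^3) * k ((1/s) *R x + 0))" by (simp add: ks_def fun_eq_iff)
 have "smooth3 (%x. k ((1/s) *R x + 0))" by (rule smooth3_affine[OF csm_smooth[OF assms(1)]])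
 then have "pd j (ks s k) = (%x. (1/s^3) * ((1/s) * pd j k ((1/s) *R x + 0)))"
  unfolding e by (subst pd_cmult) (auto simp only: pd_affine[OF csm_smooth[OF assms(1)]])
 then show ?thesis by (simp add: ks_def)
qed

lemma integral_ks: "s > 0 ==> (LL p. ks s k p) = (LL p. k p)"
 using integral_affine3[of s "ks s k" 0] by (simp add: ks_def)

lemma abs_ks: "s > 0 ==> abs(ks s k p) = ks s (%x. abs(k x)) p"
 by (simp add: ks_def abs_mult abs_divide)

lemma l2_dom_conv:
 fixes f :: "real^3 => real" and F :: "nat => real^3 => real"
 assumes [measurable]: "f \<in> BM" "!!n. F n \<in> BM"
 and w: "integrable lborel w" and lim: "AE3 x. (%n. F n x) ~~> f x"
 and b: "!!n. AE3 x. (f x - F n x)^2 <= w x"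
 shows "(%n. LL x. (f x - F n x)^2) ~~> 0"
proof -
 have "(%n. LL x. (f x - F n x)^2) ~~> (LL x::real^3. 0)"
 proof (rule integral_dominated_convergence[where w = w])
  show "AE3 x. (%i. (f x - F i x)^2) ~~> 0"
   using lim
  proof eventually_elim
   case (elim x)
   then have "(%i. (f x - F i x)^2) ~~> (f x - f x)^2" by (intro tendsto_intros)
   then show ?case by simp
  qed
  show "AE3 x. norm ((f x - F i x)^2) <= w x" for i using b[of i] by simp
 qed (use w in measurable)
 then show ?thesis by simp
qed

text \<open>Continuous functions with compact support are dense in \<open>L^2\<close>: truncate, and use that a
 Lebesgue measurable function is an almost everywhere limit of continuous ones.\<close>
lemma l2_approx:
 assumes f: "l2 f" and e: "e > 0"
 obtains g r where "continuous_on UNIV g" "!!x. r < norm x ==> g x = 0" "sq UNIV (%x. f x - g x) < e"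
proof -
 have fm[measurable]: "f \<in> BM" using f by (simp add: l2_def)
 define cl where "cl n t = max (- real n) (min (real n) t)" for n and t :: real
 have clm[measurable]: "cl n \<in> BM" for n unfolding cl_def[abs_def] by measurable
 have clc: "continuous_on UNIV (cl n)" for n unfolding cl_def[abs_def] by (intro continuous_intros)
 have cl_b: "abs(cl n t) <= real n" for n t unfolding cl_def by auto
 define F where "F n x = ind (cball 0 (real n)) x * cl n (f x)" for n x
 have Fm[measurable]: "F n \<in> BM" for n unfolding F_def[abs_def]
  by (intro borel_measurable_times borel_measurable_indicator measurable_compose[OF fm clm]) auto
 have "(%n. LL x. (f x - F n x)^2) ~~> 0"
 proof (rule l2_dom_conv[where w = "%x. (f x)^2"])
  show "integrable lborel (%x. (f x)^2)" using f by (simp add: l2_def)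
  show "AE3 x. (%n. F n x) ~~> f x"
  proof (rule AE_I2, rule tendsto_eventually)
   fix x
   obtain N where N: "norm x + abs(f x) <= real N" using real_arch_simple by blast
   show "EV n. F n x = f x"
    unfolding eventually_sequentially
   proof (intro exI[of _ N] allI impI)
    fix n assume "N <= n"
    then have "norm x + abs(f x) <= real n" using N by linarith
    then have "norm x <= real n" "abs(f x) <= real n" using abs_ge_zero[of "f x"] norm_ge_zero[of x] by linarith+
    then show "F n x = f x" unfolding F_def cl_def by auto
   qed
  qed
  show "AE3 x. (f x - F n x)^2 <= (f x)^2" for n
  proof (rule AE_I2)
   fix x
   have "abs(f x - F n x) <= abs(f x)" unfolding F_def cl_def by (auto simp: indicator_def)
   then show "(f x - F n x)^2 <= (f x)^2" by (simp add: abs_le_square_iff)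
  qed
 qed measurable
 then have "EV n. (LL x. (f x - F n x)^2) < e/4"
  using e by (intro order_tendstoD(2)) auto
 then obtain n where n: "(LL x. (f x - F n x)^2) < e/4"
  by (auto simp: eventually_sequentially)
 have "F n \<in> borel_measurable lebesgue" using Fm[of n] by (intro measurable_completion) simp
 then have "F n measurable_on UNIV" by (rule lebesgue_measurable_imp_measurable_on) simp
 then obtain N g where g: "negligible N" "!!m. continuous_on UNIV (g m)"
  "!!x. x \<notin> N ==> (%m. g m x) ~~> F n x"
  unfolding measurable_on_def by auto
 have "N \<in> null_sets (completion lborel)" using g(1) by (simp add: negligible_iff_null_sets)
 then have "AE x in completion lborel. x \<notin> N" by (rule AE_not_in)
 then have AEN: "AE3 x. x \<notin> N" by (simp add: AE_completion_iff)
 define ph :: "real^3 => real" where "ph x = max 0 (min 1 (real n + 1 - norm x))" for x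
 define G where "G m x = ph x * cl n (g m x)" for m x
 have Gc: "continuous_on UNIV (G m)" for m
  unfolding G_def[abs_def] ph_def
  by (intro continuous_intros continuous_on_compose2[OF clc g(2)]) auto
 have Gm[measurable]: "G m \<in> BM" for m using Gc by (rule borel_measurable_continuous_onI)
 have "(%m. LL x. (F n x - G m x)^2) ~~> 0"
 proof (rule l2_dom_conv[where w = "%x. (2 * real n)^2 * (ind (cball 0 (real n + 1)) x)^2"])
  show "integrable lborel (%x. (2 * real n)^2 * (ind (cball 0 (real n + 1)) (x::real^3))^2)"
   using l2_indicator_bounded[of "cball 0 (real n + 1)"] by (intro integrable_mult_right) (auto simp: l2_def)
  show "AE3 x. (%m. G m x) ~~> F n x"
   using AEN
  proof eventually_elim
   case (elim x)
   have "isCont (cl n) (F n x)" using clc by (simp add: continuous_on_eq_continuous_at)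
   then have "(%m. ph x * cl n (g m x)) ~~> ph x * cl n (F n x)"
    by (intro tendsto_intros isCont_tendsto_compose[OF _ g(3)[OF elim]])
   moreover have "ph x * cl n (F n x) = F n x"
    unfolding ph_def F_def cl_def by (auto simp: indicator_def)
   ultimately show ?case by (simp add: G_def)
  qed
  show "AE3 x. (F n x - G m x)^2 <= (2 * real n)^2 * (ind (cball 0 (real n + 1)) x)^2" for m
  proof (rule AE_I2)
   fix x :: "real^3"
   show "(F n x - G m x)^2 <= (2 * real n)^2 * (ind (cball 0 (real n + 1)) x)^2"
   proof (cases "norm x <= real n + 1")
    case True
    have "0 <= ph x" "ph x <= 1" unfolding ph_def by auto
    then have "abs(G m x) <= 1 * real n" unfolding G_def abs_mult using cl_b by (intro mult_mono) auto
    moreover have "abs(F n x) <= real n" unfolding F_def using cl_b[of n "f x"] by (auto simp: indicator_def)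
    ultimately have "abs(F n x - G m x) <= abs(2 * real n)" by linarith
    then have "(F n x - G m x)^2 <= (2 * real n)^2" by (simp only: abs_le_square_iff)
    then show ?thesis using True by simp
   next
    case False then show ?thesis by (simp add: F_def G_def ph_def)
   qed
  qed
 qed measurable
 then have "EV m. (LL x. (F n x - G m x)^2) < e/4"
  using e by (intro order_tendstoD(2)) auto
 then obtain m where m: "(LL x. (F n x - G m x)^2) < e/4"
  by (auto simp: eventually_sequentially)
 have Gz: "G m x = 0" if "real n + 1 < norm x" for x using that by (simp add: G_def ph_def)
 have Fl: "l2 (F n)" unfolding F_def[abs_def]
  using l2_bounded_mult[OF l2_indicator_bounded[of "cball 0 (real n)"], of "%x. cl n (f x)" "real n"] cl_b
  by (simp add: mult.commute)
 have Gl: "l2 (G m)" by (rule l2_cont[OF Gc Gz])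
 have "sq UNIV (%x. (f x - F n x) + (F n x - G m x)) <= 2 * sq UNIV (%x. f x - F n x) + 2 * sq UNIV (%x. F n x - G m x)"
  by (intro sq_add_le l2_diff f Fl Gl) auto
 also have "... < e" using n m by (simp add: sq_def)
 finally have "sq UNIV (%x. f x - G m x) < e" by simp
 then show ?thesis using that[OF Gc Gz] by blast
qed

lemma ks_support:
 assumes "!!x. r < norm x ==> k x = 0" "s > 0" "s * r < norm p" shows "ks s k p = 0"
proof -
 have "r < norm ((1/s) *R p)" using assms(2,3) by (simp add: field_simps)
 then show ?thesis using assms(1) by (simp add: ks_def)
qed

text \<open>Approximation of f by a continuous g of compact support, whose uniform continuity
  handles the convolution. No sign of k is assumed, because the statement is also applied to the
  mean value kernel \<open>KK\<close>; hence the factor A from the L^1 norm.\<close>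

lemma conv_ks_tendsto:
 assumes f: "l2 f" and k: "csm k" and c: "(LL p. k p) = 1" and e: "e > 0"
 shows "\<exists>d>0. \<forall>s. 0 < s & s < d --> sq UNIV (%x. conv f (ks s k) x - f x) < e"
proof -
 define A where "A = (LL p. abs(k p)) + 1"
 have A0: "0 <= (LL p. abs(k p))" by (rule integral_nonneg_AE) auto
 then have A: "A > 0" "A >= 1" unfolding A_def by linarith+
 \<comment> \<open>The error budget: \<open>e1\<close> keeps the terms with \<open>f - g\<close>
   small even after Young's factor \<open>A^2\<close>, and \<open>e2\<close> below does the same for
   the oscillation of g, integrated over the ball of radius R.\<close>
 define e1 where "e1 = e/(16 * A^2)"
 have e1: "e1 > 0" using e A by (simp add: e1_def)
 obtain g r where g: "continuous_on UNIV g" "!!x. r < norm x ==> g x = 0" "sq UNIV (%x. f x - g x) < e1"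
  using l2_approx[OF f e1] by blast
 have gl: "l2 g" using l2_cont[OF g(1,2)] .
 obtain q0 where q0: "!!x. q0 < norm x ==> k x = 0" using k unfolding csm_def by blast
 define q where "q = max q0 1"
 have q: "k x = 0" if "q < norm x" for x using q0 that by (simp add: q_def)
 have q1: "q > 0" by (simp add: q_def)
 define R where "R = max r 0 + q"
 have R0: "R > 0" using q1 by (simp add: R_def)
 define V where "V = (LL x. (ind (cball 0 R) (x::real^3) :: real))"
 have V: "V >= 0" unfolding V_def by (rule integral_nonneg_AE) auto
 define e2 where "e2 = sqrt (e/(8 * (V + 1) * A^2))"
 have e2: "e2 > 0" using e A V by (simp add: e2_def)
 have "uniformly_continuous_on (cball 0 (R + q)) g"
  by (intro compact_uniformly_continuous continuous_on_subset[OF g(1)] compact_cball) auto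
 then obtain d0 where d0: "d0 > 0" "!!x y. x \<in> cball 0 (R + q) ==> y \<in> cball 0 (R + q) ==> dist y x < d0 ==> dist (g y) (g x) < e2"
  using e2 unfolding uniformly_continuous_on_def by meson
 define d where "d = min 1 (d0/(2 * q))"
 have d: "d > 0" using d0 q1 by (simp add: d_def)
 show ?thesis
 proof (intro exI[of _ d] conjI allI impI d)
  fix s assume s: "0 < s & s < d"
  then have s0: "s > 0" and s1: "s < 1" and "2 * (s * q) < d0" using q1 by (auto simp: d_def field_simps)
  moreover have "0 < s * q" using s0 q1 by simp
  ultimately have sq: "s * q < d0" by linarith
  have K: "csm (ks s k)" using k s0 by (rule csm_ks)
  have KA: "(LL p. abs(ks s k p)) <= A"
   unfolding abs_ks[OF s0] integral_ks[OF s0] A_def by simp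
  have Kc: "(LL p. ks s k p) = 1" using s0 by (simp add: integral_ks c)
  have Kz: "ks s k p = 0" if "s * q < norm p" for p using ks_support[of q k s p] q s0 that by simp
  have diff: "abs(conv g (ks s k) x - g x) <= A * e2 * ind (cball 0 R) x" for x
  proof -
   have ig: "integrable lborel (%p. ks s k p * g (x - p))"
    using l2_prod[OF csm_l2[OF K] l2_affine[OF gl, of "-1" x]] by simp
   have ik: "integrable lborel (%p. ks s k p)" using csm_integrable[OF K] .
   have eq: "conv g (ks s k) x - g x = (LL p. ks s k p * (g (x - p) - g x))"
   proof -
    have "(LL p. ks s k p * (g (x - p) - g x)) = (LL p. ks s k p * g (x - p) - ks s k p * g x)"
     by (simp add: right_diff_distrib)
    also have "... = conv g (ks s k) x - g x"
     unfolding conv_alt using ig ik Kc by simp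
    finally show ?thesis by simp
   qed
   have b: "abs(ks s k p * (g (x - p) - g x)) <= abs(ks s k p) * (e2 * ind (cball 0 R) x)" for p
   proof (cases "s * q < norm p")
    case True then show ?thesis using Kz by simp
   next
    case False
    then have p: "norm p <= s * q" by simp
    moreover have "s * q <= 1 * q" using s1 q1 by (intro mult_right_mono) auto
    ultimately have p: "norm p <= s * q" "norm p < d0" "norm p <= q" using sq by linarith+
    have "abs(g (x - p) - g x) <= e2 * ind (cball 0 R) x"
    proof (cases "norm x <= R")
     case True
     have "norm (x - p) <= R + q" using norm_triangle_ineq4[of x p] True p by linarith
     then have "x \<in> cball 0 (R + q)" "x - p \<in> cball 0 (R + q)" "dist (x - p) x < d0"
      using True p q1 by (simp_all add: dist_norm norm_minus_commute)
     then have "dist (g (x - p)) (g x) < e2" by (rule d0(2))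
     then show ?thesis using True by (simp add: dist_norm)
    next
     case False
     have "norm x <= norm (x - p) + norm p" using norm_triangle_ineq[of "x - p" p] by simp
     then have "r < norm x" "r < norm (x - p)" using False p q1 unfolding R_def by linarith+
     then show ?thesis using g(2) False by simp
    qed
    then show ?thesis unfolding abs_mult by (rule mult_left_mono) simp
   qed
   have "abs(conv g (ks s k) x - g x) <= (LL p. abs(ks s k p * (g (x - p) - g x)))"
    unfolding eq by (rule integral_abs_bound)
   also have "... <= (LL p. abs(ks s k p) * (e2 * ind (cball 0 R) x))"
   proof (rule integral_mono)
    show "integrable lborel (%p. abs(ks s k p * (g (x - p) - g x)))"
     using Bochner_Integration.integrable_diff[OF ig integrable_mult_left[OF ik, of "g x"]]
     by (intro integrable_abs) (simp add: right_diff_distrib)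
   qed (use b csm_abs_integrable[OF K] in auto)
   also have "... = (LL p. abs(ks s k p)) * (e2 * ind (cball 0 R) x)" by simp
   also have "... <= A * (e2 * ind (cball 0 R) x)" using KA e2 by (intro mult_right_mono) auto
   finally show ?thesis by (simp add: mult.assoc)
  qed
  have "l2 (%x. ind (cball 0 R) x)" by (intro l2_indicator_bounded) auto
  then have li: "l2 (%x. A * e2 * ind (cball 0 R) x)" by (rule l2_cmult)
  have cl: "l2 (conv g (ks s k))" "l2 (conv f (ks s k))" using csm_conv_l2 K f gl by auto
  have "sq UNIV (%x. conv g (ks s k) x - g x) <= sq UNIV (%x. A * e2 * ind (cball 0 R) x)"
   using A e2 diff by (intro sq_le li l2_diff cl gl) auto
  also have "... = (A * e2)^2 * V" unfolding sq_cmult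
   by (auto simp: sq_def V_def indicator_def intro!: Bochner_Integration.integral_cong)
  also have "... < e/4"
  proof -
   have "(A * e2)^2 * V = e/8 * (V/(V + 1))"
   proof -
    have "a * (e/(8 * W * a)) * V = e/8 * (V/W)" if "a ~= 0" "W ~= 0" for a W
     using that by (simp add: field_simps)
    moreover have "e2^2 = e/(8 * (V + 1) * A^2)" unfolding e2_def using e V A by (intro real_sqrt_pow2) auto
    ultimately show ?thesis unfolding power_mult_distrib using A V by simp
   qed
   also have "... <= e/8 * 1" using e V by (intro mult_left_mono) auto
   finally show ?thesis using e by simp
  qed
  finally have 1: "sq UNIV (%x. conv g (ks s k) x - g x) < e/4" .
  have fg: "l2 (%x. f x - g x)" by (intro l2_diff f gl)
  have "sq UNIV (conv (%x. f x - g x) (ks s k)) <= A^2 * sq UNIV (%x. f x - g x)"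
   by (rule conv_bound(2)[OF fg K KA A(1)]) auto
  also have "... <= A^2 * e1" using g(3) by (intro mult_left_mono) auto
  also have "... = e/16" using A by (simp add: e1_def)
  finally have 2: "sq UNIV (conv (%x. f x - g x) (ks s k)) <= e/16" .
  have "1 * e1 <= A^2 * e1" using A e1 by (intro mult_right_mono) auto
  then have 3: "sq UNIV (%x. f x - g x) <= e/16" using g(3) A by (simp add: e1_def)
  have dec: "conv f (ks s k) x - f x = (conv g (ks s k) x - g x) + (conv (%x. f x - g x) (ks s k) x - (f x - g x))" for x
   unfolding conv_def using conv_integrable[OF f K, of x] conv_integrable[OF gl K, of x] by (simp add: algebra_simps)
  have lc: "l2 (conv (%x. f x - g x) (ks s k))" using csm_conv_l2[OF fg K] .
  have "sq UNIV (%x. conv f (ks s k) x - f x) <= 2 * sq UNIV (%x. conv g (ks s k) x - g x) + 2 * sq UNIV (%x. conv (%x. f x - g x) (ks s k) x - (f x - g x))"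
   unfolding dec by (intro sq_add_le l2_diff fg cl gl lc) auto
  also have "... <= 2 * sq UNIV (%x. conv g (ks s k) x - g x) + 2 * (2 * sq UNIV (conv (%x. f x - g x) (ks s k)) + 2 * sq UNIV (%x. f x - g x))"
   by (intro add_left_mono mult_left_mono sq_diff_le lc fg) auto
  also have "... < e" using 1 2 3 e by argo
  finally show "sq UNIV (%x. conv f (ks s k) x - f x) < e" .
 qed
qed

section \<open>Mollifiers and divergence kernels\<close>

text \<open>The functions q(1/t) exp(-1/t) for t > 0, extended by zero, are closed under
  differentiation; the polynomial changes to s^2 (q - q')(s) with s = 1/t, which is
  \<open>bq'\<close>.\<close>

definition bq :: "real poly => real => real" where
 "bq q t = (if t > 0 then poly q (1/t) * exp (- (1/t)) else 0)"

lemma poly_exp_lim: "((%s. poly q s * exp (- s)) \<longlongrightarrow> 0) (at_top :: real filter)"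
proof -
 have "((%s. \<Sum>i\<le>degree q. coeff q i * (s^i/exp s)) \<longlongrightarrow> (\<Sum>i\<le>degree q. coeff q i * 0)) (at_top :: real filter)"
  by (intro tendsto_sum tendsto_mult tendsto_const tendsto_power_div_exp_0)
 then show ?thesis
  by (simp add: poly_altdef exp_minus sum_distrib_left divide_inverse algebra_simps)
qed

lemma bq_lim: "((%t. bq q t) \<longlongrightarrow> 0) (at 0)"
proof (rule filterlim_split_at)
 show "(bq q \<longlongrightarrow> 0) (at_left 0)"
  by (rule tendsto_eventually) (auto simp: bq_def eventually_at intro!: exI[of _ 1])
 have "((%t. poly q (inverse t) * exp (- inverse t)) \<longlongrightarrow> 0) (at_right 0)"
  by (rule filterlim_compose[OF poly_exp_lim filterlim_inverse_at_top_right])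
 then show "(bq q \<longlongrightarrow> 0) (at_right 0)"
  by (rule Lim_transform_eventually) (auto simp: bq_def eventually_at inverse_eq_divide intro!: exI[of _ 1])
qed

definition bq' :: "real poly => real poly" where
 "bq' q = [:0, 0, 1:] * (q - pderiv q)"

lemma bq_deriv: "(bq q has_real_derivative bq (bq' q) t) (at t)"
proof -
 consider "t > 0" | "t < 0" | "t = 0" by linarith
 then show ?thesis
 proof cases
  case 1
  have "((%t. poly q (1/t) * exp (- (1/t))) has_real_derivative bq (bq' q) t) (at t)"
   using 1 by (auto intro!: derivative_eq_intros DERIV_chain2[OF poly_DERIV] simp: bq_def bq'_def field_simps p2eq)
  then show ?thesis
   by (rule has_field_derivative_transform_within_open[of _ _ _ "{0<..}"]) (use 1 in \<open>auto simp: bq_def\<close>)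
 next
  case 2
  have "((%t. 0) has_real_derivative bq (bq' q) t) (at t)"
   using 2 by (simp add: bq_def)
  then show ?thesis
   by (rule has_field_derivative_transform_within_open[of _ _ _ "{..<0}"]) (use 2 in \<open>auto simp: bq_def\<close>)
 next
  case 3
  have "((%t. bq (pCons 0 q) t) \<longlongrightarrow> 0) (at 0)" by (rule bq_lim)
  then have "((%t. bq q t/t) \<longlongrightarrow> 0) (at 0)"
   by (rule Lim_transform_eventually) (auto simp: bq_def eventually_at intro!: exI[of _ 1])
  then show ?thesis using 3 by (simp add: has_field_derivative_iff bq_def)
 qed
qed

lemma bq_cont: "continuous_on UNIV (bq q)"
 using bq_deriv DERIV_isCont by (simp add: continuous_on_eq_continuous_at) blast

definition bump1 :: "real => real" where "bump1 t = bq 1 (1 - t^2)"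

lemma bump1_cont: "continuous_on UNIV bump1"
 unfolding bump1_def[abs_def] by (intro continuous_on_compose2[OF bq_cont] continuous_intros) auto

lemma bump1_nonneg: "0 <= bump1 t" by (simp add: bump1_def bq_def)
lemma bump1_zero: "1 <= abs(t) ==> bump1 t = 0"
 using power_mono[of 1 "abs(t)" 2] by (simp add: bump1_def bq_def)
lemma bump1_pos: "bump1 0 > 0" by (simp add: bump1_def bq_def)

lemma smooth3_bump1: "smooth3 (%x. bump1 (x$i))"
proof (rule smooth3_class[of "{%x. a x * bq q (1 - (x$i)^2) |a q. smooth3 a}"])
 let ?S = "{%x. a x * bq q (1 - (x$i)^2) |a q. smooth3 a}"
 have "(%x. 1 * bq 1 (1 - (x$i)^2)) \<in> ?S" by (intro CollectI exI[of _ "%x. 1"] exI[of _ 1]) simp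
 then show "(%x. bump1 (x$i)) \<in> addcl ?S"
  unfolding bump1_def by (intro addcl.base) simp
 fix h assume "h \<in> ?S"
 then obtain a q where h: "h = (%x. a x * bq q (1 - (x$i)^2))" and a: "smooth3 a" by blast
 have c: "continuous_on UNIV h" unfolding h
  by (intro continuous_intros smooth3_cont a continuous_on_compose2[OF bq_cont]) auto
 have "\<exists>g\<in>addcl ?S. hasp j h g" for j
 proof -
  have d: "hasp j (%x. bq q (1 - (x$i)^2)) (%x. (if i = j then - 2 * x$i else 0) * bq (bq' q) (1 - (x$i)^2))"
   unfolding hasp_def
  proof
   fix x
   have "((%t. 1 - ((x + t *R ax j)$i)^2) has_real_derivative (if i = j then - 2 * x$i else 0)) (at 0)"
    by (auto simp: axis_def intro!: derivative_eq_intros)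
   from DERIV_chain2[OF bq_deriv this]
   show "((%t. bq q (1 - ((x + t *R ax j)$i)^2)) has_real_derivative (if i = j then - 2 * x$i else 0) * bq (bq' q) (1 - (x$i)^2)) (at 0)"
    by (simp add: mult.commute)
  qed
  have "hasp j h (%x. pd j a x * bq q (1 - (x$i)^2) + a x * ((if i = j then - 2 * x$i else 0) * bq (bq' q) (1 - (x$i)^2)))"
   unfolding h by (intro hasp_mult smooth3_imp a d)
  then have "hasp j h (%x. pd j a x * bq q (1 - (x$i)^2) + (a x * (if i = j then - 2 * x$i else 0)) * bq (bq' q) (1 - (x$i)^2))"
   by (simp add: mult.assoc)
  moreover have "(%x. pd j a x * bq q (1 - (x$i)^2) + (a x * (if i = j then - 2 * x$i else 0)) * bq (bq' q) (1 - (x$i)^2)) \<in> addcl ?S"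
  proof (intro addcl.add addcl.base)
   show "(%x. pd j a x * bq q (1 - (x$i)^2)) \<in> ?S" using smooth3_pd[OF a] by blast
   have "smooth3 (%x. a x * (if i = j then - 2 * x$i else 0))"
    using a smooth3_mult[OF a smooth3_cmult[OF smooth3_coord, of "-2" i]] by (cases "i = j") simp_all
   then show "(%x. (a x * (if i = j then - 2 * x$i else 0)) * bq (bq' q) (1 - (x$i)^2)) \<in> ?S"
    by (intro CollectI exI[of _ "%x. a x * (if i = j then - 2 * x$i else 0)"] exI[of _ "bq' q"]) simp
  qed
  ultimately show ?thesis by blast
 qed
 then show "continuous_on UNIV h & (\<forall>j. \<exists>g\<in>addcl ?S. hasp j h g)" using c by blast
qed

definition bZ :: real where "bZ = integral {-1..1} bump1"

lemma bZ_pos: "bZ > 0"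
proof -
 have "bZ ~= 0" unfolding bZ_def
  using integral_eq_0_iff[of "-1" 1 bump1] continuous_on_subset[OF bump1_cont] bump1_nonneg bump1_pos by force
 moreover have "bZ >= 0" unfolding bZ_def by (intro integral_nonneg integrable_continuous_interval continuous_on_subset[OF bump1_cont]) (auto simp: bump1_nonneg)
 ultimately show ?thesis by simp
qed

definition nb :: "real => real" where "nb t = bump1 t/bZ"
text \<open>A smooth Heaviside function, 0 up to -1 and 1 from 1 on. The lower limit -2 is a point
  to the left of the support of \<open>nb\<close>.\<close>

definition nI :: "real => real" where "nI t = integral {-2..t} nb"

lemma nb_cont: "continuous_on S nb"
 unfolding nb_def[abs_def] using bZ_pos by (intro continuous_intros continuous_on_subset[OF bump1_cont]) auto
lemma nb_zero: "1 <= abs(t) ==> nb t = 0" by (simp add: nb_def bump1_zero)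
lemma nb_nonneg: "0 <= nb t" using bZ_pos by (simp add: nb_def bump1_nonneg)
lemma nb_pos: "0 < nb 0" using bZ_pos by (simp add: nb_def bump1_pos)

lemma nI_zero: "t <= -1 ==> nI t = 0"
 unfolding nI_def using nb_zero integral_cong[of "{-2..t}" nb "%_. 0"] by simp

lemma nI_one: assumes "1 <= t" shows "nI t = 1"
proof -
 have i: "nb integrable_on {a..b}" for a b by (intro integrable_continuous_interval nb_cont)
 have "nI t = integral {-2..-1} nb + integral {-1..t} nb" unfolding nI_def
  using assms i by (intro Henstock_Kurzweil_Integration.integral_combine[symmetric]) auto
 also have "integral {-1..t} nb = integral {-1..1} nb + integral {1..t} nb"
  using assms i by (intro Henstock_Kurzweil_Integration.integral_combine[symmetric]) auto
 also have "integral {1..t} nb = 0" using nb_zero integral_cong[of "{1..t}" nb "%_. 0"] by simp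
 also have "integral {-2..-1} nb = 0" using nb_zero integral_cong[of "{-2..-1}" nb "%_. 0"] by simp
 also have "integral {-1..1} nb = 1"
  unfolding nb_def[abs_def] using bZ_pos by (simp add: divide_inverse bZ_def)
 finally show ?thesis by simp
qed

lemma nI_deriv: "(nI has_real_derivative nb t) (at t)"
proof (cases "t < -1")
 case True
 have "((%t. 0) has_real_derivative nb t) (at t)" using True nb_zero[of t] by simp
 then show ?thesis
  by (rule has_field_derivative_transform_within_open[of _ _ _ "{..< -1}"]) (use True nI_zero in auto)
next
 case False
 have "((%u. integral {-2..u} nb) has_real_derivative nb t) (at t within {-2..t+1})"
  using False by (intro integral_has_real_derivative nb_cont) auto
 then have "((%u. integral {-2..u} nb) has_real_derivative nb t) (at t)"
  using False by (subst (asm) at_within_interior) auto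
 then show ?thesis unfolding nI_def[abs_def] .
qed

lemma smooth3_nb: "smooth3 (%x. nb (c * x$i + d))"
proof -
 have "smooth3 (%x. (1/bZ) * bump1 ((c *R x + d *R ax i)$i))"
  by (intro smooth3_cmult smooth3_affine[of "%x. bump1 (x$i)"] smooth3_bump1)
 then show ?thesis by (simp add: nb_def axis_def)
qed

lemma hasp_nI: "hasp j (%x. nI (c * x$i + d)) (%x. (if i = j then c else 0) * nb (c * x$i + d))"
 unfolding hasp_def
proof
 fix x
 have "((%t. c * (x + t *R ax j)$i + d) has_real_derivative (if i = j then c else 0)) (at 0)"
  by (auto simp: axis_def intro!: derivative_eq_intros)
 from DERIV_chain2[OF nI_deriv this]
 show "((%t. nI (c * (x + t *R ax j)$i + d)) has_real_derivative (if i = j then c else 0) * nb (c * x$i + d)) (at 0)"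
  by (simp add: mult.commute)
qed

lemma smooth3_nI: "smooth3 (%x. nI (c * x$i + d))"
proof (rule smooth3_step)
 have "continuous_on UNIV nI" using nI_deriv DERIV_isCont by (simp add: continuous_on_eq_continuous_at) blast
 then show "continuous_on UNIV (%x::real^3. nI (c * x$i + d))"
  by (rule continuous_on_compose2) (auto intro!: continuous_intros)
 show "\<exists>g. smooth3 g & hasp j (%x. nI (c * x$i + d)) g" for j
  by (intro exI[of _ "%x. (if i = j then c else 0) * nb (c * x$i + d)"] conjI hasp_nI smooth3_cmult smooth3_nb)
qed

lemma pd_nI: "pd j (%x. nI (c * x$i + d)) = (%x. (if i = j then c else 0) * nb (c * x$i + d))"
 by (rule hasp_pd[OF hasp_nI])

lemma cont_AE_zero:
 fixes f :: "real^3 => real"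
 assumes "continuous_on U f" "open U" "AE3 x. x \<in> U --> f x = 0" "x \<in> U"
 shows "f x = 0"
proof (rule ccontr)
 assume "f x ~= 0"
 let ?V = "U \<inter> f -` (- {0})"
 have o: "open ?V" by (rule continuous_open_preimage[OF assms(1,2)]) (simp add: open_Compl)
 moreover have "?V ~= {}" using assms(4) \<open>f x ~= 0\<close> by blast
 ultimately have "~negligible ?V" using open_not_negligible by blast
 moreover have "negligible ?V"
 proof -
  have "AE3 x. x \<notin> ?V" using assms(3) by auto
  then have "?V \<in> null_sets lborel" by (subst AE_iff_null_sets) (auto intro: borel_open o)
  then show ?thesis by (simp add: negligible_iff_null_sets null_sets_completionI)
 qed
 ultimately show False by blast
qed

lemma integral_pos_cont:
 fixes f :: "real^3 => real"
 assumes "continuous_on UNIV f" "integrable lborel f" "!!x. 0 <= f x" "0 < f x0"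
 shows "0 < (LL x. f x)"
proof -
 have "(LL x. f x) ~= 0"
 proof
  assume "(LL x. f x) = 0"
  then have "AE3 x. f x = 0" using assms by (subst (asm) integral_nonneg_eq_0_iff_AE) auto
  then have "f x0 = 0" using cont_AE_zero[of UNIV f x0] assms(1) by auto
  then show False using assms(4) by simp
 qed
 moreover have "0 <= (LL x. f x)" using assms by (intro integral_nonneg_AE) auto
 ultimately show ?thesis by simp
qed

lemma norm3_le: "norm (x::real^3) <= abs(x$1) + abs(x$2) + abs(x$3)"
 using norm_le_l1_cart[of x] by (simp add: sum_3)

lemma csm_box:
 assumes "smooth3 f" "!!x i. f x ~= 0 ==> abs(x$i) <= R" shows "csm f"
proof -
 have "f x = 0" if "3 * R < norm x" for x
 proof (rule ccontr)
  assume "f x ~= 0"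
  then have "abs(x$1) <= R" "abs(x$2) <= R" "abs(x$3) <= R" using assms(2) by auto
  then show False using norm3_le[of x] that by linarith
 qed
 then show ?thesis using assms(1) unfolding csm_def by blast
qed

section \<open>Mollifiers in a vertical cone and their divergence kernels\<close>

definition kap0 :: "real => real^3 => real" where
 "kap0 K p = nb (p$1) * nb (p$2) * nb (p$3 - K)"

lemma kap0_smooth: "smooth3 (kap0 K)"
proof -
 have "smooth3 (%p. nb (1 * p$1 + 0) * nb (1 * p$2 + 0) * nb (1 * p$3 + (-K)))"
  by (intro smooth3_mult smooth3_nb)
 then show ?thesis by (simp add: kap0_def[abs_def])
qed

lemma kap0_supp: assumes "kap0 K p ~= 0" shows "abs(p$1) <= 1 & abs(p$2) <= 1 & abs(p$3 - K) <= 1"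
proof -
 have "nb (p$1) ~= 0" "nb (p$2) ~= 0" "nb (p$3 - K) ~= 0" using assms unfolding kap0_def by auto
 then have "~1 <= abs(p$1)" "~1 <= abs(p$2)" "~1 <= abs(p$3 - K)" using nb_zero by blast+
 then show ?thesis by linarith
qed

lemma kap0_nonneg: "0 <= kap0 K p" unfolding kap0_def by (simp add: nb_nonneg)

lemma kap0_csm: "csm (kap0 K)"
proof (rule csm_box[OF kap0_smooth])
 fix x and i :: 3 assume "kap0 K x ~= 0"
 then have "abs(x$1) <= 1" "abs(x$2) <= 1" "abs(x$3 - K) <= 1" using kap0_supp by auto
 then have "abs(x$1) <= abs(K) + 1 & abs(x$2) <= abs(K) + 1 & abs(x$3) <= abs(K) + 1" by linarith
 then show "abs(x$i) <= abs(K) + 1" using exhaust_3[of i] by auto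
qed

definition kZ :: "real => real" where "kZ K = (LL p. kap0 K p)"

lemma kZ_pos: "kZ K > 0"
 unfolding kZ_def
proof (rule integral_pos_cont)
 show "0 < kap0 K (K *R ax 3)" by (simp add: kap0_def axis_def nb_pos)
qed (auto simp: kap0_nonneg intro: csm_cont csm_integrable kap0_csm)

text \<open>A mollifier supported in a unit box centred at \<open>K e\<^sub>3\<close>; for large \<open>K\<close> it sits in a narrow vertical cone.\<close>
definition kap :: "real => real^3 => real" where "kap K p = (1/kZ K) * kap0 K p"

lemma kap_csm: "csm (kap K)" unfolding kap_def[abs_def] by (intro csm_cmult kap0_csm)
lemma kap_nonneg: "0 <= kap K p" unfolding kap_def using kap0_nonneg kZ_pos[of K] by simp
lemma kap_supp: "kap K p ~= 0 ==> abs(p$1) <= 1 & abs(p$2) <= 1 & abs(p$3 - K) <= 1"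
 using kap0_supp[of K p] by (simp add: kap_def)
lemma kap_int: "(LL p. kap K p) = 1"
 unfolding kap_def using kZ_pos[of K] by (simp add: kZ_def[symmetric])

text \<open>A smooth solution of \<open>div N = kap - ks 2 kap\<close>, obtained by telescoping the product kernel one
 coordinate at a time.\<close>
definition nk :: "real => 3 => real^3 => real" where
 "nk K i p = (1/kZ K) *
  (if i = 1 then (nI (p$1) - nI (p$1/2)) * nb (p$2) * nb (p$3 - K)
  else if i = 2 then (nb (p$1/2)/2) * (nI (p$2) - nI (p$2/2)) * nb (p$3 - K)
  else (nb (p$1/2)/2) * (nb (p$2/2)/2) * (nI (p$3 - K) - nI (p$3/2 - K)))"

lemma nI_diff_zero: "2 <= abs(t) ==> nI t - nI (t/2) = 0"
 by (cases "t >= 0") (auto simp: nI_zero nI_one)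

lemma nb2_zero: "2 <= abs(t) ==> nb (t/2) = 0"
 by (simp add: nb_zero)

lemma nI_diffK_zero:
 assumes "K >= 1" "t <= K - 1 | 2 * K + 2 <= t" shows "nI (t - K) - nI (t/2 - K) = 0"
 using assms(2)
proof
 assume "t <= K - 1"
 then have "t - K <= -1" "t/2 - K <= -1" using assms(1) by auto
 then show ?thesis by (simp add: nI_zero)
next
 assume "2 * K + 2 <= t"
 then have "1 <= t - K" "1 <= t/2 - K" using assms(1) by auto
 then show ?thesis by (simp add: nI_one)
qed

text \<open>The height is at least \<open>K - 1\<close> while the horizontal coordinates stay below
  2, so the support lies in a cone about e_3 that narrows as K grows. Both ends of the vertical
  range come from \<open>nI_diffK_zero\<close>.\<close>

lemma nk_supp:
 assumes "K >= 1" "nk K i p ~= 0"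
 shows "abs(p$1) <= 2 & abs(p$2) <= 2 & K - 1 <= p$3 & p$3 <= 2 * K + 2"
proof -
 consider "i = 1" | "i = 2" | "i = 3" using exhaust_3 by blast
 then show ?thesis
 proof cases
  case 1
  then have "nI (p$1) - nI (p$1/2) ~= 0" "nb (p$2) ~= 0" "nb (p$3 - K) ~= 0"
   using assms(2) by (auto simp: nk_def)
  then have "~2 <= abs(p$1)" "~1 <= abs(p$2)" "~1 <= abs(p$3 - K)" using nI_diff_zero nb_zero by blast+
  then show ?thesis using assms(1) by linarith
 next
  case 2
  then have "nb (p$1/2) ~= 0" "nI (p$2) - nI (p$2/2) ~= 0" "nb (p$3 - K) ~= 0"
   using assms(2) by (auto simp: nk_def)
  then have "~2 <= abs(p$1)" "~2 <= abs(p$2)" "~1 <= abs(p$3 - K)" using nI_diff_zero nb2_zero nb_zero by blast+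
  then show ?thesis using assms(1) by linarith
 next
  case 3
  then have "nb (p$1/2) ~= 0" "nb (p$2/2) ~= 0" "nI (p$3 - K) - nI (p$3/2 - K) ~= 0"
   using assms(2) by (auto simp: nk_def)
  then have "~2 <= abs(p$1)" "~2 <= abs(p$2)" "~(p$3 <= K - 1 | 2 * K + 2 <= p$3)"
   using nI_diffK_zero[OF assms(1)] nb2_zero by blast+
  then show ?thesis by linarith
 qed
qed

lemma nk_smooth: "smooth3 (nk K i)"
proof -
 have b: "smooth3 (%p. nb (p$k))" "smooth3 (%p. nb (p$k/2)/2)" "smooth3 (%p. nb (p$k - K))" for k
  using smooth3_nb[of 1 k 0] smooth3_cmult[OF smooth3_nb[of "1/2" k 0], of "1/2"] smooth3_nb[of 1 k "-K"] by simp_all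
 have I: "smooth3 (%p. nI (p$k) - nI (p$k/2))" "smooth3 (%p. nI (p$k - K) - nI (p$k/2 - K))" for k
  using smooth3_diff[OF smooth3_nI[of 1 k 0] smooth3_nI[of "1/2" k 0]]
   smooth3_diff[OF smooth3_nI[of 1 k "-K"] smooth3_nI[of "1/2" k "-K"]] by simp_all
 consider "i = 1" | "i = 2" | "i = 3" using exhaust_3 by blast
 then show ?thesis
 proof cases
  case 1
  have "smooth3 (%p. (1/kZ K) * ((nI (p$1) - nI (p$1/2)) * nb (p$2) * nb (p$3 - K)))"
   by (intro smooth3_cmult smooth3_mult b I)
  then show ?thesis using 1 by (simp add: nk_def[abs_def] mult_ac)
 next
  case 2
  have "smooth3 (%p. (1/kZ K) * ((nb (p$1/2)/2) * (nI (p$2) - nI (p$2/2)) * nb (p$3 - K)))"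
   by (intro smooth3_cmult smooth3_mult b I)
  then show ?thesis using 2 by (simp add: nk_def[abs_def] mult_ac)
 next
  case 3
  have "smooth3 (%p. (1/kZ K) * ((nb (p$1/2)/2) * (nb (p$2/2)/2) * (nI (p$3 - K) - nI (p$3/2 - K))))"
   by (intro smooth3_cmult smooth3_mult b I)
  then show ?thesis using 3 by (simp add: nk_def[abs_def] mult_ac)
 qed
qed

lemma nk_csm: assumes "K >= 1" shows "csm (nk K i)"
proof (rule csm_box[OF nk_smooth])
 fix x and k :: 3 assume "nk K i x ~= 0"
 then have "abs(x$1) <= 2 & abs(x$2) <= 2 & K - 1 <= x$3 & x$3 <= 2 * K + 2" using nk_supp assms by blast
 then have "abs(x$1) <= 2 * K + 2 & abs(x$2) <= 2 * K + 2 & abs(x$3) <= 2 * K + 2" using assms by linarith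
 then show "abs(x$k) <= 2 * K + 2" using exhaust_3[of k] by auto
qed

text \<open>Each exchange of a factor by its dilate is the derivative of a difference of two steps
  \<open>nI\<close>; this difference has compact support because the exchanged factors have the same
  integral.\<close>

lemma nk_div: "(S3 i. pd i (nk K i) p) = kap K p - ks 2 (kap K) p"
proof -
 have hI: "hasp i (%p. nI (p$i) - nI (p$i/2)) (%p. nb (p$i) - nb (p$i/2)/2)" for i
  using hasp_add[OF hasp_nI[of i 1 i 0] hasp_mult[OF hasp_const[of i "-1"] hasp_nI[of i "1/2" i 0]]] by simp
 have hIK: "hasp i (%p. nI (p$i - K) - nI (p$i/2 - K)) (%p. nb (p$i - K) - nb (p$i/2 - K)/2)" for i
  using hasp_add[OF hasp_nI[of i 1 i "-K"] hasp_mult[OF hasp_const[of i "-1"] hasp_nI[of i "1/2" i "-K"]]] by simp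
 have hc: "hasp i (%p. f (p$j)) (%p. 0)" if "i ~= j" for f :: "real => real" and i j
  using that by (simp add: hasp_def axis_def)
 have hm: "hasp j f f' ==> hasp j (%p. (1/kZ K) * f p) (%p. (1/kZ K) * f' p)" for j f f'
  using hasp_mult[OF hasp_const[of j "1/kZ K"], of f f'] by simp
 have 1: "pd 1 (nk K 1) = (%p. (1/kZ K) * ((nb (p$1) - nb (p$1/2)/2) * nb (p$2) * nb (p$3 - K)))"
  by (rule hasp_pd, rule hasp_cong[OF hm[OF hasp_mult[OF hasp_mult[OF hI[of 1] hc[of 1 2 nb]] hc[of 1 3 "%t. nb (t - K)"]]]])
   (auto simp: nk_def)
 have 2: "pd 2 (nk K 2) = (%p. (1/kZ K) * ((nb (p$1/2)/2) * (nb (p$2) - nb (p$2/2)/2) * nb (p$3 - K)))"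
  by (rule hasp_pd, rule hasp_cong[OF hm[OF hasp_mult[OF hasp_mult[OF hc[of 2 1 "%t. nb (t/2)/2"] hI[of 2]] hc[of 2 3 "%t. nb (t - K)"]]]])
   (auto simp: nk_def)
 have 3: "pd 3 (nk K 3) = (%p. (1/kZ K) * ((nb (p$1/2)/2) * (nb (p$2/2)/2) * (nb (p$3 - K) - nb (p$3/2 - K)/2)))"
  by (rule hasp_pd, rule hasp_cong[OF hm[OF hasp_mult[OF hasp_mult[OF hc[of 3 1 "%t. nb (t/2)/2"] hc[of 3 2 "%t. nb (t/2)/2"]] hIK[of 3]]]])
   (auto simp: nk_def)
 show ?thesis
  unfolding sum_3 1 2 3 kap_def kap0_def ks_def by (simp add: algebra_simps)
qed

section \<open>Weak solutions over a graph\<close>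

definition cube :: "real => (real^3) set" where "cube R = {x. \<forall>i. abs(x$i) < R}"

lemma cubeI3: "abs(x$1) < R ==> abs(x$2) < R ==> abs(x$3) < R ==> x \<in> cube R"
 unfolding cube_def by (simp add: forall_3)
lemma cubeD: "x \<in> cube R ==> abs(x$i) < R" by (simp add: cube_def)
lemma cube_mono: "r <= R ==> cube r \<subseteq> cube R" unfolding cube_def by (auto intro: less_le_trans)

lemma cube_open: "open (cube R)"
proof -
 have "cube R = {x. abs(x$1) < R} \<inter> {x. abs(x$2) < R} \<inter> {x. abs(x$3) < R}"
  unfolding cube_def by (auto simp: forall_3)
 moreover have "open {x :: real^3. abs(x$i) < R}" for i by (intro open_Collect_less continuous_intros)
 ultimately show ?thesis by (simp add: open_Int)
qed
lemma cube_borel[measurable, simp]: "cube R \<in> sets borel" using cube_open by simp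
lemma cube_bounded: "bounded (cube R)"
proof (rule boundedI)
 fix x assume "x \<in> cube R"
 then show "norm x <= 3 * R" using norm3_le[of x] cubeD[of x R 1] cubeD[of x R 2] cubeD[of x R 3] by linarith
qed

lemma l2_cube: "l2 (ind (cube R))"
 by (rule l2_indicator_bounded[OF cube_borel cube_bounded])

definition ccube :: "real => (real^3) set" where "ccube R = {x. \<forall>i. abs(x$i) <= R}"

lemma ccube_closed: "closed (ccube R)"
proof -
 have "ccube R = {x. abs(x$1) <= R} \<inter> {x. abs(x$2) <= R} \<inter> {x. abs(x$3) <= R}"
  unfolding ccube_def by (auto simp: forall_3)
 moreover have "closed {x :: real^3. abs(x$i) <= R}" for i by (intro closed_Collect_le continuous_intros)
 ultimately show ?thesis by (simp add: closed_Int)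
qed
lemma ccubeI3: "abs(x$1) <= R ==> abs(x$2) <= R ==> abs(x$3) <= R ==> x \<in> ccube R"
 unfolding ccube_def by (simp add: forall_3)
lemma ccubeD: "x \<in> ccube R ==> abs(x$i) <= R" by (simp add: ccube_def)
lemma ccube_cube: "r < R ==> ccube r \<subseteq> cube R" unfolding cube_def ccube_def by (auto intro: le_less_trans)
lemma cube_ccube: "cube r \<subseteq> ccube r" unfolding cube_def ccube_def by (auto intro: less_imp_le)

definition lipg :: "real => (real^2 => real) => bool" where
 "lipg M g \<longleftrightarrow> (\<forall>a b. abs(g a - g b) <= M * dist a b)"

definition above :: "(real^2 => real) => (real^3) set" where
 "above g = {x. g (hor x) < x$3}"

text \<open>\<open>u\<close> is extended by zero below the graph and \<open>G\<close> is its weak gradient across the graph. The flux \<open>F\<close> only arises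
 from subtracting the linear profile, which does not vanish on the graph.\<close>
definition sol :: "real => (real^2 => real) => (3 => real^3 => real) => (3 => 3 => real^3 => real) => (3 => 3 => real^3 => real) => bool" where
 "sol R g u G F \<longleftrightarrow> (\<forall>k. l2 (u k)) & (\<forall>k j. l2 (G k j)) & (\<forall>k j. l2 (F k j)) &
  (\<forall>k j ps. test_fun (cube R) ps --> (LL x. u k x * pd j ps x) = - (LL x. G k j x * ps x)) &
  (\<forall>ps. test_fun (cube R) ps --> (S3 k. LL x. u k x * pd k ps x) = 0) &
  (\<forall>k x. x \<in> cube R & x \<notin> above g --> u k x = 0) &
  (\<forall>ph :: 3 => real^3 => real. (\<forall>k. test_fun (cube R \<inter> above g) (ph k)) & (\<forall>x. (S3 k. pd k (ph k) x) = 0) -->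
   (S3 k. S3 j. LL x. (G k j x - F k j x) * pd j (ph k) x) = 0)"

lemma solD:
 assumes "sol R g u G F"
 shows "l2 (u k)" "l2 (G k j)" "l2 (F k j)"
  "test_fun (cube R) ps ==> (LL x. u k x * pd j ps x) = - (LL x. G k j x * ps x)"
  "test_fun (cube R) ps ==> (S3 k. LL x. u k x * pd k ps x) = 0"
  "x \<in> cube R ==> x \<notin> above g ==> u k x = 0"
  "(!!k. test_fun (cube R \<inter> above g) (ph k)) ==> (!!x. (S3 k. pd k (ph k) x) = 0) ==>
   (S3 k. S3 j. LL x. (G k j x - F k j x) * pd j (ph k) x) = 0"
proof -
 note s = assms[unfolded sol_def]
 show "l2 (u k)" "l2 (G k j)" "l2 (F k j)" using s by simp_all
 show "test_fun (cube R) ps ==> (LL x. u k x * pd j ps x) = - (LL x. G k j x * ps x)"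
  using s by (elim conjE) (drule spec, drule spec, drule spec, erule (1) mp)
 show "test_fun (cube R) ps ==> (S3 k. LL x. u k x * pd k ps x) = 0"
  using s by blast
 show "x \<in> cube R ==> x \<notin> above g ==> u k x = 0" using s by blast
 show "(!!k. test_fun (cube R \<inter> above g) (ph k)) ==> (!!x. (S3 k. pd k (ph k) x) = 0) ==>
   (S3 k. S3 j. LL x. (G k j x - F k j x) * pd j (ph k) x) = 0"
  using s by blast
qed

lemma hor_dist: "dist (hor x) (hor y) <= abs(x$1 - y$1) + abs(x$2 - y$2)"
proof -
 have "norm (hor x - hor y) <= (S3 i. abs((hor x - hor y)$i))" by (rule norm_le_l1_cart)
 then show ?thesis by (simp add: dist_norm sum_2 hor_def)
qed

lemma lipg_hor:
 assumes "lipg M g" "M >= 0" shows "abs(g (hor x) - g (hor y)) <= M * (abs(x$1 - y$1) + abs(x$2 - y$2))"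
 using assms mult_left_mono[OF hor_dist[of x y], of M] unfolding lipg_def by (meson order_trans)

lemma lipg_cont:
 assumes "lipg M g" "M >= 0" shows "continuous_on UNIV (%x. g (hor x))"
proof -
 have l: "dist (g (hor x)) (g (hor y)) <= (2 * M) * dist x y" for x y
 proof -
  have "abs(x$1 - y$1) <= dist x y" "abs(x$2 - y$2) <= dist x y"
   using dist_vec_nth_le[of x 1 y] dist_vec_nth_le[of x 2 y] by (auto simp: dist_real_def)
  then have "M * (abs(x$1 - y$1) + abs(x$2 - y$2)) <= M * (2 * dist x y)"
   using assms(2) by (intro mult_left_mono) auto
  then show ?thesis using lipg_hor[OF assms, of x y] by (simp add: dist_real_def mult_ac)
 qed
 have "(2 * M)-lipschitz_on UNIV (%x. g (hor x))"
  by (rule lipschitz_onI) (use l assms in auto)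
 then show ?thesis by (rule lipschitz_on_continuous_on)
qed

lemma test_fun_add:
 assumes "test_fun Om f" "test_fun Om g" shows "test_fun Om (%x. f x + g x)"
proof (rule csm_test_fun[of _ "closure {x. f x ~= 0} \<union> closure {x. g x ~= 0}"])
 show "csm (%x. f x + g x)" using assms by (intro csm_add test_fun_csm)
 have "{x. f x + g x ~= 0} \<subseteq> {x. f x ~= 0} \<union> {x. g x ~= 0}" by auto
 then show "{x. f x + g x ~= 0} \<subseteq> closure {x. f x ~= 0} \<union> closure {x. g x ~= 0}"
  using closure_subset[of "{x. f x ~= 0}"] closure_subset[of "{x. g x ~= 0}"] by (meson Un_mono order_trans)
 show "closure {x. f x ~= 0} \<union> closure {x. g x ~= 0} \<subseteq> Om"
  using assms unfolding test_fun_def by (simp only: Un_subset_iff simp_thms)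
qed (simp add: closed_Un)

lemma test_fun_0: "test_fun Om (%x. 0)" unfolding test_fun_def by simp

lemma test_fun_sum: "(!!i. i \<in> A ==> test_fun Om (f i)) ==> test_fun Om (%x. \<Sum>i\<in>A. f i x)"
 by (induction A rule: infinite_finite_induct) (auto intro: test_fun_add test_fun_0)

lemma test_fun_refl:
 assumes "csm k" "closed S" "S \<subseteq> Om" "!!p. k p ~= 0 ==> x - p \<in> S"
 shows "test_fun Om (%y. k (x - y))"
proof (rule csm_test_fun[OF csm_refl[OF assms(1)] assms(2) _ assms(3)])
 show "{y. k (x - y) ~= 0} \<subseteq> S"
 proof
  fix y assume "y \<in> {y. k (x - y) ~= 0}"
  then show "y \<in> S" using assms(4)[of "x - y"] by simp
 qed
qed

lemma pd_refl: "smooth3 k ==> pd j (%y. k (x - y)) = (%y. - pd j k (x - y))"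
 using pd_affine[of k j "-1" x] by simp

text \<open>The reflected kernel serves as test function: a derivative on the kernel moves to u and
  becomes the weak gradient there, as long as the reflected kernel is supported in the
  domain.\<close>

lemma conv_weak:
 assumes s: "sol R g u G F" and k: "csm k" and t: "test_fun (cube R) (%y. k (x - y))"
 shows "conv (u i) (pd j k) x = conv (G i j) k x"
 using solD(4)[OF s t, of i j] unfolding conv_def pd_refl[OF csm_smooth[OF k]] by (simp add: mult_ac)

lemma conv_weak_div:
 assumes s: "sol R g u G F" and k: "csm k" and t: "test_fun (cube R) (%y. k (x - y))"
 shows "(S3 i. conv (u i) (pd i k) x) = 0"
 using solD(5)[OF s t] unfolding conv_def pd_refl[OF csm_smooth[OF k]] by (simp add: mult_ac sum_negf)

lemma conv_sup:
 assumes f: "l2 f" and k: "csm k" and B: "!!x. abs(f x) <= B"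
 shows "abs(conv f k x) <= B * (LL p. abs(k p))"
proof -
 have kx: "csm (%y. k (x - y))" using csm_refl[OF k] .
 have "abs(conv f k x) <= (LL y. abs(k (x - y) * f y))"
  unfolding conv_def by (rule integral_abs_bound)
 also have "... <= (LL y. B * abs(k (x - y)))"
 proof (rule integral_mono)
  show "abs(k (x - y) * f y) <= B * abs(k (x - y))" for y
   unfolding abs_mult using mult_left_mono[OF B[of y], of "abs(k (x - y))"] by (simp add: mult.commute)
 qed (use conv_integrable[OF f k] csm_abs_integrable[OF kx] in auto)
 also have "... = B * (LL p. abs(k p))"
  using integral_reflect3[of "%p. abs(k p)" x] by simp
 finally show ?thesis .
qed

lemma conv_add_ker: "l2 f ==> csm k ==> csm k' ==> conv f (%p. k p + k' p) x = conv f k x + conv f k' x"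
 unfolding conv_def using conv_integrable by (simp add: ring_distribs)
lemma conv_diff_ker: "l2 f ==> csm k ==> csm k' ==> conv f (%p. k p - k' p) x = conv f k x - conv f k' x"
 unfolding conv_def using conv_integrable by (simp add: ring_distribs)
lemma conv_zero_ker[simp]: "conv f (%p. 0) x = 0" by (simp add: conv_def)
lemma conv_sum_ker: "l2 f ==> (!!i. i \<in> A ==> csm (k i)) ==> conv f (%p. \<Sum>i\<in>A. k i p) x = (\<Sum>i\<in>A. conv f (k i) x)"
proof (induction A rule: infinite_finite_induct)
 case (insert a A)
 then show ?case using conv_add_ker[of f "k a" "%p. \<Sum>i\<in>A. k i p" x] csm_sum[of A k] by simp
qed auto

lemma ks_supp_box:
 assumes "s > 0" "ks s k p ~= 0" "!!q. k q ~= 0 ==> a <= q$i & q$i <= b"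
 shows "s * a <= p$i & p$i <= s * b"
proof -
 have "k ((1/s) *R p) ~= 0" using assms(2) by (auto simp: ks_def)
 then show ?thesis using assms(3)[of "(1/s) *R p"] assms(1) by (simp add: field_simps)
qed

lemma abs_int_ks: "s > 0 ==> (LL p. abs(ks s k p)) = (LL p. abs(k p))"
 unfolding abs_ks by (rule integral_ks)

lemma abs_int_pd_ks: "csm k ==> s > 0 ==> (LL p. abs(pd j (ks s k) p)) = (LL p. abs(pd j k p))/s"
 by (simp add: pd_ks abs_divide abs_int_ks)

lemma conv_nonzero:
 assumes "conv f k x ~= 0" obtains p where "k p ~= 0" "f (x - p) ~= 0"
proof -
 have "\<exists>p. k p * f (x - p) ~= 0"
 proof (rule ccontr)
  assume "~?thesis"
  then have e: "k p * f (x - p) = 0" for p by blast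
  show False using assms unfolding conv_alt e by simp
 qed
 then show ?thesis using that by auto
qed

lemma ks_kap_box:
 assumes "s > 0" "ks s (kap 0) p ~= 0" shows "abs(p$i) <= s"
proof -
 have "kap 0 ((1/s) *R p) ~= 0" using assms(2) by (auto simp: ks_def)
 from kap_supp[OF this] have "abs(((1/s) *R p)$i) <= 1" using exhaust_3[of i] by auto
 then show ?thesis using assms(1) by (simp add: abs_mult field_simps)
qed

text \<open>The indicator of an intermediate cube is mollified at a quarter of the gap, so every
  derivative costs an inverse gap. The support ends halfway between the two radii.\<close>

lemma cutoff:
 "\<exists>c>0. \<forall>rh R. 0 < rh & rh < R --> (\<exists>et. csm et & (\<forall>x. 0 <= et x & et x <= 1) & (\<forall>x\<in>cube rh. et x = 1) &
  (\<forall>x. et x ~= 0 --> x \<in> ccube ((rh + R)/2)) & (\<forall>j x. abs(pd j et x) <= c/(R - rh)) &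
  (\<forall>i j x. abs(pd i (pd j et) x) <= c/(R - rh)^2))" (is "\<exists>c>0. \<forall>rh R. _ --> ?P c rh R")
proof -
 define k where "k = kap 0"
 have k: "csm k" unfolding k_def by (rule kap_csm)
 define a where "a = (S3 j. LL p. abs(pd j k p))"
 define b where "b = (S3 i. S3 j. LL p. abs(pd i (pd j k) p))"
 have n: "0 <= (LL p. abs(f p))" for f :: "real^3 => real" by (intro integral_nonneg_AE) auto
 have aj: "(LL p. abs(pd j k p)) <= a" for j unfolding a_def by (rule member_le_sum) (auto simp: n)
 have bij: "(LL p. abs(pd i (pd j k) p)) <= b" for i j
 proof -
  have "(LL p. abs(pd i (pd j k) p)) <= (S3 j. LL p. abs(pd i (pd j k) p))" by (rule member_le_sum) (auto simp: n)
  also have "... <= b" unfolding b_def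
   by (rule member_le_sum[of i UNIV "%i. S3 j. LL p. abs(pd i (pd j k) p)"]) (auto simp: n intro!: sum_nonneg)
  finally show ?thesis .
 qed
 have ab: "0 <= a" "0 <= b" using n aj[of 1] bij[of 1 1] by (meson order_trans)+
 define c where "c = 4 * a + 16 * b + 1"
 show ?thesis
 proof (intro exI[of _ c] conjI allI impI)
  show "c > 0" using ab by (simp add: c_def)
  fix rh R :: real assume r: "0 < rh & rh < R"
  define s where "s = (R - rh)/4"
  have s: "s > 0" using r by (simp add: s_def)
  define m where "m = rh + s"
  define et where "et = conv (ind (cube m)) (ks s k)"
  have K: "csm (ks s k)" using csm_ks[OF k s] .
  have sup: "abs(p$i) <= s" if "ks s k p ~= 0" for p i
   by (rule ks_kap_box[OF s that[unfolded k_def]])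
  have nn: "0 <= ks s k p" for p using kap_nonneg s by (simp add: ks_def k_def)
  have sm: "smooth3 et" unfolding et_def by (rule conv_smooth[OF l2_cube K])
  have pdc: "pd j et = conv (ind (cube m)) (pd j (ks s k))" for j
   unfolding et_def by (rule conv_pd[OF l2_cube K])
  have pdc2: "pd i (pd j et) = conv (ind (cube m)) (pd i (pd j (ks s k)))" for i j
   unfolding pdc by (rule conv_pd[OF l2_cube csm_pd[OF K]])
  have ind1: "abs(ind (cube m) x :: real) <= 1" for x by (simp add: indicator_def)
  have supp: "x \<in> ccube ((rh + R)/2)" if nz: "et x ~= 0" for x
  proof -
   obtain p where p: "ks s k p ~= 0" "ind (cube m) (x - p) ~= (0::real)" by (rule conv_nonzero[OF nz[unfolded et_def]])
   have "abs(x$i) <= (rh + R)/2" for i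
   proof -
    have "abs(p$i) <= (R - rh)/4" using sup[OF p(1), of i] unfolding s_def .
    moreover have "abs(x$i - p$i) < rh + (R - rh)/4" using p(2) cubeD[of "x - p" m i] unfolding m_def s_def by (simp add: indicator_def split: if_splits)
    ultimately show ?thesis by argo
   qed
   then show ?thesis by (simp add: ccube_def)
  qed
  show "?P c rh R"
  proof (intro exI[of _ et] conjI allI impI ballI)
   show "csm et" by (rule csm_box[OF sm]) (use supp ccubeD in blast)
   fix x
   show "0 <= et x" unfolding et_def conv_def using nn by (intro integral_nonneg_AE) auto
   have "et x <= abs(et x)" by simp
   also have "... <= 1 * (LL p. abs(ks s k p))" unfolding et_def by (rule conv_sup[OF l2_cube K ind1])
   also have "... = 1" using nn integral_ks[OF s, of k] kap_int[of 0] unfolding k_def by simp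
   finally show "et x <= 1" .
  next
   fix x assume x: "x \<in> cube rh"
   have e: "ks s k p * ind (cube m) (x - p) = ks s k p" for p
   proof (cases "ks s k p = 0")
    case False
    have "abs((x - p)$i) < m" for i using sup[OF False, of i] cubeD[OF x, of i] unfolding m_def by simp
    then show ?thesis by (simp add: cube_def)
   qed simp
   show "et x = 1" unfolding et_def conv_alt e using integral_ks[OF s, of k] kap_int[of 0] unfolding k_def by simp
  next
   fix x assume "et x ~= 0" then show "x \<in> ccube ((rh + R)/2)" by (rule supp)
  next
   fix j x
   have "abs(pd j et x) <= 1 * (LL p. abs(pd j (ks s k) p))" unfolding pdc
    by (rule conv_sup[OF l2_cube csm_pd[OF K] ind1])
   also have "... = (LL p. abs(pd j k p))/s" using abs_int_pd_ks[OF k s] by simp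
   also have "... <= a/s" using aj s by (intro divide_right_mono) auto
   also have "... = 4 * a/(R - rh)" using r by (simp add: s_def)
   also have "... <= c/(R - rh)" using r ab by (intro divide_right_mono) (auto simp: c_def)
   finally show "abs(pd j et x) <= c/(R - rh)" .
  next
   fix i j x
   have "pd i (pd j (ks s k)) = (%x. ks s (pd i (pd j k)) x/s^2)"
   proof -
    have "pd i (pd j (ks s k)) = pd i (%x. (1/s) * ks s (pd j k) x)" by (simp add: pd_ks[OF k s])
    also have "... = (%x. (1/s) * (ks s (pd i (pd j k)) x/s))"
     by (subst pd_cmult[OF csm_smooth[OF csm_ks[OF csm_pd[OF k] s]]]) (simp add: pd_ks[OF csm_pd[OF k] s])
    finally show ?thesis by (simp add: p2eq)
   qed
   then have e: "(LL p. abs(pd i (pd j (ks s k)) p)) = (LL p. abs(pd i (pd j k) p))/s^2"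
    by (simp add: abs_divide abs_int_ks[OF s])
   have "abs(pd i (pd j et) x) <= 1 * (LL p. abs(pd i (pd j (ks s k)) p))" unfolding pdc2
    by (rule conv_sup[OF l2_cube csm_pd[OF csm_pd[OF K]] ind1])
   also have "... <= b/s^2" unfolding e using bij s by (auto intro!: divide_right_mono)
   also have "... = 16 * b/(R - rh)^2" using r by (simp add: s_def power_divide)
   also have "... <= c/(R - rh)^2" using r ab by (intro divide_right_mono) (auto simp: c_def)
   finally show "abs(pd i (pd j et) x) <= c/(R - rh)^2" .
  qed
 qed
qed

section \<open>Dyadic potential kernels\<close>

definition nks :: "real => real => 3 => real^3 => real" where
 "nks K s i p = s * ks s (nk K i) p"

text \<open>The extra factor s in \<open>nks\<close> compensates the derivative, so that its
  divergence is \<open>ks s (kap K) - ks (2 * s) (kap K)\<close> and the sum over scales telescopes.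
  The scales form an arbitrary set A since coarse and fine ones will be estimated
  differently.\<close>

definition NN :: "real => real => nat set => 3 => real^3 => real" where
 "NN K L A i p = (\<Sum>m\<in>A. nks K (L/2^Suc m) i p)"

lemma nks_csm: "K >= 1 ==> s > 0 ==> csm (nks K s i)"
 unfolding nks_def[abs_def] by (intro csm_cmult csm_ks nk_csm)

lemma pd_nks: assumes "K >= 1" "s > 0" shows "pd j (nks K s i) = ks s (pd j (nk K i))"
proof -
 have "pd j (nks K s i) = (%x. s * pd j (ks s (nk K i)) x)"
  unfolding nks_def[abs_def] by (rule pd_cmult[OF csm_smooth[OF csm_ks[OF nk_csm]]]) (use assms in auto)
 then show ?thesis using assms by (simp add: pd_ks nk_csm fun_eq_iff)
qed

lemma NN_csm: "K >= 1 ==> L > 0 ==> csm (NN K L A i)"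
 unfolding NN_def[abs_def] by (intro csm_sum nks_csm) auto

lemma pd_NN: "K >= 1 ==> L > 0 ==> pd j (NN K L A i) = (%p. \<Sum>m\<in>A. ks (L/2^Suc m) (pd j (nk K i)) p)"
 unfolding NN_def[abs_def] by (subst pd_sum, rule csm_smooth, rule nks_csm, simp_all add: pd_nks)

lemma ks_ks: "s > 0 ==> ks s (ks 2 k) = ks (2 * s) k"
 by (simp add: ks_def fun_eq_iff power_mult_distrib)

lemma NN_div:
 assumes "K >= 1" "L > 0"
 shows "(S3 i. pd i (NN K L {..<n} i) p) = ks (L/2^n) (kap K) p - ks L (kap K) p"
proof (induction n)
 case 0
 have "pd i (NN K L {} i) p = 0" for i using pd_NN[OF assms, of i "{}" i] by simp
 then show ?case by simp
next
 case (Suc n)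
 define s where "s = L/2^Suc n"
 have s: "s > 0" using assms by (simp add: s_def)
 have "(S3 i. pd i (NN K L {..<Suc n} i) p) = (S3 i. pd i (NN K L {..<n} i) p) + (S3 i. ks s (pd i (nk K i)) p)"
  unfolding pd_NN[OF assms] s_def by (simp add: sum.distrib)
 also have "(S3 i. ks s (pd i (nk K i)) p) = ks s (kap K) p - ks s (ks 2 (kap K)) p"
  unfolding ks_def[of s] using nk_div[of K "(1/s) *R p"] by (simp add: sum_divide_distrib[symmetric] diff_divide_distrib)
 also have "ks s (ks 2 (kap K)) = ks (L/2^n) (kap K)"
  unfolding ks_ks[OF s] by (simp add: s_def)
 finally show ?case unfolding Suc.IH by (simp add: s_def)
qed

lemma NN_supp:
 assumes "K >= 1" "L > 0" "NN K L A i p ~= 0"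
 obtains m where "m \<in> A" "abs(p$1) <= 2 * (L/2^Suc m)" "abs(p$2) <= 2 * (L/2^Suc m)"
  "(K - 1) * (L/2^Suc m) <= p$3" "p$3 <= (2 * K + 2) * (L/2^Suc m)"
proof -
 obtain m where m: "m \<in> A" "nks K (L/2^Suc m) i p ~= 0"
  using assms(3) unfolding NN_def by (meson sum.neutral)
 define s where "s = L/2^Suc m"
 have s: "s > 0" using assms by (simp add: s_def)
 have "nk K i ((1/s) *R p) ~= 0" using m(2) unfolding nks_def ks_def s_def by auto
 from nk_supp[OF assms(1) this] s
 have "abs(p$1) <= 2 * s" "abs(p$2) <= 2 * s" "(K - 1) * s <= p$3" "p$3 <= (2 * K + 2) * s"
  by (simp_all add: abs_mult field_simps)
 then show ?thesis using that[OF m(1)] unfolding s_def by blast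
qed

lemma abs_int_sum:
 assumes "!!i. i \<in> A ==> csm (k i)"
 shows "(LL p. abs((\<Sum>i\<in>A. k i p))) <= (\<Sum>i\<in>A. LL p. abs(k i p))"
proof -
 have "(LL p. abs((\<Sum>i\<in>A. k i p))) <= (LL p. (\<Sum>i\<in>A. abs(k i p)))"
  using assms by (intro integral_mono sum_abs csm_abs_integrable csm_sum Bochner_Integration.integrable_sum) auto
 also have "... = (\<Sum>i\<in>A. LL p. abs(k i p))"
  using assms by (intro LLsum csm_abs_integrable)
 finally show ?thesis .
qed

text \<open>The L^1 norms are proportional to the scale, so a geometric series leaves only the
  coarsest scale of A. The fine part of the potential is therefore small.\<close>

lemma NN_abs_int:
 assumes "K >= 1" "L > 0" "finite A" "!!m. m \<in> A ==> m0 <= m" "(LL p. abs(nk K i p)) <= a"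
 shows "(LL p. abs(NN K L A i p)) <= a * (L/2^m0)"
proof -
 have a0: "0 <= a" by (rule order_trans[OF integral_nonneg_AE assms(5)]) simp
 have "(LL p. abs(NN K L A i p)) <= (\<Sum>m\<in>A. LL p. abs(nks K (L/2^Suc m) i p))"
  unfolding NN_def using assms by (intro abs_int_sum nks_csm) auto
 also have "... = (\<Sum>m\<in>A. (L/2^Suc m) * (LL p. abs(nk K i p)))"
  using assms by (intro sum.cong refl) (simp add: nks_def abs_mult abs_int_ks del: power_Suc)
 also have "... <= (\<Sum>m\<in>A. (L/2^Suc m) * a)" using assms by (intro sum_mono mult_left_mono) auto
 also have "... = (a * L) * (\<Sum>m\<in>A. (1/2)^Suc m)" by (simp add: sum_distrib_left sum_distrib_right power_divide mult_ac)
 also have "... <= (a * L) * (1/2)^m0"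
 proof (rule mult_left_mono)
  obtain n where n: "A \<subseteq> {m0..<m0+n}"
  proof -
   have "A \<subseteq> {m0..<m0 + Suc (Max (insert 0 A))}"
   proof
    fix m assume "m \<in> A"
    then have "m0 <= m" "m <= Max (insert 0 A)" using assms by auto
    then show "m \<in> {m0..<m0 + Suc (Max (insert 0 A))}" by auto
   qed
   then show ?thesis using that by blast
  qed
  have "(\<Sum>m\<in>A. (1/2::real)^Suc m) <= (\<Sum>m=m0..<m0+n. (1/2)^Suc m)" using n by (intro sum_mono2) auto
  also have "(\<Sum>m=m0..<m0+n. (1/2::real)^Suc m) = (1/2)^m0 - (1/2)^(m0 + n)"
  proof (induction n)
   case (Suc n)
   have "(\<Sum>m=m0..<m0+Suc n. (1/2::real)^Suc m) = (\<Sum>m=m0..<m0+n. (1/2)^Suc m) + (1/2)^(m0 + n)/2" by simp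
   then show ?case unfolding Suc by simp
  qed simp
  also have "... <= (1/2)^m0" by simp
  finally show "(\<Sum>m\<in>A. (1/2::real)^Suc m) <= (1/2)^m0" .
 qed (use a0 assms in auto)
 finally show ?thesis by (simp add: power_divide)
qed

text \<open>One derivative makes the L^1 norms independent of the scale, so their number appears;
  this bound is meant for the few coarse scales only.\<close>

lemma NN_pd_abs_int:
 assumes "K >= 1" "L > 0" "finite A" "(LL p. abs(pd j (nk K i) p)) <= b"
 shows "(LL p. abs(pd j (NN K L A i) p)) <= real (card A) * b"
proof -
 have "(LL p. abs(pd j (NN K L A i) p)) <= (\<Sum>m\<in>A. LL p. abs(ks (L/2^Suc m) (pd j (nk K i)) p))"
  unfolding pd_NN[OF assms(1,2)] using assms by (intro abs_int_sum csm_ks csm_pd nk_csm) auto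
 also have "... <= (\<Sum>m\<in>A. b)"
  using assms by (intro sum_mono) (simp add: abs_int_ks del: power_Suc)
 finally show ?thesis by simp
qed

section \<open>Caccioppoli estimate\<close>

definition enr :: "real => (3 => 3 => real^3 => real) => real" where
 "enr r G = (S3 k. S3 l. sq (cube r) (G k l))"

definition mas :: "real => (3 => real^3 => real) => real" where
 "mas r u = (S3 k. sq (cube r) (u k))"

lemma enr_nonneg[simp]: "0 <= enr r G" unfolding enr_def by (intro sum_nonneg) auto
lemma mas_nonneg[simp]: "0 <= mas r u" unfolding mas_def by (intro sum_nonneg) auto
lemma sq_le_mas: "sq (cube r) (u k) <= mas r u" unfolding mas_def by (rule member_le_sum) auto
lemma sq_le_enr: "sq (cube r) (G k l) <= enr r G" unfolding enr_def
 using member_le_sum[of l UNIV "%l. sq (cube r) (G k l)"] member_le_sum[of k UNIV "%k. S3 l. sq (cube r) (G k l)"]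
 by (simp add: sum_nonneg)

lemma sum9_const: "(\<Sum>k\<in>(UNIV::3 set). \<Sum>l\<in>(UNIV::3 set). (c::real)) = 9 * c" by (simp add: sum_3)

lemma box_shift:
 assumes "x \<in> cube (1/4)" "abs(p$1) <= 56/100" "abs(p$2) <= 56/100" "0 <= p$3" "p$3 <= 56/100"
 shows "x - p \<in> ccube (9/10)"
proof (rule ccubeI3)
 have b: "abs(a - b) <= 9/10" if "abs(a) < 1/4" "abs(b) <= 56/100" for a b :: real using that by linarith
 show "abs((x - p)$1) <= 9/10" using b[OF cubeD[OF assms(1), of 1] assms(2)] by simp
 show "abs((x - p)$2) <= 9/10" using b[OF cubeD[OF assms(1), of 2] assms(3)] by simp
 have "abs(p$3) <= 56/100" using assms(4,5) by simp
 then show "abs((x - p)$3) <= 9/10" using b[OF cubeD[OF assms(1), of 3]] by simp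
qed

lemma box_shift1: "x \<in> ccube (9/10) ==> x \<in> cube 1"
 using ccube_cube[of "9/10" 1] by auto

text \<open>At scale r a kernel moves a point horizontally by at most 2 r in each coordinate and
  down by at least (KM - 1) r = (4 M + 5) r. A graph of slope M changes by at most 4 M r meanwhile,
  which leaves a margin 5 r.\<close>

definition KM :: "real => real" where "KM M = 4 * M + 6"
text \<open>Normalizes the lowest height of the coarsest mollifier to 4/10; since
  \<open>KM M >= 6\<close>, its greatest height is then at most 56/100, and 1/4 + 56/100 < 9/10
  keeps all kernels inside the unit cube.\<close>

definition LM :: "real => real" where "LM M = 2/(5 * (KM M - 1))"

context
 fixes M :: real and g u G F
 assumes M: "M >= 0" and s: "sol 1 g u G F" and lip: "lipg M g" and gl: "!!y. -1/10 <= g y"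
begin

private abbreviation "nM \<equiv> NN (KM M) (LM M)"
private abbreviation "kM n \<equiv> ks (LM M * (1/2^n)) (kap (KM M))"

private lemma KL: "KM M >= 6" "KM M >= 1" "LM M > 0" "LM M <= 8/100" "LM M * (KM M - 1) = 4/10" "LM M * (KM M + 1) <= 56/100"
proof -
 show k: "KM M >= 6" "KM M >= 1" using M by (simp_all add: KM_def)
 show "LM M > 0" "LM M <= 8/100" using k unfolding LM_def by (simp_all add: field_simps)
 show e: "LM M * (KM M - 1) = 4/10" using k unfolding LM_def by (simp add: field_simps)
 have "LM M * (KM M + 1) = LM M * (KM M - 1) + 2 * LM M" by (simp add: algebra_simps)
 then show "LM M * (KM M + 1) <= 56/100" using e \<open>LM M <= 8/100\<close> by linarith
qed

private lemma NN_box: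
 assumes "nM A i p ~= 0" "!!m. m \<in> A ==> m0 <= m"
 shows "abs(p$1) <= (56/100)/2^m0" "abs(p$2) <= (56/100)/2^m0" "0 <= p$3" "p$3 <= (56/100)/2^m0"
proof -
 obtain m where m: "m \<in> A" "abs(p$1) <= 2 * (LM M/2^Suc m)" "abs(p$2) <= 2 * (LM M/2^Suc m)"
  "(KM M - 1) * (LM M/2^Suc m) <= p$3" "p$3 <= (2 * KM M + 2) * (LM M/2^Suc m)"
  using NN_supp[OF KL(2,3) assms(1)] by blast
 have le: "LM M/2^m <= LM M/2^m0" using assms(2)[OF m(1)] KL(3) by (intro divide_left_mono) (auto simp: power_increasing)
 have "LM M/2^m0 <= (56/100)/2^m0" using KL(4) by (intro divide_right_mono) auto
 then show "abs(p$1) <= (56/100)/2^m0" "abs(p$2) <= (56/100)/2^m0" using m(2,3) le by auto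
 have "0 <= (KM M - 1) * (LM M/2^Suc m)" using KL by (intro mult_nonneg_nonneg) auto
 then show "0 <= p$3" using m(4) by linarith
 have "p$3 <= (KM M + 1) * (LM M/2^m)" using m(5) by (simp add: field_simps)
 also have "... <= (KM M + 1) * (LM M/2^m0)" using le KL by (intro mult_left_mono) auto
 also have "... = (LM M * (KM M + 1))/2^m0" by (simp add: field_simps)
 also have "... <= (56/100)/2^m0" using KL(6) by (intro divide_right_mono) auto
 finally show "p$3 <= (56/100)/2^m0" .
qed

private lemma ks_box:
 assumes "s > 0" "ks (LM M * s) (kap (KM M)) p ~= 0"
 shows "abs(p$1) <= (56/100) * s" "abs(p$2) <= (56/100) * s" "(4/10) * s <= p$3" "p$3 <= (56/100) * s"
proof -
 have sp: "LM M * s > 0" using assms KL by simp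
 have *: "abs(q$1) <= 1 & abs(q$2) <= 1 & abs(q$3 - KM M) <= 1" if "kap (KM M) q ~= 0" for q using kap_supp[OF that] .
 have 1: "LM M * s * (-1) <= p$1 & p$1 <= LM M * s * 1"
  by (rule ks_supp_box[OF sp assms(2)]) (use * in fastforce)
 have 2: "LM M * s * (-1) <= p$2 & p$2 <= LM M * s * 1"
  by (rule ks_supp_box[OF sp assms(2)]) (use * in fastforce)
 have 3: "LM M * s * (KM M - 1) <= p$3 & p$3 <= LM M * s * (KM M + 1)"
  by (rule ks_supp_box[OF sp assms(2)]) (use * in fastforce)
 have "LM M * s <= (56/100) * s" using KL assms by (intro mult_right_mono) auto
 then show "abs(p$1) <= (56/100) * s" "abs(p$2) <= (56/100) * s" using 1 2 by auto
 have "LM M * s * (KM M - 1) = (LM M * (KM M - 1)) * s" by (simp only: mult_ac)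
 then have "LM M * s * (KM M - 1) = (4/10) * s" unfolding KL(5) .
 then show "(4/10) * s <= p$3" using 3 by linarith
 have "LM M * s * (KM M + 1) = (LM M * (KM M + 1)) * s" by (simp add: mult_ac)
 also have "... <= (56/100) * s" using KL(6) assms by (intro mult_right_mono) auto
 finally show "p$3 <= (56/100) * s" using 3 by linarith
qed

private lemma NN_test:
 assumes "x \<in> cube (1/4)" shows "test_fun (cube 1) (%y. nM A i (x - y))"
proof (rule test_fun_refl[OF NN_csm[OF KL(2,3)] ccube_closed ccube_cube])
 show "(9/10::real) < 1" by simp
 fix p assume p: "nM A i p ~= 0"
 show "x - p \<in> ccube (9/10)"
  by (rule box_shift[OF assms]) (use NN_box[OF p, of 0] in auto)
qed

private lemma ks_test:
 assumes "x \<in> cube (1/4)" "0 < r" "r <= 1" shows "test_fun (cube 1) (%y. ks (LM M * r) (kap (KM M)) (x - y))"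
proof (rule test_fun_refl[OF csm_ks[OF kap_csm] ccube_closed ccube_cube])
 show "(9/10::real) < 1" by simp
 show "LM M * r > 0" using KL assms by simp
 fix p assume p: "ks (LM M * r) (kap (KM M)) p ~= 0"
 show "x - p \<in> ccube (9/10)"
  by (rule box_shift[OF assms(1)]) (use ks_box[OF assms(2) p] assms(2,3) in linarith)+
qed

text \<open>From the cube of half-width 1/4 the coarsest mollifier sees only heights below 1/4 -
  4/10, which is less than the lower bound -1/10 of the graph. This disposes of the coarse end of
  the telescope.\<close>

private lemma zeroL:
 assumes x: "x \<in> cube (1/4)" shows "conv (u i) (ks (LM M) (kap (KM M))) x = 0"
proof (rule ccontr)
 assume "conv (u i) (ks (LM M) (kap (KM M))) x ~= 0"
 then obtain p where p: "ks (LM M * 1) (kap (KM M)) p ~= 0" "u i (x - p) ~= 0" by (auto elim: conv_nonzero)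
 note b = ks_box[OF _ p(1)]
 note c = cubeD[OF x, of 1] cubeD[OF x, of 2] cubeD[OF x, of 3]
 have "x - p \<in> cube 1" by (rule box_shift1[OF box_shift[OF x]]) (use b in auto)
 then have "x - p \<in> above g" using solD(6)[OF s, of "x - p" i] p(2) by blast
 then have "g (hor (x - p)) < x$3 - p$3" by (simp add: above_def)
 moreover have "x$3 - p$3 < - 1/10" using b(3) c(3) by auto
 ultimately show False using gl[of "hor (x - p)"] by linarith
qed

definition PP :: "nat => 3 => 3 => real^3 => real" where
 "PP n i j x = conv (u i) (nM {..<n} j) x - conv (u j) (nM {..<n} i) x"

definition un :: "nat => 3 => real^3 => real" where
 "un n i = conv (u i) (kM n)"

definition Gn :: "nat => 3 => 3 => real^3 => real" where
 "Gn n k l = conv (G k l) (kM n)"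

private lemma uGF: "l2 (u i)" "l2 (G k l)" "l2 (F k l)" using solD(1-3)[OF s] by auto
private lemma Nc: "csm (nM A i)" by (rule NN_csm[OF KL(2,3)])
private lemma kc: "csm (kM n)" by (rule csm_ks[OF kap_csm]) (use KL in simp)

private lemma PP_smooth: "smooth3 (PP n i j)"
 unfolding PP_def[abs_def] by (intro smooth3_diff conv_smooth uGF Nc)
private lemma un_smooth: "smooth3 (un n i)"
 unfolding un_def by (intro conv_smooth uGF kc)
private lemma PP_l2: "l2 (PP n i j)"
 unfolding PP_def[abs_def] by (intro l2_diff csm_conv_l2 uGF Nc)
private lemma un_l2: "l2 (un n i)" unfolding un_def by (intro csm_conv_l2 uGF kc)
private lemma Gn_l2: "l2 (Gn n k l)" unfolding Gn_def by (intro csm_conv_l2 uGF kc)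

private lemma pd_PP: "pd l (PP n i j) x = conv (u i) (pd l (nM {..<n} j)) x - conv (u j) (pd l (nM {..<n} i)) x"
 unfolding PP_def[abs_def] by (subst pd_diff) (simp_all add: conv_smooth uGF Nc conv_pd)

text \<open>The first half telescopes to the mollified u, with the coarse end removed by
  \<open>zeroL\<close>; in the second half the derivative acts on the summed index, so it vanishes
  because u is solenoidal.\<close>

private lemma div_PP:
 assumes x: "x \<in> cube (1/4)" shows "(S3 j. pd j (PP n i j) x) = un n i x"
proof -
 have "(S3 j. conv (u i) (pd j (nM {..<n} j)) x)
  = conv (u i) (%p. S3 j. pd j (nM {..<n} j) p) x"
  by (rule conv_sum_ker[symmetric]) (auto intro: uGF csm_pd Nc)
 also have "... = conv (u i) (%p. ks (LM M/2^n) (kap (KM M)) p - ks (LM M) (kap (KM M)) p) x"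
  unfolding NN_div[OF KL(2,3)] ..
 also have "... = conv (u i) (ks (LM M/2^n) (kap (KM M))) x - conv (u i) (ks (LM M) (kap (KM M))) x"
  by (rule conv_diff_ker) (use KL in \<open>auto intro: uGF csm_ks kap_csm\<close>)
 also have "... = un n i x" using zeroL[OF x] by (simp add: un_def)
 finally have "(S3 j. conv (u i) (pd j (nM {..<n} j)) x) = un n i x" .
 moreover have "(S3 j. conv (u j) (pd j (nM {..<n} i)) x) = 0"
  by (rule conv_weak_div[OF s Nc NN_test[OF x]])
 ultimately show ?thesis unfolding pd_PP by (simp add: sum_subtractf)
qed

text \<open>If the potential is nonzero at x, then some x - p lies above the graph with p in the
  cone, and the choice of \<open>KM\<close> puts x at a definite height above the graph. That height
  shrinks with n, so the mollification is removed only after testing.\<close>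

private lemma PP_supp:
 assumes x: "x \<in> cube (1/4)" and n: "PP n i j x ~= 0"
 shows "g (hor x) + LM M/2^n <= x$3"
proof -
 have "\<exists>i j. conv (u i) (nM {..<n} j) x ~= 0"
 proof (rule ccontr)
  assume "~?thesis"
  then show False using n unfolding PP_def by simp
 qed
 then obtain i j where "conv (u i) (nM {..<n} j) x ~= 0" by blast
 then obtain p where p: "nM {..<n} j p ~= 0" "u i (x - p) ~= 0" by (rule conv_nonzero)
 have "x - p \<in> cube 1"
  by (rule box_shift1[OF box_shift[OF x]]) (use NN_box[OF p(1), of 0] in auto)
 then have "x - p \<in> above g" using solD(6)[OF s, of "x - p" i] p(2) by blast
 then have ab: "g (hor (x - p)) < x$3 - p$3" by (simp add: above_def)
 obtain m where m: "m < n" "abs(p$1) <= 2 * (LM M/2^Suc m)" "abs(p$2) <= 2 * (LM M/2^Suc m)"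
  "(KM M - 1) * (LM M/2^Suc m) <= p$3"
  using NN_supp[OF KL(2,3) p(1)] by (metis lessThan_iff)
 define r where "r = LM M/2^Suc m"
 have r: "LM M/2^n <= r" unfolding r_def using m(1) KL(3) by (intro divide_left_mono power_increasing) auto
 have "g (hor x) <= g (hor (x - p)) + M * (abs(p$1) + abs(p$2))"
  using lipg_hor[OF lip M, of x "x - p"] by simp
 also have "M * (abs(p$1) + abs(p$2)) <= M * (4 * r)" using m(2,3) M unfolding r_def[symmetric] by (intro mult_left_mono) auto
 finally have "g (hor x) < x$3 - p$3 + 4 * M * r" using ab by simp
 moreover have "(4 * M + 5) * r <= p$3" using m(4) unfolding r_def[symmetric] KM_def by (simp add: add.commute)
 moreover have "0 < r" using KL(3) by (simp add: r_def)
 ultimately show ?thesis using r by (simp add: algebra_simps)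
qed

context
 fixes et :: "real^3 => real" and q :: real and n :: nat
 assumes ec: "csm et" and q: "q < 1/4" and esupp: "!!x. et x ~= 0 ==> x \<in> ccube q"
begin

private lemma es: "smooth3 et" using ec by (rule csm_smooth)

private lemma eP_test: "test_fun (cube 1 \<inter> above g) (%x. et x * PP n i j x)"
proof (rule csm_test_fun[of _ "ccube q \<inter> {x. g (hor x) + LM M/2^n <= x$3}"])
 show "csm (%x. et x * PP n i j x)" by (rule csm_mult[OF ec PP_smooth])
 have "closed {x :: real^3. g (hor x) + LM M/2^n <= x$3}"
  by (intro closed_Collect_le continuous_intros lipg_cont[OF lip M])
 then show "closed (ccube q \<inter> {x. g (hor x) + LM M/2^n <= x$3})" by (intro closed_Int ccube_closed)
 show "{x. et x * PP n i j x ~= 0} \<subseteq> ccube q \<inter> {x. g (hor x) + LM M/2^n <= x$3}"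
 proof
  fix x assume "x \<in> {x. et x * PP n i j x ~= 0}"
  then have x: "x \<in> ccube q" "PP n i j x ~= 0" using esupp by auto
  then have "x \<in> cube (1/4)" using ccube_cube[OF q] by blast
  then show "x \<in> ccube q \<inter> {x. g (hor x) + LM M/2^n <= x$3}" using PP_supp x by blast
 qed
 have "LM M/2^n > 0" using KL by simp
 moreover have "ccube q \<subseteq> cube 1" using ccube_cube[of q 1] q by linarith
 ultimately show "ccube q \<inter> {x. g (hor x) + LM M/2^n <= x$3} \<subseteq> cube 1 \<inter> above g"
  unfolding above_def by auto
qed

private definition "phi i x = (S3 j. pd j (%x. et x * PP n i j x) x)"

private lemma eP_smooth: "smooth3 (%x. et x * PP n i j x)" by (intro smooth3_mult es PP_smooth)

private lemma phi_test: "test_fun (cube 1 \<inter> above g) (phi i)"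
 unfolding phi_def[abs_def] by (intro test_fun_sum test_fun_pd eP_test)

private lemma phi_div: "(S3 i. pd i (phi i) x) = 0"
proof -
 define Q where "Q i j = (%x. et x * PP n i j x)" for i j
 have Qs: "smooth3 (Q i j)" for i j unfolding Q_def by (rule eP_smooth)
 have Qa: "Q i j = (%x. - Q j i x)" for i j unfolding Q_def PP_def by (auto simp: algebra_simps)
 have e: "pd i (phi i) x = (S3 j. pd i (pd j (Q i j)) x)" for i
  unfolding phi_def[abs_def] Q_def[symmetric] by (subst pd_sum) (auto intro: Qs)
 have a: "pd i (pd j (Q i j)) x = - pd j (pd i (Q j i)) x" for i j
 proof -
  have "pd i (pd j (Q i j)) = pd j (pd i (Q i j))" by (rule pd_commute[OF Qs])
  also have "pd i (Q i j) = (%x. - pd i (Q j i) x)" by (subst Qa) (rule pd_uminus[OF Qs])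
  also have "pd j (%x. - pd i (Q j i) x) = (%x. - pd j (pd i (Q j i)) x)" by (rule pd_uminus[OF smooth3_pd[OF Qs]])
  finally show ?thesis by simp
 qed
 have "(S3 i. S3 j. pd i (pd j (Q i j)) x) = (S3 i. S3 j. - pd j (pd i (Q j i)) x)"
  by (intro sum.cong refl a)
 also have "... = - (S3 i. S3 j. pd j (pd i (Q j i)) x)" by (simp add: sum_negf)
 also have "(S3 i. S3 j. pd j (pd i (Q j i)) x) = (S3 i. S3 j. pd i (pd j (Q i j)) x)"
  by (rule sum.swap)
 finally show ?thesis unfolding e by simp
qed

text \<open>The part of the gradient of the test field \<open>phi\<close> in which some derivative
  falls on the cutoff. The rest is \<open>et * Gn\<close>, which produces the energy.\<close>

definition XX :: "3 => 3 => real^3 => real" where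
 "XX k l x = (S3 j. pd l (pd j et) x * PP n k j x + pd j et x * pd l (PP n k j) x) + pd l et x * un n k x"

private lemma phi_pd: "pd l (phi k) x = XX k l x + et x * Gn n k l x"
proof -
 have out: "et x = 0" if "x \<notin> cube (1/4)" for x
  using that esupp ccube_cube[OF q] by blast
 have p: "phi k = (%x. (S3 j. pd j et x * PP n k j x) + et x * un n k x)"
 proof
  fix x
  have "phi k x = (S3 j. pd j et x * PP n k j x) + et x * (S3 j. pd j (PP n k j) x)"
   unfolding phi_def by (simp add: pd_mult[OF es PP_smooth] sum.distrib sum_distrib_left)
  moreover have "et x * (S3 j. pd j (PP n k j) x) = et x * un n k x"
   using out[of x] div_PP[of x] by (cases "x \<in> cube (1/4)") auto
  ultimately show "phi k x = (S3 j. pd j et x * PP n k j x) + et x * un n k x" by simp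
 qed
 have sm: "smooth3 (%x. pd j et x * PP n k j x)" for j by (intro smooth3_mult smooth3_pd es PP_smooth)
 have "pd l (phi k) x = (S3 j. pd l (pd j et) x * PP n k j x + pd j et x * pd l (PP n k j) x) + (pd l et x * un n k x + et x * pd l (un n k) x)"
  unfolding p
  apply (subst pd_add)
   apply (intro smooth3_sum sm)
  apply (intro smooth3_mult es un_smooth)
  apply (simp only: pd_sum[OF sm] pd_mult[OF smooth3_pd[OF es] PP_smooth] pd_mult[OF es un_smooth])
  done
 moreover have "et x * pd l (un n k) x = et x * Gn n k l x"
 proof (cases "x \<in> cube (1/4)")
  case True
  have "pd l (un n k) x = Gn n k l x"
   unfolding un_def Gn_def conv_pd[OF uGF(1) kc]
   by (rule conv_weak[OF s kc ks_test[OF True]]) (auto simp: divide_simps)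
  then show ?thesis by simp
 qed (simp add: out)
 ultimately show ?thesis unfolding XX_def by simp
qed

private lemma bmul: assumes "smooth3 f" "l2 f" "csm k" shows "l2 (%x. k x * f x)"
proof -
 obtain B where "B > 0" "!!x. abs(k x) <= B" using csm_bounded[OF assms(3)] by blast
 then show ?thesis using assms l2_bounded_mult[of f k B] csm_l2[OF assms(3)] by (simp add: l2_def)
qed

private lemma pdPP_l2: "l2 (pd l (PP n k j))"
 unfolding pd_PP[abs_def] by (intro l2_diff csm_conv_l2 uGF csm_pd Nc)

lemma XX_l2: "l2 (XX k l)"
 unfolding XX_def[abs_def]
 by (intro l2_add l2_sum bmul csm_pd ec PP_smooth PP_l2 smooth3_pd pdPP_l2 un_smooth un_l2)

text \<open>The identity obtained by inserting the solenoidal field \<open>phi\<close>, absorbed by Young's inequality.\<close>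
lemma cacc_basic:
 assumes S: "S \<in> sets borel" "ccube q \<subseteq> S" and d: "d > 0" and e01: "!!x. 0 <= et x" "!!x. et x <= 1"
  and T: "!!x. x \<in> T ==> et x = 1" "T \<in> sets borel"
 shows "(S3 k. S3 l. sq T (G k l))/2 <=
  (S3 k. S3 l. 2 * d * sq S (G k l) + (2 * d + 1/(4 * d)) * sq S (F k l) + sq S (XX k l)/(4 * d)
    + d * sq S (Gn n k l) + sq UNIV (%x. Gn n k l x - G k l x)/2)" (is "_ <= (S3 k. S3 l. ?Q k l)")
proof -
 have z: "(S3 k. S3 l. LL x. (G k l x - F k l x) * pd l (phi k) x) = 0"
  by (rule solD(7)[OF s phi_test phi_div])
 have oneS: "et x = 0" if "x \<notin> S" for x using that esupp S(2) by blast
 have XS: "XX k l x = 0" if "x \<notin> S" for k l x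
 proof -
  have op: "open (- ccube q)" using ccube_closed by (rule open_Compl)
  have xin: "x \<in> - ccube q" using that S(2) by blast
  have z0: "et y = (%_. 0) y" if "y \<in> - ccube q" for y using that esupp by blast
  have d1: "pd j et y = 0" if "y \<in> - ccube q" for j y using pd_eq_open[OF op that z0] by simp
  have d1': "pd j et y = (%_. 0) y" if "y \<in> - ccube q" for j y using d1[OF that] by simp
  have d2: "pd l (pd j et) x = 0" for j using pd_eq_open[OF op xin d1'[of _ j]] by simp
  show ?thesis unfolding XX_def using d1[OF xin] d2 by simp
 qed
 have pw: "sq T (G k l)/2 <= (LL x. (G k l x - F k l x) * pd l (phi k) x)
  + ?Q k l" for k l
 proof -
  let ?G = "G k l" let ?F = "F k l" let ?X = "XX k l" let ?H = "Gn n k l"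
  have eH: "l2 (%x. et x * ?H x)"
   unfolding Gn_def by (intro bmul conv_smooth csm_conv_l2 uGF kc ec)
  have ip: "integrable lborel (%x. (?G x - ?F x) * pd l (phi k) x)"
   unfolding phi_pd by (intro l2_prod l2_diff uGF l2_add XX_l2 eH)
  let ?R = "%x. 2 * d * (ind S x * (?G x)^2) + (2 * d + 1/(4 * d)) * (ind S x * (?F x)^2)
    + (1/(4 * d)) * (ind S x * (?X x)^2) + d * (ind S x * (?H x)^2) + (1/2) * (ind UNIV x * (?H x - ?G x)^2)"
  have ii: "integrable lborel (%x. ind S x * (?G x)^2)" "integrable lborel (%x. ind S x * (?F x)^2)"
   "integrable lborel (%x. ind S x * (?X x)^2)" "integrable lborel (%x. ind S x * (?H x)^2)"
   "integrable lborel (%x. ind UNIV x * (?H x - ?G x)^2)"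
   by (intro sq_integrable uGF XX_l2 Gn_l2 l2_diff S; simp)+
  have iR: "integrable lborel ?R" using ii by (intro Bochner_Integration.integrable_add integrable_mult_right)
  have "sq T ?G/2 = (LL x. (1/2) * (ind T x * (?G x)^2))" by (simp add: sq_def)
  also have "... <= (LL x. (?G x - ?F x) * pd l (phi k) x + ?R x)"
  proof (rule integral_mono)
   show "integrable lborel (%x. (1/2) * (ind T x * (?G x)^2))"
    by (intro integrable_mult_right sq_integrable uGF T)
   show "integrable lborel (%x. (?G x - ?F x) * pd l (phi k) x + ?R x)"
    by (rule Bochner_Integration.integrable_add[OF ip iR])
   fix x
   show "(1/2) * (ind T x * (?G x)^2) <= (?G x - ?F x) * pd l (phi k) x + ?R x"
   proof (cases "x \<in> S")
    case False
    then have "x \<notin> T" using T(1)[of x] oneS[of x] by auto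
    then show ?thesis using False oneS[OF False] XS[OF False] by (simp add: phi_pd)
   next
    case True
    have young: "a * b <= d * a^2 + (1/(4 * d)) * b^2" for a b
    proof -
     have "0 <= d * (a - b/(2 * d))^2" using d by simp
     also have "... = d * a^2 - a * b + (1/(4 * d)) * b^2" using d by (simp add: p2eq field_simps)
     finally show ?thesis by simp
    qed
    define G' F' X' H' h where gs: "G' = ?G x" "F' = ?F x" "X' = ?X x" "H' = ?H x" "h = et x"
    have h: "0 <= h" "h <= 1" using e01 by (auto simp: gs)
    have 1: "ind T x * G'^2 <= h * G'^2"
     using T(1)[of x] h by (cases "x \<in> T") (auto simp: gs)
    have "0 <= (H' - G')^2" by simp
    \<comment> \<open>Replaces the product of the gradient and its mollification by the energy. The
      error keeps no cutoff; it tends to zero in L^2 over the whole space as n grows.\<close>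
    have 2: "h * (G'^2/2) <= h * (G' * H') + (1/2) * (H' - G')^2"
    proof -
     have "h * (G'^2/2 - G' * H') <= h * ((H' - G')^2/2)"
     proof (rule mult_left_mono[OF _ h(1)])
      have "0 <= H'^2" by simp
      then show "G'^2/2 - G' * H' <= (H' - G')^2/2" by (simp add: p2eq field_simps)
     qed
     also have "... <= 1 * ((H' - G')^2/2)" using h by (intro mult_right_mono) auto
     finally show ?thesis by (simp add: algebra_simps)
    qed
    have 3: "- ((G' - F') * X') <= d * (G' - F')^2 + (1/(4 * d)) * X'^2"
     using young[of "- (G' - F')" X'] unfolding power2_minus by (simp only: mult_minus_left)
    have 4: "(G' - F')^2 <= 2 * G'^2 + 2 * F'^2"
     using zero_le_power2[of "G' + F'"] by (simp add: p2eq algebra_simps)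
    have 5: "F' * (h * H') <= d * H'^2 + (1/(4 * d)) * F'^2"
    proof -
     have "F' * (h * H') = (h * H') * F'" by simp
     also have "... <= d * (h * H')^2 + (1/(4 * d)) * F'^2" by (rule young)
     also have "(h * H')^2 <= 1 * H'^2" unfolding power_mult_distrib using h by (intro mult_right_mono power_le_one) auto
     finally show ?thesis using d by simp
    qed
    have 6: "d * (G' - F')^2 <= d * (2 * G'^2 + 2 * F'^2)" using 4 d by (intro mult_left_mono) auto
    have "(1/2) * (ind T x * G'^2) <= (G' - F') * (X' + h * H') + (2 * d * G'^2 + (2 * d + 1/(4 * d)) * F'^2
    + (1/(4 * d)) * X'^2 + d * H'^2 + (1/2) * (H' - G')^2)"
    proof -
     have "(1/2) * (ind T x * G'^2) <= h * (G'^2/2)" using 1 by simp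
     also have "... <= (G' - F') * (X' + h * H') + (d * (2 * G'^2 + 2 * F'^2) + (1/(4 * d)) * X'^2 + (d * H'^2 + (1/(4 * d)) * F'^2) + (1/2) * (H' - G')^2)"
     proof -
      have e: "(G' - F') * (X' + h * H') = (G' - F') * X' + h * (G' * H') - F' * (h * H')" by (simp add: algebra_simps)
      show ?thesis unfolding e using 2 3 5 6 by linarith
     qed
     finally show ?thesis by (simp add: algebra_simps)
    qed
    then show ?thesis using True by (simp add: phi_pd gs)
   qed
  qed
  also have "... = (LL x. (?G x - ?F x) * pd l (phi k) x) + (LL x. ?R x)"
   by (rule Bochner_Integration.integral_add[OF ip iR])
  also have "(LL x. ?R x) = ?Q k l"
   unfolding sq_def using ii by simp
  finally show ?thesis .
 qed
 have "(S3 k. S3 l. sq T (G k l))/2 = (S3 k. S3 l. sq T (G k l)/2)"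
  by (simp add: sum_divide_distrib)
 also have "... <= (S3 k. S3 l. (LL x. (G k l x - F k l x) * pd l (phi k) x)
  + ?Q k l)"
  by (intro sum_mono pw)
 also have "... = (S3 k. S3 l. ?Q k l)"
  using z by (simp add: sum.distrib)
 finally show ?thesis .
qed

text \<open>The difficulty is the term in which the gradient falls on the potential. On coarse
  scales it stays on the kernel and costs a count of scales times the mass; on fine scales it moves
  to u and yields the energy with the small factor \<open>a/2^m0\<close>. That factor is what makes
  absorption possible.\<close>

lemma XX_bound:
 assumes a: "!!i. (LL p. abs(nk (KM M) i p)) <= a" "a > 0"
  and b: "!!i j. (LL p. abs(pd j (nk (KM M) i) p)) <= b" "b > 0"
  and c1: "!!j x. abs(pd j et x) <= c1" and c2: "!!i j x. abs(pd i (pd j et) x) <= c2"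
  and r: "r <= 1/4" "r + (56/100)/2^m0 <= R" and mn: "m0 <= n"
 shows "sq (cube r) (XX k l) <= 24 * (8 * c2^2 * a^2 * mas 1 u + 16 * c1^2 * ((real (m0 + 1) * b)^2 * mas 1 u + (a/2^m0)^2 * enr R G)) + 2 * c1^2 * mas 1 u"
  and "sq (cube r) (Gn n k l) <= sq (cube R) (G k l)"
proof -
 let ?U = "mas 1 u" let ?E = "enr R G" let ?S = "cube r" let ?W = "(real (m0 + 1) * b)^2 * ?U + (a/2^m0)^2 * ?E"
 have c0: "0 <= c1" "0 <= c2" using c1[of 1 0] c2[of 1 1 0] by linarith+
 have inR: "x - p \<in> cube R" if "x \<in> ?S" "abs(p$1) <= (56/100)/2^m0" "abs(p$2) <= (56/100)/2^m0" "0 <= p$3" "p$3 <= (56/100)/2^m0" for x p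
 proof (rule cubeI3)
  have bb: "abs(y - z) < R" if "abs(y) < r" "abs(z) <= (56/100)/2^m0" for y z using that r(2) by linarith
  show "abs((x - p)$1) < R" using bb[OF cubeD[OF that(1), of 1] that(2)] by simp
  show "abs((x - p)$2) < R" using bb[OF cubeD[OF that(1), of 2] that(3)] by simp
  have "abs(p$3) <= (56/100)/2^m0" using that(4,5) by simp
  then show "abs((x - p)$3) < R" using bb[OF cubeD[OF that(1), of 3]] by simp
 qed
 have r14: "x \<in> cube (1/4)" if "x \<in> ?S" for x using that cube_mono[OF r(1)] by blast
 have in1: "x - p \<in> cube 1" if "x \<in> ?S" "nM A i p ~= 0" for x p A i
  by (rule box_shift1[OF box_shift[OF r14[OF that(1)]]]) (use NN_box[OF that(2), of 0] in auto)
 have suppT: "y \<in> T" if "!!p. k p ~= 0 ==> x - p \<in> T" "k (x - y) ~= 0" for k T and x y :: "real^3"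
  using that(1)[OF that(2)] by simp
 have pdin1: "x - p \<in> ccube (9/10)" if x: "x \<in> ?S" and p: "pd l (nM A i) p ~= 0" for x p A i l
 proof (rule ccontr)
  assume out: "x - p \<notin> ccube (9/10)"
  define V where "V = (%p. x - p) -` (- ccube (9/10))"
  have "open V" unfolding V_def by (intro open_vimage continuous_intros open_Compl ccube_closed)
  moreover have "p \<in> V" using out by (simp add: V_def)
  moreover have "nM A i y = (%_. 0) y" if "y \<in> V" for y
  proof (rule ccontr)
   assume "nM A i y ~= (%_. 0) y"
   then have "x - y \<in> ccube (9/10)"
    by (intro box_shift[OF r14[OF x]]) (use NN_box[of A i y 0] in auto)
   then show False using that by (simp add: V_def)
  qed
  ultimately have "pd l (nM A i) p = pd l (%_. 0) p" by (rule pd_eq_open)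
  then show False using p by simp
 qed
 have L1: "LM M <= 1" using KL(4) by simp
 have Pc: "sq ?S (conv (u i) (nM {..<n} j)) <= a^2 * ?U" for i j
 proof -
  have "(LL p. abs(nM {..<n} j p)) <= a * (LM M/2^0)"
   by (rule NN_abs_int[OF KL(2,3)]) (use a in auto)
  also have "... <= a" using L1 a(2) by (simp add: mult_left_le)
  finally have "sq ?S (conv (u i) (nM {..<n} j)) <= a^2 * sq (cube 1) (u i)"
   by (rule conv_bound(2)[OF uGF(1) Nc _ a(2)]) (auto intro: suppT in1)
  also have "... <= a^2 * ?U" by (intro mult_left_mono sq_le_mas) auto
  finally show ?thesis .
 qed
 have Pb: "sq ?S (PP n i j) <= 4 * a^2 * ?U" for i j
 proof -
  have "sq ?S (PP n i j) <= 2 * sq ?S (conv (u i) (nM {..<n} j)) + 2 * sq ?S (conv (u j) (nM {..<n} i))"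
   unfolding PP_def[abs_def] by (intro sq_diff_le csm_conv_l2 uGF Nc cube_borel)
  then show ?thesis using Pc[of i j] Pc[of j i] by linarith
 qed
 have dP: "sq ?S (conv (u i) (pd l (nM {..<n} j))) <= 2 * (real (m0 + 1) * b)^2 * ?U + 2 * (a/2^m0)^2 * ?E" for i j l
 proof -
  \<comment> \<open>The splitting at \<open>m0\<close> into coarse and fine scales.\<close>
  have dec: "pd l (nM {..<n} j) = (%p. pd l (nM {..<m0} j) p + pd l (nM {m0..<n} j) p)"
  proof -
   have "{..<n} = {..<m0} \<union> {m0..<n}" using mn by auto
   then show ?thesis unfolding pd_NN[OF KL(2,3)] by (simp add: sum.union_disjoint ivl_disj_int)
  qed
  have 1: "sq ?S (conv (u i) (pd l (nM {..<m0} j))) <= (real (m0 + 1) * b)^2 * ?U"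
  proof -
   have "(LL p. abs(pd l (nM {..<m0} j) p)) <= real (card {..<m0}) * b"
    by (rule NN_pd_abs_int[OF KL(2,3)]) (use b in auto)
   also have "... <= real (m0 + 1) * b" using b(2) by simp
   finally have "sq ?S (conv (u i) (pd l (nM {..<m0} j))) <= (real (m0 + 1) * b)^2 * sq (cube 1) (u i)"
    by (rule conv_bound(2)[OF uGF(1) csm_pd[OF Nc]]) (use b(2) in \<open>auto intro: suppT box_shift1[OF pdin1]\<close>)
   also have "... <= (real (m0 + 1) * b)^2 * ?U" by (intro mult_left_mono sq_le_mas) auto
   finally show ?thesis .
  qed
  have 2: "sq ?S (conv (G i l) (nM {m0..<n} j)) <= (a/2^m0)^2 * ?E"
  proof -
   have "(LL p. abs(nM {m0..<n} j p)) <= a * (LM M/2^m0)"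
    by (rule NN_abs_int[OF KL(2,3)]) (use a in auto)
   also have "... <= a * (1/2^m0)" using L1 a(2) by (intro mult_left_mono divide_right_mono) auto
   finally have "(LL p. abs(nM {m0..<n} j p)) <= a/2^m0" by simp
   then have "sq ?S (conv (G i l) (nM {m0..<n} j)) <= (a/2^m0)^2 * sq (cube R) (G i l)"
   proof (rule conv_bound(2)[OF uGF(2) Nc])
    fix x y assume x: "x \<in> ?S" and k: "nM {m0..<n} j (x - y) ~= 0"
    have "x - (x - y) \<in> cube R" by (rule inR[OF x]) (use NN_box[OF k, of m0] in auto)
    then show "y \<in> cube R" by simp
   qed (use a(2) in auto)
   also have "... <= (a/2^m0)^2 * ?E" by (intro mult_left_mono sq_le_enr) auto
   finally show ?thesis .
  qed
  have "sq ?S (conv (u i) (pd l (nM {..<n} j))) = sq ?S (%x. conv (u i) (pd l (nM {..<m0} j)) x + conv (G i l) (nM {m0..<n} j) x)"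
  proof (rule sq_cong)
   fix x assume x: "x \<in> ?S"
   show "conv (u i) (pd l (nM {..<n} j)) x = conv (u i) (pd l (nM {..<m0} j)) x + conv (G i l) (nM {m0..<n} j) x"
    unfolding dec conv_add_ker[OF uGF(1) csm_pd[OF Nc] csm_pd[OF Nc]]
    by (simp add: conv_weak[OF s Nc NN_test[OF r14[OF x]]])
  qed
  also have "... <= 2 * sq ?S (conv (u i) (pd l (nM {..<m0} j))) + 2 * sq ?S (conv (G i l) (nM {m0..<n} j))"
   by (intro sq_add_le csm_conv_l2 uGF csm_pd Nc cube_borel)
  finally show ?thesis using 1 2 by linarith
 qed
 have dPb: "sq ?S (pd l (PP n i j)) <= 8 * (?W)" for l i j
 proof -
  have "sq ?S (pd l (PP n i j)) <= 2 * sq ?S (conv (u i) (pd l (nM {..<n} j))) + 2 * sq ?S (conv (u j) (pd l (nM {..<n} i)))"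
   unfolding pd_PP[abs_def] by (intro sq_diff_le csm_conv_l2 uGF csm_pd Nc cube_borel)
  then show ?thesis using dP[of i l j] dP[of j l i] by (simp add: algebra_simps)
 qed
 have kap1: "(LL p. abs(kM n p)) <= 1"
  using KL(3) by (simp add: abs_int_ks kap_nonneg kap_int)
 have ub: "sq ?S (un n i) <= ?U" for i
 proof -
  have "sq ?S (un n i) <= 1^2 * sq (cube 1) (u i)" unfolding un_def
  proof (rule conv_bound(2)[OF uGF(1) kc kap1])
   fix x y assume x: "x \<in> ?S" and k: "kM n (x - y) ~= 0"
   have n1: "0 < 1/(2::real)^n" "1/(2::real)^n <= 1" by (auto simp: divide_simps)
   have "x - (x - y) \<in> cube 1"
    by (rule box_shift1[OF box_shift[OF r14[OF x]]]) (use ks_box[OF n1(1) k] n1 in linarith)+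
   then show "y \<in> cube 1" by simp
  qed auto
  then show ?thesis using sq_le_mas[of 1 u i] by simp
 qed
 show "sq ?S (Gn n k l) <= sq (cube R) (G k l)"
 proof -
  have "sq ?S (Gn n k l) <= 1^2 * sq (cube R) (G k l)" unfolding Gn_def
  proof (rule conv_bound(2)[OF uGF(2) kc kap1])
   fix x y assume x: "x \<in> ?S" and k: "kM n (x - y) ~= 0"
   have n1: "0 < 1/(2::real)^n" by simp
   have n2: "(56/100) * (1/(2::real)^n) <= (56/100)/2^m0"
    using mn by (simp add: frac_le power_increasing)
   have n3: "0 <= (4/10) * (1/(2::real)^n)" by simp
   have "x - (x - y) \<in> cube R"
    by (rule inR[OF x]) (use ks_box[OF n1 k] n2 n3 in linarith)+
   then show "y \<in> cube R" by simp
  qed auto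
  then show ?thesis by simp
 qed
 have PPs: "l2 (%x. pd l (pd j et) x * PP n k j x)" "l2 (%x. pd j et x * pd l (PP n k j) x)" "l2 (%x. pd l et x * un n k x)" for k l j
  by (intro bmul csm_pd ec PP_smooth PP_l2 smooth3_pd pdPP_l2 un_smooth un_l2)+
 have m1: "sq ?S (%x. h x * f x) <= c^2 * sq ?S f" if "l2 (%x. h x * f x)" "l2 f" "!!x. abs(h x) <= c" "0 <= c" for h f c
 proof -
  have "sq ?S (%x. h x * f x) <= sq ?S (%x. c * f x)"
   using that by (intro sq_le l2_cmult) (auto simp: abs_mult intro!: mult_right_mono)
  then show ?thesis by (simp add: sq_cmult)
 qed
 let ?A = "%j x. pd l (pd j et) x * PP n k j x + pd j et x * pd l (PP n k j) x"
 have Aj: "sq ?S (?A j) <= 8 * c2^2 * a^2 * ?U + 16 * c1^2 * (?W)" for j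
 proof -
  have "sq ?S (?A j) <= 2 * sq ?S (%x. pd l (pd j et) x * PP n k j x) + 2 * sq ?S (%x. pd j et x * pd l (PP n k j) x)"
   by (intro sq_add_le PPs cube_borel)
  also have "... <= 2 * (c2^2 * sq ?S (PP n k j)) + 2 * (c1^2 * sq ?S (pd l (PP n k j)))"
   by (intro add_mono mult_left_mono m1 PPs PP_l2 pdPP_l2 c1 c2 c0) auto
  also have "... <= 2 * (c2^2 * (4 * a^2 * ?U)) + 2 * (c1^2 * (8 * (?W)))"
   by (intro add_mono mult_left_mono Pb dPb) auto
  finally show ?thesis by (simp add: algebra_simps)
 qed
 have "sq ?S (XX k l) <= 2 * sq ?S (%x. S3 j. ?A j x) + 2 * sq ?S (%x. pd l et x * un n k x)"
  unfolding XX_def[abs_def] by (intro sq_add_le l2_sum l2_add PPs cube_borel)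
 also have "... <= 2 * (4 * (S3 j. sq ?S (?A j))) + 2 * (c1^2 * sq ?S (un n k))"
  by (intro add_mono mult_left_mono sq_sum3_le m1 PPs l2_add un_l2 c1 c0 cube_borel) auto
 also have "... <= 2 * (4 * (\<Sum>j\<in>(UNIV::3 set). 8 * c2^2 * a^2 * ?U + 16 * c1^2 * (?W))) + 2 * (c1^2 * ?U)"
  by (intro add_mono mult_left_mono sum_mono Aj ub) auto
 also have "... = 24 * (8 * c2^2 * a^2 * ?U + 16 * c1^2 * (?W)) + 2 * c1^2 * ?U"
  by simp
 finally show "sq ?S (XX k l) <= 24 * (8 * c2^2 * a^2 * ?U + 16 * c1^2 * (?W)) + 2 * c1^2 * ?U" .
qed

end

end

lemma Gn_tendsto:
 assumes M: "M >= 0" and s: "sol 1 g u G F" and lip: "lipg M g" and gl: "!!y. -1/10 <= g y" and e: "e > 0"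
 shows "EV n. \<forall>k l. sq UNIV (%x. Gn M G n k l x - G k l x) < e"
proof -
 note G = solD(2)[OF s]
 have L: "LM M > 0" unfolding LM_def KM_def using M by simp
 have "EV n. sq UNIV (%x. Gn M G n k l x - G k l x) < e" for k l
 proof -
  obtain d where d: "d > 0" "!!s. 0 < s ==> s < d ==> sq UNIV (%x. conv (G k l) (ks s (kap (KM M))) x - G k l x) < e"
   using conv_ks_tendsto[OF G kap_csm kap_int e] by blast
  have "(%n. LM M * (1/2^n)) ~~> LM M * 0"
   using LIMSEQ_power_zero[of "1/2::real"] by (intro tendsto_mult tendsto_const) (simp add: power_divide)
  then have "EV n. LM M * (1/2^n) < d" using d(1) by (intro order_tendstoD(2)) auto
  then show ?thesis
  proof eventually_elim
   case (elim n)
   moreover have "0 < LM M * (1/2^n)" using L by simp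
   ultimately have "sq UNIV (%x. conv (G k l) (ks (LM M * (1/2^n)) (kap (KM M))) x - G k l x) < e" by (rule d(2)[rotated])
   then show ?case unfolding Gn_def[OF M s lip gl] .
  qed
 qed
 then show ?thesis by (intro eventually_all_finite) auto
qed

lemma pow2_between:
 fixes y :: real assumes "y >= 1" obtains m :: nat where "y <= 2^m" "2^m <= 2 * y"
proof -
 obtain n :: nat where n: "y < 2^n" using real_arch_pow[of 2 y] by auto
 define m where "m = (LEAST n. y <= (2::real)^n)"
 have m: "y <= 2^m" unfolding m_def by (rule LeastI[of _ n]) (use n in simp)
 have "2^m <= 2 * y"
 proof (cases m)
  case 0 then show ?thesis using assms by simp
 next
  case (Suc k)
  have "~y <= 2^k" using not_less_Least[of k "%n. y <= (2::real)^n"] Suc unfolding m_def by simp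
  then show ?thesis using Suc by simp
 qed
 then show ?thesis using that m by blast
qed

lemma enr_mono: "(!!k l. l2 (G k l)) ==> r <= R ==> enr r G <= enr R G"
 unfolding enr_def by (intro sum_mono sq_mono cube_mono) auto
lemma mas_mono: "(!!k. l2 (u k)) ==> r <= R ==> mas r u <= mas R u"
 unfolding mas_def by (intro sum_mono sq_mono cube_mono) auto

text \<open>With t = R - rh the cutoff contributes 1/t and the fine scales \<open>1/2^m0\<close>, so
  \<open>2^m0\<close> comparable to \<open>B/t\<close> makes their product as small as desired,
  uniformly in t. The number of coarse scales is at most \<open>2^m0\<close>, hence of order 1/t,
  and the mass is multiplied by t^-4 in total.\<close>

lemma cacc_step:
 assumes M: "M >= 0"
 shows "\<exists>C>0. \<forall>g u G F (rh::real) R. sol 1 g u G F & lipg M g & (\<forall>y. -1/10 <= g y) & 0 < rh & rh < R & R <= 1/4 -->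
  enr rh G <= enr R G/32 + C * (mas 1 u/(R - rh)^4 + enr 1 F)"
proof -
 obtain c where c: "c > 0" and cut: "!!rh R. 0 < rh & rh < R ==> (\<exists>et. csm et & (\<forall>x. 0 <= et x & et x <= 1) & (\<forall>x\<in>cube rh. et x = 1) &
  (\<forall>x. et x ~= 0 --> x \<in> ccube ((rh + R)/2)) & (\<forall>j x. abs(pd j et x) <= c/(R - rh)) &
  (\<forall>i j x. abs(pd i (pd j et) x) <= c/(R - rh)^2))"
  using cutoff by blast
 have nn: "0 <= (LL p. abs(f p))" for f :: "real^3 => real" by (intro integral_nonneg_AE) auto
 define a where "a = (S3 i. LL p. abs(nk (KM M) i p)) + 1"
 define b where "b = (S3 i. S3 j. LL p. abs(pd j (nk (KM M) i) p)) + 1"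
 have a: "a > 0" "(LL p. abs(nk (KM M) i p)) <= a" for i
 proof -
  show "a > 0" unfolding a_def using sum_nonneg[of UNIV "%i. LL p. abs(nk (KM M) i p)"] nn by (simp add: add_nonneg_pos)
  have "(LL p. abs(nk (KM M) i p)) <= (S3 i. LL p. abs(nk (KM M) i p))" by (rule member_le_sum) (auto simp: nn)
  then show "(LL p. abs(nk (KM M) i p)) <= a" unfolding a_def by linarith
 qed
 have b: "b > 0" "(LL p. abs(pd j (nk (KM M) i) p)) <= b" for i j
 proof -
  have "0 <= (S3 i. S3 j. LL p. abs(pd j (nk (KM M) i) p))" by (intro sum_nonneg nn)
  then show "b > 0" unfolding b_def by linarith
  have "(LL p. abs(pd j (nk (KM M) i) p)) <= (S3 j. LL p. abs(pd j (nk (KM M) i) p))" by (rule member_le_sum) (auto simp: nn)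
  also have "... <= (S3 i. S3 j. LL p. abs(pd j (nk (KM M) i) p))"
   by (rule member_le_sum[of i UNIV "%i. S3 j. LL p. abs(pd j (nk (KM M) i) p)"]) (auto simp: nn sum_nonneg)
  finally show "(LL p. abs(pd j (nk (KM M) i) p)) <= b" unfolding b_def by linarith
 qed
 \<comment> \<open>13100^2 exceeds 864 * 1536 * 128, the product of constants needed in
   \<open>small\<close>. The summand 2 makes the fine kernels reach no farther than t/2.\<close>
 define B where "B = 2 + 13100 * c * a"
 have B: "B >= 2" "B > 0" "13100 * c * a <= B" using mult_pos_pos[OF c a(1)] unfolding B_def by (auto simp: mult.assoc)
 define C1 where "C1 = 3072 * c^2 * a^2 + 6144 * c^2 * b^2 * B^2 + 8 * c^2"
 have C1: "C1 > 0" unfolding C1_def using c a b B by (intro add_nonneg_pos add_nonneg_nonneg) auto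
 define C where "C = 200 + 1728 * C1"
 show ?thesis
 proof (intro exI[of _ C] conjI allI impI)
  show "C > 0" using C1 by (simp add: C_def)
  fix g u G F and rh R :: real
  assume as: "sol 1 g u G F & lipg M g & (\<forall>y. -1/10 <= g y) & 0 < rh & rh < R & R <= 1/4"
  then have s: "sol 1 g u G F" and lip: "lipg M g" and gl: "!!y. -1/10 <= g y" and r: "0 < rh" "rh < R" "R <= 1/4" by auto
  note ul = solD(1-3)[OF s]
  define t where "t = R - rh"
  have t: "0 < t" "t <= 1" using r by (auto simp: t_def)
  define R' where "R' = (rh + R)/2"
  define q where "q = (rh + R')/2"
  have R': "rh < R'" "R' < R" "R' - rh = t/2" "R' + t/2 = R" "q < R'" "R' <= 1/4" "q < 1/4" using r unfolding q_def R'_def t_def by (auto simp: field_simps)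
  obtain et where e: "csm et" "!!x. 0 <= et x" "!!x. et x <= 1" "!!x. x \<in> cube rh ==> et x = 1"
   "!!x. et x ~= 0 ==> x \<in> ccube q" "!!j x. abs(pd j et x) <= c/(R' - rh)" "!!i j x. abs(pd i (pd j et) x) <= c/(R' - rh)^2"
   using cut[of rh R'] r(1) R'(1) unfolding q_def by blast
  have e1: "abs(pd j et x) <= 2 * c/t" for j x using e(6)[of j x] unfolding R'(3) by (simp add: mult.commute)
  have e2: "abs(pd i (pd j et) x) <= 4 * c/t^2" for i j x using e(7)[of i j x] unfolding R'(3) by (simp add: power_divide mult.commute)
  have "1 <= B/t" using B t by (simp add: divide_simps)
  then obtain m0 :: nat where m0: "B/t <= 2^m0" "2^m0 <= 2 * (B/t)" by (rule pow2_between)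
  have reach: "R' + (56/100)/2^m0 <= R"
  proof -
   have "2/t <= 2^m0" using B t by (intro order_trans[OF _ m0(1)] divide_right_mono) auto
   then have "(56/100) * 2 <= t * 2^m0" using t by (simp add: field_simps)
   then have "(56/100)/2^m0 <= t/2" by (simp add: field_simps)
   then show ?thesis using R'(4) by linarith
  qed
  have ma: "a/2^m0 <= a * t/B"
  proof -
   have "a/2^m0 <= a/(B/t)" using m0(1) a(1) B t by (intro divide_left_mono) auto
   then show ?thesis using t B by (simp add: field_simps)
  qed
  have mb: "real (m0 + 1) * b <= 2 * B/t * b"
  proof -
   have "m0 + 1 <= 2^m0" using less_exp[of m0] by (simp add: Suc_leI)
   then have "real (m0 + 1) <= 2^m0" by (metis of_nat_le_iff of_nat_numeral of_nat_power)
   also have "... <= 2 * B/t" using m0(2) by simp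
   finally show ?thesis using b(1) by (intro mult_right_mono) auto
  qed
  have pm: "(real (m0 + 1) * b)^2 <= (2 * B/t * b)^2" "(a/2^m0)^2 <= (a * t/B)^2"
  proof -
   have "0 <= real (m0 + 1) * b" using b(1) by simp
   then show "(real (m0 + 1) * b)^2 <= (2 * B/t * b)^2" by (rule power_mono[OF mb])
   have "0 <= a/2^m0" using a(1) by simp
   then show "(a/2^m0)^2 <= (a * t/B)^2" by (rule power_mono[OF ma])
  qed
  let ?U = "mas 1 u" let ?E = "enr R G"
  have X: "sq (cube R') (XX M u et n k l) <= C1 * (?U/t^4) + 1536 * c^2 * a^2/B^2 * ?E" if "m0 <= n" for n k l
  proof -
   have "sq (cube R') (XX M u et n k l) <= 24 * (8 * (4 * c/t^2)^2 * a^2 * ?U + 16 * (2 * c/t)^2 * ((real (m0 + 1) * b)^2 * ?U + (a/2^m0)^2 * ?E)) + 2 * (2 * c/t)^2 * ?U"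
    by (rule XX_bound(1)[OF M s lip gl e(1) R'(7) e(5) a(2) a(1) b(2) b(1) e1 e2 R'(6) reach that])
   also have "... <= 24 * (8 * (4 * c/t^2)^2 * a^2 * ?U + 16 * (2 * c/t)^2 * ((2 * B/t * b)^2 * ?U + (a * t/B)^2 * ?E)) + 2 * (2 * c/t)^2 * ?U"
    by (intro add_mono mult_left_mono mult_right_mono pm order_refl) auto
   also have "... = (3072 * c^2 * a^2 + 6144 * c^2 * b^2 * B^2) * (?U/t^4) + 8 * c^2 * (?U/t^2) + 1536 * c^2 * a^2/B^2 * ?E"
    using t B by (simp add: power_divide power_mult_distrib field_simps p2eq power4_eq_xxxx)
   also have "... <= (3072 * c^2 * a^2 + 6144 * c^2 * b^2 * B^2) * (?U/t^4) + 8 * c^2 * (?U/t^4) + 1536 * c^2 * a^2/B^2 * ?E"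
   proof -
    have "t^4 <= t^2" using t by (intro power_decreasing) auto
    then have "?U/t^2 <= ?U/t^4" using t by (intro divide_left_mono) auto
    then show ?thesis by (intro add_mono mult_left_mono order_refl) auto
   qed
   finally show ?thesis unfolding C1_def by (simp add: algebra_simps)
  qed
  have small: "864 * (1536 * c^2 * a^2/B^2) <= 1/128"
  proof -
   have "(13100 * c * a)^2 <= B^2" using B c a(1) by (intro power_mono) auto
   then have "171610000 * (c^2 * a^2) <= B^2" by (simp add: power_mult_distrib)
   moreover have "0 <= c^2 * a^2" by simp
   ultimately have "864 * 1536 * 128 * (c^2 * a^2) <= B^2" by linarith
   then show ?thesis using B by (simp add: field_simps)
  qed
  have main: "enr rh G <= ?E/32 + C * (?U/t^4 + enr 1 F) + eps" if eps: "eps > 0" for eps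
  proof -
   have "EV n. m0 <= n & (\<forall>k l. sq UNIV (%x. Gn M G n k l x - G k l x) < eps/9)"
    using eps by (intro eventually_conj eventually_ge_at_top Gn_tendsto[OF M s lip gl]) auto
   then obtain n where n: "m0 <= n" "!!k l. sq UNIV (%x. Gn M G n k l x - G k l x) < eps/9"
    by (auto simp: eventually_sequentially)
   \<comment> \<open>The energy terms with weights 2 d and d add up to 3/384 = 1/128. With the other
     1/128 from \<open>small\<close>, and doubled because of the halved left side, this is the 1/32
     of the claim.\<close>
   let ?d = "1/384 :: real"
   have sub: "ccube q \<subseteq> cube R'" using R'(5) by (rule ccube_cube)
   have GS: "sq (cube R') (G k l) <= sq (cube R) (G k l)" for k l
    using R'(2) by (intro sq_mono ul cube_mono) auto
   have FS: "sq (cube R') (F k l) <= sq (cube 1) (F k l)" for k l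
    using R'(6) by (intro sq_mono ul cube_mono) auto
   have "enr rh G/2 <= (S3 k. S3 l. 2 * ?d * sq (cube R') (G k l) + (2 * ?d + 1/(4 * ?d)) * sq (cube R') (F k l) + sq (cube R') (XX M u et n k l)/(4 * ?d)
    + ?d * sq (cube R') (Gn M G n k l) + sq UNIV (%x. Gn M G n k l x - G k l x)/2)"
    unfolding enr_def
    by (rule cacc_basic[OF M s lip gl e(1) R'(7) e(5) cube_borel sub _ e(2,3,4) cube_borel]) auto
   also have "... <= (S3 k. S3 l. (1/128) * sq (cube R) (G k l) + 100 * sq (cube 1) (F k l) + (96 * (C1 * (?U/t^4) + 1536 * c^2 * a^2/B^2 * ?E) + eps/18))"
   proof (intro sum_mono)
    fix k l
    have 1: "sq (cube R') (Gn M G n k l) <= sq (cube R) (G k l)"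
     by (rule XX_bound(2)[OF M s lip gl e(1) R'(7) e(5) a(2) a(1) b(2) b(1) e1 e2 R'(6) reach n(1)])
    have f0: "0 <= sq (cube 1) (F k l)" by simp
    have gen: "2 * ?d * g + (2 * ?d + 1/(4 * ?d)) * f + x/(4 * ?d) + ?d * h + w/2 <= (1/128) * g' + 100 * f' + (96 * A + eps/18)"
     if "g <= g'" "f <= f'" "0 <= f'" "x <= A" "h <= g'" "w < eps/9" for g g' f f' x h w A :: real
    proof -
     have "2 * ?d * g + (2 * ?d + 1/(4 * ?d)) * f + x/(4 * ?d) + ?d * h + w/2 = g/192 + (18433/192) * f + 96 * x + h/384 + w/2" by simp
     then show ?thesis using that by linarith
    qed
    show "2 * ?d * sq (cube R') (G k l) + (2 * ?d + 1/(4 * ?d)) * sq (cube R') (F k l) + sq (cube R') (XX M u et n k l)/(4 * ?d)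
    + ?d * sq (cube R') (Gn M G n k l) + sq UNIV (%x. Gn M G n k l x - G k l x)/2
     <= (1/128) * sq (cube R) (G k l) + 100 * sq (cube 1) (F k l) + (96 * (C1 * (?U/t^4) + 1536 * c^2 * a^2/B^2 * ?E) + eps/18)"
     by (rule gen[OF GS FS f0 X[OF n(1)] 1 n(2)])
   qed
   also have "... = (1/128) * ?E + 100 * enr 1 F + 9 * (96 * (C1 * (?U/t^4) + 1536 * c^2 * a^2/B^2 * ?E) + eps/18)"
    unfolding sum.distrib sum9_const enr_def by (simp add: sum_distrib_left)
   also have "... = (1/128) * ?E + 100 * enr 1 F + 864 * C1 * (?U/t^4) + (864 * (1536 * c^2 * a^2/B^2)) * ?E + eps/2"
    by (simp add: algebra_simps)
   also have "... <= (1/128) * ?E + 100 * enr 1 F + 864 * C1 * (?U/t^4) + (1/128) * ?E + eps/2"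
    by (intro add_mono mult_right_mono small order_refl) auto
   finally have "enr rh G <= ?E/32 + 200 * enr 1 F + 1728 * C1 * (?U/t^4) + eps" by simp
   also have "... <= ?E/32 + C * (?U/t^4 + enr 1 F) + eps"
   proof -
    have "0 <= 200 * (?U/t^4)" "0 <= 1728 * C1 * enr 1 F" using t C1 by auto
    then show ?thesis unfolding C_def by (simp add: algebra_simps)
   qed
   finally show ?thesis .
  qed
  show "enr rh G <= enr R G/32 + C * (mas 1 u/(R - rh)^4 + enr 1 F)"
   unfolding t_def[symmetric] by (rule field_le_epsilon) (use main in simp)
 qed
qed

text \<open>The energy on the larger cube is absorbed through the supremum of the energy weighted by
  (1/4 - rh)^4. The supremum is finite because the gradient is square integrable, so an inequality S
  <= S/2 + Q can be solved for S.\<close>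

theorem caccioppoli:
 assumes M: "M >= 0"
 shows "\<exists>C>0. \<forall>g u G F. sol 1 g u G F & lipg M g & (\<forall>y. -1/10 <= g y) --> enr (1/8) G <= C * (mas 1 u + enr 1 F)"
proof -
 obtain C where C: "C > 0" and st: "!!g u G F rh R. sol 1 g u G F & lipg M g & (\<forall>y. -1/10 <= g y) & 0 < rh & rh < R & R <= 1/4 ==>
  enr rh G <= enr R G/32 + C * (mas 1 u/(R - rh)^4 + enr 1 F)"
  using cacc_step[OF M] by blast
 show ?thesis
 proof (intro exI[of _ "32 * C * 4096"] conjI allI impI)
  show "32 * C * 4096 > 0" using C by simp
  fix g u G F assume as: "sol 1 g u G F & lipg M g & (\<forall>y. -1/10 <= g y)"
  then have s: "sol 1 g u G F" by simp
  note ul = solD(1-3)[OF s]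
  define h where "h rh = (1/4 - rh)^4 * enr rh G" for rh
  define I where "I = {1/8..<1/4::real}"
  have hb: "h rh <= enr (1/4) G" if "rh \<in> I" for rh
  proof -
   have "(1/4 - rh)^4 <= 1" "0 <= (1/4 - rh)^4" using that by (auto intro!: power_le_one simp: I_def)
   moreover have "enr rh G <= enr (1/4) G" using that by (intro enr_mono ul) (auto simp: I_def)
   ultimately have "h rh <= 1 * enr (1/4) G" unfolding h_def by (intro mult_mono) auto
   then show ?thesis by simp
  qed
  define S where "S = (SUP rh\<in>I. h rh)"
  have I: "I ~= {}" "1/8 \<in> I" by (auto simp: I_def)
  have bdd: "bdd_above (h ` I)" using hb by (intro bdd_aboveI2)
  have hS: "h rh <= S" if "rh \<in> I" for rh unfolding S_def using that bdd by (intro cSUP_upper)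
  let ?Q = "16 * C * (mas 1 u + enr 1 F)"
  have "h rh <= S/2 + ?Q" if "rh \<in> I" for rh
  proof -
   define t where "t = (1/4 - rh)/2"
   \<comment> \<open>Halving the distance to 1/4 lowers the weight by 16, and 16/32 = 1/2 is the
     contraction factor.\<close>
   define R where "R = rh + t"
   have t: "0 < t" "t <= 1/16" "R - rh = t" "1/4 - R = t" "1/4 - rh = 2 * t" using that by (auto simp: I_def t_def R_def field_simps)
   have R: "R \<in> I" "rh < R" "0 < rh" "R <= 1/4" using t that by (auto simp: I_def R_def)
   have t4: "0 < t^4" "t^4 <= 1" using t by (auto intro!: power_le_one)
   have "enr rh G <= enr R G/32 + C * (mas 1 u/(R - rh)^4 + enr 1 F)"
    by (rule st) (use as R in auto)
   then have "16 * t^4 * enr rh G <= 16 * t^4 * (enr R G/32 + C * (mas 1 u/t^4 + enr 1 F))"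
    unfolding t(3) using t4 by (intro mult_left_mono) auto
   also have "... = (t^4 * enr R G)/2 + 16 * C * (mas 1 u + t^4 * enr 1 F)"
    using t4 by (simp add: field_simps)
   also have "... <= h R/2 + 16 * C * (mas 1 u + 1 * enr 1 F)"
    using t4 C by (intro add_mono mult_left_mono mult_right_mono) (auto simp: h_def t(4))
   also have "... <= S/2 + ?Q" using hS[OF R(1)] by simp
   finally show ?thesis unfolding h_def t(5) by (simp add: power_mult_distrib)
  qed
  then have "S <= S/2 + ?Q" unfolding S_def[symmetric] by (subst S_def) (intro cSUP_least I)
  then have "S <= 2 * ?Q" by simp
  moreover have "h (1/8) <= S" using hS I(2) by blast
  ultimately have "(1/8)^4 * enr (1/8) G <= 2 * ?Q" unfolding h_def by simp
  then show "enr (1/8) G <= 32 * C * 4096 * (mas 1 u + enr 1 F)" by (simp add: power_divide algebra_simps)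
 qed
qed

section \<open>Operations on solutions\<close>

text \<open>Convolving f with the indicator of a large ball gives the constant integral of f near
  the origin. The derivative at the origin is 0 on the one hand and the integral of
  \<open>pd j f\<close> on the other, so the divergence theorem follows from
  \<open>conv_pd\<close>.\<close>

lemma integral_pd_zero:
 assumes f: "csm f" shows "(LL x. pd j f x) = 0"
proof -
 obtain r where r: "!!x. r < norm x ==> f x = 0" using f unfolding csm_def by blast
 define B where "B = cball (0::real^3) (abs(r) + 1)"
 have lB: "l2 (ind B)" unfolding B_def by (rule l2_indicator_bounded) auto
 have c: "conv (ind B) k x = (LL p. k p)"
  if "x \<in> ball 0 1" "!!p. r < norm p ==> k p = 0" for x and k :: "real^3 => real"
 proof -
  have e: "k p * ind B (x - p) = k p" for p
  proof (cases "r < norm p")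
   case False
   have "norm (x - p) <= norm x + norm p" by (rule norm_triangle_ineq4)
   moreover have "norm x < 1" using that(1) by simp
   ultimately have "x - p \<in> B" using False unfolding B_def by (simp only: mem_cball dist_0_norm)
   then show ?thesis by simp
  qed (use that in simp)
  show ?thesis unfolding conv_alt e ..
 qed
 have pz: "pd j f p = 0" if "r < norm p" for p
 proof -
  have "open {x::real^3. r < norm x}" by (intro open_Collect_less continuous_intros)
  then have "pd j f p = pd j (%x. 0) p"
   by (rule pd_eq_open) (use that r in auto)
  then show ?thesis by simp
 qed
 have "pd j (conv (ind B) f) 0 = pd j (%_. LL p. f p) 0"
  by (rule pd_eq_open[of "ball 0 1"]) (auto simp: c[OF _ r])
 then have "conv (ind B) (pd j f) 0 = 0" unfolding conv_pd[OF lB f] by simp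
 then show ?thesis using c[of 0 "pd j f"] pz by simp
qed

lemma IBP:
 assumes f: "csm f" and w: "smooth3 w"
 shows "(LL x. w x * pd j f x) = - (LL x. pd j w x * f x)"
proof -
 have "(LL x. pd j (%x. f x * w x) x) = 0" by (rule integral_pd_zero[OF csm_mult[OF f w]])
 moreover have "(LL x. pd j (%x. f x * w x) x) = (LL x. pd j f x * w x) + (LL x. f x * pd j w x)"
  unfolding pd_mult[OF csm_smooth[OF f] w]
  by (rule Bochner_Integration.integral_add) (intro csm_integrable csm_mult csm_pd f w smooth3_pd)+
 ultimately show ?thesis by (simp add: mult.commute)
qed

lemma test_fun_affine:
 assumes "test_fun Om ps" "c ~= 0" "!!x. c *R x + a \<in> Om ==> x \<in> Om'"
 shows "test_fun Om' (%x. ps (c *R x + a))"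
proof (rule csm_test_fun[of _ "(%x. c *R x + a) -` closure {x. ps x ~= 0}"])
 show "csm (%x. ps (c *R x + a))" by (rule csm_affine[OF test_fun_csm[OF assms(1)] assms(2)])
 show "closed ((%x. c *R x + a) -` closure {x. ps x ~= 0})"
  by (intro closed_vimage continuous_intros closed_closure)
 show "{x. ps (c *R x + a) ~= 0} \<subseteq> (%x. c *R x + a) -` closure {x. ps x ~= 0}"
  using closure_subset[of "{x. ps x ~= 0}"] by (simp add: subset_iff)
 have "closure {x. ps x ~= 0} \<subseteq> Om" using assms(1) unfolding test_fun_def by (elim conjE)
 then show "(%x. c *R x + a) -` closure {x. ps x ~= 0} \<subseteq> Om'"
  using assms(3) by (simp add: subset_iff)
qed

lemma sol_affine:
 assumes s: "sol R g u G F" and r: "r > 0"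
  and cub: "!!x. x \<in> cube R' ==> t + r *R x \<in> cube R"
  and ab: "!!x. x \<in> above g' \<longleftrightarrow> t + r *R x \<in> above g"
 shows "sol R' g' (%k x. c * u k (t + r *R x)) (%k j x. c * r * G k j (t + r *R x)) (%k j x. c * r * F k j (t + r *R x))"
proof -
 note ul = solD(1-3)[OF s]
 define Y where "Y ps = (%x::real^3. ps ((1/r) *R x + (- ((1/r) *R t))) :: real)" for ps
 have inv: "(1/r) *R (t + r *R x) + (- ((1/r) *R t)) = x" for x using r by (simp add: algebra_simps)
 have inv2: "t + r *R ((1/r) *R x + (- ((1/r) *R t))) = x" for x using r by (simp add: algebra_simps)
 have Yx: "Y ps (t + r *R x) = ps x" for ps x unfolding Y_def inv ..
 have Yt: "test_fun Om (Y ps)" if "test_fun Om' ps" "!!x. x \<in> Om' ==> t + r *R x \<in> Om" for Om Om' ps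
  unfolding Y_def
 proof (rule test_fun_affine[OF that(1)])
  fix x assume "(1/r) *R x + - ((1/r) *R t) \<in> Om'"
  from that(2)[OF this] show "x \<in> Om" unfolding inv2 .
 qed (use r in simp)
 have Yp: "pd j ps x = r * pd j (Y ps) (t + r *R x)" if "smooth3 ps" for j ps x
  unfolding Y_def pd_affine[OF that] inv using r by simp
 have I: "(LL x. f (t + r *R x)) = (LL x. f x)/r^3" for f :: "real^3 => real"
  using integral_affine3[of r f t] r by simp
 have ts: "smooth3 ps" if "test_fun Om ps" for Om ps using csm_smooth[OF test_fun_csm[OF that]] .
 have cv: "(LL x. c * f (t + r *R x) * pd j ps x) = c * r/r^3 * (LL x. f x * pd j (Y ps) x)"
  if "smooth3 ps" for f :: "real^3 => real" and j ps
 proof -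
  have "(LL x. c * f (t + r *R x) * pd j ps x) = (LL x. (%y. c * r * (f y * pd j (Y ps) y)) (t + r *R x))"
   by (rule icong) (simp add: Yp[OF that] mult_ac)
  also have "... = c * r/r^3 * (LL x. f x * pd j (Y ps) x)" using I[of "%y. f y * pd j (Y ps) y"] by simp
  finally show ?thesis .
 qed
 show ?thesis unfolding sol_def
 proof (intro conjI allI impI)
  show "l2 (%x. c * u k (t + r *R x))" for k by (intro l2_cmult l2_affine ul) (use r in simp)
  show "l2 (%x. c * r * G k j (t + r *R x))" "l2 (%x. c * r * F k j (t + r *R x))" for k j by (intro l2_cmult l2_affine ul; use r in simp)+
 next
  fix k j ps assume t: "test_fun (cube R') ps"
  have tY: "test_fun (cube R) (Y ps)" by (rule Yt[OF t cub])
  have "(LL x. c * r * G k j (t + r *R x) * ps x) = (LL x. (%y. c * r * (G k j y * Y ps y)) (t + r *R x))"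
   by (simp only: Yx mult_ac)
  also have "... = c * r/r^3 * (LL x. G k j x * Y ps x)" using I[of "%y. G k j y * Y ps y"] by simp
  finally show "(LL x. c * u k (t + r *R x) * pd j ps x) = - (LL x. c * r * G k j (t + r *R x) * ps x)"
   unfolding cv[OF ts[OF t]] solD(4)[OF s tY] by simp
 next
  fix ps assume t: "test_fun (cube R') ps"
  have tY: "test_fun (cube R) (Y ps)" by (rule Yt[OF t cub])
  show "(S3 k. LL x. c * u k (t + r *R x) * pd k ps x) = 0"
   unfolding cv[OF ts[OF t]] sum_distrib_left[symmetric] solD(5)[OF s tY] by simp
 next
  fix k x assume "x \<in> cube R' & x \<notin> above g'"
  then show "c * u k (t + r *R x) = 0" using solD(6)[OF s cub, of x k] ab by simp
 next
  fix ph :: "3 => real^3 => real" assume p: "(\<forall>k. test_fun (cube R' \<inter> above g') (ph k)) & (\<forall>x. (S3 k. pd k (ph k) x) = 0)"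
  have tY: "test_fun (cube R \<inter> above g) (Y (ph k))" for k
   by (rule Yt[of "cube R' \<inter> above g'"]) (use p cub ab in auto)
  have dY: "(S3 k. pd k (Y (ph k)) y) = 0" for y
  proof -
   have sm: "smooth3 (ph k)" for k using p ts by blast
   have "(S3 k. pd k (Y (ph k)) y) = (1/r) * (S3 k. pd k (ph k) ((1/r) *R y + (- ((1/r) *R t))))"
    unfolding Y_def pd_affine[OF sm] sum_distrib_left ..
   then show ?thesis using p by simp
  qed
  have sm: "smooth3 (ph k)" for k using p ts by blast
  have e: "(LL x. (c * r * G k j (t + r *R x) - c * r * F k j (t + r *R x)) * pd j (ph k) x)
   = c * r * r/r^3 * (LL x. (G k j x - F k j x) * pd j (Y (ph k)) x)" for k j
  proof -
   have "(LL x. (c * r * G k j (t + r *R x) - c * r * F k j (t + r *R x)) * pd j (ph k) x)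
   = (LL x. (%y. c * r * r * ((G k j y - F k j y) * pd j (Y (ph k)) y)) (t + r *R x))"
    by (rule icong) (simp add: Yp[OF sm] algebra_simps)
   also have "... = c * r * r/r^3 * (LL x. (G k j x - F k j x) * pd j (Y (ph k)) x)" using I[of "%y. (G k j y - F k j y) * pd j (Y (ph k)) y"] by simp
   finally show ?thesis .
  qed
  show "(S3 k. S3 j. LL x. (c * r * G k j (t + r *R x) - c * r * F k j (t + r *R x)) * pd j (ph k) x) = 0"
   unfolding e sum_distrib_left[symmetric] using solD(7)[OF s tY dY] by simp
 qed
qed

lemma sol_add:
 assumes s: "sol R g u G F" and s': "sol R g u' G' F'"
 shows "sol R g (%k x. u k x + u' k x) (%k j x. G k j x + G' k j x) (%k j x. F k j x + F' k j x)"
proof -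
 note ul = solD(1-3)[OF s] solD(1-3)[OF s']
 have add: "(LL x. (f x + f' x) * h x) = (LL x. f x * h x) + (LL x. f' x * h x)"
  if "l2 f" "l2 f'" "l2 h" for f f' h
  using that l2_prod by (simp add: ring_distribs)
 have tl: "l2 ps" "l2 (pd j ps)" if "test_fun Om ps" for Om ps j
  using csm_l2[OF test_fun_csm[OF that]] csm_l2[OF csm_pd[OF test_fun_csm[OF that]]] by auto
 show ?thesis unfolding sol_def
 proof (intro conjI allI impI)
  show "l2 (%x. u k x + u' k x)" for k by (intro l2_add ul)
  show "l2 (%x. G k j x + G' k j x)" "l2 (%x. F k j x + F' k j x)" for k j by (intro l2_add ul)+
 next
  fix k j ps assume t: "test_fun (cube R) ps"
  show "(LL x. (u k x + u' k x) * pd j ps x) = - (LL x. (G k j x + G' k j x) * ps x)"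
   unfolding add[OF ul(1) ul(4) tl(2)[OF t]] add[OF ul(2) ul(5) tl(1)[OF t]] solD(4)[OF s t] solD(4)[OF s' t] by simp
 next
  fix ps assume t: "test_fun (cube R) ps"
  show "(S3 k. LL x. (u k x + u' k x) * pd k ps x) = 0"
   unfolding add[OF ul(1) ul(4) tl(2)[OF t]] sum.distrib solD(5)[OF s t] solD(5)[OF s' t] by simp
 next
  fix k x assume "x \<in> cube R & x \<notin> above g"
  then show "u k x + u' k x = 0" using solD(6)[OF s, of x k] solD(6)[OF s', of x k] by simp
 next
  fix ph :: "3 => real^3 => real" assume p: "(\<forall>k. test_fun (cube R \<inter> above g) (ph k)) & (\<forall>x. (S3 k. pd k (ph k) x) = 0)"
  have e: "(LL x. (G k j x + G' k j x - (F k j x + F' k j x)) * pd j (ph k) x) =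
   (LL x. (G k j x - F k j x) * pd j (ph k) x) + (LL x. (G' k j x - F' k j x) * pd j (ph k) x)" for k j
  proof -
   have t: "test_fun (cube R \<inter> above g) (ph k)" using p by blast
   show ?thesis using add[OF l2_diff[OF ul(2,3)] l2_diff[OF ul(5,6)] tl(2)[OF t], of k j k j k j k j j] by (simp add: algebra_simps)
  qed
  show "(S3 k. S3 j. LL x. (G k j x + G' k j x - (F k j x + F' k j x)) * pd j (ph k) x) = 0"
   unfolding e sum.distrib using solD(7)[OF s, of ph] solD(7)[OF s', of ph] p by simp
 qed
qed

lemma sol_mono: "sol R g u G F ==> R' <= R ==> sol R' g u G F"
 using sol_affine[of R g u G F 1 R' 0 g 1] cube_mono[of R' R] by auto

lemma sol_scale:
 assumes s: "sol R g u G F" and r: "r > 0"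
 shows "sol (R/r) (%y. g (r *R y)/r) (%k x. c * u k (r *R x)) (%k j x. c * r * G k j (r *R x)) (%k j x. c * r * F k j (r *R x))"
proof -
 have h: "hor (r *R x) = r *R hor x" for x by (simp add: hor_def vec_eq_iff)
 have "sol (R/r) (%y. g (r *R y)/r) (%k x. c * u k (0 + r *R x)) (%k j x. c * r * G k j (0 + r *R x)) (%k j x. c * r * F k j (0 + r *R x))"
 proof (rule sol_affine[OF s r])
  show "0 + r *R x \<in> cube R" if "x \<in> cube (R/r)" for x
   using that r by (simp add: cube_def abs_mult field_simps)
  show "(x \<in> above (%y. g (r *R y)/r)) = (0 + r *R x \<in> above g)" for x
   using r by (simp add: above_def h field_simps)
 qed
 then show ?thesis by simp
qed

lemma lipg_scale:
 assumes "lipg M g" "r > 0" shows "lipg M (%y. g (r *R y)/r)"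
 unfolding lipg_def
proof (intro allI)
 fix a b :: "real^2"
 have "abs(g (r *R a) - g (r *R b)) <= M * dist (r *R a) (r *R b)" using assms(1) unfolding lipg_def by blast
 also have "dist (r *R a) (r *R b) = r * dist a b" using assms(2) by (simp add: dist_norm scaleR_diff_right[symmetric])
 finally have "abs(g (r *R a) - g (r *R b))/r <= M * dist a b" using assms(2) by (simp add: field_simps)
 moreover have "abs(g (r *R a)/r - g (r *R b)/r) = abs(g (r *R a) - g (r *R b))/r"
  using assms(2) by (simp add: diff_divide_distrib[symmetric] abs_divide)
 ultimately show "abs(g (r *R a)/r - g (r *R b)/r) <= M * dist a b" by simp
qed

lemma sq_scale: "r > 0 ==> sq (cube R) (%x. c * f (r *R x)) = c^2/r^3 * sq (cube (r * R)) f"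
proof -
 assume r: "r > 0"
 have e: "(%x. 0 + r *R x) -` cube (r * R) = cube R" using r by (auto simp: cube_def abs_mult)
 have "sq (cube (r * R)) f = r^3 * sq (cube R) (%x. f (r *R x))"
  using sq_affine[of r "cube (r * R)" f 0] r unfolding e by simp
 then show ?thesis using r by (simp add: sq_cmult)
qed

text \<open>Young's inequality with weights \<open>1 + et\<close> and \<open>1 + 1/et\<close> keeps
  the constant A exact, which the factor 2 of \<open>sq_add_le\<close> would not.\<close>

lemma sq_le_limit:
 assumes l: "l2 D" "S \<in> sets borel"
  and lim: "!!e. e > 0 ==> \<exists>E. l2 E & sq S E <= A & sq S (%x. E x - D x) < e"
 shows "sq S D <= A"
proof -
 have A0: "0 <= A"
 proof -
  obtain E where "sq S E <= A" using lim[of 1] by auto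
  then show ?thesis using sq_nonneg[of S E] by linarith
 qed
 have "sq S D <= A + eps" if eps: "eps > 0" for eps
 proof -
  define et where "et = eps/(2 * (A + 1))"
  have et: "et > 0" using A0 eps by (simp add: et_def)
  define e where "e = eps/(2 * (1 + 1/et))"
  have p: "1 + 1/et > 0" using et by (simp add: add_pos_pos)
  have e: "e > 0" using eps p by (simp add: e_def)
  obtain E where n: "l2 E" "sq S E <= A" "sq S (%x. E x - D x) < e" using lim[OF e] by blast
  have "sq S D <= (LL x. (1 + et) * (ind S x * (E x)^2) + (1 + 1/et) * (ind S x * (E x - D x)^2))"
   unfolding sq_def
  proof (rule integral_mono)
   fix x
   have "(D x)^2 <= (1 + et) * (E x)^2 + (1 + 1/et) * (E x - D x)^2"
   proof -
    define a b where ab: "a = E x" "b = E x - D x"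
    have "0 <= et * (a + b/et)^2" using et by simp
    also have "... = et * a^2 + 2 * a * b + b^2/et" using et by (simp add: p2eq field_simps)
    finally have "(a - b)^2 <= (1 + et) * a^2 + (1 + 1/et) * b^2" by (simp add: p2eq algebra_simps)
    then show ?thesis by (simp add: ab)
   qed
   then show "ind S x * (D x)^2 <= (1 + et) * (ind S x * (E x)^2) + (1 + 1/et) * (ind S x * (E x - D x)^2)"
    by (auto simp: indicator_def)
  qed (intro Bochner_Integration.integrable_add integrable_mult_right sq_integrable l2_diff l n)+
  also have "... = (1 + et) * sq S E + (1 + 1/et) * sq S (%x. E x - D x)"
   unfolding sq_def using sq_integrable[OF n(1) l(2)] sq_integrable[OF l2_diff[OF n(1) l(1)] l(2)] by simp
  also have "... <= (1 + et) * A + (1 + 1/et) * e" using n et p by (intro add_mono mult_left_mono) auto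
  also have "(1 + 1/et) * e = eps/2"
  proof -
   have "w * (eps/(2 * w)) = eps/2" if "w > 0" for w :: real using that by (simp add: field_simps)
   from this[OF p] show ?thesis unfolding e_def .
  qed
  also have "(1 + et) * A = A + eps/2 * (A/(A + 1))" using A0 by (simp add: et_def field_simps)
  also have "A + eps/2 * (A/(A + 1)) + eps/2 <= A + eps/2 * 1 + eps/2" using A0 eps by (intro add_mono mult_left_mono) auto
  finally show ?thesis by simp
 qed
 then show ?thesis by (rule field_le_epsilon)
qed

lemma sq_UNIV_shift: "sq UNIV (%x. f (x + t)) = sq UNIV f"
 using sq_affine[of 1 UNIV f t] by (simp add: add.commute)

section \<open>Difference quotients and a Poincare inequality near the graph\<close>

lemma smooth_line_diff:
 assumes f: "smooth3 f"
 shows "(f (x + h *R ax j) - f x)^2 <= (LL s. ind {0..1} s * (h^2 * (pd j f (x + (s * h) *R ax j))^2))"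
proof -
 let ?w = "%s. h * pd j f (x + (s * h) *R ax j)"
 have wc: "continuous_on {0..1} ?w"
  by (intro continuous_intros continuous_on_compose2[OF smooth3_cont[OF smooth3_pd[OF f], of UNIV]]) auto
 have d: "((%s. f (x + (s * h) *R ax j)) has_vector_derivative ?w s) (at s within {0..1})" for s
 proof -
  have "((%t. f (x + t *R ax j)) has_real_derivative pd j f (x + (s * h) *R ax j)) (at (s * h))"
   by (rule hasp_line[OF smooth3_imp(2)[OF f]])
  moreover have "((%s. s * h) has_real_derivative h) (at s)" by (auto intro!: derivative_eq_intros)
  ultimately have "((%s. f (x + (s * h) *R ax j)) has_real_derivative pd j f (x + (s * h) *R ax j) * h) (at s)"
   by (rule DERIV_chain2)
  then show ?thesis by (simp add: has_real_derivative_iff_has_vector_derivative mult.commute has_vector_derivative_at_within)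
 qed
 have "(LL s. ind {0..1} s *R ?w s) = f (x + (1 * h) *R ax j) - f (x + (0 * h) *R ax j)"
  by (rule integral_FTC_atLeastAtMost) (use d wc in auto)
 then have e: "f (x + h *R ax j) - f x = (LL s. ind {0..1} s * ?w s)" by simp
 have i: "integrable lborel (%s. ind {0..1} s * v s)" if "continuous_on {0..1} v" for v :: "real => real"
  using borel_integrable_compact[OF _ that] by simp
 have "(LL s. ind {0..1} s * ?w s)^2 <= 1 * (LL s. ind {0..1} s * (?w s)^2)"
  by (rule CS_weight) (use i[of "%_. 1"] i[OF wc] i[OF continuous_on_power[OF wc, of 2]] in auto)
 then show ?thesis unfolding e by (simp add: power_mult_distrib)
qed

lemma kap_abs_int: "s > 0 ==> (LL p. abs(ks s (kap K) p)) = 1"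
 by (simp add: abs_int_ks kap_nonneg kap_int)

text \<open>For mollified u this is the fundamental theorem along segments, Cauchy-Schwarz, and an
  exchange of the integrals over segment parameter and space; the sharp constant survives the limit.
  The number \<open>dl\<close> is the room for the mollifier.\<close>

lemma diff_bound:
 assumes s: "sol R g u G F" and S[measurable]: "S \<in> sets borel" and T: "T \<in> sets borel" and dl: "dl > 0"
  and reach: "!!x sg p. x \<in> S ==> 0 <= sg ==> sg <= 1 ==> (!!i. abs(p$i) <= dl) ==> x + (sg * h) *R ax j - p \<in> T"
  and Tr: "T \<subseteq> ccube r" "r < R"
 shows "sq S (%x. u k (x + h *R ax j) - u k x) <= h^2 * sq T (G k j)"
proof -
 note ul = solD(1-3)[OF s]
 have step: "sq S (%x. conv (u k) (ks e (kap 0)) (x + h *R ax j) - conv (u k) (ks e (kap 0)) x) <= h^2 * sq T (G k j)"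
  if e: "0 < e" "e <= dl" for e
 proof -
  let ?K = "ks e (kap 0)"
  have K: "csm ?K" by (rule csm_ks[OF kap_csm e(1)])
  let ?f = "conv (u k) ?K" let ?w = "conv (G k j) ?K"
  have fs: "smooth3 ?f" by (rule conv_smooth[OF ul(1) K])
  have ws: "continuous_on UNIV ?w" by (rule conv_cont[OF ul(2) K])
  have [measurable]: "?f \<in> BM" "?w \<in> BM"
   using smooth3_cont[OF fs] ws by (auto intro: borel_measurable_continuous_onI)
  have inT: "x + (sg * h) *R ax j - p \<in> T" if "x \<in> S" "0 <= sg" "sg <= 1" "?K p ~= 0" for x sg p
   using reach[OF that(1-3)] ks_kap_box[OF e(1) that(4)] e(2) order_trans by blast
  have pdw: "pd j ?f (x + (sg * h) *R ax j) = ?w (x + (sg * h) *R ax j)" if "x \<in> S" "0 <= sg" "sg <= 1" for x sg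
   unfolding conv_pd[OF ul(1) K]
  proof (rule conv_weak[OF s K])
   show "test_fun (cube R) (%y. ?K (x + (sg * h) *R ax j - y))"
    by (rule test_fun_refl[OF K ccube_closed ccube_cube[OF Tr(2)]]) (use inT[OF that] Tr(1) in blast)
  qed
  have "(\<integral>\<^sup>+x. ennreal (ind S x * (?f (x + h *R ax j) - ?f x)^2) \<partial>lborel)
   <= (\<integral>\<^sup>+x. (\<integral>\<^sup>+sg. ennreal (ind S x * (ind {0..1} sg * (h^2 * (?w (x + (sg * h) *R ax j))^2))) \<partial>lborel) \<partial>lborel)"
  proof (rule nn_integral_mono)
   fix x
   show "ennreal (ind S x * (?f (x + h *R ax j) - ?f x)^2) <= (\<integral>\<^sup>+sg. ennreal (ind S x * (ind {0..1} sg * (h^2 * (?w (x + (sg * h) *R ax j))^2))) \<partial>lborel)"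
   proof (cases "x \<in> S")
    case True
    have c: "continuous_on {0..1} (%sg. h^2 * (?w (x + (sg * h) *R ax j))^2)"
     by (intro continuous_intros continuous_on_compose2[OF ws]) auto
    have i: "integrable lborel (%sg. ind {0..1} sg * (h^2 * (?w (x + (sg * h) *R ax j))^2))"
     using borel_integrable_compact[OF _ c] by simp
    have "(?f (x + h *R ax j) - ?f x)^2 <= (LL sg. ind {0..1} sg * (h^2 * (pd j ?f (x + (sg * h) *R ax j))^2))"
     by (rule smooth_line_diff[OF fs])
    also have "... = (LL sg. ind {0..1} sg * (h^2 * (?w (x + (sg * h) *R ax j))^2))"
     by (rule icong) (use pdw[OF True] in \<open>auto simp: indicator_def\<close>)
    finally have "ennreal ((?f (x + h *R ax j) - ?f x)^2) <= ennreal (LL sg. ind {0..1} sg * (h^2 * (?w (x + (sg * h) *R ax j))^2))"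
     by (rule ennreal_leI)
    also have "... = (\<integral>\<^sup>+sg. ennreal (ind {0..1} sg * (h^2 * (?w (x + (sg * h) *R ax j))^2)) \<partial>lborel)"
     by (rule nn_integral_eq_integral[symmetric, OF i]) auto
    finally show ?thesis using True by simp
   qed simp
  qed
  also have "... = (\<integral>\<^sup>+sg. (\<integral>\<^sup>+x. ennreal (ind S x * (ind {0..1} sg * (h^2 * (?w (x + (sg * h) *R ax j))^2))) \<partial>lborel) \<partial>lborel)"
   by (rule lborel_pair.Fubini'[symmetric]) measurable
  also have "... <= (\<integral>\<^sup>+sg. ennreal (h^2 * sq T (G k j)) * ind {0..1} (sg::real) \<partial>lborel)"
  proof (rule nn_integral_mono)
   fix sg :: real
   show "(\<integral>\<^sup>+x. ennreal (ind S x * (ind {0..1} sg * (h^2 * (?w (x + (sg * h) *R ax j))^2))) \<partial>lborel) <= ennreal (h^2 * sq T (G k j)) * ind {0..1} sg"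
   proof (cases "sg \<in> {0..1}")
    case True
    let ?t = "(sg * h) *R ax j"
    let ?S = "(%x. x + ?t) -` S"
    define S' where "S' = (%y. y - ?t) -` S"
    have S'b: "S' \<in> sets borel"
    proof -
     have "(%y. y - ?t) \<in> BM" by measurable
     from measurable_sets[OF this, of S] show ?thesis using S by (simp add: S'_def)
    qed
    have Sv: "(%x. ?t + 1 *R x) -` S' = S" unfolding S'_def by auto
    have wl: "l2 ?w" by (rule csm_conv_l2[OF ul(2) K])
    have wl2: "l2 (%x. h * ?w (x + ?t))" by (intro l2_cmult l2_shift wl)
    have "sq S (%x. ?w (x + ?t)) = sq S' ?w"
     using sq_affine[of 1 S' ?w ?t] unfolding Sv by (simp add: add.commute)
    also have "... <= 1^2 * sq T (G k j)"
    proof (rule conv_bound(2)[OF ul(2) K _ _ S'b T])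
     show "(LL p. abs(?K p)) <= 1" using kap_abs_int[OF e(1)] by simp
     fix x y assume "x \<in> S'" and k: "?K (x - y) ~= 0"
     then have "x - ?t \<in> S" by (simp add: S'_def)
     from inT[OF this _ _ k, of sg] True show "y \<in> T" by simp
    qed simp
    finally have b: "sq S (%x. h * ?w (x + ?t)) <= h^2 * sq T (G k j)" unfolding sq_cmult by (simp add: mult_left_mono)
    have "(\<integral>\<^sup>+x. ennreal (ind S x * (ind {0..1} sg * (h^2 * (?w (x + ?t))^2))) \<partial>lborel) = (\<integral>\<^sup>+x. ennreal (ind S x * (h * ?w (x + ?t))^2) \<partial>lborel)"
     using True by (simp add: power_mult_distrib)
    also have "... = ennreal (sq S (%x. h * ?w (x + ?t)))"
     unfolding sq_def by (rule nn_integral_eq_integral[OF sq_integrable[OF wl2 S]]) auto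
    also have "... <= ennreal (h^2 * sq T (G k j))" using b by (rule ennreal_leI)
    finally show ?thesis using True by simp
   qed simp
  qed
  also have "... = ennreal (h^2 * sq T (G k j))" by (simp add: nn_integral_cmult_indicator)
  finally show ?thesis unfolding sq_def[of S] by (rule nn_bound(2)[rotated 2]) auto
 qed
 show ?thesis
 proof (rule sq_le_limit[OF l2_diff[OF l2_shift[OF ul(1)] ul(1)] S])
  fix e :: real assume e: "e > 0"
  obtain d where d: "d > 0" "!!s. 0 < s & s < d ==> sq UNIV (%x. conv (u k) (ks s (kap 0)) x - u k x) < e/8"
   using conv_ks_tendsto[OF ul(1) kap_csm kap_int, of "e/8" k 0] e by auto
  define s where "s = min dl d/2"
  have s: "0 < s" "s <= dl" "s < d" using d dl by (auto simp: s_def)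
  let ?E = "conv (u k) (ks s (kap 0))"
  have E: "l2 ?E" using s by (intro csm_conv_l2 ul csm_ks kap_csm)
  have "sq S (%x. ?E (x + h *R ax j) - ?E x - (u k (x + h *R ax j) - u k x))
   = sq S (%x. (?E (x + h *R ax j) - u k (x + h *R ax j)) - (?E x - u k x))" by (simp add: algebra_simps)
  also have "... <= sq UNIV (%x. (?E (x + h *R ax j) - u k (x + h *R ax j)) - (?E x - u k x))"
   by (intro sq_mono l2_diff l2_shift[of ?E] l2_shift[of "u k"] E ul S) auto
  also have "... <= 2 * sq UNIV (%x. ?E (x + h *R ax j) - u k (x + h *R ax j)) + 2 * sq UNIV (%x. ?E x - u k x)"
   by (intro sq_diff_le l2_diff l2_shift[of ?E] l2_shift[of "u k"] E ul) auto
  also have "... < e" using sq_UNIV_shift[of "%x. ?E x - u k x" "h *R ax j"] d(2)[of s] s e by simp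
  finally show "\<exists>E. l2 E & sq S E <= h^2 * sq T (G k j) & sq S (%x. E x - (u k (x + h *R ax j) - u k x)) < e"
   by (intro exI[of _ "%x. ?E (x + h *R ax j) - ?E x"] conjI l2_diff l2_shift[of ?E] E step[OF s(1,2)])
 qed
qed

text \<open>Every point of the strip, moved down by \<open>s + eps\<close>, lands below the graph
  where u vanishes; so there u is, up to sign, a vertical difference. Points lower than -eps carry
  no mass and are dropped, and \<open>s + 2 * eps < r\<close> keeps the moved points inside the
  cube.\<close>

lemma poincare:
 assumes s: "sol R g u G F" and g: "!!y. - eps <= g y" and e: "0 <= eps" "0 <= s" "s < s'" and r: "r < r'" "r' < R" "s + 2 * eps < r"
 shows "sq (cube r \<inter> {x. x$3 < s}) (u k) <= (s + eps)^2 * sq (cube r' \<inter> {x. x$3 < s'}) (G k 3)"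
proof -
 define L where "L = s + eps"
 define S where "S = cube r \<inter> {x. x$3 < s} \<inter> {x. - eps <= x$3}"
 define T where "T = cube r' \<inter> {x. x$3 < s'}"
 note ul = solD(1-3)[OF s]
 have ob: "open {x::real^3. x$3 < c}" for c by (intro open_Collect_less continuous_intros)
 have "closed {x::real^3. - eps <= x$3}" by (intro closed_Collect_le continuous_intros)
 then have Sb: "S \<in> sets borel" unfolding S_def using ob by (intro sets.Int cube_borel) auto
 have Tb: "T \<in> sets borel" unfolding T_def using ob by (intro sets.Int cube_borel) auto
 have low: "u k x = 0" if "x \<in> cube R" "x$3 < - eps" for x
  using solD(6)[OF s that(1), of k] g[of "hor x"] that(2) by (force simp: above_def)
 have Sb0: "cube r \<inter> {x. x$3 < s} \<in> sets borel" using ob by (intro sets.Int cube_borel) auto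
 have S1: "sq (cube r \<inter> {x. x$3 < s}) (u k) = sq S (u k)"
  unfolding sq_def
 proof (rule icong)
  fix x
  show "ind (cube r \<inter> {x. x$3 < s}) x * (u k x)^2 = ind S x * (u k x)^2"
  proof (cases "x \<in> cube r & x$3 < - eps")
   case True
   then have "x \<in> cube R" using cube_mono[of r R] r by auto
   then show ?thesis using low True by simp
  next
   case False
   then show ?thesis unfolding S_def indicator_def by auto
  qed
 qed
 have S2: "sq S (u k) = sq S (%x. u k (x + (- L) *R ax 3) - u k x)"
  unfolding sq_def
 proof (rule icong)
  fix x
  show "ind S x * (u k x)^2 = ind S x * (u k (x + (- L) *R ax 3) - u k x)^2"
  proof (cases "x \<in> S")
   case True
   have x: "abs(x$1) < r" "abs(x$2) < r" "x$3 < s" "- eps <= x$3" using True cubeD[of x r] by (auto simp: S_def)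
   have "x + (- L) *R ax 3 \<in> cube R"
    by (rule cubeI3) (use x r e in \<open>auto simp: axis_def L_def abs_less_iff\<close>)
   moreover have "(x + (- L) *R ax 3)$3 < - eps" using x by (simp add: axis_def L_def)
   ultimately have "u k (x + (- L) *R ax 3) = 0" by (rule low)
   then show ?thesis by simp
  qed simp
 qed
 define dl where "dl = min (r' - r) (s' - s)"
 have dl: "dl > 0" "dl <= r' - r" "dl <= s' - s" using r e by (auto simp: dl_def)
 have "sq S (%x. u k (x + (- L) *R ax 3) - u k x) <= (- L)^2 * sq T (G k 3)"
 proof (rule diff_bound[OF s Sb Tb dl(1), where r = r'])
  show "T \<subseteq> ccube r'" unfolding T_def using cube_ccube by blast
  fix x p :: "real^3" and sg :: real assume a: "x \<in> S" "0 <= sg" "sg <= 1" and p: "!!i. abs(p$i) <= dl"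
  have x: "abs(x$1) < r" "abs(x$2) < r" "x$3 < s" "- eps <= x$3" using a cubeD[of x r] by (auto simp: S_def)
  have sL: "0 <= sg * L" "sg * L <= L" using a e mult_right_mono[of sg 1 L] by (auto simp: L_def)
  define y where "y = x + (sg * - L) *R ax 3 - p"
  have y: "y$1 = x$1 - p$1" "y$2 = x$2 - p$2" "y$3 = x$3 - sg * L - p$3"
   by (simp_all add: y_def axis_def)
  have "abs(y$1) < r'" "abs(y$2) < r'" unfolding y using x(1,2) p[of 1] p[of 2] dl(2) by linarith+
  moreover have "y$3 < s'" "- r' < y$3" "y$3 < r'"
   unfolding y using x(3,4) p[of 3] dl(2,3) sL r e unfolding L_def by linarith+
  ultimately have "y \<in> T" unfolding T_def by (auto intro!: cubeI3 simp: abs_less_iff)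
  then show "x + (sg * - L) *R ax 3 - p \<in> T" by (simp add: y_def)
 qed (use r in auto)
 then show ?thesis unfolding S1 S2 T_def[symmetric] L_def[symmetric] by simp
qed

section \<open>The linear profile of the half space\<close>

lemma nI_bounds: "0 <= nI t & nI t <= 1"
proof -
 have mono: "nI a <= nI b" if "a <= b" for a b
  by (rule DERIV_nonneg_imp_nondecreasing[OF that]) (use nI_deriv nb_nonneg in blast)
 have "nI (min t (-1)) <= nI t" "nI t <= nI (max t 1)" by (auto intro!: mono)
 then show ?thesis by (simp add: nI_zero nI_one)
qed

lemma nb_le: "nb t <= 1/bZ"
 unfolding nb_def bump1_def bq_def using bZ_pos by (intro divide_right_mono) auto

definition HC :: "real => (real^3) set" where "HC R = {x \<in> cube R. 0 < x$3}"

lemma HC_open: "open (HC R)"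
proof -
 have "HC R = cube R \<inter> {x. 0 < x$3}" by (auto simp: HC_def)
 moreover have "open {x::real^3. 0 < x$3}" by (intro open_Collect_less continuous_intros)
 ultimately show ?thesis using cube_open by (simp add: open_Int)
qed
lemma HC_borel[simp, measurable]: "HC R \<in> sets borel" using HC_open by simp

lemma slab_measure:
 assumes "0 < r" "a <= b"
 shows "l2 (ind (cube r \<inter> {x. a <= x$3 & x$3 <= b}))" "sq UNIV (ind (cube r \<inter> {x. a <= x$3 & x$3 <= b})) <= 4 * r^2 * (b - a)"
proof -
 define S where "S = cube r \<inter> {x::real^3. a <= x$3 & x$3 <= b}"
 have "closed {x::real^3. a <= x$3 & x$3 <= b}" by (intro closed_Collect_conj closed_Collect_le continuous_intros)
 then have Sb: "S \<in> sets borel" unfolding S_def by (intro sets.Int cube_borel) auto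
 define p q :: "real^3" where pq: "p = (\<chi> i. if i = 3 then a else - r)" "q = (\<chi> i. if i = 3 then b else r)"
 have sub: "S \<subseteq> cbox p q"
 proof
  fix x assume x: "x \<in> S"
  have "p$i <= x$i & x$i <= q$i" for i
   using x cubeD[of x r i] by (auto simp: S_def pq)
  then show "x \<in> cbox p q" by (simp add: mem_box_cart)
 qed
 have ne: "cbox p q ~= {}" using assms by (auto simp: interval_ne_empty_cart pq)
 have m: "measure lborel (cbox p q) = 4 * r^2 * (b - a)"
  using content_cbox_cart[OF ne] unfolding UNIV_3 by (simp add: pq p2eq)
 have l: "l2 (ind S)" by (rule l2_indicator_bounded[OF Sb bounded_subset[OF bounded_cbox sub]])
 have "sq UNIV (ind S) <= sq UNIV (ind (cbox p q))"
  by (intro sq_le l l2_indicator_bounded bounded_cbox) (use sub in \<open>auto simp: indicator_def\<close>)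
 also have "... = (LL x. ind (cbox p q) x)"
  unfolding sq_def by (intro Bochner_Integration.integral_cong) (auto simp: indicator_def)
 also have "... = 4 * r^2 * (b - a)" by (simp add: m[symmetric])
 finally show "sq UNIV (ind (cube r \<inter> {x. a <= x$3 & x$3 <= b})) <= 4 * r^2 * (b - a)" unfolding S_def .
 show "l2 (ind (cube r \<inter> {x. a <= x$3 & x$3 <= b}))" using l unfolding S_def .
qed

text \<open>A vertical cutoff at height 1/N turns a test function crossing the plane into one of the
  open half cube. Its derivative is of size N on a layer of height 3/N, while the mass of z there is
  at most (3/N)^2 E; by Cauchy-Schwarz the square of the commutator is of order 1/N.\<close>

lemma flat_weak:
 assumes R: "R > 0" and zl: "l2 z" and z0: "!!x. x \<in> cube R ==> x$3 <= 0 ==> z x = 0"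
  and D: "l2 D" "!!ps. test_fun (HC R) ps ==> (LL x. z x * pd j ps x) = - (LL x. D x * ps x)" "!!x. x \<in> cube R ==> x$3 <= 0 ==> D x = 0"
  and strip: "!!s. 0 < s ==> s < s0 ==> sq (cube R \<inter> {x. x$3 < s}) z <= s^2 * E" and s0: "0 < s0"
  and t: "test_fun (cube R) ps"
 shows "(LL x. z x * pd j ps x) = - (LL x. D x * ps x)"
proof -
 have c: "csm ps" "csm (pd j ps)" using test_fun_csm[OF t] csm_pd by blast+
 note [measurable] = l2_meas[OF csm_l2[OF c(1)]] l2_meas[OF csm_l2[OF c(2)]] l2_meas[OF zl] l2_meas[OF D(1)]
 have sp: "ps x ~= 0 ==> x \<in> cube R" "pd j ps x ~= 0 ==> x \<in> cube R" for x
  using test_fun_support[OF t] test_fun_support[OF test_fun_pd[OF t]] by blast+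
 define N where "N n = real (Suc n)" for n
 have N: "N n > 0" for n by (simp add: N_def)
 define w where "w n x = nI (N n * x$3 + (-2))" for n and x :: "real^3"
 have ws: "smooth3 (w n)" for n unfolding w_def[abs_def] by (intro smooth3_nI)
 have wp: "pd j (w n) = (%x. (if 3 = j then N n else 0) * nb (N n * x$3 + (-2)))" for n unfolding w_def[abs_def] pd_nI by (simp add: fun_eq_iff)
 have wm[measurable]: "w n \<in> BM" for n using smooth3_cont[OF ws] by (rule borel_measurable_continuous_onI)
 have wb: "abs(w n x) <= 1" for n x using nI_bounds[of "N n * x$3 + (-2)"] by (simp add: w_def)
 have w1: "EV n. w n x = 1" if "0 < x$3" for x
 proof -
  obtain m :: nat where m: "3/x$3 <= real m" using real_arch_simple by blast
  show ?thesis unfolding eventually_sequentially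
  proof (intro exI[of _ m] allI impI)
   fix n assume "m <= n"
   then have "3/x$3 <= N n" using m by (simp add: N_def)
   then have "1 <= N n * x$3 + (-2)" using that by (simp add: field_simps)
   then show "w n x = 1" by (simp add: w_def nI_one)
  qed
 qed
 have lim: "(%n. LL x. h x * w n x * f x) ~~> (LL x. h x * f x)"
  if h: "l2 h" "!!x. x \<in> cube R ==> x$3 <= 0 ==> h x = 0" and f: "csm f" "!!x. f x ~= 0 ==> x \<in> cube R" for h f
 proof (rule integral_dominated_convergence[where w = "%x. abs(h x * f x)"])
  note [measurable] = l2_meas[OF h(1)] l2_meas[OF csm_l2[OF f(1)]]
  show "(%x. h x * f x) \<in> borel_measurable lborel" "(%x. h x * w n x * f x) \<in> borel_measurable lborel" for n by measurable
  show "integrable lborel (%x. abs(h x * f x))" by (intro integrable_abs l2_prod h csm_l2 f)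
  show "AE3 x. (%n. h x * w n x * f x) ~~> h x * f x"
  proof (rule AE_I2, rule tendsto_eventually)
   fix x
   show "EV n. h x * w n x * f x = h x * f x"
   proof (cases "f x = 0 | h x = 0")
    case False
    then have "0 < x$3" using h(2)[of x] f(2)[of x] by force
    from w1[OF this] show ?thesis by eventually_elim simp
   qed auto
  qed
  show "AE3 x. norm (h x * w n x * f x) <= abs(h x * f x)" for n
  proof (rule AE_I2)
   fix x show "norm (h x * w n x * f x) <= abs(h x * f x)"
    using mult_left_le[OF wb[of n x], of "abs(h x * f x)"] by (simp add: abs_mult mult_ac)
  qed
 qed
 obtain B where B: "B > 0" "!!x. abs(ps x) <= B" using csm_bounded[OF c(1)] by metis
 define dl where "dl n = (LL x. z x * (pd j (w n) x * ps x))" for n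
 have key: "(LL x. z x * w n x * pd j ps x) + dl n = - (LL x. D x * w n x * ps x)" for n
 proof -
  have cw: "csm (%x. ps x * w n x)" by (rule csm_mult[OF c(1) ws])
  have tw: "test_fun (HC R) (%x. ps x * w n x)"
  proof (rule csm_test_fun[OF cw, of "closure {x. ps x ~= 0} \<inter> {x. 1/N n <= x$3}"])
   show "closed (closure {x. ps x ~= 0} \<inter> {x. 1/N n <= x$3})" by (intro closed_Int closed_closure closed_Collect_le continuous_intros)
   have "closure {x. ps x ~= 0} \<subseteq> cube R" using t unfolding test_fun_def by (elim conjE)
   moreover have "0 < x$3" if "1/N n <= x$3" for x :: "real^3" using that N[of n] by (smt (verit) divide_pos_pos)
   ultimately show "closure {x. ps x ~= 0} \<inter> {x. 1/N n <= x$3} \<subseteq> HC R" unfolding HC_def by blast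
   show "{x. ps x * w n x ~= 0} \<subseteq> closure {x. ps x ~= 0} \<inter> {x. 1/N n <= x$3}"
   proof
    fix x assume "x \<in> {x. ps x * w n x ~= 0}"
    then have a: "ps x ~= 0" "w n x ~= 0" by auto
    have "~N n * x$3 + (-2) <= -1" using a(2) nI_zero unfolding w_def by blast
    then have "1/N n <= x$3" using N[of n] by (simp add: field_simps)
    moreover have "x \<in> closure {x. ps x ~= 0}" using a(1) by (intro subsetD[OF closure_subset]) simp
    ultimately show "x \<in> closure {x. ps x ~= 0} \<inter> {x. 1/N n <= x$3}" by simp
   qed
  qed
  have "- (LL x. D x * w n x * ps x) = (LL x. z x * pd j (%x. ps x * w n x) x)"
   unfolding D(2)[OF tw] by (simp add: mult_ac)
  also have "(LL x. z x * pd j (%x. ps x * w n x) x) = (LL x. z x * w n x * pd j ps x + z x * (pd j (w n) x * ps x))"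
   unfolding pd_mult[OF csm_smooth[OF c(1)] ws] by (rule icong) (simp add: algebra_simps)
  also have "... = (LL x. z x * w n x * pd j ps x) + dl n"
   unfolding dl_def
  proof (rule Bochner_Integration.integral_add)
   show "integrable lborel (%x. z x * w n x * pd j ps x)"
    using l2_prod[OF zl csm_l2[OF csm_mult2[OF c(2) ws]], of n] by (simp add: mult.assoc)
   show "integrable lborel (%x. z x * (pd j (w n) x * ps x))"
    by (intro l2_prod zl csm_l2 csm_mult2 c smooth3_pd ws)
  qed
  finally show ?thesis ..
 qed
 have d0: "dl ~~> 0"
 proof -
  define C where "C = 12 * R^2 * (B/bZ)^2 * (9 * E)"
  have "(dl n)^2 <= C/N n" if n: "3/N n < s0" for n
  proof -
   define h where "h x = pd j (w n) x * ps x" for x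
   have hc: "csm h" unfolding h_def[abs_def] by (intro csm_mult2 c smooth3_pd ws)
   define S where "S = cube R \<inter> {x. 0 <= x$3 & x$3 <= 3/N n}"
   define T where "T = cube R \<inter> {x. x$3 < 3/N n}"
   have Tb: "T \<in> sets borel" unfolding T_def by (intro sets.Int cube_borel) (auto intro!: borel_open open_Collect_less continuous_intros)
   have hS: "x \<in> S" "x \<in> T" "abs(h x) <= N n * (B/bZ)" if "h x ~= 0" for x
   proof -
    have a: "ps x ~= 0" "nb (N n * x$3 + (-2)) ~= 0" using that unfolding h_def wp by auto
    have "~1 <= abs(N n * x$3 + (-2))" using a(2) nb_zero by blast
    then have "0 <= N n * x$3" "N n * x$3 < 3" by linarith+
    then have "0 <= x$3" "x$3 < 3/N n" using N[of n] by (auto simp: field_simps zero_le_mult_iff)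
    then show "x \<in> S" "x \<in> T" using sp(1)[OF a(1)] unfolding S_def T_def by auto
    have "abs(nb (N n * x$3 + (-2))) * abs(ps x) <= (1/bZ) * B" using nb_le nb_nonneg B bZ_pos by (intro mult_mono) auto
    then have "N n * (abs(nb (N n * x$3 + (-2))) * abs(ps x)) <= N n * ((1/bZ) * B)" using N[of n] by (intro mult_left_mono) auto
    moreover have "abs(h x) <= N n * (abs(nb (N n * x$3 + (-2))) * abs(ps x))" unfolding h_def wp using N[of n] by (auto simp: abs_mult)
    ultimately show "abs(h x) <= N n * (B/bZ)" by simp
   qed
   have "dl n = (LL x. (ind T x * z x) * h x)"
    unfolding dl_def h_def[symmetric]
   proof (rule icong)
    fix x show "z x * h x = (ind T x * z x) * h x" using hS(2)[of x] by (cases "h x = 0") auto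
   qed
   then have "(dl n)^2 <= (LL x. (ind T x * z x)^2) * (LL x. (h x)^2)"
    using CS[OF l2_indicator[OF zl Tb] csm_l2[OF hc]] by simp
   also have "(LL x. (ind T x * z x)^2) = sq T z"
    unfolding sq_def by (rule icong) (auto simp: indicator_def)
   also have "sq T z * (LL x. (h x)^2) <= ((3/N n)^2 * E) * ((N n * (B/bZ))^2 * (4 * R^2 * (3/N n - 0)))"
   proof (rule mult_mono)
    show 1: "sq T z <= (3/N n)^2 * E" unfolding T_def by (rule strip[OF _ n]) (use N[of n] in simp)
    show "0 <= (3/N n)^2 * E" using 1 sq_nonneg[of T z] by linarith
    have Sl: "l2 (ind S)" "sq UNIV (ind S) <= 4 * R^2 * (3/N n - 0)"
     unfolding S_def using slab_measure[OF R, of 0 "3/N n"] N[of n] by auto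
    have "(LL x. (h x)^2) = sq UNIV h" by (simp add: sq_def)
    also have "... <= sq UNIV (%x. (N n * (B/bZ)) * ind S x)"
    proof (rule sq_le[OF csm_l2[OF hc] l2_cmult[OF Sl(1)]])
     fix x show "abs(h x) <= abs(N n * (B/bZ) * ind S x)"
      using hS(1,3)[of x] B(1) bZ_pos N[of n] by (cases "h x = 0") auto
    qed auto
    also have "... = (N n * (B/bZ))^2 * sq UNIV (ind S)" by (rule sq_cmult)
    also have "... <= (N n * (B/bZ))^2 * (4 * R^2 * (3/N n - 0))" by (rule mult_left_mono[OF Sl(2)]) simp
    finally show "(LL x. (h x)^2) <= (N n * (B/bZ))^2 * (4 * R^2 * (3/N n - 0))" .
   qed auto
   also have "... = C/N n" using N[of n] unfolding C_def by (simp add: field_simps p2eq)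
   finally show ?thesis .
  qed
  moreover have "EV n. 3/N n < s0"
  proof -
   have "(%n. 3/N n) ~~> 3 * 0" unfolding N_def using tendsto_mult[OF tendsto_const[of 3] LIMSEQ_inverse_real_of_nat] by (simp add: field_simps)
   from order_tendstoD(2)[OF this] s0 show ?thesis by simp
  qed
  ultimately have ev: "EV n. norm ((dl n)^2) <= C/N n" by (auto elim: eventually_mono)
  have "(%n. C/N n) ~~> C * 0" unfolding N_def using tendsto_mult[OF tendsto_const[of C] LIMSEQ_inverse_real_of_nat] by (simp add: field_simps)
  then have "(%n. (dl n)^2) ~~> 0" using Lim_null_comparison[OF ev] by simp
  then show ?thesis using tendsto_null_power[of "%n. (dl n)^2"] by (simp add: tendsto_rabs_zero_iff flip: real_sqrt_abs)
 qed
 have "(%n. (LL x. z x * w n x * pd j ps x) + dl n) ~~> (LL x. z x * pd j ps x) + 0"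
  by (rule tendsto_add[OF lim[OF zl z0 c(2) sp(2)] d0])
 moreover have "(%n. - (LL x. D x * w n x * ps x)) ~~> - (LL x. D x * ps x)"
  by (rule tendsto_minus[OF lim[OF D(1,3) c(1) sp(1)]])
 ultimately have "(LL x. z x * pd j ps x) + 0 = - (LL x. D x * ps x)" unfolding key by (rule LIMSEQ_unique)
 then show ?thesis by simp
qed

definition xp :: "real => real^3 => real" where "xp R x = ind (cube R) x * max 0 (x$3)"
definition xd :: "real => real^3 => real" where "xd R x = ind (cube R) x * (if 0 < x$3 then 1 else 0)"
text \<open>The layer between the lowest possible graph and the plane. Above the graph
  \<open>xd + xs\<close> is the constant 1, which as a constant gradient is annihilated by
  derivatives of test functions.\<close>

definition xs :: "real => real => real^3 => real" where "xs R eps x = ind (cube R \<inter> {x. - eps <= x$3 & x$3 <= 0}) x"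

lemma half_meas[measurable]: "{x::real^3. 0 < x$3} \<in> sets borel" "{x::real^3. - eps <= x$3 & x$3 <= 0} \<in> sets borel"
proof -
 have "open {x::real^3. 0 < x$3}" by (intro open_Collect_less continuous_intros)
 then show "{x::real^3. 0 < x$3} \<in> sets borel" by simp
 have "closed {x::real^3. - eps <= x$3 & x$3 <= 0}" by (intro closed_Collect_conj closed_Collect_le continuous_intros)
 then show "{x::real^3. - eps <= x$3 & x$3 <= 0} \<in> sets borel" by simp
qed

lemma xp_l2: "l2 (xp R)"
proof -
 have "l2 (%x. max 0 (min \<bar>R\<bar> (x$3)) * ind (cube R) x)"
  by (rule l2_bounded_mult[OF l2_cube, of _ "abs(R)"]) (auto intro!: borel_measurable_continuous_onI continuous_intros)
 moreover have "(%x. max 0 (min \<bar>R\<bar> (x$3)) * ind (cube R) x) = xp R"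
  using cubeD[of _ R 3] by (fastforce simp: xp_def indicator_def fun_eq_iff)
 ultimately show ?thesis by simp
qed

lemma xd_eq: "xd R = ind (cube R \<inter> {x. 0 < x$3})"
 by (auto simp: xd_def indicator_def fun_eq_iff)

lemma xd_l2: "l2 (xd R)" unfolding xd_eq
 by (intro l2_indicator_bounded sets.Int cube_borel half_meas) (use cube_bounded in \<open>blast intro: bounded_subset\<close>)

lemma xs_l2: "l2 (xs R eps)" unfolding xs_def[abs_def]
 using l2_indicator_bounded[of "cube R \<inter> {x. - eps <= x$3 & x$3 <= 0}"] cube_bounded bounded_subset[OF cube_bounded[of R], of "cube R \<inter> {x. - eps <= x$3 & x$3 <= 0}"]
  sets.Int[OF cube_borel half_meas(2)] by simp

lemma xp_weak:
 assumes t: "test_fun (cube R) ps"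
 shows "(LL x. xp R x * pd j ps x) = - (LL x. (if j = 3 then xd R x else 0) * ps x)"
proof (cases "R > 0")
 case R: True
 show ?thesis
 proof (rule flat_weak[OF R xp_l2 _ _ _ _ _ zero_less_one t, where E = "4 * R^2"])
  show "l2 (%x. if j = 3 then xd R x else 0)" by (cases "j = 3") (auto simp: xd_l2)
  show "xp R x = 0" "(if j = 3 then xd R x else 0) = 0" if "x$3 <= 0" for x using that by (auto simp: xp_def xd_def)
  fix ph assume t: "test_fun (HC R) ph"
  have e: "xp R x * pd j ph x = x$3 * pd j ph x" "(if j = 3 then xd R x else 0) * ph x = (if 3 = j then 1 else 0) * ph x" for x
   using test_fun_support[OF t, of x] test_fun_support[OF test_fun_pd[OF t], of j x] by ((cases "x \<in> HC R"; auto simp: xp_def xd_def HC_def)+)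
  show "(LL x. xp R x * pd j ph x) = - (LL x. (if j = 3 then xd R x else 0) * ph x)"
   unfolding e using IBP[OF test_fun_csm[OF t] smooth3_coord, of 3 j] unfolding pd_coord .
 next
  fix s :: real assume s: "0 < s" "s < 1"
  let ?S = "cube R \<inter> {x::real^3. x$3 < s}" let ?g = "%x::real^3. s * ind (cube R \<inter> {x. 0 <= x$3 & x$3 <= s}) x"
  have g: "l2 ?g" by (rule l2_cmult[OF slab_measure(1)[OF R]]) (use s in simp)
  have S: "?S \<in> sets borel" by (intro sets.Int cube_borel borel_open open_Collect_less continuous_intros)
  have "sq ?S (xp R) <= sq ?S ?g" by (rule sq_le[OF xp_l2 g S]) (use s in \<open>auto simp: xp_def indicator_def\<close>)
  also have "... <= sq UNIV ?g" by (intro sq_mono g S) auto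
  also have "... <= s^2 * (4 * R^2 * (s - 0))"
   unfolding sq_cmult using slab_measure(2)[OF R, of 0 s] s by (intro mult_left_mono) auto
  also have "... <= s^2 * (4 * R^2)" using s by (intro mult_left_mono) (auto simp: mult_left_le)
  finally show "sq ?S (xp R) <= s^2 * (4 * R^2)" .
 qed
next
 case False
 then have "x \<notin> cube R" for x using cubeD[of x R 1] by auto
 then have "ps x = 0" "pd j ps x = 0" for x using test_fun_support[OF t] test_fun_support[OF test_fun_pd[OF t]] by blast+
 then show ?thesis by simp
qed

text \<open>The profile has a jump in its gradient at the plane, inside the rough domain; moving the
  layer \<open>xs\<close> into the flux completes the gradient to a constant. The condition
  \<open>a 3 = 0\<close> keeps the divergence zero, and \<open>g y <= 0\<close> keeps the zero
  values below the graph.\<close>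

lemma sol_minus:
 assumes s: "sol R g u G F" and g: "!!y. - eps <= g y" "!!y. g y <= 0" and a: "a 3 = 0"
 shows "sol R g (%k x. u k x - a k * xp R x) (%k j x. G k j x - a k * (if j = 3 then xd R x else 0))
   (%k j x. F k j x + a k * (if j = 3 then xs R eps x else 0))"
proof -
 note ul = solD(1-3)[OF s]
 have dl: "l2 (%x. if j = 3 then xd R x else 0)" for j :: 3 by (cases "j = 3") (auto simp: xd_l2)
 have sl: "l2 (%x. if j = 3 then xs R eps x else 0)" for j :: 3 by (cases "j = 3") (auto simp: xs_l2)
 have tl: "l2 ps" "l2 (pd j ps)" if "test_fun Om ps" for Om ps j
  using csm_l2[OF test_fun_csm[OF that]] csm_l2[OF csm_pd[OF test_fun_csm[OF that]]] by auto
 have sub: "(LL x. (f x - c * f' x) * h x) = (LL x. f x * h x) - c * (LL x. f' x * h x)"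
  if "l2 f" "l2 f'" "l2 h" for f f' h c
  using l2_prod[OF that(1,3)] l2_prod[OF that(2,3)] by (simp add: left_diff_distrib mult.assoc)
 show ?thesis unfolding sol_def
 proof (intro conjI allI impI)
  show "l2 (%x. u k x - a k * xp R x)" for k by (intro l2_diff l2_cmult ul xp_l2)
  show "l2 (%x. G k j x - a k * (if j = 3 then xd R x else 0))" for k j by (intro l2_diff l2_cmult ul dl)
  show "l2 (%x. F k j x + a k * (if j = 3 then xs R eps x else 0))" for k j by (intro l2_add l2_cmult ul sl)
 next
  fix k j ps assume t: "test_fun (cube R) ps"
  show "(LL x. (u k x - a k * xp R x) * pd j ps x) = - (LL x. (G k j x - a k * (if j = 3 then xd R x else 0)) * ps x)"
   unfolding sub[OF ul(1) xp_l2 tl(2)[OF t]] sub[OF ul(2) dl tl(1)[OF t]] solD(4)[OF s t] xp_weak[OF t] by simp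
 next
  fix ps assume t: "test_fun (cube R) ps"
  have "(S3 k. a k * (LL x. xp R x * pd k ps x)) = 0"
   unfolding xp_weak[OF t] sum_3 using a by simp
  then show "(S3 k. LL x. (u k x - a k * xp R x) * pd k ps x) = 0"
   unfolding sub[OF ul(1) xp_l2 tl(2)[OF t]] sum_subtractf solD(5)[OF s t] by simp
 next
  fix k x assume x: "x \<in> cube R & x \<notin> above g"
  then have "x$3 <= 0" using g(2)[of "hor x"] by (simp add: above_def)
  then show "u k x - a k * xp R x = 0" using solD(6)[OF s, of x k] x by (simp add: xp_def)
 next
  fix ph :: "3 => real^3 => real" assume p: "(\<forall>k. test_fun (cube R \<inter> above g) (ph k)) & (\<forall>x. (S3 k. pd k (ph k) x) = 0)"
  have t: "test_fun (cube R \<inter> above g) (ph k)" for k using p by blast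
  have z: "(LL x. (xd R x + xs R eps x) * pd 3 (ph k) x) = 0" for k
  proof -
   have e: "(xd R x + xs R eps x) * pd 3 (ph k) x = pd 3 (ph k) x" for x
   proof (cases "pd 3 (ph k) x = 0")
    case False
    then have "x \<in> cube R" "x \<in> above g" using test_fun_support[OF test_fun_pd[OF t]] by blast+
    moreover then have "- eps <= x$3" using g(1)[of "hor x"] by (simp add: above_def)
    ultimately show ?thesis by (simp add: xd_def xs_def)
   qed simp
   show ?thesis unfolding e by (rule integral_pd_zero[OF test_fun_csm[OF t]])
  qed
  have e: "(LL x. (G k j x - a k * (if j = 3 then xd R x else 0) - (F k j x + a k * (if j = 3 then xs R eps x else 0))) * pd j (ph k) x)
   = (LL x. (G k j x - F k j x) * pd j (ph k) x)" for k j
  proof (cases "j = 3")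
   case True
   have "(LL x. ((G k j x - F k j x) - a k * (xd R x + xs R eps x)) * pd j (ph k) x)
    = (LL x. (G k j x - F k j x) * pd j (ph k) x) - a k * (LL x. (xd R x + xs R eps x) * pd j (ph k) x)"
    by (rule sub) (intro l2_diff l2_add ul xd_l2 xs_l2 tl(2)[OF t])+
   then show ?thesis using True z[of k] by (simp add: algebra_simps)
  qed simp
  show "(S3 k. S3 j. LL x. (G k j x - a k * (if j = 3 then xd R x else 0) - (F k j x + a k * (if j = 3 then xs R eps x else 0))) * pd j (ph k) x) = 0"
   unfolding e using solD(7)[OF s, of ph] p by simp
 qed
qed

section \<open>Mean value kernel\<close>

definition lap :: "(real^3 => real) => real^3 => real" where
 "lap f x = (S3 j. pd j (pd j f) x)"

lemma smooth3_lap: "smooth3 f ==> smooth3 (lap f)"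
 unfolding lap_def[abs_def] by auto

lemma csm_lap: "csm f ==> csm (lap f)"
 unfolding lap_def[abs_def] by (intro csm_sum csm_pd)

lemma test_fun_lap: "test_fun Om f ==> test_fun Om (lap f)"
 unfolding lap_def[abs_def] by (intro test_fun_sum test_fun_pd)

lemma pd_lap: "smooth3 f ==> pd i (lap f) = lap (pd i f)"
proof
 fix x assume f: "smooth3 f"
 have "pd i (lap f) x = (S3 j. pd i (pd j (pd j f)) x)"
  unfolding lap_def[abs_def] by (subst pd_sum) (auto intro: f)
 also have "... = (S3 j. pd j (pd j (pd i f)) x)"
 proof (intro sum.cong refl)
  fix j
  have "pd i (pd j (pd j f)) = pd j (pd i (pd j f))" by (rule pd_commute) (use f in auto)
  also have "pd i (pd j f) = pd j (pd i f)" by (rule pd_commute[OF f])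
  finally show "pd i (pd j (pd j f)) x = pd j (pd j (pd i f)) x" by simp
 qed
 finally show "pd i (lap f) x = lap (pd i f) x" by (simp add: lap_def)
qed

lemma lap_affine: "smooth3 f ==> lap (%x. f (c *R x + a)) = (%x. c^2 * lap f (c *R x + a))"
proof -
 assume f: "smooth3 f"
 have "pd j (pd j (%x. f (c *R x + a))) = (%x. c^2 * pd j (pd j f) (c *R x + a))" for j
  unfolding pd_affine[OF f] by (subst pd_cmult) (auto simp: pd_affine[OF smooth3_pd[OF f]] p2eq intro: smooth3_affine f)
 then show ?thesis unfolding lap_def by (simp add: sum_distrib_left)
qed

lemma lap_cmult: "smooth3 f ==> lap (%x. c * f x) = (%x. c * lap f x)"
proof -
 assume f: "smooth3 f"
 have "pd j (pd j (%x. c * f x)) = (%x. c * pd j (pd j f) x)" for j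
  using f by (simp add: pd_cmult)
 then show ?thesis unfolding lap_def by (simp add: sum_distrib_left)
qed

lemma lap_diff: "smooth3 f ==> smooth3 g ==> lap (%x. f x - g x) = (%x. lap f x - lap g x)"
proof -
 assume f: "smooth3 f" "smooth3 g"
 have "pd j (pd j (%x. f x - g x)) = (%x. pd j (pd j f) x - pd j (pd j g) x)" for j
  using f by (simp add: pd_diff)
 then show ?thesis unfolding lap_def by (simp add: sum_subtractf)
qed

lemma lap_eq_open: "open U ==> x \<in> U ==> (!!y. y \<in> U ==> f y = g y) ==> lap f x = lap g x"
 unfolding lap_def by (intro sum.cong refl pd_eq_open[of U x] pd_eq_open[of U]) auto

text \<open>This is |x|^(1 - 2 k) f(x), with the exponent split so that differentiation raises k by
  one; together with f vanishing near the origin this gives a class closed under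
  differentiation.\<close>

definition nE :: "nat => (real^3 => real) => real^3 => real" where
 "nE k f x = norm x * inverse ((norm x)^2)^k * f x"

lemma norm_sq3: "(norm (x::real^3))^2 = (S3 i. (x$i)^2)"
 by (simp add: norm_vec_def L2_set_def sum_nonneg)

lemma nE_hasp:
 assumes f: "smooth3 f" and z: "!!x. x \<in> cube (1/4) ==> f x = 0"
 shows "hasp j (nE k f) (%x. nE (Suc k) (%x. ((1 - 2 * real k) * x$j) * f x) x + nE k (pd j f) x)"
 unfolding hasp_def
proof
 fix x :: "real^3"
 show "((%t. nE k f (x + t *R ax j)) has_real_derivative nE (Suc k) (%x. ((1 - 2 * real k) * x$j) * f x) x + nE k (pd j f) x) (at 0)"
 proof (cases "x \<in> cube (1/4)")
  case True
  then obtain e where e: "e > 0" "ball x e \<subseteq> cube (1/4)" using cube_open open_contains_ball by meson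
  have p0: "pd j f x = 0" using pd_eq_open[OF cube_open True, of f "%_. 0" j] z by simp
  have "((%t. 0) has_real_derivative 0) (at 0)" by simp
  then have "((%t. nE k f (x + t *R ax j)) has_real_derivative 0) (at 0)"
  proof (rule has_field_derivative_transform_within_open[of _ _ _ "{-e<..<e}"])
   fix t :: real assume "t \<in> {-e<..<e}"
   then have "x + t *R ax j \<in> ball x e" by (auto simp: dist_norm norm_axis_1)
   then show "0 = nE k f (x + t *R ax j)" using z e by (auto simp: nE_def)
  qed (use e in auto)
  then show ?thesis using p0 z[OF True] by (simp add: nE_def)
 next
  case False
  then have "x ~= 0" by (auto simp: cube_def)
  define q where "q t = (norm (x + t *R ax j))^2" for t
  have q: "q t = (norm x)^2 + 2 * t * x$j + t^2" for t
   unfolding q_def power2_norm_eq_inner by (simp add: inner_add inner_axis inner_commute algebra_simps inner_axis' p2eq)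
  have q0: "q 0 > 0" "q 0 = (norm x)^2" using \<open>x ~= 0\<close> by (auto simp: q_def)
  have dq: "(q has_real_derivative 2 * x$j) (at 0)"
   unfolding q[abs_def] by (auto intro!: derivative_eq_intros)
  have ds: "((%t. sqrt (q t)) has_real_derivative (inverse (sqrt (q 0))/2) * (2 * x$j)) (at 0)"
   by (rule DERIV_chain2[OF DERIV_real_sqrt[OF q0(1)] dq])
  have di: "((%t. inverse (q t)^k) has_real_derivative real k * inverse (q 0)^k * (- (2 * x$j) * inverse (q 0))) (at 0)"
  proof (cases k)
   case (Suc m)
   have "((%t. inverse (q t)) has_real_derivative - (inverse (q 0) * (2 * x$j) * inverse (q 0))) (at 0)"
    using DERIV_inverse_fun[OF dq] q0(1) by (simp add: p2eq mult_ac)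
   from DERIV_power[OF this, of k] show ?thesis using Suc by (simp add: algebra_simps)
  qed simp
  have df: "((%t. f (x + t *R ax j)) has_real_derivative pd j f x) (at 0)"
   using smooth3_imp(2)[OF f] unfolding hasp_def by blast
  have "((%t. sqrt (q t) * inverse (q t)^k * f (x + t *R ax j)) has_real_derivative
   ((inverse (sqrt (q 0))/2) * (2 * x$j) * inverse (q 0)^k + real k * inverse (q 0)^k * (- (2 * x$j) * inverse (q 0)) * sqrt (q 0)) * f (x + 0 *R ax j) + pd j f x * (sqrt (q 0) * inverse (q 0)^k)) (at 0)"
   by (rule DERIV_mult[OF DERIV_mult[OF ds di] df])
  moreover have "(%t. sqrt (q t) * inverse (q t)^k * f (x + t *R ax j)) = (%t. nE k f (x + t *R ax j))"
   by (simp add: nE_def q_def)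
  moreover have "((inverse (sqrt (q 0))/2) * (2 * x$j) * inverse (q 0)^k + real k * inverse (q 0)^k * (- (2 * x$j) * inverse (q 0)) * sqrt (q 0)) * f (x + 0 *R ax j) + pd j f x * (sqrt (q 0) * inverse (q 0)^k)
   = nE (Suc k) (%x. ((1 - 2 * real k) * x$j) * f x) x + nE k (pd j f) x"
  proof -
   have s: "sqrt (q 0) = norm x" by (simp add: q0(2))
   have i: "inverse (norm x) = norm x * inverse ((norm x)^2)" using \<open>x ~= 0\<close> by (simp add: p2eq)
   have alg: "((iv/2) * (2 * y) * v^k + real k * v^k * (- (2 * y) * v) * n) * a + p * (n * v^k) = n * v^Suc k * (((1 - 2 * real k) * y) * a) + n * v^k * p"
    if "iv = n * v" for iv n v y a p :: real using that by (simp add: algebra_simps)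
   show ?thesis unfolding s nE_def q0(2) using alg[OF i] by simp
  qed
  ultimately show ?thesis by simp
 qed
qed

lemma nE_smooth:
 assumes f: "smooth3 f" and z: "!!x. x \<in> cube (1/4) ==> f x = 0"
 shows "smooth3 (nE k f)"
proof (rule smooth3_class[of "{nE k f |k f. smooth3 f & (\<forall>x\<in>cube (1/4). f x = 0)}"])
 let ?S = "{nE k f |k f. smooth3 f & (\<forall>x\<in>cube (1/4). f x = 0)}"
 show "nE k f \<in> addcl ?S" using assms by (intro addcl.base) blast
 fix h assume "h \<in> ?S"
 then obtain k f where h: "h = nE k f" and f: "smooth3 f" and z: "!!x. x \<in> cube (1/4) ==> f x = 0" by blast
 have c: "continuous_on UNIV h"
 proof -
  have "isCont h x" for x
  proof (cases "x \<in> cube (1/4)")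
   case True
   have "continuous_on (cube (1/4)) h"
    using z by (subst continuous_on_cong[of _ _ h "%_. 0"]) (auto simp: h nE_def)
   then show ?thesis using True cube_open by (simp add: continuous_on_eq_continuous_at)
  next
   case False
   then have "x ~= 0" by (auto simp: cube_def)
   have "continuous_on (- {0}) h" unfolding h nE_def[abs_def]
    by (intro continuous_intros smooth3_cont f) auto
   then show ?thesis using \<open>x ~= 0\<close> by (simp add: continuous_on_eq_continuous_at open_Compl)
  qed
  then show ?thesis by (simp add: continuous_on_eq_continuous_at)
 qed
 have d: "\<exists>g\<in>addcl ?S. hasp j h g" for j
 proof (rule bexI[rotated])
  show "(%x. nE (Suc k) (%x. ((1 - 2 * real k) * x$j) * f x) x + nE k (pd j f) x) \<in> addcl ?S"
  proof (intro addcl.add addcl.base)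
   have "smooth3 (%x. ((1 - 2 * real k) * x$j) * f x)" by (intro smooth3_mult smooth3_cmult smooth3_coord f)
   moreover have "\<forall>x\<in>cube (1/4). ((1 - 2 * real k) * x$j) * f x = 0" using z by simp
   ultimately show "nE (Suc k) (%x. ((1 - 2 * real k) * x$j) * f x) \<in> ?S" by blast
   have "\<forall>x\<in>cube (1/4). pd j f x = 0"
   proof
    fix x :: "real^3" assume "x \<in> cube (1/4)"
    then show "pd j f x = 0" using pd_eq_open[OF cube_open, of x "1/4" f "%_. 0" j] z by simp
   qed
   then show "nE k (pd j f) \<in> ?S" using smooth3_pd[OF f] by blast
  qed
  show "hasp j h (%x. nE (Suc k) (%x. ((1 - 2 * real k) * x$j) * f x) x + nE k (pd j f) x)"
   unfolding h by (rule nE_hasp[OF f z])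
 qed
 then show "continuous_on UNIV h & (\<forall>j. \<exists>g\<in>addcl ?S. hasp j h g)" using c by blast
qed

definition cht :: "real^3 => real" where
 "cht = (SOME h. smooth3 h & (\<forall>x\<in>cube (1/4). h x = 0) & (\<forall>x. x \<notin> ccube (3/8) --> h x = 1))"

lemma cht: "smooth3 cht" "x \<in> cube (1/4) ==> cht x = 0" "x \<notin> ccube (3/8) ==> cht x = 1"
proof -
 obtain c where c: "!!rh R. 0 < rh & rh < R ==> (\<exists>et. csm et & (\<forall>x. 0 <= et x & et x <= 1) & (\<forall>x\<in>cube rh. et x = 1) &
  (\<forall>x. et x ~= 0 --> x \<in> ccube ((rh + R)/2)) & (\<forall>j x. abs(pd j et x) <= c/(R - rh)) &
  (\<forall>i j x. abs(pd i (pd j et) x) <= c/(R - rh)^2))"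
  using cutoff by blast
 obtain et where et: "csm et" "\<forall>x\<in>cube (1/4). et x = 1" "\<forall>x. et x ~= 0 --> x \<in> ccube ((1/4 + 1/2)/2)"
  using c[of "1/4" "1/2"] by auto
 have "smooth3 (%x. 1 - et x) & (\<forall>x\<in>cube (1/4). 1 - et x = 0) & (\<forall>x. x \<notin> ccube (3/8) --> 1 - et x = 1)"
  using et csm_smooth[OF et(1)] by auto
 then have "\<exists>h. smooth3 h & (\<forall>x\<in>cube (1/4). h x = 0) & (\<forall>x. x \<notin> ccube (3/8) --> h x = 1)"
  by (rule exI[of _ "%x. 1 - et x"])
 from someI_ex[OF this] show "smooth3 cht" "x \<in> cube (1/4) ==> cht x = 0" "x \<notin> ccube (3/8) ==> cht x = 1" unfolding cht_def[symmetric] by auto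
qed

text \<open>|x| is, up to a constant factor, the fundamental solution of the bilaplacian. Cutting
  out the origin turns the point mass of its bilaplacian into the smooth compactly supported kernel
  \<open>K0\<close>.\<close>

definition G0 :: "real^3 => real" where "G0 = nE 0 cht"
definition K0 :: "real^3 => real" where "K0 = lap (lap G0)"

lemma G0_smooth: "smooth3 G0" unfolding G0_def by (rule nE_smooth) (auto simp: cht)
lemma G0_far: "x \<notin> ccube (3/8) ==> G0 x = norm x" unfolding G0_def nE_def by (simp add: cht)

abbreviation farU :: "(real^3) set" where "farU \<equiv> - ccube (3/8)"
lemma farU_open: "open farU" using ccube_closed by (rule open_Compl)

lemma far_nz: "x \<in> farU ==> norm x ~= 0" by (auto simp: ccube_def)

lemma pd_nE_far:
 assumes f: "smooth3 f" and x: "x \<in> farU"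
 shows "pd j (nE k (%x. f x * cht x)) x = nE (Suc k) (%x. (1 - 2 * real k) * x$j * f x) x + nE k (pd j f) x"
proof -
 have s: "smooth3 (%x. f x * cht x)" by (intro smooth3_mult f cht(1))
 have "pd j (nE k (%x. f x * cht x)) x = nE (Suc k) (%x. ((1 - 2 * real k) * x$j) * (f x * cht x)) x + nE k (pd j (%x. f x * cht x)) x"
  using hasp_pd[OF nE_hasp[OF s], of j k] cht(2) by simp
 moreover have "pd j (%x. f x * cht x) x = pd j f x"
  by (rule pd_eq_open[OF farU_open x]) (simp add: cht)
 ultimately show ?thesis using x by (simp add: nE_def cht)
qed

lemma lapG0_far: assumes x: "x \<in> farU" shows "lap G0 x = nE 1 (%x. 2 * cht x) x"
proof -
 have p1: "pd j G0 y = nE 1 (%x. x$j * cht x) y" if "y \<in> farU" for j y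
  using pd_nE_far[OF smooth3_const[of 1] that, of j 0] that unfolding G0_def by (simp add: nE_def cht)
 have p2: "pd j (pd j G0) x = nE 2 (%x. - x$j * x$j) x + nE 1 (%x. 1) x" for j
 proof -
  have "pd j (pd j G0) x = pd j (nE 1 (%x. x$j * cht x)) x"
   by (rule pd_eq_open[OF farU_open x p1])
  also have "... = nE 2 (%x. - x$j * x$j) x + nE 1 (%x. 1) x"
   using pd_nE_far[OF smooth3_coord x, of j 1 j] by (simp add: pd_coord numeral_2_eq_2)
  finally show ?thesis .
 qed
 have "lap G0 x = - (norm x * (inverse ((norm x)^2))^2 * (norm x)^2) + 3 * (norm x * inverse ((norm x)^2))"
  unfolding lap_def p2 nE_def norm_sq3 by (simp add: sum_3 algebra_simps p2eq)
 also have "... = 2 * (norm x * inverse ((norm x)^2))" using far_nz[OF x] by (simp add: field_simps p2eq)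
 finally show ?thesis using x by (simp add: nE_def cht)
qed

lemma pd_lapG0_far: assumes x: "x \<in> farU" shows "pd j (lap G0) x = - 2 * x$j * (norm x * (inverse ((norm x)^2))^2)"
proof -
 have "pd j (lap G0) x = pd j (nE 1 (%x. 2 * cht x)) x"
  by (rule pd_eq_open[OF farU_open x lapG0_far])
 then show ?thesis
  using pd_nE_far[OF smooth3_const[of 2] x, of j 1] by (simp add: nE_def numeral_2_eq_2)
qed

lemma K0_far: assumes x: "x \<in> farU" shows "K0 x = 0"
proof -
 have p1: "pd j (lap G0) y = nE 2 (%x. - 2 * x$j * cht x) y" if "y \<in> farU" for j y
  using pd_lapG0_far[OF that, of j] that by (simp add: nE_def cht)
 have p2: "pd j (pd j (lap G0)) x = nE 3 (%x. 6 * (x$j * x$j)) x - nE 2 (%x. 2) x" for j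
 proof -
  have "pd j (pd j (lap G0)) x = pd j (nE 2 (%x. (- 2 * x$j) * cht x)) x"
   by (rule pd_eq_open[OF farU_open x]) (use p1 in auto)
  also have "... = nE 3 (%x. (1 - 2 * real 2) * x$j * (- 2 * x$j)) x + nE 2 (pd j (%x. - 2 * x$j)) x"
   using pd_nE_far[OF smooth3_cmult[OF smooth3_coord, of "-2" j] x, of j 2] by (simp add: numeral_3_eq_3)
  also have "pd j (%x. - 2 * x$j) = (%x. -2)" by (subst pd_cmult) (auto simp: pd_coord)
  finally show ?thesis by (simp add: nE_def algebra_simps)
 qed
 have "K0 x = 6 * (norm x * (inverse ((norm x)^2))^3 * (norm x)^2) - 6 * (norm x * (inverse ((norm x)^2))^2)"
  unfolding K0_def lap_def[of "lap G0"] p2 nE_def norm_sq3 by (simp add: sum_3 algebra_simps p2eq)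
 also have "... = 0" using far_nz[OF x] by (simp add: field_simps p2eq power3_eq_cube)
 finally show ?thesis .
qed

lemma K0_csm: "csm K0"
proof (rule csm_box)
 show "smooth3 K0" unfolding K0_def by (intro smooth3_lap G0_smooth)
 fix x i assume "K0 x ~= 0"
 then have "x \<in> ccube (3/8)" using K0_far by blast
 then show "abs(x$i) <= 3/8" by (rule ccubeD)
qed

text \<open>A smooth plateau in one coordinate: 1 for |x_i| <= 2 and 0 for |x_i| >= 4, with a slope
  whose sign is opposite to that of x_i.\<close>

definition b1 :: "3 => real^3 => real" where "b1 i x = nI ((-1) * x$i + 3) * nI (1 * x$i + 3)"

text \<open>The flux of \<open>\<nabla> lap G0 = \<nabla>(2/\<bar>x\<bar>)\<close> through infinity does not vanish; it is measured with a cutoff that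
 decreases in every \<open>\<bar>x\<^sub>i\<bar>\<close>.\<close>
lemma K0_int: "(LL x. K0 x) < 0"
proof -
 define H where "H x = b1 1 x * b1 2 x * b1 3 x" for x
 have bs: "smooth3 (b1 i)" for i unfolding b1_def[abs_def] by (intro smooth3_mult smooth3_nI)
 have b0: "0 <= b1 i x" for i x unfolding b1_def using nI_bounds by simp
 have bz: "b1 i x = 0" if "4 <= abs(x$i)" for i x
  using that unfolding b1_def by (cases "x$i >= 0") (auto simp: nI_zero)
 have bone: "b1 i x = 1" if "abs(x$i) <= 2" for i x
  using that unfolding b1_def by (auto simp: nI_one abs_le_iff)
 have pb: "pd j (b1 i) x = (if i = j then - nb (- x$i + 3) * nI (x$i + 3) + nI (- x$i + 3) * nb (x$i + 3) else 0)" for i j x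
  unfolding b1_def[abs_def] pd_mult[OF smooth3_nI smooth3_nI] pd_nI by simp
 have Hs: "smooth3 H" unfolding H_def[abs_def] by (intro smooth3_mult bs)
 have Hc: "csm H"
 proof (rule csm_box[OF Hs])
  fix x and i :: 3 assume "H x ~= 0"
  then have "~4 <= abs(x$1)" "~4 <= abs(x$2)" "~4 <= abs(x$3)" unfolding H_def using bz by auto
  then show "abs(x$i) <= 4" using exhaust_3[of i] by auto
 qed
 define Hi where "Hi i x = (\<Prod>j\<in>UNIV - {i}. b1 j x)" for i :: 3 and x
 have pH: "pd i H x = pd i (b1 i) x * Hi i x" for i x
 proof -
  have e: "pd i H x = (pd i (b1 1) x * b1 2 x + b1 1 x * pd i (b1 2) x) * b1 3 x + (b1 1 x * b1 2 x) * pd i (b1 3) x"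
   unfolding H_def[abs_def] pd_mult[OF smooth3_mult[OF bs bs] bs] pd_mult[OF bs bs] ..
  have u: "UNIV - {1::3} = {2,3}" "UNIV - {2::3} = {1,3}" "UNIV - {3::3} = {1,2}" unfolding UNIV_3 by auto
  have "Hi i x = (if i = 1 then b1 2 x * b1 3 x else if i = 2 then b1 1 x * b1 3 x else b1 1 x * b1 2 x)"
   unfolding Hi_def using exhaust_3[of i] by (auto simp: u)
  then show ?thesis unfolding e using exhaust_3[of i] by (auto simp: pb)
 qed
 have Hi0: "0 <= Hi i x" for i x unfolding Hi_def by (intro prod_nonneg b0)
 define T where "T i = pd i (lap G0)" for i
 have ls: "smooth3 (lap G0)" by (intro smooth3_lap G0_smooth)
 have sg: "0 <= T i x * pd i H x" for i x
 proof (cases "pd i (b1 i) x = 0")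
  case True then show ?thesis by (simp add: pH)
 next
  case False
  have "2 < abs(x$i)"
  proof (rule ccontr)
   assume "~2 < abs(x$i)"
   then have "1 <= abs(- x$i + 3)" "1 <= abs(x$i + 3)" by linarith+
   then show False using False by (simp add: pb nb_zero)
  qed
  then have xU: "x \<in> farU" using ccubeD[of x "3/8" i] by fastforce
  have s: "x$i * pd i (b1 i) x <= 0"
  proof (cases "x$i > 0")
   case True
   then have "nb (x$i + 3) = 0" by (intro nb_zero) simp
   then show ?thesis using True nb_nonneg nI_bounds by (simp add: pb mult_nonneg_nonneg)
  next
   case False
   then have "nb (- x$i + 3) = 0" by (intro nb_zero) simp
   then show ?thesis using False nb_nonneg nI_bounds by (simp add: pb mult_nonpos_nonneg)
  qed
  have "T i x * pd i H x = - 2 * (norm x * (inverse ((norm x)^2))^2) * Hi i x * (x$i * pd i (b1 i) x)"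
   unfolding T_def pd_lapG0_far[OF xU] pH by (simp add: mult_ac)
  then show ?thesis using s Hi0[of i x] by (simp add: mult_nonneg_nonpos)
 qed
 have Tc: "csm (%x. T i x * pd i H x)" for i
  unfolding T_def by (intro csm_mult2 csm_pd Hc smooth3_pd ls)
 have "(LL x. K0 x) = (LL x. K0 x * H x)"
 proof (rule icong)
  fix x
  show "K0 x = K0 x * H x"
  proof (cases "K0 x = 0")
   case False
   then have c: "x \<in> ccube (3/8)" using K0_far by blast
   then have "b1 i x = 1" for i using ccubeD[OF c, of i] by (intro bone) simp
   then show ?thesis by (simp add: H_def)
  qed simp
 qed
 also have "... = (S3 i. LL x. pd i (T i) x * H x)"
  unfolding K0_def lap_def[of "lap G0"] T_def sum_distrib_right
  by (rule LLsum) (intro csm_integrable csm_mult2 Hc smooth3_pd ls)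
 also have "... = (S3 i. - (LL x. T i x * pd i H x))"
  by (intro sum.cong refl) (simp add: IBP[OF Hc] T_def ls)
 also have "... = - (S3 i. LL x. T i x * pd i H x)" by (simp add: sum_negf)
 finally have e: "(LL x. K0 x) = - (S3 i. LL x. T i x * pd i H x)" .
 have n: "0 <= (LL x. T i x * pd i H x)" for i by (intro integral_nonneg_AE) (simp add: sg)
 have p: "0 < (LL x. T 1 x * pd 1 H x)"
 proof (rule integral_pos_cont)
  show "continuous_on UNIV (%x. T 1 x * pd 1 H x)" by (rule csm_cont[OF Tc])
  show "integrable lborel (%x. T 1 x * pd 1 H x)" by (rule csm_integrable[OF Tc])
  let ?x = "3 *R ax 1 :: real^3"
  have xU: "?x \<in> farU" by (auto simp: ccube_def axis_def)
  have "Hi 1 ?x = 1" unfolding Hi_def by (rule prod.neutral) (auto intro!: bone simp: axis_def split: if_splits)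
  moreover have "pd 1 (b1 1) ?x = - nb 0" using nI_one[of 6] nb_zero[of 6] by (simp add: pb axis_def)
  moreover have "0 < norm ?x" by (simp add: norm_axis_1)
  ultimately show "0 < T 1 ?x * pd 1 H ?x" using nb_pos
   unfolding T_def pd_lapG0_far[OF xU] pH by (simp add: axis_def norm_axis_1)
 qed (simp add: sg)
 show ?thesis unfolding e using p n[of 2] n[of 3] by (simp add: sum_3)
qed

definition cK :: real where "cK = (LL x. K0 x)"
lemma cK_neg: "cK < 0" unfolding cK_def by (rule K0_int)

definition KK :: "real^3 => real" where "KK x = (1/cK) * K0 x"
lemma KK_csm: "csm KK" unfolding KK_def[abs_def] by (intro csm_cmult K0_csm)
lemma KK_int: "(LL x. KK x) = 1" unfolding KK_def using cK_neg by (simp add: cK_def[symmetric])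
lemma KK_supp: "KK x ~= 0 ==> abs(x$i) <= 3/8"
 unfolding KK_def using K0_far ccubeD by (metis ComplI mult_zero_right)

lemma ks_KK_supp:
 assumes "s > 0" "ks s KK p ~= 0" shows "abs(p$i) <= 3/8 * s"
proof -
 have "KK ((1/s) *R p) ~= 0" using assms(2) by (auto simp: ks_def)
 from KK_supp[OF this, of i] show ?thesis using assms(1) by (simp add: abs_mult field_simps)
qed

text \<open>Both dilates coincide with |x| away from the origin, so the difference has compact
  support, and its bilaplacian is the difference of two mean value kernels. As a test function it
  shows that the mean value does not depend on the scale.\<close>

definition psK :: "real => real => real^3 => real" where
 "psK s t x = (1/cK) * (s * G0 ((1/s) *R x + 0) - t * G0 ((1/t) *R x + 0))"

lemma psK_supp:
 assumes "s > 0" "t > 0" "psK s t x ~= 0" shows "abs(x$i) <= max s t"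
proof (rule ccontr)
 assume n: "~?thesis"
 have f: "G0 ((1/r) *R x) = norm x/r" if "r > 0" "r <= max s t" for r
 proof -
  have "r < abs(x$i)" using n that by simp
  then have "1 < abs(((1/r) *R x)$i)" using that by (simp add: abs_mult)
  then have "(1/r) *R x \<notin> ccube (3/8)" using ccubeD[of "(1/r) *R x" "3/8" i] by linarith
  then show ?thesis using that by (simp add: G0_far)
 qed
 have "psK s t x = 0" using f[of s] f[of t] assms(1,2) by (simp add: psK_def)
 then show False using assms(3) by simp
qed

lemma psK_smooth: "smooth3 (psK s t)"
 unfolding psK_def[abs_def] by (intro smooth3_cmult smooth3_diff smooth3_affine G0_smooth)

lemma psK_csm: "s > 0 ==> t > 0 ==> csm (psK s t)"
 by (rule csm_box[OF psK_smooth, of s t "max s t"]) (rule psK_supp)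

lemma psK_lap:
 assumes "s > 0" "t > 0" shows "lap (lap (psK s t)) x = ks s KK x - ks t KK x"
proof -
 have g: "smooth3 (%x. G0 ((1/r) *R x + 0))" for r by (intro smooth3_affine G0_smooth)
 have l2: "lap (lap (%x. r * G0 ((1/r) *R x + 0))) = (%x. K0 ((1/r) *R x + 0)/r^3)" if "r > 0" for r
 proof -
  have 1: "lap (%x. r * G0 ((1/r) *R x + 0)) = (%x. (1/r) * lap G0 ((1/r) *R x + 0))"
   unfolding lap_cmult[OF g] lap_affine[OF G0_smooth] using that by (simp add: p2eq field_simps)
  have "smooth3 (%x. lap G0 ((1/r) *R x + 0))" by (intro smooth3_affine smooth3_lap G0_smooth)
  then show ?thesis unfolding 1 K0_def using that
   by (simp only: lap_cmult lap_affine[OF smooth3_lap[OF G0_smooth]]) (simp add: p2eq power3_eq_cube field_simps)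
 qed
 have "lap (lap (psK s t)) = (%x. (1/cK) * (lap (lap (%x. s * G0 ((1/s) *R x + 0))) x - lap (lap (%x. t * G0 ((1/t) *R x + 0))) x))"
  unfolding psK_def[abs_def]
  by (simp only: lap_cmult lap_diff smooth3_lap smooth3_diff smooth3_cmult g)
 then show ?thesis unfolding l2[OF assms(1)] l2[OF assms(2)] by (simp add: ks_def KK_def right_diff_distrib mult.commute)
qed

text \<open>Every component of a Stokes solution is weakly biharmonic: test with \<open>curl curl (ps e\<^sub>k)\<close>.\<close>
lemma weak_biharm:
 assumes s: "sol R g u G F" and t: "test_fun Om ps" and Om: "Om \<subseteq> cube R \<inter> above g" and F0: "!!k j x. x \<in> Om ==> F k j x = 0"
 shows "(LL x. u k x * lap (lap ps) x) = 0"
proof -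
 note ul = solD(1-3)[OF s]
 have c: "csm ps" using t by (rule test_fun_csm)
 have sm: "smooth3 ps" using c by (rule csm_smooth)
 define ph where "ph i x = pd i (pd k ps) x - (if i = k then lap ps x else 0)" for i x
 have ts: "test_fun Om (%x. f x - h x)" if "test_fun Om f" "test_fun Om h" for f h
  using test_fun_add[OF that(1), of "%x. - h x"] that(2) csm_test_fun[of "%x. - h x" "closure {x. h x ~= 0}" Om]
 proof -
  have "test_fun Om (%x. - h x)" using that(2) unfolding test_fun_def by auto
  from test_fun_add[OF that(1) this] show ?thesis by simp
 qed
 have tphi: "test_fun Om (ph i)" for i
  unfolding ph_def[abs_def]
  by (cases "i = k") (auto intro!: ts test_fun_pd test_fun_lap t simp: test_fun_0)
 have t1: "test_fun (cube R \<inter> above g) (ph i)" for i using test_fun_mono[OF tphi Om] .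
 have tR: "test_fun (cube R) (ph i)" for i by (rule test_fun_mono[OF t1]) auto
 have psm: "smooth3 (ph i)" for i using csm_smooth[OF test_fun_csm[OF tphi]] .
 have pphi: "pd j (ph i) x = pd j (pd i (pd k ps)) x - (if i = k then pd j (lap ps) x else 0)" for i j x
  unfolding ph_def[abs_def] by (cases "i = k") (auto simp: pd_diff sm smooth3_lap)
 have div: "(S3 i. pd i (ph i) x) = 0" for x
 proof -
  have "(S3 i. pd i (ph i) x) = lap (pd k ps) x - (S3 i. if i = k then pd i (lap ps) x else 0)"
   unfolding pphi sum_subtractf lap_def ..
  also have "... = lap (pd k ps) x - pd k (lap ps) x" by simp
  also have "... = 0" by (simp add: pd_lap[OF sm])
  finally show ?thesis .
 qed
 have "0 = (S3 i. S3 j. LL x. (G i j x - F i j x) * pd j (ph i) x)"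
  by (rule solD(7)[OF s t1 div, symmetric])
 also have "... = (S3 i. S3 j. - (LL x. u i x * pd j (pd j (ph i)) x))"
 proof (intro sum.cong refl)
  fix i j
  have "(LL x. (G i j x - F i j x) * pd j (ph i) x) = (LL x. G i j x * pd j (ph i) x)"
  proof (rule icong)
   fix x show "(G i j x - F i j x) * pd j (ph i) x = G i j x * pd j (ph i) x"
    using F0 test_fun_support[OF test_fun_pd[OF tphi], of j i x] by (cases "pd j (ph i) x = 0") auto
  qed
  then show "(LL x. (G i j x - F i j x) * pd j (ph i) x) = - (LL x. u i x * pd j (pd j (ph i)) x)"
   using solD(4)[OF s test_fun_pd[OF tR], of i j j i] by simp
 qed
 also have "... = - (S3 i. LL x. u i x * lap (ph i) x)"
 proof -
  have "(LL x. u i x * lap (ph i) x) = (S3 j. LL x. u i x * pd j (pd j (ph i)) x)" for i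
   unfolding lap_def sum_distrib_left
   by (rule LLsum) (intro l2_prod ul csm_l2 csm_pd test_fun_csm[OF tphi])
  then show ?thesis by (simp add: sum_negf)
 qed
 finally have z: "(S3 i. LL x. u i x * lap (ph i) x) = 0" by simp
 have lphi: "lap (ph i) x = pd i (pd k (lap ps)) x - (if i = k then lap (lap ps) x else 0)" for i x
 proof -
  have "lap (ph i) x = lap (pd i (pd k ps)) x - (if i = k then lap (lap ps) x else 0)"
   unfolding ph_def[abs_def] by (cases "i = k") (auto simp: lap_diff sm smooth3_lap)
  then show ?thesis by (simp add: pd_lap sm)
 qed
 have tl: "test_fun (cube R) (pd k (lap ps))" by (intro test_fun_pd test_fun_lap test_fun_mono[OF t]) (use Om in auto)
 have cl: "csm (lap (lap ps))" by (intro csm_lap c)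
 have "(S3 i. LL x. u i x * lap (ph i) x) = (S3 i. (LL x. u i x * pd i (pd k (lap ps)) x) - (if i = k then LL x. u k x * lap (lap ps) x else 0))"
 proof (intro sum.cong refl)
  fix i
  show "(LL x. u i x * lap (ph i) x) = (LL x. u i x * pd i (pd k (lap ps)) x) - (if i = k then LL x. u k x * lap (lap ps) x else 0)"
   unfolding lphi right_diff_distrib
   using l2_prod[OF ul(1) csm_l2[OF csm_pd[OF csm_pd[OF csm_lap[OF c]]]], of i i k] l2_prod[OF ul(1)[of k] csm_l2[OF cl]]
   by (cases "i = k") auto
 qed
 also have "... = - (LL x. u k x * lap (lap ps) x)"
  unfolding sum_subtractf solD(5)[OF s tl] by simp
 finally show ?thesis using z by simp
qed

section \<open>Mean value property and pointwise representatives\<close>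

definition hcs :: "real => real => (real^3) set" where
 "hcs R s = {x. abs(x$1) < R - s & abs(x$2) < R - s & s < x$3 & x$3 < R - s}"

lemma hcs_HC:
 assumes "x \<in> hcs R s" "s >= 0" "!!i. abs(x$i - y$i) <= s" shows "y \<in> HC R"
proof -
 have x: "abs(x$1) < R - s" "abs(x$2) < R - s" "s < x$3" "x$3 < R - s" using assms(1) by (auto simp: hcs_def)
 have "abs(y$1) < R" "abs(y$2) < R" "0 < y$3" "y$3 < R"
  using x assms(3)[of 1] assms(3)[of 2] assms(3)[of 3] by linarith+
 then show ?thesis unfolding HC_def by (auto intro!: cubeI3)
qed

lemma hcs_open: "open (hcs R s)"
 unfolding hcs_def by (intro open_Collect_conj open_Collect_less continuous_intros)
lemma hcs_borel[simp, measurable]: "hcs R s \<in> sets borel" using hcs_open by simp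
lemma hcs_mono: "s <= t ==> hcs R t \<subseteq> hcs R s" unfolding hcs_def by auto
lemma hcs_sub_HC: "s >= 0 ==> hcs R s \<subseteq> HC R" using hcs_HC[of _ R s] by force

lemma HC_hcs:
 assumes "x \<in> HC R" obtains s where "s > 0" "x \<in> hcs R s"
proof -
 have x: "abs(x$1) < R" "abs(x$2) < R" "0 < x$3" "x$3 < R" using assms cubeD[of x R] by (auto simp: HC_def abs_less_iff)
 define m where "m = min (min (R - abs(x$1)) (R - abs(x$2))) (min (x$3) (R - x$3))"
 have m: "m > 0" "m <= R - abs(x$1)" "m <= R - abs(x$2)" "m <= x$3" "m <= R - x$3" using x by (auto simp: m_def min_le_iff_disj)
 have "x \<in> hcs R (m/2)" unfolding hcs_def using m by auto
 then show ?thesis using that[of "m/2"] m by auto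
qed

lemma test_fun_HC:
 assumes k: "csm k" and x: "x \<in> hcs R s" "0 <= s" and p: "!!p. k p ~= 0 ==> p \<in> ccube s"
 shows "test_fun (HC R) (%y. k (x - y))"
proof (rule test_fun_refl[OF k, of "(%y. x - y) -` ccube s"])
 show "closed ((%y. x - y) -` ccube s)" by (intro closed_vimage ccube_closed continuous_intros)
 show "(%y. x - y) -` ccube s \<subseteq> HC R"
 proof
  fix y assume "y \<in> (%y. x - y) -` ccube s"
  then have "abs(x$i - y$i) <= s" for i using ccubeD[of "x - y" s i] by simp
  then show "y \<in> HC R" by (rule hcs_HC[OF x])
 qed
qed (use p in simp)

lemma KK_test:
 assumes "0 < t" "x \<in> hcs R t" shows "test_fun (HC R) (%y. ks t KK (x - y))"
proof (rule test_fun_HC[OF csm_ks[OF KK_csm assms(1)] assms(2)])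
 fix p assume p: "ks t KK p ~= 0"
 have "abs(p$i) <= t" for i using ks_KK_supp[OF assms(1) p, of i] assms(1) by linarith
 then show "p \<in> ccube t" by (simp add: ccube_def)
qed (use assms in simp)

lemma conv_indep:
 assumes s: "sol R g u G F" and g: "!!y. g y <= 0" and F0: "!!k j x. x \<in> HC R ==> F k j x = 0"
  and ab: "a > 0" "b > 0" and x: "x \<in> hcs R a" "x \<in> hcs R b"
 shows "conv (u k) (ks a KK) x = conv (u k) (ks b KK) x"
proof -
 note ul = solD(1-3)[OF s]
 have c: "csm (psK a b)" using psK_csm ab by blast
 have xm: "x \<in> hcs R (max a b)" using x by (auto simp: hcs_def max_def)
 have sub: "HC R \<subseteq> cube R \<inter> above g" unfolding HC_def above_def using g by (auto intro: le_less_trans)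
 have t: "test_fun (HC R) (%y. psK a b (x - y))"
  by (rule test_fun_HC[OF c xm]) (use psK_supp[OF ab] ab in \<open>auto simp: ccube_def\<close>)
 have sm: "smooth3 (psK a b)" by (rule psK_smooth)
 have e: "lap (lap (%y. psK a b (x - y))) y = ks a KK (x - y) - ks b KK (x - y)" for y
 proof -
  have 1: "lap (%y. psK a b (x - y)) = (%y. lap (psK a b) (x - y))"
   using lap_affine[OF sm, of "-1" x] by simp
  show ?thesis unfolding 1 using lap_affine[OF smooth3_lap[OF sm], of "-1" x] psK_lap[OF ab, of "x - y"] by simp
 qed
 have "0 = (LL y. u k y * lap (lap (%y. psK a b (x - y))) y)"
  by (rule weak_biharm[OF s t sub F0, symmetric])
 also have "... = conv (u k) (ks a KK) x - conv (u k) (ks b KK) x"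
  unfolding e conv_def using conv_integrable[OF ul(1)[of k] csm_ks[OF KK_csm ab(1)], of x] conv_integrable[OF ul(1)[of k] csm_ks[OF KK_csm ab(2)], of x]
  by (simp add: algebra_simps)
 finally show ?thesis by simp
qed

lemma sq_zero_AE:
 assumes "l2 f" "S \<in> sets borel" "sq S f = 0" shows "AE3 x. x \<in> S --> f x = 0"
proof -
 have "AE3 x. ind S x * (f x)^2 = 0"
  using assms(3) unfolding sq_def by (subst (asm) integral_nonneg_eq_0_iff_AE[OF sq_integrable[OF assms(1,2)]]) auto
 then show ?thesis by eventually_elim (auto simp: indicator_def)
qed

text \<open>By \<open>conv_indep\<close> the scale may shrink to zero without changing the
  convolution, while the convolution tends to u in L^2.\<close>

lemma rep_AE:
 assumes s: "sol R g u G F" and g: "!!y. g y <= 0" and F0: "!!k j x. x \<in> HC R ==> F k j x = 0" and a: "a > 0"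
 shows "AE3 x. x \<in> hcs R a --> conv (u k) (ks a KK) x = u k x"
proof -
 note ul = solD(1-3)[OF s]
 have l: "l2 (%x. conv (u k) (ks r KK) x - u k x)" if "r > 0" for r by (intro l2_diff csm_conv_l2 ul csm_ks KK_csm that)
 have "sq (hcs R a) (%x. conv (u k) (ks a KK) x - u k x) <= 0 + e" if e: "e > 0" for e
 proof -
  obtain d where d: "d > 0" "!!s. 0 < s & s < d ==> sq UNIV (%x. conv (u k) (ks s KK) x - u k x) < e"
   using conv_ks_tendsto[OF ul(1) KK_csm KK_int e, of k] by blast
  define b where "b = min a d/2"
  have b: "b > 0" "b < d" "b <= a" using a d(1) by (auto simp: b_def)
  have "sq (hcs R a) (%x. conv (u k) (ks a KK) x - u k x) = sq (hcs R a) (%x. conv (u k) (ks b KK) x - u k x)"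
  proof (rule sq_cong)
   fix x assume x: "x \<in> hcs R a"
   then have "x \<in> hcs R b" using hcs_mono[OF b(3)] by blast
   then show "conv (u k) (ks a KK) x - u k x = conv (u k) (ks b KK) x - u k x"
    using conv_indep[OF s g F0 a b(1) x] by simp
  qed
  also have "... <= sq UNIV (%x. conv (u k) (ks b KK) x - u k x)" by (intro sq_mono l b) auto
  also have "... < e" using d(2)[of b] b by simp
  finally show ?thesis by simp
 qed
 then have "sq (hcs R a) (%x. conv (u k) (ks a KK) x - u k x) <= 0" by (rule field_le_epsilon)
 then have "sq (hcs R a) (%x. conv (u k) (ks a KK) x - u k x) = 0" using sq_nonneg[of "hcs R a"] by (simp add: antisym)
 from sq_zero_AE[OF l[OF a] hcs_borel this] show ?thesis by simp
qed

text \<open>The mean value property at every point and every scale that fits. It fixes a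
  representative, so that pointwise bounds, pointwise limits and derivatives make sense.\<close>

definition rep :: "real => (real^3 => real) => bool" where
 "rep R f \<longleftrightarrow> l2 f & (\<forall>s>0. \<forall>x\<in>hcs R s. f x = conv f (ks s KK) x)"

lemma conv_cong_AE:
 assumes "l2 f" "l2 f'" "csm k" "AE3 x. f x = f' x" shows "conv f k x = conv f' k x"
 unfolding conv_def
proof (rule integral_cong_AE)
 show "AE3 y. k (x - y) * f y = k (x - y) * f' y" using assms(4) by eventually_elim simp
qed (use conv_integrable[OF assms(1,3)] conv_integrable[OF assms(2,3)] in auto)

lemma sol_cong_AE:
 assumes s: "sol R g u G F" and u': "!!k. l2 (u' k)" "!!k. AE3 x. x \<in> cube R --> u k x = u' k x"
  "!!k x. x \<in> cube R ==> x \<notin> above g ==> u' k x = 0"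
 shows "sol R g u' G F"
proof -
 note ul = solD(1-3)[OF s]
 have e: "(LL x. u' k x * pd j ps x) = (LL x. u k x * pd j ps x)" if "test_fun (cube R) ps" for k j ps
 proof (rule integral_cong_AE)
  have c: "l2 (pd j ps)" using csm_l2[OF csm_pd[OF test_fun_csm[OF that]]] .
  show "(%x. u' k x * pd j ps x) \<in> borel_measurable lborel" "(%x. u k x * pd j ps x) \<in> borel_measurable lborel"
   using l2_prod[OF u'(1) c] l2_prod[OF ul(1) c] by auto
  show "AE3 x. u' k x * pd j ps x = u k x * pd j ps x" using u'(2)[of k]
  proof eventually_elim
   case (elim x)
   then show ?case using test_fun_support[OF test_fun_pd[OF that], of j x] by (cases "pd j ps x = 0") auto
  qed
 qed
 show ?thesis unfolding sol_def
 proof (intro conjI allI impI)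
  fix k j ps assume t: "test_fun (cube R) ps"
  show "(LL x. u' k x * pd j ps x) = - (LL x. G k j x * ps x)"
   unfolding e[OF t] by (rule solD(4)[OF s t])
 next
  fix ps assume t: "test_fun (cube R) ps"
  show "(S3 k. LL x. u' k x * pd k ps x) = 0"
   unfolding e[OF t] by (rule solD(5)[OF s t])
 next
  fix ph :: "3 => real^3 => real" assume "(\<forall>k. test_fun (cube R \<inter> above g) (ph k)) & (\<forall>x. (S3 k. pd k (ph k) x) = 0)"
  then show "(S3 k. S3 j. LL x. (G k j x - F k j x) * pd j (ph k) x) = 0"
   by (intro solD(7)[OF s]) auto
 qed (use ul u' in auto)
qed

definition dd :: "real => real^3 => real" where
 "dd R x = min (min (R - abs(x$1)) (R - abs(x$2))) (min (x$3) (R - x$3))"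

lemma dd_hcs: "s < dd R x \<longleftrightarrow> x \<in> hcs R s"
 unfolding dd_def hcs_def by auto
lemma dd_HC: "R > 0 ==> 0 < dd R x \<longleftrightarrow> x \<in> HC R"
 unfolding dd_hcs hcs_def HC_def cube_def by (auto simp: forall_3 abs_less_iff)
lemma dd_cont: "continuous_on S (dd R)"
 unfolding dd_def[abs_def] by (intro continuous_intros)

text \<open>Half the sup-norm distance to the boundary is a concrete admissible scale at each point;
  near a point a fixed scale gives the same values, hence continuity in the half cube. Outside it u
  is left as it is, so the zero values below the graph persist.\<close>

lemma rep_exists:
 assumes R: "R > 0" and s: "sol R g u G F" and g: "!!y. g y <= 0" and F0: "!!k j x. x \<in> HC R ==> F k j x = 0"
 obtains u' where "!!k. AE3 x. u k x = u' k x" "sol R g u' G F" "!!k. rep R (u' k)"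
proof -
 note ul = solD(1-3)[OF s]
 define v where "v k x = conv (u k) (ks (dd R x/2) KK) x" for k x
 have vs: "v k x = conv (u k) (ks a KK) x" if "a > 0" "x \<in> hcs R a" for k a x
 proof -
  have d: "dd R x > a" using that(2) by (simp add: dd_hcs)
  then have "x \<in> hcs R (dd R x/2)" unfolding dd_hcs[symmetric] using that(1) by simp
  then show ?thesis unfolding v_def using d that by (intro conv_indep[OF s g F0]) auto
 qed
 have vc: "continuous_on (HC R) (v k)" for k
 proof -
  have "isCont (v k) x" if hx: "x \<in> HC R" for x
  proof -
   obtain a where a: "a > 0" "x \<in> hcs R a" using HC_hcs[OF hx] by blast
   have "continuous_on (hcs R a) (v k)"
    using continuous_on_subset[OF conv_cont[OF ul(1) csm_ks[OF KK_csm a(1)]], of "hcs R a" k] vs[OF a(1)]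
    by (subst continuous_on_cong[OF refl]) auto
   then show ?thesis using a(2) hcs_open by (simp add: continuous_on_eq_continuous_at)
  qed
  then show ?thesis by (simp add: continuous_at_imp_continuous_on)
 qed
 define u' where "u' k x = (if x \<in> HC R then v k x else u k x)" for k x
 have AEk: "AE3 x. u k x = u' k x" for k
 proof -
  have "AE3 x. \<forall>n::nat. x \<in> hcs R (1/real (Suc n)) --> conv (u k) (ks (1/real (Suc n)) KK) x = u k x"
   by (subst AE_all_countable) (intro allI rep_AE[OF s g F0]; simp)
  then show ?thesis
  proof eventually_elim
   case (elim x)
   show ?case
   proof (cases "x \<in> HC R")
    case True
    obtain a where a: "a > 0" "x \<in> hcs R a" using HC_hcs[OF True] by blast
    obtain n :: nat where n: "1/real (Suc n) < a" using nat_approx_posE[OF a(1)] by blast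
    have "x \<in> hcs R (1/real (Suc n))" using hcs_mono[of "1/real (Suc n)" a R] n a(2) by auto
    then show ?thesis using elim vs[of "1/real (Suc n)" x k] True by (simp add: u'_def)
   qed (simp add: u'_def)
  qed
 qed
 have um: "u' k \<in> BM" for k
 proof -
  have "u' k = (%x. ind (HC R) x *R v k x + ind (- HC R) x * u k x)"
   by (auto simp: u'_def indicator_def fun_eq_iff)
  moreover have "(%x. ind (HC R) x *R v k x) \<in> BM"
   by (rule borel_measurable_continuous_on_indicator[OF HC_borel vc])
  moreover have "(%x. ind (- HC R) x * u k x) \<in> BM"
   using l2_meas[OF ul(1)[of k]] by (intro borel_measurable_times borel_measurable_indicator) auto
  ultimately show ?thesis by simp
 qed
 have ul2: "l2 (u' k)" for k
  unfolding l2_def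
 proof
  show "integrable lborel (%x. (u' k x)^2)"
  proof (rule integrable_cong_AE_imp[of _ "%x. (u k x)^2"])
   show "AE3 x. (u k x)^2 = (u' k x)^2" using AEk[of k] by eventually_elim simp
  qed (use ul(1) um[of k] in \<open>auto simp: l2_def\<close>)
 qed (rule um)
 have s': "sol R g u' G F"
 proof (rule sol_cong_AE[OF s ul2])
  show "AE3 x. x \<in> cube R --> u k x = u' k x" for k using AEk[of k] by eventually_elim simp
  fix k x assume x: "x \<in> cube R" "x \<notin> above g"
  then have "x \<notin> HC R" using g[of "hor x"] by (auto simp: HC_def above_def)
  then show "u' k x = 0" using solD(6)[OF s x] by (simp add: u'_def)
 qed
 have "rep R (u' k)" for k
  unfolding rep_def
 proof (intro conjI allI impI ballI ul2)
  fix a x assume a: "0 < (a::real)" and x: "x \<in> hcs R a"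
  then have "x \<in> HC R" using hcs_sub_HC[of a R] by auto
  then have "u' k x = conv (u k) (ks a KK) x" using vs[OF a x] by (simp add: u'_def)
  also have "... = conv (u' k) (ks a KK) x" by (rule conv_cong_AE[OF ul(1) ul2 csm_ks[OF KK_csm a] AEk])
  finally show "u' k x = conv (u' k) (ks a KK) x" .
 qed
 then show ?thesis using that AEk s' by blast
qed

lemma rep_l2: "rep R f ==> l2 f" by (simp add: rep_def)
lemma repD: "rep R f ==> s > 0 ==> x \<in> hcs R s ==> f x = conv f (ks s KK) x" by (simp add: rep_def)

lemma rep_pd:
 assumes f: "rep R f" and s: "s > 0" and x: "x \<in> hcs R s"
 shows "foldr pd al f x = conv f (foldr pd al (ks s KK)) x"
 using x
proof (induction al arbitrary: x)
 case Nil then show ?case using repD[OF f s] by simp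
next
 case (Cons j al)
 have c: "csm (foldr pd al (ks s KK))" by (induction al) (auto intro: csm_pd csm_ks KK_csm s)
 have "pd j (foldr pd al f) x = pd j (conv f (foldr pd al (ks s KK))) x"
  by (rule pd_eq_open[OF hcs_open Cons.prems]) (rule Cons.IH)
 then show ?case using conv_pd[OF rep_l2[OF f] c] by simp
qed

lemma conv_CS:
 assumes f: "l2 f" and k: "csm k" and S: "S \<in> sets borel" "!!y. k (x - y) ~= 0 ==> y \<in> S"
 shows "(conv f k x)^2 <= (LL p. (k p)^2) * sq S f"
proof -
 have i: "l2 (%y. ind S y * f y)" by (intro l2_indicator f S)
 have "conv f k x = (LL y. k (x - y) * (ind S y * f y))"
  unfolding conv_def
 proof (rule icong)
  fix y show "k (x - y) * f y = k (x - y) * (ind S y * f y)" using S(2)[of y] by (cases "k (x - y) = 0") auto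
 qed
 then have "(conv f k x)^2 <= (LL y. (k (x - y))^2) * (LL y. (ind S y * f y)^2)"
  using CS[OF csm_l2[OF csm_refl[OF k]] i] by simp
 also have "(LL y. (k (x - y))^2) = (LL p. (k p)^2)" using integral_reflect3[of "%p. (k p)^2" x] by simp
 also have "(LL y. (ind S y * f y)^2) = sq S f"
  unfolding sq_def by (rule icong) (auto simp: indicator_def)
 finally show ?thesis .
qed

lemma rep_bound:
 assumes f: "rep R f" and s: "s > 0" and x: "x \<in> hcs R s"
 shows "(f x)^2 <= (LL p. (KK p)^2)/s^3 * sq (HC R) f"
proof -
 have "(f x)^2 <= (LL p. (ks s KK p)^2) * sq (HC R) f"
  unfolding repD[OF f s x]
 proof (rule conv_CS[OF rep_l2[OF f] csm_ks[OF KK_csm s] HC_borel])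
  fix y assume k: "ks s KK (x - y) ~= 0"
  have "abs(x$i - y$i) <= s" for i using ks_KK_supp[OF s k, of i] s by simp
  then show "y \<in> HC R" using hcs_HC[OF x] s by simp
 qed
 also have "(LL p. (ks s KK p)^2) = (LL p. (KK p)^2)/s^3"
 proof -
  have "(LL p. (ks s KK p)^2) = s^3 * (LL p. (KK p)^2/(s^3)^2)"
   using integral_affine3[of s "%p. (ks s KK p)^2" 0] s by (simp add: ks_def power_divide)
  also have "... = (s^3/(s^3)^2) * (LL p. (KK p)^2)" by simp
  also have "s^3/(s^3)^2 = 1/s^3"
  proof -
   have "a/a^2 = 1/a" if "a > 0" for a :: real using that by (simp add: p2eq)
   then show ?thesis using s by (metis zero_less_power)
  qed
  finally show ?thesis by simp
 qed
 finally show ?thesis .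
qed

lemma fatou_sq:
 fixes f :: "nat => real^3 => real"
 assumes f: "!!n. l2 (f n)" and z[measurable]: "z \<in> BM" and S[measurable]: "S \<in> sets borel"
  and lim: "!!x. x \<in> S ==> (%n. f n x) ~~> z x" and c: "EV n. sq S (f n) <= c"
 shows "integrable lborel (%x. ind S x * (z x)^2)" "sq S z <= c"
proof -
 note [measurable] = l2_meas[OF f]
 have c0: "0 <= c"
 proof -
  obtain n where "sq S (f n) <= c" using c by (auto simp: eventually_sequentially)
  then show ?thesis using sq_nonneg[of S "f n"] by linarith
 qed
 have "(\<integral>\<^sup>+x. ennreal (ind S x * (z x)^2) \<partial>lborel) = (\<integral>\<^sup>+x. liminf (%n. ennreal (ind S x * (f n x)^2)) \<partial>lborel)"
 proof (rule nn_integral_cong)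
  fix x
  have "(%n. ennreal (ind S x * (f n x)^2)) ~~> ennreal (ind S x * (z x)^2)"
  proof (cases "x \<in> S")
   case True then show ?thesis using lim[OF True] by (intro tendsto_ennrealI tendsto_intros)
  qed simp
  then show "ennreal (ind S x * (z x)^2) = liminf (%n. ennreal (ind S x * (f n x)^2))"
   using lim_imp_Liminf[OF sequentially_bot] by metis
 qed
 also have "... <= liminf (%n. \<integral>\<^sup>+x. ennreal (ind S x * (f n x)^2) \<partial>lborel)"
  by (rule nn_integral_liminf) measurable
 also have "... <= ennreal c"
 proof -
  have "(\<integral>\<^sup>+x. ennreal (ind S x * (f n x)^2) \<partial>lborel) = ennreal (sq S (f n))" for n
   unfolding sq_def by (rule nn_integral_eq_integral[OF sq_integrable[OF f S]]) auto
  moreover have "liminf (%n. ennreal (sq S (f n))) <= ennreal c"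
   using c by (intro Liminf_le) (auto elim!: eventually_mono intro: ennreal_leI)
  ultimately show ?thesis by simp
 qed
 finally have *: "(\<integral>\<^sup>+x. ennreal (ind S x * (z x)^2) \<partial>lborel) <= ennreal c" .
 show "integrable lborel (%x. ind S x * (z x)^2)" by (rule nn_bound(1)[OF _ _ * c0]) auto
 show "sq S z <= c" unfolding sq_def by (rule nn_bound(2)[OF _ _ * c0]) auto
qed

lemma rep_cont: assumes "rep R f" shows "continuous_on (HC R) (foldr pd al f)"
proof -
 have "isCont (foldr pd al f) x" if hx: "x \<in> HC R" for x
 proof -
  obtain s where s: "s > 0" "x \<in> hcs R s" using HC_hcs[OF hx] by blast
  have c: "csm (foldr pd al (ks s KK))" by (induction al) (auto intro: csm_pd csm_ks KK_csm s)
  have "continuous_on (hcs R s) (foldr pd al f)"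
   using continuous_on_subset[OF conv_cont[OF rep_l2[OF assms] c], of "hcs R s"] rep_pd[OF assms s(1)]
   by (subst continuous_on_cong[OF refl]) auto
  then show ?thesis using s(2) hcs_open by (simp add: continuous_on_eq_continuous_at)
 qed
 then show ?thesis by (simp add: continuous_at_imp_continuous_on)
qed

lemma test_HC_hcs:
 assumes R: "R > 0" and t: "test_fun (HC R) ps"
 obtains s where "s > 0" "test_fun (hcs R s) ps"
proof (cases "closure {x. ps x ~= 0} = {}")
 case True
 then have "test_fun (hcs R 1) ps" using t unfolding test_fun_def by simp
 then show ?thesis using that[of 1] by simp
next
 case False
 note t' = t[unfolded test_fun_def]
 note c = conjunct1[OF t'] conjunct1[OF conjunct2[OF t']] conjunct2[OF conjunct2[OF t']]
 obtain y where y: "y \<in> closure {x. ps x ~= 0}" "!!x. x \<in> closure {x. ps x ~= 0} ==> dd R y <= dd R x"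
  using continuous_attains_inf[OF c(2) False dd_cont] by blast
 have d: "dd R y > 0" using dd_HC[OF R] y(1) c(3) by blast
 have "closure {x. ps x ~= 0} \<subseteq> hcs R (dd R y/2)"
 proof
  fix x assume "x \<in> closure {x. ps x ~= 0}"
  from y(2)[OF this] show "x \<in> hcs R (dd R y/2)" unfolding dd_hcs[symmetric] using d by simp
 qed
 then have "test_fun (hcs R (dd R y/2)) ps" using c(1,2) unfolding test_fun_def by (intro conjI)
 then show ?thesis using that[of "dd R y/2"] d by simp
qed

lemma rep_IBP:
 assumes R: "R > 0" and f: "rep R f" and t: "test_fun (HC R) ps"
 shows "(LL x. f x * pd j ps x) = - (LL x. pd j f x * ps x)"
proof -
 obtain s where s: "s > 0" and ts: "test_fun (hcs R s) ps" using test_HC_hcs[OF R t] by blast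
 note sp = test_fun_support[OF ts] test_fun_support[OF test_fun_pd[OF ts]]
 define w where "w = conv f (ks s KK)"
 have ws: "smooth3 w" unfolding w_def by (intro conv_smooth rep_l2[OF f] csm_ks KK_csm s)
 have fw: "f x = w x" if "x \<in> hcs R s" for x unfolding w_def using repD[OF f s(1) that] .
 have pf: "pd j f x = pd j w x" if "x \<in> hcs R s" for x by (rule pd_eq_open[OF hcs_open that fw])
 have "(LL x. f x * pd j ps x) = (LL x. w x * pd j ps x)"
 proof (rule icong)
  fix x show "f x * pd j ps x = w x * pd j ps x" using fw[of x] sp(2)[of j x] by (cases "pd j ps x = 0") auto
 qed
 also have "... = - (LL x. pd j w x * ps x)" by (rule IBP[OF test_fun_csm[OF t] ws])
 also have "(LL x. pd j w x * ps x) = (LL x. pd j f x * ps x)"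
 proof (rule icong)
  fix x show "pd j w x * ps x = pd j f x * ps x" using pf[of x] sp(1)[of x] by (cases "ps x = 0") auto
 qed
 finally show ?thesis .
qed

lemma rep_restrict:
 assumes f: "rep R f" and r: "r <= R" shows "rep r (%x. ind (cube r) x * f x)"
 unfolding rep_def
proof (intro conjI allI impI ballI)
 show "l2 (%x. ind (cube r) x * f x)" by (intro l2_indicator rep_l2[OF f] cube_borel)
 fix s x assume s: "0 < (s::real)" and x: "x \<in> hcs r s"
 have xc: "x \<in> cube r" using hcs_sub_HC[of s r] s x by (auto simp: HC_def)
 have xR: "x \<in> hcs R s" using x r by (auto simp: hcs_def)
 have "ind (cube r) x * f x = conv f (ks s KK) x" using xc repD[OF f s xR] by simp
 also have "... = conv (%x. ind (cube r) x * f x) (ks s KK) x"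
  unfolding conv_def
 proof (rule icong)
  fix y show "ks s KK (x - y) * f y = ks s KK (x - y) * (ind (cube r) y * f y)"
  proof (cases "ks s KK (x - y) = 0")
   case False
   have "abs(x$i - y$i) <= s" for i using ks_KK_supp[OF s False, of i] s by simp
   then have "y \<in> HC r" using hcs_HC[OF x] s by simp
   then show ?thesis by (simp add: HC_def)
  qed simp
 qed
 finally show "ind (cube r) x * f x = conv (%x. ind (cube r) x * f x) (ks s KK) x" .
qed

lemma rep_measurable_pd:
 assumes "rep R f" shows "(%x. ind (HC R) x * foldr pd al f x) \<in> BM"
 using borel_measurable_continuous_on_indicator[OF HC_borel rep_cont[OF assms, of al]] by simp

section \<open>Compactness\<close>

lemma caccioppoli_scaled:
 assumes M: "M >= 0"
 shows "\<exists>C>0. \<forall>R g u G F. 0 < R & sol R g u G F & lipg M g & (\<forall>y. - R/10 <= g y) --> enr (R/8) G <= C * (mas R u/R^2 + enr R F)"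
proof -
 obtain C where C: "C > 0" "!!g u G F. sol 1 g u G F & lipg M g & (\<forall>y. -1/10 <= g y) ==> enr (1/8) G <= C * (mas 1 u + enr 1 F)"
  using caccioppoli[OF M] by blast
 have "enr (R/8) G <= C * (mas R u/R^2 + enr R F)"
  if R: "0 < R" and s: "sol R g u G F" and l: "lipg M g" and g: "!!y. - R/10 <= g y" for R g u G F
 proof -
  have s': "sol 1 (%y. g (R *R y)/R) (%k x. 1 * u k (R *R x)) (%k j x. 1 * R * G k j (R *R x)) (%k j x. 1 * R * F k j (R *R x))"
   using sol_scale[OF s R, of 1] R by simp
  have e: "enr q (%k j x. 1 * R * H k j (R *R x)) = enr (R * q) H/R" for q H
  proof -
   have "R^2/R^3 = 1/R" using R by (simp add: p2eq power3_eq_cube)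
   then show ?thesis unfolding enr_def sum_divide_distrib mult_1 sq_scale[OF R] by simp
  qed
  have m: "mas 1 (%k x. 1 * u k (R *R x)) = mas R u/R^3"
   unfolding mas_def sum_divide_distrib sq_scale[OF R] by simp
  have g': "- 1/10 <= g (R *R y)/R" for y using g[of "R *R y"] R by (simp add: field_simps)
  have "enr (R/8) G/R <= C * (mas R u/R^3 + enr R F/R)"
   using C(2)[OF conjI[OF s' conjI[OF lipg_scale[OF l R]]]] g' unfolding e m by simp
  then have "enr (R/8) G/R * R <= C * (mas R u/R^3 + enr R F/R) * R" using R by (intro mult_right_mono) auto
  also have "enr (R/8) G/R * R = enr (R/8) G" using R by simp
  also have "C * (mas R u/R^3 + enr R F/R) * R = C * (mas R u/R^2 + enr R F)"
   using R by (simp add: distrib_left distrib_right p2eq power3_eq_cube)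
  finally show ?thesis .
 qed
 then show ?thesis using C(1) by blast
qed

text \<open>The squared L^2 distance between k and its translate is twice the drop of the
  autocorrelation of k, which is a convolution and therefore continuous.\<close>

lemma translation_continuity:
 assumes k: "csm k" and e: "e > 0"
 shows "\<exists>d>0. \<forall>h. norm h < d --> (LL p. (k (1 *R p + h) - k p)^2) < e"
proof -
 have k0: "l2 (%y. k (0 - y))" by (intro csm_l2 csm_refl k)
 define c where "c = conv (%y. k (0 - y)) k"
 have c: "c h = (LL p. k (p + h) * k p)" for h
 proof -
  have "c h = (LL y. (%p. k (p + h) * k p) (0 - y))" unfolding c_def conv_def by (simp add: add.commute)
  also have "... = (LL p. k (p + h) * k p)" by (rule integral_reflect3)
  finally show ?thesis .
 qed
 have kh: "csm (%p. k (1 *R p + h))" for h by (intro csm_affine k) auto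
 have id: "(LL p. (k (1 *R p + h) - k p)^2) = 2 * (c 0 - c h)" for h
 proof -
  have "(LL p. (k (1 *R p + h) - k p)^2) = (LL p. (k (p + h))^2 + (k p)^2 - 2 * (k (p + h) * k p))"
   by (rule icong) (simp add: p2eq algebra_simps)
  also have "... = (LL p. (k (p + h))^2) + (LL p. (k p)^2) - 2 * c h"
   using l2_prod[OF csm_l2[OF kh[of h]] csm_l2[OF kh[of h]]] l2_prod[OF csm_l2[OF k] csm_l2[OF k]] l2_prod[OF csm_l2[OF kh[of h]] csm_l2[OF k]]
   by (simp add: c p2eq)
  also have "... = 2 * (c 0 - c h)" unfolding c using integral_shift3[of "%p. (k p)^2" h] by (simp add: p2eq)
  finally show ?thesis .
 qed
 have "isCont c 0" using conv_cont[OF k0 k] unfolding c_def by (simp add: continuous_on_eq_continuous_at)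
 then have "(c \<longlongrightarrow> c 0) (at 0)" by (simp add: isCont_def)
 then obtain d where d: "d > 0" "!!h. h ~= 0 ==> norm h < d ==> abs(c h - c 0) < e/2"
  using e unfolding tendsto_iff eventually_at dist_norm by (metis UNIV_I diff_zero half_gt_zero real_norm_def)
 show ?thesis
 proof (intro exI[of _ d] conjI d allI impI)
  fix h :: "real^3" assume "norm h < d"
  then have "abs(c h - c 0) < e/2" using d(2)[of h] e by (cases "h = 0") auto
  then show "(LL p. (k (1 *R p + h) - k p)^2) < e" unfolding id using abs_ge_minus_self[of "c h - c 0"] by argo
 qed
qed

lemma rep_diff:
 assumes f: "rep R f" and s: "s > 0" and x: "x \<in> hcs R s" and y: "y \<in> hcs R s"
 shows "(f y - f x)^2 <= (LL p. (ks s KK (1 *R p + (y - x)) - ks s KK p)^2) * sq (HC R) f"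
proof -
 have c: "csm (ks s KK)" by (rule csm_ks[OF KK_csm s])
 have c2: "csm (%p. ks s KK (1 *R p + (y - x)))" by (intro csm_affine c) auto
 have in1: "z \<in> HC R" if "ks s KK (w - z) ~= 0" "w \<in> hcs R s" for w z
 proof (rule hcs_HC[OF that(2)])
  show "abs(w$i - z$i) <= s" for i using ks_KK_supp[OF s that(1), of i] s by simp
 qed (use s in simp)
 have "f y - f x = conv f (%p. ks s KK (1 *R p + (y - x)) - ks s KK p) x"
  unfolding conv_diff_ker[OF rep_l2[OF f] c2 c] repD[OF f s x] repD[OF f s y] by (simp add: conv_def algebra_simps)
 also have "(...)^2 <= (LL p. (ks s KK (1 *R p + (y - x)) - ks s KK p)^2) * sq (HC R) f"
 proof (rule conv_CS[OF rep_l2[OF f] csm_diff[OF c2 c] HC_borel])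
  fix z assume "ks s KK (1 *R (x - z) + (y - x)) - ks s KK (x - z) ~= 0"
  then have "ks s KK (y - z) ~= 0 | ks s KK (x - z) ~= 0" by auto
  then show "z \<in> HC R" using in1 x y by blast
 qed
 finally show ?thesis .
qed

lemma rep_0[simp]: "rep R (%x. 0)" by (simp add: rep_def conv_def)

text \<open>Arzela-Ascoli: the mean value formula moves both boundedness and equicontinuity from the
  solutions to the fixed kernel. The half scale s/2 leaves a compact set of points on which the
  formula applies.\<close>

lemma rep_subsequence:
 fixes f :: "nat => 3 => real^3 => real"
 assumes f: "!!n k. rep R (f n k)" "!!n k. sq (HC R) (f n k) <= A" and s: "s > 0"
 shows "\<exists>sg::nat=>nat. strict_mono sg & (\<forall>x\<in>hcs R s. \<forall>k. convergent (%n. f (sg n) k x))"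
proof -
 define S where "S = {x. s <= dd R x}"
 have Sh: "x \<in> hcs R (s/2)" if "x \<in> S" for x using that s unfolding S_def dd_hcs[symmetric] by simp
 have s2: "s/2 > 0" using s by simp
 define K where "K = (LL p. (KK p)^2)/(s/2)^3"
 have A0: "0 <= A" using f(2) sq_nonneg[of "HC R"] order_trans by blast
 have K0: "0 <= K" unfolding K_def using s by (intro divide_nonneg_nonneg integral_nonneg) auto
 have nrm: "norm (\<chi> k. a k) <= 3 * b" if "!!k. abs(a k) <= b" for a :: "3 => real" and b
  using norm3_le[of "\<chi> k. a k"] that[of 1] that[of 2] that[of 3] by simp
 have comp: "compact S"
 proof -
  have "closed S" unfolding S_def by (intro closed_Collect_le continuous_on_const dd_cont)
  moreover have "S \<subseteq> cube R" using Sh hcs_sub_HC[of "s/2" R] s by (force simp: HC_def)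
  ultimately show ?thesis using bounded_subset[OF cube_bounded] by (simp add: compact_eq_bounded_closed)
 qed
 have bd: "norm (\<chi> k. f n k x) <= 3 * sqrt (K * A)" if "x \<in> S" for n x
 proof (rule nrm)
  fix k
  have "(f n k x)^2 <= K * sq (HC R) (f n k)" unfolding K_def by (rule rep_bound[OF f(1) s2 Sh[OF that]])
  also have "... <= K * A" by (rule mult_left_mono[OF f(2) K0])
  finally show "abs(f n k x) <= sqrt (K * A)" by (intro real_le_rsqrt) simp
 qed
 have eq: "\<exists>d>0. \<forall>n y. y \<in> S & norm (x - y) < d --> norm ((\<chi> k. f n k x) - (\<chi> k. f n k y)) < e"
  if x: "x \<in> S" and e: "e > 0" for x e
 proof -
  have "e^2/(16 * (A + 1)) > 0" using e A0 by simp
  from translation_continuity[OF csm_ks[OF KK_csm s2] this]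
  obtain d where d: "d > 0" "!!h. norm h < d ==> (LL p. (ks (s/2) KK (1 *R p + h) - ks (s/2) KK p)^2) < e^2/(16 * (A + 1))"
   by blast
  show ?thesis
  proof (intro exI[of _ d] conjI d allI impI)
   fix n y assume y: "y \<in> S & norm (x - y) < d"
   have "norm (\<chi> k. f n k x - f n k y) <= 3 * (e/4)"
   proof (rule nrm)
    fix k
    have "(f n k x - f n k y)^2 <= (LL p. (ks (s/2) KK (1 *R p + (x - y)) - ks (s/2) KK p)^2) * sq (HC R) (f n k)"
     by (rule rep_diff[OF f(1) s2 Sh Sh]) (use x y in auto)
    also have "... <= e^2/(16 * (A + 1)) * (A + 1)"
     by (rule mult_mono) (use d(2)[of "x - y"] y f(2)[of n k] A0 in auto)
    also have "... = (e/4)^2"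
    proof -
     have "e^2/(16 * B) * B = (e/4)^2" if "B ~= 0" for B :: real using that by (simp add: power_divide)
     then show ?thesis using A0 by (metis add_nonneg_eq_0_iff zero_le_one zero_neq_one)
    qed
    finally show "abs(f n k x - f n k y) <= e/4" using abs_le_square_iff[of "f n k x - f n k y" "e/4"] e by simp
   qed
   moreover have "(\<chi> k. f n k x) - (\<chi> k. f n k y) = (\<chi> k. f n k x - f n k y)" by (simp add: vec_eq_iff)
   ultimately show "norm ((\<chi> k. f n k x) - (\<chi> k. f n k y)) < e" using e by simp
  qed
 qed
 obtain g and sg :: "nat => nat" where "continuous_on S g" and sg: "strict_mono sg"
  "!!e. 0 < e ==> \<exists>N. \<forall>n x. n >= N & x \<in> S --> norm ((\<chi> k. f (sg n) k x) - g x) < e"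
 proof (rule Arzela_Ascoli[OF comp, of "%n x. \<chi> k. f n k x", OF bd eq])
  fix g and sg :: "nat => nat"
  assume a: "continuous_on S g" "strict_mono sg" and b: "!!e. 0 < e ==> \<exists>N. \<forall>n x. n >= N & x \<in> S --> norm ((\<chi> k. f (sg n) k x) - g x) < e"
  show thesis by (rule that[OF a b])
 qed
 have "convergent (%n. f (sg n) k x)" if "x \<in> hcs R s" for x k
 proof -
  have xS: "x \<in> S" using that unfolding S_def dd_hcs[symmetric] by simp
  have "(%n. \<chi> k. f (sg n) k x) ~~> g x"
   unfolding LIMSEQ_iff using sg(2) xS by meson
  from tendsto_vec_nth[OF this, of k] show ?thesis by (auto simp: convergent_def)
 qed
 then show ?thesis using sg(1) by blast
qed

text \<open>A solution in the half space is square integrable only locally, whereas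
  \<open>sol\<close> asks for global square integrability; so global solutions are described through
  their truncations to dyadic cubes.\<close>

definition hz :: "nat => (3 => real^3 => real) => 3 => real^3 => real" where
 "hz j v k x = ind (cube (2^j)) x * v k x"

definition gsol :: "(3 => real^3 => real) => bool" where
 "gsol v \<longleftrightarrow> (\<forall>j. (\<exists>G. sol (2^j) (%_. 0) (hz j v) G (%_ _ _. 0)) & (\<forall>k. rep (2^j) (hz j v k)))"

text \<open>The sets \<open>hcs (2^j) (1/2^j)\<close> exhaust the open half space, and on each of
  them a subsequence converges pointwise.\<close>

lemma diagonal_subsequence:
 fixes u :: "nat => 3 => real^3 => real" and i :: "nat => nat"
 assumes i: "filterlim i at_top sequentially" and r: "!!n k. rep (2^i n) (u n k)"
  and A: "!!n j. j <= i n ==> mas (2^j) (u n) <= A j"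
 shows "\<exists>sg::nat=>nat. strict_mono sg & (\<forall>x k. 0 < x$3 --> convergent (%n. u (sg n) k x))"
proof -
 define P where "P j sg \<longleftrightarrow> (\<forall>x\<in>hcs (2^j) (1/2^j). \<forall>k. convergent (%n. u (sg n) k x))" for j and sg :: "nat => nat"
 have st: "P j (sg \<circ> \<tau>)" if "strict_mono \<tau>" "P j sg" for j sg \<tau>
 proof -
  have "convergent (%n. u ((sg \<circ> \<tau>) n) k x)" if x: "x \<in> hcs (2^j) (1/2^j)" for x k
   using convergent_subseq_convergent[OF _ \<open>strict_mono \<tau>\<close>, of "%n. u (sg n) k x"] \<open>P j sg\<close> x by (simp add: P_def o_def)
  then show ?thesis by (simp add: P_def)
 qed
 interpret subseqs P
 proof
  fix j and sg :: "nat => nat" assume sm: "strict_mono sg"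
  have il: "filterlim (%n. i (sg n)) at_top sequentially" using filterlim_compose[OF i filterlim_subseq[OF sm]] .
  \<comment> \<open>Where the domain does not yet contain the cube, zero is substituted, so that the
    bounds hold for all n.\<close>
  define f where "f n k = (if j <= i (sg n) then (%x. ind (cube (2^j)) x * u (sg n) k x) else (%x. 0))" for n k
  have fr: "rep (2^j) (f n k)" for n k unfolding f_def using rep_restrict[OF r, of "2^j" "sg n" k] by auto
  have fA: "sq (HC (2^j)) (f n k) <= max 0 (A j)" for n k
  proof (cases "j <= i (sg n)")
   case True
   have "sq (HC (2^j)) (f n k) = sq (HC (2^j)) (u (sg n) k)" by (rule sq_cong) (use True in \<open>auto simp: f_def HC_def\<close>)
   also have "... <= sq (cube (2^j)) (u (sg n) k)" by (intro sq_mono rep_l2[OF r]) (auto simp: HC_def)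
   also have "... <= mas (2^j) (u (sg n))" by (rule sq_le_mas)
   also have "... <= A j" by (rule A[OF True])
   finally show ?thesis by simp
  qed (simp add: f_def)
  obtain \<tau> :: "nat => nat" where \<tau>: "strict_mono \<tau>" "\<forall>x\<in>hcs (2^j) (1/2^j). \<forall>k. convergent (%n. f (\<tau> n) k x)"
   using rep_subsequence[of "2^j" f "max 0 (A j)" "1/2^j", OF fr fA] by auto
  have "convergent (%n. u ((sg \<circ> \<tau>) n) k x)" if x: "x \<in> hcs (2^j) (1/2^j)" for x k
  proof -
   have xc: "x \<in> cube (2^j)" using hcs_sub_HC[of "1/2^j" "2^j"] x by (auto simp: HC_def)
   obtain l where l: "(%n. f (\<tau> n) k x) ~~> l" using \<tau>(2) x by (auto simp: convergent_def)
   have "EV n. j <= i (sg (\<tau> n))"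
    using filterlim_compose[OF il filterlim_subseq[OF \<tau>(1)]] by (simp add: filterlim_at_top)
   then have "EV n. f (\<tau> n) k x = u ((sg \<circ> \<tau>) n) k x" by eventually_elim (simp add: f_def xc)
   then have "(%n. u ((sg \<circ> \<tau>) n) k x) ~~> l" using l by (rule Lim_transform_eventually[rotated])
   then show ?thesis by (auto simp: convergent_def)
  qed
  then show "\<exists>r'. strict_mono r' & P j (sg \<circ> r')" using \<tau>(1) unfolding P_def by blast
 qed
 have "convergent (%n. u (diagseq n) k x)" if x: "0 < x$3" for x k
 proof -
  define m where "m = Max {abs(x$1), abs(x$2), x$3, 1/x$3}"
  have m: "abs(x$1) <= m" "abs(x$2) <= m" "x$3 <= m" "1/x$3 <= m" by (auto simp: m_def)
  obtain j :: nat where j: "m + 2 < 2^j" using real_arch_pow[of 2 "m + 2"] by auto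
  have j1: "1/2^j <= (1::real)" by simp
  have "1/x$3 < 2^j" using m(4) j by linarith
  then have "1/2^j < x$3" using x by (simp add: field_simps)
  moreover have "m < 2^j - 1/2^j" using j j1 by linarith
  ultimately have xh: "x \<in> hcs (2^j) (1/2^j)" unfolding hcs_def using m(1-3) by simp
  have "P j (diagseq \<circ> ((+) (Suc j)))" by (rule diagseq_holds) (rule st)
  then have "convergent (%n. u (diagseq (Suc j + n)) k x)" using xh by (simp add: P_def o_def)
  then show ?thesis using convergent_ignore_initial_segment[of "%n. u (diagseq n) k x" "Suc j"] by (simp add: add.commute)
 qed
 then show ?thesis using subseq_diagseq by blast
qed

lemma l2_weak_limit:
 assumes u: "!!n. l2 (u n)" and z: "l2 z" and f: "l2 f" "!!x. f x ~= 0 ==> x \<in> S" and S: "S \<in> sets borel"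
  and lim: "(%n. sq S (%x. u n x - z x)) ~~> 0"
 shows "(%n. LL x. u n x * f x) ~~> (LL x. z x * f x)"
proof -
 have "((LL x. u n x * f x) - (LL x. z x * f x))^2 <= sq S (%x. u n x - z x) * (LL x. (f x)^2)" for n
 proof -
  have i: "l2 (%x. ind S x * (u n x - z x))" by (intro l2_indicator l2_diff u z S)
  have "(LL x. u n x * f x) - (LL x. z x * f x) = (LL x. u n x * f x - z x * f x)"
   by (rule Bochner_Integration.integral_diff[symmetric]) (intro l2_prod u z f)+
  also have "... = (LL x. (ind S x * (u n x - z x)) * f x)"
  proof (rule icong)
   fix x show "u n x * f x - z x * f x = ind S x * (u n x - z x) * f x" using f(2)[of x] by (cases "f x = 0") (auto simp: algebra_simps)
  qed
  also have "(...)^2 <= (LL x. (ind S x * (u n x - z x))^2) * (LL x. (f x)^2)" by (rule CS[OF i f(1)])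
  also have "(LL x. (ind S x * (u n x - z x))^2) = sq S (%x. u n x - z x)"
   unfolding sq_def by (rule icong) (auto simp: indicator_def)
  finally show ?thesis .
 qed
 then have "EV n. norm (((LL x. u n x * f x) - (LL x. z x * f x))^2) <= sq S (%x. u n x - z x) * (LL x. (f x)^2)" by simp
 from Lim_null_comparison[OF this] have "(%n. ((LL x. u n x * f x) - (LL x. z x * f x))^2) ~~> 0"
  using tendsto_mult_left_zero[OF lim] by blast
 from tendsto_real_sqrt[OF this] have "(%n. (LL x. u n x * f x) - (LL x. z x * f x)) ~~> 0"
  by (simp add: tendsto_rabs_zero_iff)
 then show ?thesis by (rule LIM_zero_cancel)
qed

lemma rep_DERIV:
 assumes f: "rep R f" and x: "x \<in> HC R"
 shows "((%t. foldr pd al f (x + t *R ax j)) has_real_derivative pd j (foldr pd al f) x) (at 0)"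
proof -
 obtain s where s: "s > 0" "x \<in> hcs R s" using HC_hcs[OF x] by blast
 have c: "csm (foldr pd al (ks s KK))" by (induction al) (auto intro: csm_pd csm_ks KK_csm s)
 define w where "w = conv f (foldr pd al (ks s KK))"
 have fw: "foldr pd al f y = w y" if "y \<in> hcs R s" for y unfolding w_def by (rule rep_pd[OF f s(1) that])
 have "((%t. w (x + t *R ax j)) has_real_derivative pd j w x) (at 0)"
  using smooth3_imp(2)[OF conv_smooth[OF rep_l2[OF f] c], of j] unfolding w_def[symmetric] hasp_def by blast
 moreover have "pd j w x = pd j (foldr pd al f) x" by (rule pd_eq_open[OF hcs_open s(2)]) (simp add: fw)
 moreover have ev: "\<forall>\<^sub>F t in nhds 0. foldr pd al f (x + t *R ax j) = w (x + t *R ax j)"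
  unfolding eventually_nhds
 proof (intro exI[of _ "(%t. x + t *R ax j) -` hcs R s"] conjI ballI)
  show "open ((%t. x + t *R ax j) -` hcs R s)" by (intro open_vimage hcs_open continuous_intros)
 qed (use s(2) fw in auto)
 ultimately show ?thesis using iffD2[OF DERIV_cong_ev[OF refl ev refl]] by simp
qed

lemma hcs_R_mono: "R <= R' ==> hcs R s \<subseteq> hcs R' s" by (auto simp: hcs_def)

lemma flat_domain: "cube R \<inter> above (%_. 0) = HC R" by (auto simp: above_def HC_def)

lemma l2_I:
 assumes "(f :: real^3 => real) \<in> BM" "integrable lborel (%x. ind S x * (z x)^2)"
  "!!x. f x = ind S x * z x"
 shows "l2 f"
proof -
 have "(f x)^2 = ind S x * (z x)^2" for x unfolding assms(3) by (simp add: indicator_def)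
 then show ?thesis using assms(1,2) by (simp add: l2_def)
qed

section \<open>Passage to the limit over flattening graphs\<close>

context
 fixes M :: real and i :: "nat => nat" and g :: "nat => real^2 => real" and u :: "nat => 3 => real^3 => real"
  and G F :: "nat => 3 => 3 => real^3 => real" and eps A :: "nat => real" and z :: "3 => real^3 => real"
 assumes M: "0 <= M" and s: "!!n. sol (2^i n) (g n) (u n) (G n) (F n)" and lip: "!!n. lipg M (g n)"
  and gl: "!!n y. - eps n <= g n y" and gu: "!!n y. g n y <= 0" and e0: "eps ~~> 0"
  and F0: "!!n k j x. x \<in> HC (2^i n) ==> F n k j x = 0" and i: "filterlim i at_top sequentially"
  and A: "!!n j. j <= i n ==> mas (2^j) (u n) <= A j"
  and FA: "!!j. (%n. enr (2^j) (F n)) ~~> 0"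
  and r: "!!n k. rep (2^i n) (u n k)"
  and lim: "!!x k. 0 < x$3 ==> (%n. u n k x) ~~> z k x" and z0: "!!x k. x$3 <= 0 ==> z k x = 0"
begin

private lemma ul: "l2 (u n k)" and Gl: "l2 (G n k j)" using solD(1,2)[OF s] .
private lemma epos: "0 <= eps n" using gl[of n 0] gu[of n 0] by linarith
private lemma ige: "EV n. j <= i n" using i by (simp add: filterlim_at_top)
private lemma esmall: "0 < d ==> EV n. eps n < d" using order_tendstoD(2)[OF e0] .

private lemma pos10: "0 < (1/10::real)" by simp

text \<open>Caccioppoli from the cube eight times as large. Its side is at least 8, so
  \<open>eps n < 1/10\<close> suffices for the lower bound on the graph, and the flux is eventually
  below 1.\<close>

private lemma energy_bound: "\<exists>B\<ge>0. EV n. enr (2^j) (G n) <= B"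
proof -
 obtain C where C: "C > 0" "!!R g u G F. 0 < R & sol R g u G F & lipg M g & (\<forall>y. - R/10 <= g y) ==> enr (R/8) G <= C * (mas R u/R^2 + enr R F)"
  using caccioppoli_scaled[OF M] by blast
 define R :: real where "R = 2^(j + 3)"
 have R: "R/8 = 2^j" "8 <= R" unfolding R_def by (simp_all add: power_add)
 define B where "B = C * (abs(A (j + 3)) + 1)"
 have "EV n. enr R (F n) < 1" unfolding R_def by (rule order_tendstoD(2)[OF FA]) simp
 then have "EV n. enr (2^j) (G n) <= B"
  using ige[of "j + 3"] esmall[OF pos10]
 proof eventually_elim
  case (elim n)
  have "sol R (g n) (u n) (G n) (F n)" by (rule sol_mono[OF s]) (use elim in \<open>simp add: R_def\<close>)
  moreover have "- R/10 <= g n y" for y using gl[of n y] elim R by linarith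
  ultimately have "enr (R/8) (G n) <= C * (mas R (u n)/R^2 + enr R (F n))" using lip R by (intro C(2)) auto
  also have "... <= B" unfolding B_def
  proof (intro mult_left_mono add_mono)
   have "1 <= R^2" using R(2) by (intro one_le_power) simp
   then have "mas R (u n)/R^2 <= mas R (u n)/1" by (intro divide_left_mono) auto
   then show "mas R (u n)/R^2 <= abs(A (j + 3))" using A[of "j+3" n] elim unfolding R_def by linarith
  qed (use elim C in auto)
  finally show ?case unfolding R(1) .
 qed
 then show ?thesis using C(1) by (intro exI[of _ B]) (auto simp: B_def)
qed

private lemma z_meas[measurable]: "z k \<in> BM"
proof (rule borel_measurable_LIMSEQ_real[of _ "%n x. ind {x. 0 < x$3} x * u n k x"])
 show "(%n. ind {x. 0 < x$3} x * u n k x) ~~> z k x" for x :: "real^3"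
  using lim[of x k] z0[of x k] by (cases "0 < x$3") auto
 show "(%x. ind {x. 0 < x$3} x * u n k x) \<in> BM" for n
  using l2_meas[OF l2_indicator[OF ul half_meas(1)]] by simp
qed

private lemma hz_ind: "hz j z k x = ind (HC (2^j)) x * z k x"
 using z0[of x k] by (cases "0 < x$3") (auto simp: hz_def HC_def indicator_def)

private lemma hz_cong: "S \<subseteq> cube (2^j) ==> sq S (hz j z k) = sq (S \<inter> {x. 0 < x$3}) (z k)"
 unfolding sq_def
proof (rule icong)
 fix x assume "S \<subseteq> cube (2^j)"
 then show "ind S x * (hz j z k x)^2 = ind (S \<inter> {x. 0 < x$3}) x * (z k x)^2"
  using z0[of x k] by (cases "0 < x$3") (auto simp: hz_def indicator_def)
qed

private lemma z_l2: "l2 (hz j z k)"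
proof -
 have "integrable lborel (%x. ind (HC (2^j)) x * (z k x)^2)"
 proof (rule fatou_sq(1)[OF ul z_meas HC_borel])
  show "(%n. u n k x) ~~> z k x" if "x \<in> HC (2^j)" for x using that lim by (simp add: HC_def)
  show "EV n. sq (HC (2^j)) (u n k) <= A j" using ige[of j]
  proof eventually_elim
   case (elim n)
   have "sq (HC (2^j)) (u n k) <= sq (cube (2^j)) (u n k)" by (rule sq_mono[OF ul]) (auto simp: HC_def)
   also have "... <= mas (2^j) (u n)" by (rule sq_le_mas)
   finally show ?case using A[OF elim] by linarith
  qed
 qed
 moreover have "hz j z k \<in> BM" unfolding hz_def[abs_def] by measurable
 ultimately show ?thesis by (intro l2_I[of "hz j z k" "HC (2^j)" "z k"] hz_ind)
qed

text \<open>No mass concentrates at the boundary: the Poincare inequality and the energy bound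
  control thin strips uniformly in n, and Fatou passes the quadratic rate to the limit.\<close>

private lemma strips:
 "\<exists>B\<ge>0. (\<forall>s. 0 < s & s < 1/2 --> (EV n. sq (cube (2^j) \<inter> {x. x$3 < s}) (u n k) <= (s + eps n)^2 * B))
  & (\<forall>s. 0 < s & s < 1/2 --> sq (cube (2^j) \<inter> {x. x$3 < s}) (hz j z k) <= s^2 * B)"
proof -
 obtain B where B: "B >= 0" "EV n. enr (2^Suc j) (G n) <= B" using energy_bound by blast
 have pw: "(1::real) <= 2^j" by simp
 have a: "EV n. sq (cube (2^j) \<inter> {x. x$3 < t}) (u n k) <= (t + eps n)^2 * B" if t: "0 < t" "t < 1/2" for t
  using B(2) ige[of "Suc (Suc j)"] esmall[OF pos10]
 proof eventually_elim
  case (elim n)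
  have "(2::real)^Suc (Suc j) <= 2^i n" by (rule power_increasing[OF elim(2)]) simp
  then have "4 * (2::real)^j <= 2^i n" by simp
  then have "2 * (2::real)^j < 2^i n" using pw by linarith
  then have R: "(2::real)^Suc j < 2^i n" by simp
  have hb: "{x::real^3. x$3 < t + 1} \<in> sets borel" by (intro borel_open open_Collect_less continuous_intros)
  have "sq (cube (2^j) \<inter> {x. x$3 < t}) (u n k) <= (t + eps n)^2 * sq (cube (2^Suc j) \<inter> {x. x$3 < t + 1}) (G n k 3)"
  proof (rule poincare[OF s gl epos _ _ _ R])
   show "t + 2 * eps n < 2^j" using t pw elim by linarith
  qed (use t in auto)
  also have "... <= (t + eps n)^2 * B"
  proof (rule mult_left_mono)
   have "sq (cube (2^Suc j) \<inter> {x. x$3 < t + 1}) (G n k 3) <= sq (cube (2^Suc j)) (G n k 3)"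
    by (rule sq_mono[OF Gl]) (use hb in \<open>auto intro: sets.Int\<close>)
   also have "... <= enr (2^Suc j) (G n)" by (rule sq_le_enr)
   finally show "sq (cube (2^Suc j) \<inter> {x. x$3 < t + 1}) (G n k 3) <= B" using elim by linarith
  qed simp
  finally show ?case .
 qed
 have "sq (cube (2^j) \<inter> {x. x$3 < t}) (hz j z k) <= t^2 * B + e" if t: "0 < t" "t < 1/2" and e: "e > 0" for t e
 proof -
  have "(%n. (t + eps n)^2 * B) ~~> (t + 0)^2 * B" by (intro tendsto_intros e0)
  from order_tendstoD(2)[OF this, of "t^2 * B + e"] e have ev: "EV n. (t + eps n)^2 * B < t^2 * B + e" by simp
  have Sb1: "cube (2^j) \<inter> {x. x$3 < t} \<in> sets borel" by (intro sets.Int cube_borel borel_open open_Collect_less continuous_intros)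
  then have Sb: "cube (2^j) \<inter> {x. x$3 < t} \<inter> {x. 0 < x$3} \<in> sets borel" by (rule sets.Int[OF _ half_meas(1)])
  have "sq (cube (2^j) \<inter> {x. x$3 < t} \<inter> {x. 0 < x$3}) (z k) <= t^2 * B + e"
  proof (rule fatou_sq(2)[OF ul z_meas Sb])
   show "EV n. sq (cube (2^j) \<inter> {x. x$3 < t} \<inter> {x. 0 < x$3}) (u n k) <= t^2 * B + e"
    using a[OF t] ev
   proof eventually_elim
    case (elim n)
    have "sq (cube (2^j) \<inter> {x. x$3 < t} \<inter> {x. 0 < x$3}) (u n k) <= sq (cube (2^j) \<inter> {x. x$3 < t}) (u n k)"
     by (rule sq_mono[OF ul Sb Sb1]) auto
    then show ?case using elim by linarith
   qed
  qed (use lim in auto)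
  then show ?thesis by (subst hz_cong) auto
 qed
 then have "sq (cube (2^j) \<inter> {x. x$3 < t}) (hz j z k) <= t^2 * B" if "0 < t" "t < 1/2" for t
  using field_le_epsilon that by blast
 then show ?thesis using a B(1) by blast
qed

text \<open>Below height t both functions are small by \<open>strips\<close>; above it
  \<open>rep_bound\<close> gives a uniform pointwise bound, so pointwise convergence improves to L^2
  convergence by dominated convergence.\<close>

lemma limit_strong: "(%n. sq (cube (2^j)) (%x. u n k x - hz j z k x)) ~~> 0"
proof (rule LIMSEQ_I)
 fix e :: real assume e: "e > 0"
 obtain B where B: "B >= 0" "!!t. 0 < t & t < 1/2 ==> EV n. sq (cube (2^j) \<inter> {x. x$3 < t}) (u n k) <= (t + eps n)^2 * B"
  "!!t. 0 < t & t < 1/2 ==> sq (cube (2^j) \<inter> {x. x$3 < t}) (hz j z k) <= t^2 * B" using strips[of j k] by auto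
 define t where "t = min (1/4) (sqrt (e/(20 * (B + 1))))"
 have t: "0 < t" "t < 1/2" unfolding t_def using e B(1) by auto
 have tB: "10 * t^2 * B < e"
 proof -
  have "t <= sqrt (e/(20 * (B + 1)))" by (simp add: t_def)
  then have "t^2 <= (sqrt (e/(20 * (B + 1))))^2" using t by (intro power_mono) auto
  also have "... = e/(20 * (B + 1))" using e B(1) by simp
  finally have "t^2 * (20 * (B + 1)) <= e" using B(1) by (simp add: pos_le_divide_eq)
  moreover have "0 < t^2" using t by simp
  moreover have "t^2 * (20 * (B + 1)) = 20 * (t^2 * B) + 20 * t^2" "10 * t^2 * B = 10 * (t^2 * B)" by (simp_all add: algebra_simps)
  moreover have "0 <= t^2 * B" using B(1) by simp
  ultimately show ?thesis by linarith
 qed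
 define S where "S = cube (2^j) \<inter> {x::real^3. x$3 < t}"
 define T where "T = cube (2^j) \<inter> {x::real^3. t <= x$3}"
 have Sb: "S \<in> sets borel" unfolding S_def by (intro sets.Int cube_borel borel_open open_Collect_less continuous_intros)
 have Tb: "T \<in> sets borel" unfolding T_def by (intro sets.Int cube_borel borel_closed closed_Collect_le continuous_intros)
 have dl: "l2 (%x. u n k x - hz j z k x)" for n by (intro l2_diff ul z_l2)
 have split: "sq (cube (2^j)) (%x. u n k x - hz j z k x) = sq S (%x. u n k x - hz j z k x) + sq T (%x. u n k x - hz j z k x)" for n
 proof -
  have "sq (cube (2^j)) (%x. u n k x - hz j z k x) = (LL x. ind S x * (u n k x - hz j z k x)^2 + ind T x * (u n k x - hz j z k x)^2)"
   unfolding sq_def by (rule icong) (auto simp: indicator_def S_def T_def)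
  then show ?thesis unfolding sq_def using sq_integrable[OF dl Sb] sq_integrable[OF dl Tb] by simp
 qed
 define K where "K = (LL p. (KK p)^2)/(t/2)^3"
 have K0: "0 <= K" unfolding K_def using t by (intro divide_nonneg_nonneg integral_nonneg) auto
 have inT: "x \<in> hcs (2^Suc j) (t/2)" "0 < x$3" "x \<in> cube (2^j)" if "x \<in> T" for x
 proof -
  have x: "abs(x$1) < 2^j" "abs(x$2) < 2^j" "abs(x$3) < 2^j" "t <= x$3" using that cubeD[of x "2^j"] by (auto simp: T_def)
  have "(1::real) <= 2^j" by simp
  then show "x \<in> hcs (2^Suc j) (t/2)" "0 < x$3" using x t unfolding hcs_def by auto
  show "x \<in> cube (2^j)" using that by (simp add: T_def)
 qed
 have ub: "EV n. \<forall>x\<in>T. (u n k x)^2 <= K * A (Suc j)" using ige[of "Suc j"]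
 proof eventually_elim
  case (elim n)
  show ?case
  proof
   fix x assume x: "x \<in> T"
   define f where "f x = ind (cube (2^Suc j)) x * u n k x" for x
   have fr: "rep (2^Suc j) f" unfolding f_def[abs_def] by (intro rep_restrict[OF r] power_increasing elim) simp
   have "x \<in> cube (2^Suc j)" using inT(3)[OF x] cube_mono[of "2^j" "2^Suc j"] by auto
   then have "(u n k x)^2 = (f x)^2" by (simp add: f_def)
   also have "... <= K * sq (HC (2^Suc j)) f" unfolding K_def by (rule rep_bound[OF fr _ inT(1)[OF x]]) (use t in simp)
   also have "... <= K * A (Suc j)"
   proof (rule mult_left_mono[OF _ K0])
    have "sq (HC (2^Suc j)) f = sq (HC (2^Suc j)) (u n k)" by (rule sq_cong) (auto simp: f_def HC_def)
    also have "... <= sq (cube (2^Suc j)) (u n k)" by (rule sq_mono[OF ul]) (auto simp: HC_def)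
    also have "... <= mas (2^Suc j) (u n)" by (rule sq_le_mas)
    finally show "sq (HC (2^Suc j)) f <= A (Suc j)" using A[OF elim] by linarith
   qed
   finally show "(u n k x)^2 <= K * A (Suc j)" .
  qed
 qed
 then obtain n0 where n0: "!!n x. n0 <= n ==> x \<in> T ==> (u n k x)^2 <= K * A (Suc j)" by (auto simp: eventually_sequentially)
 have zb: "(z k x)^2 <= K * A (Suc j)" if "x \<in> T" for x
  by (rule LIMSEQ_le_const2[OF tendsto_power[OF lim[OF inT(2)[OF that], of k]]]) (use n0 that in blast)
 have "(%n. sq T (%x. u (n + n0) k x - hz j z k x)) ~~> (LL x::real^3. 0)"
  unfolding sq_def
 proof (rule integral_dominated_convergence[where w = "%x. (4 * (K * A (Suc j))) * ind T x"])
  note [measurable] = l2_meas[OF ul] l2_meas[OF z_l2] Tb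
  show "(%x. ind T x * (u (n + n0) k x - hz j z k x)^2) \<in> borel_measurable lborel" for n by measurable
  have "l2 (ind T)" by (rule l2_indicator_bounded[OF Tb bounded_subset[OF cube_bounded]]) (auto simp: T_def)
  moreover have "(ind T x :: real)^2 = ind T x" for x by (simp add: indicator_def)
  ultimately show "integrable lborel (%x. (4 * (K * A (Suc j))) * ind T x)" by (intro integrable_mult_right) (simp add: l2_def)
  show "AE3 x. (%n. ind T x * (u (n + n0) k x - hz j z k x)^2) ~~> 0"
  proof (rule AE_I2)
   fix x show "(%n. ind T x * (u (n + n0) k x - hz j z k x)^2) ~~> 0"
   proof (cases "x \<in> T")
    case True
    have "(%n. (u (n + n0) k x - hz j z k x)^2) ~~> (z k x - hz j z k x)^2"
     by (intro tendsto_intros LIMSEQ_ignore_initial_segment lim inT True)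
    then show ?thesis using True inT(3)[OF True] by (simp add: hz_def)
   qed simp
  qed
  show "AE3 x. norm (ind T x * (u (n + n0) k x - hz j z k x)^2) <= (4 * (K * A (Suc j))) * ind T x" for n
  proof (rule AE_I2)
   fix x
   have "(u (n + n0) k x - z k x)^2 <= 2 * (u (n + n0) k x)^2 + 2 * (z k x)^2"
    using sum_squares_bound[of "u (n + n0) k x" "- z k x"] by (simp add: power2_diff)
   then show "norm (ind T x * (u (n + n0) k x - hz j z k x)^2) <= (4 * (K * A (Suc j))) * ind T x"
    using n0[of "n + n0" x] zb[of x] inT(3)[of x] by (cases "x \<in> T") (auto simp: hz_def)
  qed
 qed auto
 then have "(%n. sq T (%x. u (n + n0) k x - hz j z k x)) ~~> 0" by simp
 then have "(%n. sq T (%x. u n k x - hz j z k x)) ~~> 0" by (rule LIMSEQ_offset)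
 from order_tendstoD(2)[OF this, of "e - 10 * t^2 * B"] tB
 have "EV n. sq T (%x. u n k x - hz j z k x) < e - 10 * t^2 * B" by simp
 then have "EV n. sq (cube (2^j)) (%x. u n k x - hz j z k x) < e"
  using B(2)[OF conjI[OF t]] esmall[OF t(1)]
 proof eventually_elim
  case (elim n)
  have "sq S (%x. u n k x - hz j z k x) <= 2 * sq S (u n k) + 2 * sq S (hz j z k)" by (rule sq_diff_le[OF ul z_l2 Sb])
  moreover have "sq S (hz j z k) <= t^2 * B" unfolding S_def by (rule B(3)[OF conjI[OF t]])
  moreover have "sq S (u n k) <= (2 * t)^2 * B"
  proof -
   have "(t + eps n)^2 * B <= (2 * t)^2 * B" using elim epos[of n] t B(1) by (intro mult_right_mono power_mono) auto
   then show ?thesis using elim unfolding S_def by linarith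
  qed
  ultimately have "sq S (%x. u n k x - hz j z k x) <= 10 * t^2 * B" by (simp add: power_mult_distrib)
  then show ?case using elim unfolding split by linarith
 qed
 then show "\<exists>no. \<forall>n\<ge>no. norm (sq (cube (2^j)) (%x. u n k x - hz j z k x) - 0) < e"
  by (auto simp: eventually_sequentially)
qed

private lemma conv_lim:
 assumes c: "csm w" and w: "!!y. w (x - y) ~= 0 ==> y \<in> HC (2^j)"
 shows "(%n. conv (u n k) w x) ~~> conv (hz j z k) w x"
proof -
 have "y \<in> cube (2^j)" if "w (x - y) ~= 0" for y using w[OF that] by (simp add: HC_def)
 then have "(%n. LL y. u n k y * w (x - y)) ~~> (LL y. hz j z k y * w (x - y))"
  by (intro l2_weak_limit[OF ul z_l2 _ _ cube_borel limit_strong] csm_l2 csm_refl c)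
 then show ?thesis by (simp add: conv_def mult.commute)
qed

private lemma z_rep: "rep (2^j) (hz j z k)"
 unfolding rep_def
proof (intro conjI allI impI ballI z_l2)
 fix t x assume t: "0 < (t::real)" and x: "x \<in> hcs (2^j) t"
 have xc: "x \<in> HC (2^j)" using hcs_sub_HC[of t "2^j"] t x by auto
 note 1 = conv_lim[OF csm_ks[OF KK_csm t] test_fun_support[OF KK_test[OF t x]]]
 have "EV n. conv (u n k) (ks t KK) x = u n k x" using ige[of j]
 proof eventually_elim
  case (elim n)
  have "(2::real)^j <= 2^i n" using elim by (simp add: power_increasing)
  then have "x \<in> hcs (2^i n) t" using x hcs_R_mono by blast
  from repD[OF r t this] show ?case by simp
 qed
 from Lim_transform_eventually[OF 1 this] have "(%n. u n k x) ~~> conv (hz j z k) (ks t KK) x" .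
 moreover have "(%n. u n k x) ~~> z k x" by (rule lim) (use xc in \<open>simp add: HC_def\<close>)
 ultimately have "conv (hz j z k) (ks t KK) x = z k x" by (rule LIMSEQ_unique)
 then show "hz j z k x = conv (hz j z k) (ks t KK) x" using xc by (simp add: hz_def HC_def)
qed

private definition zD :: "nat => 3 => 3 => real^3 => real" where
 "zD j k l x = ind (HC (2^j)) x * pd l (hz j z k) x"

private lemma zD_meas: "zD j k l \<in> BM"
 using rep_measurable_pd[OF z_rep, of j "[l]" k] unfolding zD_def[abs_def] by simp

text \<open>At a fixed distance from the boundary the gradient of the limit is the pointwise limit
  of mollified gradients, whose norms Young's inequality bounds independently of that distance. A
  second use of Fatou lets the distance tend to zero.\<close>

private lemma zD_l2: "l2 (zD j k l)"
proof -
 obtain B where B: "EV n. enr (2^j) (G n) <= B" using energy_bound by blast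
 define N where "N m = 1/real (Suc m)" for m
 have N: "N m > 0" for m by (simp add: N_def)
 define S where "S m = hcs (2^j) (N m)" for m
 have Sb: "S m \<in> sets borel" for m by (simp add: S_def)
 define C where "C = (LL p. abs(KK p)) + 1"
 have C: "C > 0" "(LL p. abs(KK p)) <= C" unfolding C_def by (auto intro: add_nonneg_pos integral_nonneg_AE)
 have q: "integrable lborel (%x. ind (S m) x * (zD j k l x)^2)" "sq (S m) (zD j k l) <= C^2 * B" for m
 proof -
  let ?K = "ks (N m) KK"
  have c: "csm ?K" by (rule csm_ks[OF KK_csm N])
  have bd: "EV n. sq (S m) (conv (G n k l) ?K) <= C^2 * B" using B
  proof eventually_elim
   case (elim n)
   have "sq (S m) (conv (G n k l) ?K) <= C^2 * sq (cube (2^j)) (G n k l)"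
   proof (rule conv_bound(2)[OF Gl c _ C(1) Sb cube_borel])
    fix x y assume "x \<in> S m" "?K (x - y) ~= 0"
    then show "y \<in> cube (2^j)" using test_fun_support[OF KK_test[OF N]] by (auto simp: S_def HC_def)
   qed (use C N in \<open>simp add: abs_int_ks\<close>)
   also have "... <= C^2 * B" by (rule mult_left_mono[OF order_trans[OF sq_le_enr elim]]) simp
   finally show ?case .
  qed
  have "(%n. conv (G n k l) ?K x) ~~> zD j k l x" if x: "x \<in> S m" for x
  proof -
   note x = x[unfolded S_def]
   have t: "test_fun (HC (2^j)) (%y. ?K (x - y))" by (rule KK_test[OF N x])
   have L: "(%n. conv (u n k) (pd l ?K) x) ~~> conv (hz j z k) (pd l ?K) x"
    by (rule conv_lim[OF csm_pd[OF c]]) (use test_fun_support[OF test_fun_pd[OF t, of l]] in \<open>simp add: pd_refl[OF csm_smooth[OF c]]\<close>)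
   have "EV n. conv (u n k) (pd l ?K) x = conv (G n k l) ?K x" using ige[of j]
   proof eventually_elim
    case (elim n)
    have "HC (2^j) \<subseteq> cube (2^i n)" using cube_mono[of "2^j" "2^i n"] elim by (auto simp: HC_def power_increasing)
    then show ?case by (intro conv_weak[OF s c] test_fun_mono[OF t])
   qed
   moreover have "x \<in> HC (2^j)" using hcs_sub_HC[of "N m"] x N[of m] by (meson less_imp_le subsetD)
   ultimately show ?thesis
    using Lim_transform_eventually[OF L] rep_pd[OF z_rep N x, of "[l]"] by (simp add: zD_def)
  qed
  note f = fatou_sq[OF csm_conv_l2[OF Gl c] zD_meas Sb this bd]
  show "integrable lborel (%x. ind (S m) x * (zD j k l x)^2)" "sq (S m) (zD j k l) <= C^2 * B" using f by auto
 qed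
 define f where "f m x = ind (S m) x * zD j k l x" for m x
 have fl: "l2 (f m)" for m
  by (rule l2_I[OF _ q(1)]) (auto simp: f_def[abs_def] intro!: borel_measurable_times borel_measurable_indicator Sb zD_meas)
 have "integrable lborel (%x. ind (HC (2^j)) x * (zD j k l x)^2)"
 proof (rule fatou_sq(1)[OF fl zD_meas HC_borel, where c = "C^2 * B"])
  fix x assume "x \<in> HC (2^j)"
  then obtain t where t: "t > 0" "x \<in> hcs (2^j) t" using HC_hcs by blast
  have "N ~~> 0" unfolding N_def using LIMSEQ_inverse_real_of_nat by (simp add: inverse_eq_divide)
  then have "EV m. N m < t" using t by (intro order_tendstoD(2))
  then have "EV m. f m x = zD j k l x"
   by eventually_elim (use t(2) subsetD[OF hcs_mono[OF less_imp_le]] in \<open>simp add: f_def S_def\<close>)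
  then show "(%m. f m x) ~~> zD j k l x" by (rule tendsto_eventually)
 next
  have "sq (HC (2^j)) (f m) <= C^2 * B" for m
  proof -
   have "sq (HC (2^j)) (f m) <= sq UNIV (f m)" by (intro sq_mono fl) auto
   also have "... = sq (S m) (zD j k l)" unfolding sq_def f_def by (rule icong) (auto simp: indicator_def)
   finally show ?thesis using q(2)[of m] by linarith
  qed
  then show "EV m. sq (HC (2^j)) (f m) <= C^2 * B" by simp
 qed
 then show ?thesis by (rule l2_I[OF zD_meas]) (simp add: zD_def indicator_def)
qed

private lemma z_weak:
 assumes "test_fun (cube (2^j)) ps"
 shows "(LL x. hz j z k x * pd l ps x) = - (LL x. zD j k l x * ps x)"
proof -
 obtain B where B: "!!t. 0 < t & t < 1/2 ==> sq (cube (2^j) \<inter> {x. x$3 < t}) (hz j z k) <= t^2 * B" using strips[of j k] by auto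
 have "(LL x. hz j z k x * pd l ph x) = - (LL x. zD j k l x * ph x)" if t: "test_fun (HC (2^j)) ph" for ph
 proof -
  have e: "pd l (hz j z k) x * ph x = zD j k l x * ph x" for x using test_fun_support[OF t, of x] by (cases "ph x = 0") (auto simp: zD_def)
  have "(LL x. hz j z k x * pd l ph x) = - (LL x. pd l (hz j z k) x * ph x)" by (rule rep_IBP[OF _ z_rep t]) simp
  then show ?thesis unfolding e .
 qed
 then show ?thesis
  by (intro flat_weak[OF _ rep_l2[OF z_rep] _ zD_l2 _ _ _ _ assms, where ?s0.0 = "1/2" and E = B]) (use B in \<open>auto simp: hz_ind zD_def HC_def\<close>)
qed

text \<open>Before the limit both derivatives are put on the test field, so that only the strong
  convergence of u enters; afterwards one of them is put back with \<open>z_weak\<close>.\<close>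

lemma limit_gsol: "gsol z"
proof -
 have "sol (2^j) (%_. 0) (hz j z) (zD j) (%_ _ _. 0)" for j
  unfolding sol_def
 proof (intro conjI allI impI)
  show "l2 (hz j z k)" "l2 (zD j k l)" "l2 (%_. 0)" for k l by (rule z_l2 zD_l2 l2_0)+
  show "(LL x. hz j z k x * pd l ps x) = - (LL x. zD j k l x * ps x)" if "test_fun (cube (2^j)) ps" for k l ps
   by (rule z_weak[OF that])
  show "hz j z k x = 0" if "x \<in> cube (2^j) & x \<notin> above (%_. 0)" for k x
   using that z0[of x k] by (auto simp: hz_def above_def)
 next
  fix ps assume t: "test_fun (cube (2^j)) ps"
  have "(%n. S3 k. LL x. u n k x * pd k ps x) ~~> (S3 k. LL x. hz j z k x * pd k ps x)"
   by (intro tendsto_sum l2_weak_limit[OF ul z_l2 _ _ cube_borel limit_strong] csm_l2 csm_pd test_fun_csm[OF t] test_fun_support[OF test_fun_pd[OF t]])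
  moreover have "EV n. (S3 k. LL x. u n k x * pd k ps x) = 0" using ige[of j]
  proof eventually_elim
   case (elim n)
   show ?case by (rule solD(5)[OF s test_fun_mono[OF t cube_mono]]) (use elim in \<open>simp add: power_increasing\<close>)
  qed
  ultimately show "(S3 k. LL x. hz j z k x * pd k ps x) = 0"
   using LIMSEQ_unique[OF Lim_transform_eventually tendsto_const] by blast
 next
  fix ph :: "3 => real^3 => real"
  assume ph: "(\<forall>k. test_fun (cube (2^j) \<inter> above (%_. 0)) (ph k)) & (\<forall>x. (S3 k. pd k (ph k) x) = 0)"
  have t: "test_fun (cube (2^j)) (ph k)" "test_fun (HC (2^j)) (ph k)" for k
   using ph[unfolded flat_domain] test_fun_mono[of "HC (2^j)" "ph k" "cube (2^j)"] by (auto simp: HC_def)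
  have tp: "test_fun (cube (2^j)) (pd l (ph k))" for k l by (rule test_fun_pd[OF t(1)])
  have L: "(%n. S3 k. S3 l. LL x. u n k x * pd l (pd l (ph k)) x) ~~> (S3 k. S3 l. LL x. hz j z k x * pd l (pd l (ph k)) x)"
   by (intro tendsto_sum l2_weak_limit[OF ul z_l2 _ _ cube_borel limit_strong] csm_l2 csm_pd test_fun_csm[OF t(1)] test_fun_support[OF test_fun_pd[OF tp]])
  have "EV n. (S3 k. S3 l. LL x. u n k x * pd l (pd l (ph k)) x) = 0" using ige[of j]
  proof eventually_elim
   case (elim n)
   have c: "cube (2^j) \<subseteq> cube (2^i n)" by (rule cube_mono) (use elim in \<open>simp add: power_increasing\<close>)
   have sub: "HC (2^j) \<subseteq> cube (2^i n) \<inter> above (g n)" using c gu[of n] by (auto simp: HC_def above_def intro: le_less_trans)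
   have "0 = (S3 k. S3 l. LL x. (G n k l x - F n k l x) * pd l (ph k) x)"
    using solD(7)[OF s[of n], of ph] test_fun_mono[OF t(2) sub] ph by simp
   also have "... = (S3 k. S3 l. - (LL x. u n k x * pd l (pd l (ph k)) x))"
   proof (intro sum.cong refl)
    fix k l
    have "(LL x. (G n k l x - F n k l x) * pd l (ph k) x) = (LL x. G n k l x * pd l (ph k) x)"
    proof (rule icong)
     fix x show "(G n k l x - F n k l x) * pd l (ph k) x = G n k l x * pd l (ph k) x"
      using F0[of x n k l] test_fun_support[OF test_fun_pd[OF t(2)], of l k x] c by (cases "pd l (ph k) x = 0") (auto simp: HC_def)
    qed
    then show "(LL x. (G n k l x - F n k l x) * pd l (ph k) x) = - (LL x. u n k x * pd l (pd l (ph k)) x)"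
     using solD(4)[OF s test_fun_mono[OF tp c], of k l l k] by simp
   qed
   finally show ?case by (simp add: sum_negf)
  qed
  from LIMSEQ_unique[OF Lim_transform_eventually[OF L this] tendsto_const]
  have "(S3 k. S3 l. LL x. hz j z k x * pd l (pd l (ph k)) x) = 0" .
  then show "(S3 k. S3 l. LL x. (zD j k l x - 0) * pd l (ph k) x) = 0"
   unfolding z_weak[OF tp] by (simp add: sum_negf)
 qed
 then show ?thesis unfolding gsol_def using z_rep by blast
qed

end

theorem compactness:
 fixes i :: "nat => nat" and u :: "nat => 3 => real^3 => real"
 assumes M: "0 <= M" and s: "!!n. sol (2^i n) (g n) (u n) (G n) (F n)" and lip: "!!n. lipg M (g n)"
  and gl: "!!n y. - eps n <= g n y" and gu: "!!n y. g n y <= 0" and e0: "eps ~~> 0"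
  and F0: "!!n k j x. x \<in> HC (2^i n) ==> F n k j x = 0" and i: "filterlim i at_top sequentially"
  and A: "!!n j. j <= i n ==> mas (2^j) (u n) <= A j"
  and FA: "!!j. (%n. enr (2^j) (F n)) ~~> 0"
  and r: "!!n k. rep (2^i n) (u n k)"
 shows "\<exists>sg z. strict_mono sg & gsol z & (\<forall>j k. (%n. sq (cube (2^j)) (%x. u (sg n) k x - hz j z k x)) ~~> 0)"
proof -
 obtain sg :: "nat => nat" where sg: "strict_mono sg" "!!x k. 0 < x$3 ==> convergent (%n. u (sg n) k x)"
  using diagonal_subsequence[OF i r A] by blast
 define z where "z k x = (if 0 < x$3 then lim (%n. u (sg n) k x) else 0)" for k and x :: "real^3"
 have lim: "(%n. u (sg n) k x) ~~> z k x" if "0 < x$3" for k x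
  using sg(2)[OF that, of k] that by (simp add: z_def convergent_LIMSEQ_iff)
 have z0: "z k x = 0" if "x$3 <= 0" for k x using that by (simp add: z_def)
 have su: "f ~~> l ==> (%n. f (sg n)) ~~> l" for f :: "nat => real" and l
  using LIMSEQ_subseq_LIMSEQ[OF _ sg(1), of f l] by (simp add: o_def)
 note L = limit_gsol limit_strong
 note a = L[OF M s lip gl gu su[OF e0] F0 filterlim_compose[OF i filterlim_subseq[OF sg(1)]] A su[OF FA] r lim z0]
 show ?thesis using sg(1) a by blast
qed

section \<open>Growth of half-space solutions under tangential differences\<close>

lemma gsolD:
 assumes "gsol v" obtains G where "sol (2^j) (%_. 0) (hz j v) G (%_ _ _. 0)"
 using assms unfolding gsol_def by blast
lemma gsol_rep: "gsol v ==> rep (2^j) (hz j v k)" by (simp add: gsol_def)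
lemma gsol_l2: "gsol v ==> l2 (hz j v k)" using gsol_rep rep_l2 by blast

text \<open>The growth is measured per doubling of the radius in terms of mass: a function
  homogeneous of degree m in three variables has \<open>kp = 8 * 4^m\<close>, so 32 is linear and
  128 quadratic.\<close>

definition growth :: "real => (3 => real^3 => real) => bool" where
 "growth kp v \<longleftrightarrow> (\<exists>A\<ge>0. \<forall>j. mas (2^j) (hz j v) <= A * kp^j)"

definition tdiff :: "3 => real => (3 => real^3 => real) => 3 => real^3 => real" where
 "tdiff l h v k x = v k (x + h *R ax l) - v k x"

lemma rep_shift_diff:
 assumes f: "rep R' f" and h: "!!x s. s > 0 ==> x \<in> hcs R s ==> x + t \<in> hcs R' s" and R: "R <= R'"
 shows "rep R (%x. f (x + t) - f x)"
 unfolding rep_def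
proof (intro conjI allI impI ballI)
 show "l2 (%x. f (x + t) - f x)" by (intro l2_diff l2_shift rep_l2[OF f])
 fix s x assume s: "0 < (s::real)" and x: "x \<in> hcs R s"
 have c: "csm (ks s KK)" by (rule csm_ks[OF KK_csm s])
 have "conv (%x. f (x + t) - f x) (ks s KK) x = conv (%x. f (x + t)) (ks s KK) x - conv f (ks s KK) x"
  unfolding conv_def right_diff_distrib
  by (rule Bochner_Integration.integral_diff) (intro conv_integrable l2_shift rep_l2[OF f] c)+
 also have "conv (%x. f (x + t)) (ks s KK) x = conv f (ks s KK) (x + t)"
  unfolding conv_alt by (simp add: algebra_simps)
 finally show "f (x + t) - f x = conv (%x. f (x + t) - f x) (ks s KK) x"
  using repD[OF f s h[OF s x]] repD[OF f s, of x] hcs_R_mono[OF R] x by auto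
qed

lemma cube_shift:
 assumes "x \<in> cube (2^j)" "abs(h) <= 1" shows "x + h *R ax l \<in> cube (2^Suc j)"
proof -
 have "abs((x + h *R ax l)$i) < 2^Suc j" for i
 proof -
  have "abs(h * ax l$i) <= 1" using assms(2) by (simp add: axis_def)
  moreover have "(1::real) <= 2^j" by simp
  ultimately have "abs(x$i + h * ax l$i) < 2 * 2^j" using cubeD[OF assms(1), of i] by linarith
  then show ?thesis by simp
 qed
 then show ?thesis by (simp add: cube_def)
qed

lemma hz_tdiff:
 assumes "abs(h) <= 1"
 shows "hz j (tdiff l h v) k x = ind (cube (2^j)) x * (hz (Suc j) v k (x + h *R ax l) - hz (Suc j) v k x)"
proof (cases "x \<in> cube (2^j)")
 case True
 have "(2::real)^j <= 2^Suc j" by simp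
 then have "x \<in> cube (2^Suc j)" using True cube_mono by blast
 then show ?thesis using True cube_shift[OF True assms, of l] by (simp add: hz_def tdiff_def)
qed (simp add: hz_def)

lemma gsol_tdiff:
 assumes v: "gsol v" and h: "abs(h) <= 1" and l: "l ~= 3"
 shows "gsol (tdiff l h v)"
 unfolding gsol_def
proof (intro allI conjI)
 fix j
 define U where "U = hz (Suc j) v"
 define t where "t = h *R ax l"
 have t3: "t$3 = 0" using l by (simp add: t_def axis_def)
 have Ul: "l2 (U k)" for k unfolding U_def by (rule gsol_l2[OF v])
 have e: "hz j (tdiff l h v) k x = ind (cube (2^j)) x * (U k (x + t) - U k x)" for k x unfolding U_def t_def by (rule hz_tdiff[OF h])
 have le: "(2::real)^j <= 2^Suc j" by simp
 obtain G where G: "sol (2^Suc j) (%_. 0) U G (%_ _ _. 0)" unfolding U_def by (rule gsolD[OF v])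
 have 1: "sol (2^j) (%_. 0) (%k x. 1 * U k (t + 1 *R x)) (%k j x. 1 * 1 * G k j (t + 1 *R x)) (%k j x. 1 * 1 * 0)"
 proof (rule sol_affine[OF G])
  show "t + 1 *R x \<in> cube (2^Suc j)" if "x \<in> cube (2^j)" for x
   using cube_shift[OF that h, of l] by (simp add: t_def add.commute)
 qed (use t3 in \<open>auto simp: above_def\<close>)
 have 2: "sol (2^j) (%_. 0) (%k x. -1 * U k (0 + 1 *R x)) (%k j x. -1 * 1 * G k j (0 + 1 *R x)) (%k j x. -1 * 1 * 0)"
  by (rule sol_affine[OF G]) (use cube_mono[OF le] in auto)
 have 3: "sol (2^j) (%_. 0) (hz j (tdiff l h v)) (%k j x. 1 * 1 * G k j (t + 1 *R x) + -1 * 1 * G k j (0 + 1 *R x)) (%k j x. 1 * 1 * 0 + -1 * 1 * 0)"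
 proof (rule sol_cong_AE[OF sol_add[OF 1 2]])
  show "l2 (hz j (tdiff l h v) k)" for k unfolding e[abs_def] by (intro l2_indicator l2_diff l2_shift Ul cube_borel)
  show "AE3 x. x \<in> cube (2^j) --> 1 * U k (t + 1 *R x) + -1 * U k (0 + 1 *R x) = hz j (tdiff l h v) k x" for k
   by (rule AE_I2) (simp add: e add.commute)
  fix k x assume x: "x \<in> cube (2^j)" "x \<notin> above (%_. 0)"
  have "x \<in> cube (2^Suc j)" "x + t \<in> cube (2^Suc j)" using x(1) cube_mono[OF le] cube_shift[OF x(1) h, of l] by (auto simp: t_def)
  moreover have "x + t \<notin> above (%_. 0)" using x(2) t3 by (simp add: above_def)
  ultimately show "hz j (tdiff l h v) k x = 0" using solD(6)[OF G] x(2) by (simp add: e)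
 qed
 then show "\<exists>G. sol (2^j) (%_. 0) (hz j (tdiff l h v)) G (%_ _ _. 0)" by (intro exI) simp
 fix k
 have "rep (2^j) (%x. U k (x + t) - U k x)"
 proof (rule rep_shift_diff[OF _ _ le])
  show "rep (2^Suc j) (U k)" unfolding U_def by (rule gsol_rep[OF v])
  fix x s assume s: "0 < (s::real)" and x: "x \<in> hcs (2^j) s"
  have t1: "abs(t$i) <= 1" for i using h by (simp add: t_def axis_def)
  have p1: "(1::real) <= 2^j" by simp
  have "abs(x$1 + t$1) < 2 * 2^j - s" "abs(x$2 + t$2) < 2 * 2^j - s" "x$3 < 2 * 2^j - s"
   using x t1[of 1] t1[of 2] p1 unfolding hcs_def mem_Collect_eq by linarith+
  then show "x + t \<in> hcs (2^Suc j) s" using x t3 by (simp add: hcs_def)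
 qed
 from rep_restrict[OF this order_refl] show "rep (2^j) (hz j (tdiff l h v) k)" unfolding e[abs_def] .
qed

text \<open>A tangential difference with step at most 1 is bounded by the gradient, and Caccioppoli
  bounds the energy by the mass divided by the squared radius; hence a factor 4^-j. The shift j + 5
  makes the radius 32 times larger: 8 is lost in Caccioppoli, the remaining 4 gives room for the
  step and the mollifier.\<close>

lemma growth_tdiff:
 assumes v: "gsol v" and gr: "growth kp v" and kp: "kp > 0" and h: "abs(h) <= 1" and l: "l ~= 3"
 shows "growth (kp/4) (tdiff l h v)"
proof -
 obtain A where A: "A >= 0" "!!j. mas (2^j) (hz j v) <= A * kp^j" using gr unfolding growth_def by blast
 obtain C where C: "C > 0" "!!R g u G F. 0 < R & sol R g u G F & lipg 0 g & (\<forall>y. - R/10 <= g y) ==> enr (R/8) G <= C * (mas R u/R^2 + enr R F)"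
  using caccioppoli_scaled[of 0] by auto
 have "mas (2^j) (hz j (tdiff l h v)) <= (C * A * kp^5/4^5) * (kp/4)^j" for j
 proof -
  define R :: real where "R = 2^(j + 5)"
  have R: "R/8 = 4 * 2^j" "R > 0" "R^2 = 4^(j + 5)" unfolding R_def by (simp_all add: power_add power_mult_distrib[symmetric] p2eq)
  have p1: "(1::real) <= 2^j" by simp
  define U where "U = hz (j + 5) v"
  obtain G where G: "sol R (%_. 0) U G (%_ _ _. 0)" unfolding U_def R_def by (rule gsolD[OF v])
  have "sq (cube (2^j)) (hz j (tdiff l h v) k) <= (S3 m. sq (cube (R/8)) (G k m))" for k
  proof -
   have "sq (cube (2^j)) (hz j (tdiff l h v) k) = sq (cube (2^j)) (%x. U k (x + h *R ax l) - U k x)"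
   proof (rule sq_cong)
    fix x assume x: "x \<in> cube (2^j)"
    have le: "(2::real)^Suc j <= 2^(j + 5)" "(2::real)^j <= 2^(j + 5)" by (intro power_increasing; simp)+
    have "x \<in> cube (2^(j + 5))" "x + h *R ax l \<in> cube (2^(j + 5))"
     using x cube_shift[OF x h, of l] cube_mono[OF le(1)] cube_mono[OF le(2)] by auto
    then show "hz j (tdiff l h v) k x = U k (x + h *R ax l) - U k x" using x by (simp add: U_def hz_def tdiff_def)
   qed
   also have "... <= h^2 * sq (cube (R/8)) (G k l)"
   proof (rule diff_bound[OF G cube_borel cube_borel zero_less_one _ cube_ccube])
    show "R/8 < R" using R(2) by simp
    fix x p :: "real^3" and sg :: real assume x: "x \<in> cube (2^j)" "0 <= sg" "sg <= 1" "!!i. abs(p$i) <= 1"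
    have "abs(sg * h) <= 1" using x(2,3) h by (simp add: abs_mult mult_le_one)
    from cube_shift[OF x(1) this, of l] have c1: "abs((x + (sg * h) *R ax l)$i) < 2 * 2^j" for i using cubeD by fastforce
    have "abs((x + (sg * h) *R ax l - p)$i) < R/8" for i
     unfolding R(1) vector_minus_component using c1[of i] x(4)[of i] p1 by linarith
    then show "x + (sg * h) *R ax l - p \<in> cube (R/8)" by (simp add: cube_def)
   qed
   also have "... <= 1 * sq (cube (R/8)) (G k l)"
    using power_mono[OF h, of 2] by (intro mult_right_mono) auto
   also have "... <= (S3 m. sq (cube (R/8)) (G k m))" using member_le_sum[of l UNIV "%m. sq (cube (R/8)) (G k m)"] by simp
   finally show ?thesis .
  qed
  then have "mas (2^j) (hz j (tdiff l h v)) <= enr (R/8) G" unfolding mas_def enr_def by (intro sum_mono)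
  also have "... <= C * (mas R U/R^2 + enr R (%_ _ _. 0))" using R(2) G by (intro C(2)) (auto simp: lipg_def)
  also have "... = C * (mas R U/R^2)" by (simp add: enr_def)
  also have "... <= C * ((A * kp^(j + 5))/R^2)" using A(2)[of "j + 5"] C(1) unfolding U_def R_def by (intro mult_left_mono divide_right_mono) auto
  also have "... = (C * A * kp^5/4^5) * (kp/4)^j" unfolding R(3) by (simp add: power_add power_divide mult_ac)
  finally show ?thesis .
 qed
 moreover have "0 <= C * A * kp^5/4^5" using C(1) A(1) kp by simp
 ultimately show ?thesis unfolding growth_def by blast
qed

lemma growth_point:
 assumes v: "gsol v" and gr: "growth kp v"
 shows "\<exists>A\<ge>0. \<forall>j s x k. 0 < s --> x \<in> hcs (2^j) s --> (v k x)^2 <= A/s^3 * kp^j"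
proof -
 obtain A where A: "A >= 0" "!!j. mas (2^j) (hz j v) <= A * kp^j" using gr unfolding growth_def by blast
 define K where "K = (LL p. (KK p)^2)"
 have K: "K >= 0" unfolding K_def by simp
 have "(v k x)^2 <= (K * A)/s^3 * kp^j" if s: "0 < s" and x: "x \<in> hcs (2^j) s" for j s x k
 proof -
  have xc: "x \<in> cube (2^j)" using hcs_sub_HC[of s "2^j"] s x by (auto simp: HC_def)
  have "(hz j v k x)^2 <= K/s^3 * sq (HC (2^j)) (hz j v k)" unfolding K_def by (rule rep_bound[OF gsol_rep[OF v] s x])
  also have "... <= K/s^3 * (A * kp^j)"
  proof (rule mult_left_mono)
   have "sq (HC (2^j)) (hz j v k) <= sq (cube (2^j)) (hz j v k)" by (rule sq_mono[OF gsol_l2[OF v]]) (auto simp: HC_def)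
   also have "... <= mas (2^j) (hz j v)" by (rule sq_le_mas)
   finally show "sq (HC (2^j)) (hz j v k) <= A * kp^j" using A(2)[of j] by linarith
  qed (use K s in auto)
  finally show ?thesis using xc by (simp add: hz_def)
 qed
 then show ?thesis using A(1) K by (intro exI[of _ "K * A"]) simp
qed

lemma pow_lim_zero:
 fixes a q :: real assumes "!!j. j >= j0 ==> a <= c * q^j" "0 <= q" "q < 1" shows "a <= 0"
proof -
 have "(%j. c * q^j) ~~> c * 0" by (intro tendsto_mult tendsto_const LIMSEQ_power_zero) (use assms in auto)
 then show ?thesis using LIMSEQ_le_const[of "%j. c * q^j" "c * 0" a] assms(1) by auto
qed

lemma hcs_pow: assumes "0 < x$3" obtains s j0 where "s > 0" "!!j. j0 <= j ==> x \<in> hcs (2^j) s"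
proof -
 define s where "s = x$3/2"
 define m where "m = Max {abs(x$1) + s, abs(x$2) + s, x$3 + s}"
 have m: "abs(x$1) + s <= m" "abs(x$2) + s <= m" "x$3 + s <= m" by (auto simp: m_def)
 obtain j0 :: nat where j: "m < 2^j0" using real_arch_pow[of 2 m] by auto
 have "x \<in> hcs (2^j0) s" using m j assms by (auto simp: hcs_def s_def)
 then have "x \<in> hcs (2^i) s" if "j0 <= i" for i using hcs_R_mono[of "2^j0" "2^i" s] that by (auto simp: power_increasing)
 then show ?thesis using that[of s j0] assms by (simp add: s_def)
qed

lemma growth_decay:
 assumes v: "gsol v" and gr: "growth kp v" and kp: "0 < kp" "kp < 1" and x: "0 < x$3"
 shows "v k x = 0"
proof -
 obtain s j0 where s: "s > 0" "!!j. j0 <= j ==> x \<in> hcs (2^j) s" using hcs_pow[OF x] by blast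
 obtain A where "A >= 0" and A: "!!j s x k. 0 < s ==> x \<in> hcs (2^j) s ==> (v k x)^2 <= A/s^3 * kp^j"
  using growth_point[OF v gr] by blast
 have "(v k x)^2 <= 0" by (rule pow_lim_zero[of j0 _ "A/s^3" kp]) (use A s kp in auto)
 then show ?thesis by simp
qed

definition x3only :: "(3 => real^3 => real) => bool" where
 "x3only v \<longleftrightarrow> (\<forall>k x l h. l ~= 3 & abs(h) <= 1 & 0 < x$3 --> v k (x + h *R ax l) = v k x)"

text \<open>A long shift is a chain of steps of length at most 1, the only ones that
  \<open>x3only\<close> covers.\<close>

lemma x3only_shift:
 assumes v: "x3only v" and l: "l ~= 3" and x: "0 < x$3" shows "v k (x + h *R ax l) = v k x"
proof -
 obtain n :: nat where n: "abs(h) <= real n" using real_arch_simple by blast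
 define q where "q = h/real n"
 have q: "abs(q) <= 1" "h = real n * q" using n by (auto simp: q_def divide_le_eq)
 have "v k (x + (real m * q) *R ax l) = v k x" for m
 proof (induction m)
  case (Suc m)
  have 1: "x + (real (Suc m) * q) *R ax l = (x + (real m * q) *R ax l) + q *R ax l"
   by (simp add: distrib_right scaleR_add_left add_ac)
  have "0 < (x + (real m * q) *R ax l)$3" using x l by (simp add: axis_def)
  then have "v k (x + (real (Suc m) * q) *R ax l) = v k (x + (real m * q) *R ax l)" unfolding 1 using v l q(1) unfolding x3only_def by blast
  then show ?case using Suc by simp
 qed simp
 then show ?thesis unfolding q(2) .
qed

lemma x3only_eq:
 assumes v: "x3only v" and x: "0 < x$3" shows "v k x = v k ((x$3) *R ax 3)"
proof -
 define y where "y = (x$3) *R ax 3 + (x$1) *R ax 1"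
 have y3: "0 < y$3" "0 < ((x$3) *R ax 3)$3" using x by (auto simp: y_def axis_def)
 have e: "x = y + (x$2) *R ax 2" unfolding y_def by (simp add: vec_eq_iff forall_3 axis_def)
 have "v k x = v k (y + (x$2) *R ax 2)" using e by simp
 also have "... = v k y" by (rule x3only_shift[OF v _ y3(1)]) simp
 also have "... = v k ((x$3) *R ax 3)" unfolding y_def by (rule x3only_shift[OF v _ y3(2)]) simp
 finally show ?thesis .
qed

section \<open>Liouville theorem\<close>

lemma foldr_pd_eq_open:
 assumes "open U" "!!y. y \<in> U ==> f y = g y" "x \<in> U"
 shows "foldr pd al f x = foldr pd al g x"
 using assms(3)
proof (induction al arbitrary: x)
 case (Cons j al)
 show ?case using pd_eq_open[OF assms(1) Cons.prems Cons.IH] by simp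
qed (use assms(2) in simp)

lemma foldr_pd_0: "foldr pd al (%_. 0) = (%_. 0)" by (induction al) auto

lemma conv_lap: "l2 f ==> csm k ==> lap (conv f k) = conv f (lap k)"
 unfolding lap_def by (simp add: conv_pd csm_pd conv_sum_ker fun_eq_iff)

text \<open>For a function of x_3 alone the bilaplacian is the fourth derivative. It is computed on
  the smooth mollification w, where derivatives commute and every one containing a tangential
  direction vanishes.\<close>

lemma x3only_fourth:
 assumes v: "gsol v" and x3: "x3only v" and x: "x \<in> HC (2^j)"
 shows "foldr pd [3,3,3,3] (hz j v k) x = 0"
proof -
 define ph where "ph = hz j v k"
 have rp: "rep (2^j) ph" unfolding ph_def by (rule gsol_rep[OF v])
 have fl: "l2 ph" using rep_l2[OF rp] .
 obtain s where s: "s > 0" "x \<in> hcs (2^j) s" using HC_hcs[OF x] by blast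
 define U where "U = hcs (2^j) s"
 have U: "open U" "x \<in> U" unfolding U_def using hcs_open s by auto
 define K where "K = ks s KK"
 have c: "csm K" unfolding K_def by (rule csm_ks[OF KK_csm s(1)])
 have sK: "smooth3 K" using c by (rule csm_smooth)
 define w where "w = conv ph K"
 have sw: "smooth3 w" unfolding w_def by (rule conv_smooth[OF fl c])
 have fw: "ph y = w y" if "y \<in> U" for y using repD[OF rp s(1)] that unfolding w_def K_def U_def by blast
 have yh: "0 < y$3 & y \<in> cube (2^j)" if "y \<in> U" for y using that hcs_sub_HC[of s "2^j"] s(1) by (auto simp: U_def HC_def)
 have p0: "pd l w y = 0" if l: "l ~= 3" and y: "y \<in> U" for l y
 proof -
  have "pd l w y = pd l (v k) y"
   by (rule pd_eq_open[OF U(1) y]) (use fw yh in \<open>simp add: ph_def hz_def\<close>)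
  also have "... = 0" unfolding pd_def using x3only_shift[OF x3 l, of y k] yh[OF y] by simp
  finally show ?thesis .
 qed
 have f0: "foldr pd al (pd l w) y = 0" if "l ~= 3" "y \<in> U" for al l y
  using foldr_pd_eq_open[OF U(1) p0[OF that(1)] that(2)] by (simp add: foldr_pd_0)
 have l1: "lap w y = pd 3 (pd 3 w) y" if "y \<in> U" for y
  unfolding lap_def sum_3 using f0[of 1 y "[1]"] f0[of 2 y "[2]"] that by simp
 have cm: "pd l (pd l (pd 3 (pd 3 w))) = foldr pd [3,3,l] (pd l w)" for l
  by (simp add: pd_commute[of _ l 3] sw)
 have "lap (lap w) x = lap (pd 3 (pd 3 w)) x" by (rule lap_eq_open[OF U l1])
 also have "... = pd 3 (pd 3 (pd 3 (pd 3 w))) x"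
  unfolding lap_def sum_3 using cm[of 1] cm[of 2] f0[of 1 x "[3,3,1]"] f0[of 2 x "[3,3,2]"] U(2) by simp
 finally have 1: "lap (lap w) x = pd 3 (pd 3 (pd 3 (pd 3 w))) x" .
 obtain G where G: "sol (2^j) (%_. 0) (hz j v) G (%_ _ _. 0)" by (rule gsolD[OF v])
 note t = KK_test[OF s, folded K_def]
 have lk: "lap (lap (%y. K (x - y))) y = lap (lap K) (x - y)" for y
 proof -
  have "lap (%y. K (x - y)) = (%y. lap K (x - y))" using lap_affine[OF sK, of "-1" x] by simp
  then show ?thesis using lap_affine[OF smooth3_lap[OF sK], of "-1" x] by simp
 qed
 have "(LL y. hz j v k y * lap (lap (%y. K (x - y))) y) = 0"
  by (rule weak_biharm[OF G t]) (auto simp: flat_domain)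
 then have "conv ph (lap (lap K)) x = 0" unfolding lk conv_def ph_def by (simp add: mult.commute)
 then have "lap (lap w) x = 0" unfolding w_def by (simp add: conv_lap fl c csm_lap)
 then show ?thesis using 1 foldr_pd_eq_open[OF U(1) fw U(2), where al = "[3,3,3,3]"] by (simp add: ph_def)
qed

lemma x3only_cubic:
 assumes v: "gsol v" and x3: "x3only v"
 shows "\<exists>c. \<forall>t>0. v k (t *R ax 3) = (\<Sum>m<4. c m * (t - 1)^m)"
proof (intro exI[of _ "%m. foldr pd (replicate m 3) (v k) (1 *R ax 3)/fact m"] allI impI)
 fix t :: real assume t: "t > 0"
 obtain j :: nat where j: "t + 1 < 2^j" using real_arch_pow[of 2 "t + 1"] by auto
 define d where "d m t = foldr pd (replicate m 3) (hz j v k) (t *R ax 3)" for m t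
 have inH: "q *R ax 3 \<in> HC (2^j)" if "0 < q" "q < 2^j" for q
  using that unfolding HC_def by (auto intro!: cubeI3 simp: axis_def)
 have eq: "foldr pd al (hz j v k) x = foldr pd al (v k) x" if "x \<in> HC (2^j)" for x al
  by (rule foldr_pd_eq_open[OF HC_open _ that]) (simp add: hz_def HC_def)
 have D: "DERIV (d m) q :> d (Suc m) q" if "0 < q" "q < 2^j" for m q
  using rep_DERIV[OF gsol_rep[OF v] inH[OF that], of "replicate m 3" k 3] DERIV_shift[of "d m" "d (Suc m) q" 0 q]
  by (simp add: d_def scaleR_add_left add.commute)
 have s4: "(\<Sum>m<4. f m) = f 0 + f 1 + f 2 + f (3::nat)" for f :: "nat => real" by (simp add: eval_nat_numeral)
 have "v k (t *R ax 3) = d 0 t" using eq[OF inH, of t "[]"] t j by (simp add: d_def)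
 also have "... = (\<Sum>m<4. (d m 1/fact m) * (t - 1)^m)"
 proof (cases "t = 1")
  case True then show ?thesis unfolding s4 by simp
 next
  case False
  have j1: "(1::real) < 2^j" using j t by linarith
  have "\<exists>q. (if t < 1 then t < q & q < 1 else 1 < q & q < t) &
    d 0 t = (\<Sum>m<4. (d m 1/fact m) * (t - 1)^m) + (d 4 q/fact 4) * (t - 1)^4"
   by (rule Taylor[of 4 d "d 0" "min t 1" "max t 1"]) (use t j j1 False in \<open>auto intro!: D\<close>)
  then obtain q where q: "if t < 1 then t < q & q < 1 else 1 < q & q < t"
   "d 0 t = (\<Sum>m<4. (d m 1/fact m) * (t - 1)^m) + (d 4 q/fact 4) * (t - 1)^4" by blast
  have "0 < q" "q < 2^j" using q(1) t j by (auto split: if_splits)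
  then have "d 4 q = 0" using x3only_fourth[OF v x3 inH, of q k] by (simp add: d_def eval_nat_numeral)
  then show ?thesis using q(2) by simp
 qed
 also have "... = (\<Sum>m<4. foldr pd (replicate m 3) (v k) (1 *R ax 3)/fact m * (t - 1)^m)"
 proof -
  have "d m 1 = foldr pd (replicate m 3) (v k) (1 *R ax 3)" for m
   unfolding d_def by (rule eq[OF inH]) (use j t in auto)
  then show ?thesis by simp
 qed
 finally show "v k (t *R ax 3) = (\<Sum>m<4. foldr pd (replicate m 3) (v k) (1 *R ax 3)/fact m * (t - 1)^m)" .
qed

lemma lim_sq_zero:
 fixes X :: "nat => real"
 assumes "X ~~> c" "!!j. (X j)^2 <= B * q^j" "0 <= q" "q < 1" shows "c = 0"
proof -
 have "(%j. B * q^j) ~~> B * 0" by (intro tendsto_mult tendsto_const LIMSEQ_power_zero) (use assms in auto)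
 then have "c^2 <= 0" using LIMSEQ_le[OF tendsto_power[OF assms(1), of 2]] assms(2) by fastforce
 then show ?thesis by simp
qed

text \<open>At the points 2^j e_3 the mean value formula is available at a scale comparable to the
  distance, so the square of the value is bounded by a multiple of (kp/8)^j. Dividing by 2^(jm)
  isolates the coefficient of degree m, which vanishes if kp < 8 * 4^m; this gives the thresholds
  128 and 32.\<close>

lemma x3only_affine:
 assumes v: "gsol v" and x3: "x3only v" and gr: "growth kp v" and kp: "0 < kp" "kp < 128"
 shows "\<exists>d a. (\<forall>x. 0 < x$3 --> v k x = d + a * x$3) & (kp < 32 --> a = 0)"
proof -
 obtain c where c: "!!t. t > 0 ==> v k (t *R ax 3) = (\<Sum>m<4. c m * (t - 1)^m)" using x3only_cubic[OF v x3] by blast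
 have s4: "(\<Sum>m<4. f m) = f 0 + f 1 + f 2 + f (3::nat)" for f :: "nat => real" by (simp add: eval_nat_numeral)
 obtain A where A: "A >= 0" "!!j s x k. 0 < s ==> x \<in> hcs (2^j) s ==> (v k x)^2 <= A/s^3 * kp^j" using growth_point[OF v gr] by blast
 define f where "f t = v k (t *R ax 3)" for t
 have fc: "f t = c 0 + c 1 * (t - 1) + c 2 * (t - 1)^2 + c 3 * (t - 1)^3" if "t > 0" for t
  unfolding f_def c[OF that] s4 by simp
 define B where "B = A * 8 * kp"
 have fB: "(f (2^j))^2 <= B * (kp/8)^j" for j
 proof -
  define T :: real where "T = 2^j"
  have "T^3 = (2^3)^j" unfolding T_def by (metis power_mult mult.commute)
  then have T: "T > 0" "T^3 = 8^j" by (simp_all add: T_def)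
  have "(2^j) *R ax 3 \<in> hcs (2^Suc j) (T/2)" using T(1) unfolding hcs_def T_def by (simp add: axis_def)
  then have "(f (2^j))^2 <= A/(T/2)^3 * kp^Suc j" unfolding f_def by (rule A(2)[rotated]) (use T in simp)
  also have "... = B * (kp/8)^j" unfolding B_def by (simp add: power_divide T(2))
  finally show ?thesis .
 qed
 have h: "(%j. (1/2::real)^j) ~~> 0" by (rule LIMSEQ_power_zero) simp
 have kill: "l = 0" if "(%j. f (2^j) * ((1/2)^j)^m) ~~> l" "kp < 8 * 4^m" for l m
 proof (rule lim_sq_zero[OF that(1), of B "kp/(8 * 4^m)"])
  fix j
  have e: "(((1/2::real)^j)^m)^2 = (1/4^m)^j"
  proof -
   have "((q^j)^m)^2 = ((q^2)^m)^j" for q :: real by (simp add: power_mult[symmetric] mult_ac)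
   then show ?thesis by (simp add: power_one_over p2eq)
  qed
  have "(f (2^j) * ((1/2)^j)^m)^2 = (f (2^j))^2 * (1/4^m)^j" unfolding power_mult_distrib e ..
  also have "... <= (B * (kp/8)^j) * (1/4^m)^j" by (rule mult_right_mono[OF fB]) simp
  also have "... = B * (kp/(8 * 4^m))^j" by (simp add: power_mult_distrib[symmetric] mult.assoc)
  finally show "(f (2^j) * ((1/2)^j)^m)^2 <= B * (kp/(8 * 4^m))^j" .
 qed (use kp that(2) in auto)
 have T: "(2::real)^j * (1/2)^j = 1" for j by (simp add: power_mult_distrib[symmetric])
 have e3: "f (2^j) * ((1/2)^j)^3 = c 0 * ((1/2)^j)^3 + c 1 * (1 - (1/2)^j) * ((1/2)^j)^2 + c 2 * (1 - (1/2)^j)^2 * (1/2)^j + c 3 * (1 - (1/2)^j)^3" for j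
 proof -
  have "f T * q^3 = c 0 * q^3 + c 1 * (1 - q) * q^2 + c 2 * (1 - q)^2 * q + c 3 * (1 - q)^3" if "T > 0" "T * q = 1" for T q
  proof -
   have e: "(1 - q) = (T - 1) * q" using that(2) by (simp add: algebra_simps)
   show ?thesis unfolding fc[OF that(1)] e by (simp add: p2eq power3_eq_cube algebra_simps)
  qed
  then show ?thesis using T by simp
 qed
 have "(%j. f (2^j) * ((1/2)^j)^3) ~~> c 0 * 0^3 + c 1 * (1 - 0) * 0^2 + c 2 * (1 - 0)^2 * 0 + c 3 * (1 - 0)^3"
  unfolding e3 by (intro tendsto_intros h)
 then have c3: "c 3 = 0" using kill[of 3] kp by simp
 have e2: "f (2^j) * ((1/2)^j)^2 = c 0 * ((1/2)^j)^2 + c 1 * (1 - (1/2)^j) * (1/2)^j + c 2 * (1 - (1/2)^j)^2" for j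
 proof -
  have "f T * q^2 = c 0 * q^2 + c 1 * (1 - q) * q + c 2 * (1 - q)^2" if "T > 0" "T * q = 1" for T q
  proof -
   have e: "(1 - q) = (T - 1) * q" using that(2) by (simp add: algebra_simps)
   show ?thesis unfolding fc[OF that(1)] c3 e by (simp add: p2eq algebra_simps)
  qed
  then show ?thesis using T by simp
 qed
 have "(%j. f (2^j) * ((1/2)^j)^2) ~~> c 0 * 0^2 + c 1 * (1 - 0) * 0 + c 2 * (1 - 0)^2"
  unfolding e2 by (intro tendsto_intros h)
 then have c2: "c 2 = 0" using kill[of 2] kp by simp
 have fl: "f t = (c 0 - c 1) + c 1 * t" if "t > 0" for t using fc[OF that] c2 c3 by (simp add: algebra_simps)
 have "v k x = (c 0 - c 1) + c 1 * x$3" if "0 < x$3" for x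
  using x3only_eq[OF x3 that] fl[OF that] by (simp add: f_def)
 moreover have "c 1 = 0" if "kp < 32"
 proof -
  have e1: "f (2^j) * ((1/2)^j)^1 = (c 0 - c 1) * (1/2)^j + c 1" for j
   using fl[of "2^j"] T[of j] by (simp add: distrib_right mult.assoc)
  have "(%j. f (2^j) * ((1/2)^j)^1) ~~> (c 0 - c 1) * 0 + c 1" unfolding e1 by (intro tendsto_intros h)
  then show ?thesis using kill[of 1] that by simp
 qed
 ultimately show ?thesis by blast
qed

lemma slab_integral:
 assumes "- r <= a" "a < b" "b <= r"
 shows "(LL x. ind (cube r \<inter> {x. a < x$3 & x$3 < b}) x) = 4 * r^2 * (b - a)"
  "integrable lborel (ind (cube r \<inter> {x::real^3. a < x$3 & x$3 < b}) :: _ => real)"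
proof -
 define p q :: "real^3" where pq: "p = (\<chi> i. if i = 3 then a else - r)" "q = (\<chi> i. if i = 3 then b else r)"
 have S: "cube r \<inter> {x. a < x$3 & x$3 < b} = box p q"
  unfolding cube_def pq using assms by (auto simp: mem_box_cart forall_3 abs_less_iff)
 have ne: "cbox p q ~= {}" using assms by (auto simp: interval_ne_empty_cart pq)
 have "measure lborel (box p q) = measure lborel (cbox p q)"
  by (simp add: measure_def emeasure_lborel_box_eq emeasure_lborel_cbox_eq)
 also have "... = 4 * r^2 * (b - a)"
  using content_cbox_cart[OF ne] unfolding UNIV_3 by (simp add: pq p2eq)
 finally show "(LL x. ind (cube r \<inter> {x. a < x$3 & x$3 < b}) x) = 4 * r^2 * (b - a)" unfolding S by simp
 show "integrable lborel (ind (cube r \<inter> {x::real^3. a < x$3 & x$3 < b}) :: _ => real)"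
  unfolding S using emeasure_lborel_box_finite by (intro integrable_real_indicator) auto
qed

text \<open>A constant d contributes 4 s d^2 to the mass of the layer of height s, while the
  Poincare inequality allows only order s^2. Letting s run through q j gives d = 0.\<close>

lemma trace_zero:
 assumes v: "gsol v" and e: "!!x. 0 < x$3 ==> v k x = d + a * x$3"
 shows "d = 0"
proof -
 obtain G where G: "sol (2^1) (%_. 0) (hz 1 v) G (%_ _ _. 0)" by (rule gsolD[OF v])
 define E where "E = sq (cube (3/2) \<inter> {x. x$3 < 1}) (G k 3)"
 define q where "q j = (1/4) * (1/2::real)^j" for j
 have "d^2 <= ((E/2 + 2 * a^2)/4) * (1/2)^j" for j
 proof -
  define s where "s = q j"
  have "(1/2::real)^j <= 1" by (rule power_le_one) auto
  then have s: "0 < s" "s <= 1/4" by (auto simp: s_def q_def)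
  define L where "L = cube 1 \<inter> {x::real^3. 0 < x$3 & x$3 < s}"
  define T where "T = cube 1 \<inter> {x::real^3. x$3 < s}"
  have Tb: "T \<in> sets borel" unfolding T_def by (intro sets.Int cube_borel borel_open open_Collect_less continuous_intros)
  have m: "(LL x. ind L x) = 4 * s" "integrable lborel (ind L :: _ => real)"
   unfolding L_def using slab_integral[of 1 0 s] s by auto
  have P: "sq T (hz 1 v k) <= (s + 0)^2 * E"
   unfolding E_def T_def by (rule poincare[OF G]) (use s in auto)
  have "d^2 * (4 * s) = (LL x. d^2 * ind L x)" using m(1) by simp
  also have "... <= (LL x. 2 * (ind T x * (hz 1 v k x)^2) + (2 * (a * s)^2) * ind L x)"
  proof (rule integral_mono)
   show "integrable lborel (%x. d^2 * ind L x)" by (rule integrable_mult_right[OF m(2)])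
   show "integrable lborel (%x. 2 * (ind T x * (hz 1 v k x)^2) + (2 * (a * s)^2) * ind L x)"
    by (intro Bochner_Integration.integrable_add integrable_mult_right m sq_integrable gsol_l2 v Tb)
   fix x
   show "d^2 * ind L x <= 2 * (ind T x * (hz 1 v k x)^2) + (2 * (a * s)^2) * ind L x"
   proof (cases "x \<in> L")
    case True
    have "x \<in> cube (2^1)" using True cube_mono[of 1 2] by (auto simp: L_def)
    then have hv: "hz 1 v k x = d + a * x$3" using e[of x] True by (simp add: L_def hz_def)
    have "(x$3)^2 <= s^2" using True by (intro power_mono) (auto simp: L_def)
    then have "(a * x$3)^2 <= (a * s)^2" by (simp add: power_mult_distrib mult_left_mono)
    moreover have "d^2 <= 2 * (d + a * x$3)^2 + 2 * (a * x$3)^2"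
    proof -
     have "2 * (d + b)^2 + 2 * b^2 - d^2 = (d + 2 * b)^2" for b by (simp add: p2eq algebra_simps)
     then show ?thesis using zero_le_power2[of "d + 2 * (a * x$3)"] by (smt (verit))
    qed
    ultimately show ?thesis using True hv by (simp add: L_def T_def)
   next
    case False then show ?thesis by (simp add: indicator_def)
   qed
  qed
  also have "... = 2 * sq T (hz 1 v k) + (2 * (a * s)^2) * (4 * s)"
   using sq_integrable[OF gsol_l2[OF v] Tb, of 1 k] m unfolding sq_def by simp
  also have "... <= 2 * (s^2 * E) + (2 * (a * s)^2) * (4 * s)" using P by simp
  also have "... = (s * (E/2) + 2 * a^2 * s^2) * (4 * s)" by (simp add: p2eq algebra_simps)
  finally have "d^2 <= s * (E/2) + 2 * a^2 * s^2" using s by (simp add: mult_le_cancel_right)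
  also have "... <= s * (E/2) + 2 * a^2 * s"
   using s by (intro add_left_mono mult_left_mono) (auto simp: p2eq mult_left_le)
  also have "... = ((E/2 + 2 * a^2)/4) * (1/2)^j" by (simp add: s_def q_def algebra_simps)
  finally show ?thesis .
 qed
 then have "d^2 <= 0" by (rule pow_lim_zero) auto
 then show ?thesis by simp
qed

lemma x3only_linear:
 assumes "gsol v" "x3only v" "growth kp v" "0 < kp" "kp < 128"
 shows "\<exists>a. (\<forall>k x. 0 < x$3 --> v k x = a k * x$3) & (kp < 32 --> a = (%_. 0))"
proof -
 have "\<exists>a. (\<forall>x. 0 < x$3 --> v k x = a * x$3) & (kp < 32 --> a = 0)" for k
  using x3only_affine[OF assms, of k] trace_zero[OF assms(1), of k] by fastforce
 then obtain a where "!!k. (\<forall>x. 0 < x$3 --> v k x = a k * x$3) & (kp < 32 --> a k = 0)" by metis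
 then show ?thesis by (intro exI[of _ a]) auto
qed

lemma x3only_zero:
 assumes v: "gsol v" "growth kp v" and kp: "0 < kp" "kp < 32"
  and d: "!!l h k x. l ~= 3 ==> abs(h) <= 1 ==> 0 < x$3 ==> tdiff l h v k x = 0" and x: "0 < x$3"
 shows "v k x = 0"
proof -
 have "x3only v" unfolding x3only_def using d by (auto simp: tdiff_def)
 from x3only_linear[OF v(1) this v(2)] show ?thesis using kp x by auto
qed

lemma hz_linear:
 assumes z: "gsol z" and a: "!!k x. 0 < x$3 ==> z k x = a k * x$3"
 shows "hz 0 z k x = a k * xp 1 x"
proof (cases "x \<in> cube 1 & 0 < x$3")
 case True then show ?thesis using a[of x k] by (simp add: hz_def xp_def)
next
 case False
 obtain G where G: "sol (2^0) (%_. 0) (hz 0 z) G (%_ _ _. 0)" by (rule gsolD[OF z])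
 have "hz 0 z k x = 0" using solD(6)[OF G, of x k] False by (cases "x \<in> cube 1") (auto simp: hz_def above_def)
 then show ?thesis using False by (auto simp: xp_def)
qed

text \<open>Three tangential differences lower the growth from 32 sqrt 2 to 8 sqrt 2, 2 sqrt 2 and
  sqrt 2/2 < 1, so third differences vanish. Going back, second and first differences depend on x_3
  alone and grow by less than 32, so they vanish as well; at last z itself depends on x_3 alone and
  grows by less than 128.\<close>

theorem liouville:
 assumes z: "gsol z" "growth (32 * sqrt 2) z"
 shows "\<exists>a. a 3 = 0 & (\<forall>k x. 0 < x$3 --> z k x = a k * x$3)"
proof -
 have s2: "1 < sqrt 2" "sqrt 2 < 3/2" by (simp, rule real_less_lsqrt) (auto simp: p2eq)
 define z1 where "z1 l h = tdiff l h z" for l h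
 define z2 where "z2 l h l' h' = tdiff l' h' (z1 l h)" for l h l' h'
 have a1: "gsol (z1 l h)" "growth (8 * sqrt 2) (z1 l h)" if "l ~= 3" "abs(h) <= 1" for l h
  unfolding z1_def using gsol_tdiff[OF z(1) that(2,1)] growth_tdiff[OF z _ that(2,1)] by auto
 have a2: "gsol (z2 l h l' h')" "growth (2 * sqrt 2) (z2 l h l' h')" if "l ~= 3" "abs(h) <= 1" "l' ~= 3" "abs(h') <= 1" for l h l' h'
  unfolding z2_def using gsol_tdiff[OF a1(1)[OF that(1,2)] that(4,3)] growth_tdiff[OF a1[OF that(1,2)] _ that(4,3)] by auto
 have b3: "tdiff m q (z2 l h l' h') k x = 0" if "l ~= 3" "abs(h) <= 1" "l' ~= 3" "abs(h') <= 1" "m ~= 3" "abs(q) <= 1" "0 < x$3" for l h l' h' m q k x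
 proof (rule growth_decay)
  show "gsol (tdiff m q (z2 l h l' h'))" by (rule gsol_tdiff[OF a2(1)[OF that(1-4)] that(6,5)])
  show "growth (2 * sqrt 2/4) (tdiff m q (z2 l h l' h'))" by (rule growth_tdiff[OF a2[OF that(1-4)] _ that(6,5)]) simp
 qed (use s2 that in auto)
 have b2: "tdiff l' h' (z1 l h) k x = 0" if "l ~= 3" "abs(h) <= 1" "l' ~= 3" "abs(h') <= 1" "0 < x$3" for l h l' h' k x
  using x3only_zero[OF a2[OF that(1-4)] _ _ b3[OF that(1-4)] that(5)] s2 by (simp add: z2_def)
 have b1: "tdiff l h z k x = 0" if "l ~= 3" "abs(h) <= 1" "0 < x$3" for l h k x
  using x3only_zero[OF a1[OF that(1,2)] _ _ b2[OF that(1,2)] that(3)] s2 by (simp add: z1_def)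
 then have x3: "x3only z" unfolding x3only_def by (auto simp: tdiff_def)
 obtain a where a: "!!k x. 0 < x$3 ==> z k x = a k * x$3" using x3only_linear[OF z(1) x3 z(2)] s2 by auto
 obtain G where G: "sol (2^0) (%_. 0) (hz 0 z) G (%_ _ _. 0)" by (rule gsolD[OF z(1)])
 have zx: "hz 0 z k x = a k * xp 1 x" for k x by (rule hz_linear[OF z(1) a])
 \<comment> \<open>A cutoff that crosses the plane tests the divergence of the linear profile; only
   its third component contributes, and with a nonzero weight.\<close>
 obtain et where et: "csm et" "!!x. 0 <= et x" "!!x. x \<in> cube (1/4) ==> et x = 1" "!!x. et x ~= 0 ==> x \<in> ccube ((1/4 + 1/2)/2)"
  using cutoff by (elim exE conjE, elim allE[of _ "1/4"] allE[of _ "1/2"]) auto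
 have t: "test_fun (cube 1) et"
  by (rule csm_test_fun[OF et(1) ccube_closed, of "3/8"]) (use et(4) ccube_cube[of "3/8" 1] in auto)
 have "0 = (S3 k. LL x. hz 0 z k x * pd k et x)" using solD(5)[OF G, of et] t by simp
 also have "... = (S3 k. a k * (LL x. xp 1 x * pd k et x))" unfolding zx by (simp add: mult.assoc)
 also have "... = - a 3 * (LL x. xd 1 x * et x)" unfolding sum_3 xp_weak[OF t] by simp
 finally have a3: "a 3 * (LL x. xd 1 x * et x) = 0" by simp
 have "0 < (LL x. ind (cube (1/4) \<inter> {x. 0 < x$3 & x$3 < 1/4}) x :: real)" using slab_integral(1)[of "1/4" 0 "1/4"] by simp
 also have "... <= (LL x. xd 1 x * et x)"
 proof (rule integral_mono)
  show "integrable lborel (%x. xd 1 x * et x)" by (intro l2_prod xd_l2 csm_l2 et)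
  show "integrable lborel (ind (cube (1/4) \<inter> {x::real^3. 0 < x$3 & x$3 < 1/4}) :: _ => real)" by (rule slab_integral(2)) auto
  show "ind (cube (1/4) \<inter> {x. 0 < x$3 & x$3 < 1/4}) x <= xd 1 x * et x" for x
   using et(2)[of x] et(3)[of x] cube_mono[of "1/4" 1] by (auto simp: indicator_def xd_def)
 qed
 finally have "a 3 = 0" using a3 by simp
 then show ?thesis using a by blast
qed

section \<open>Excess decay\<close>

definition k0 :: real where "k0 = sq (cube 1) (xp 1)"

lemma k0_pos: "k0 > 0"
proof -
 define L where "L = cube 1 \<inter> {x::real^3. 1/2 < x$3 & x$3 < 1}"
 have m: "(LL x. ind L x) = (2::real)" "integrable lborel (ind L :: _ => real)"
  unfolding L_def using slab_integral[of 1 "1/2" 1] by auto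
 have "(LL x. (1/4) * ind L x) <= k0"
  unfolding k0_def sq_def
 proof (rule integral_mono)
  show "integrable lborel (%x. (1/4::real) * ind L x)" by (rule integrable_mult_right[OF m(2)])
  show "integrable lborel (%x. ind (cube 1) x * (xp 1 x)^2)" by (rule sq_integrable[OF xp_l2]) simp
  fix x show "(1/4) * ind L x <= ind (cube 1) x * (xp 1 x)^2"
  proof (cases "x \<in> L")
   case True
   then have "(1/2)^2 <= (x$3)^2" by (intro power_mono) (auto simp: L_def)
   then show ?thesis using True by (simp add: L_def xp_def p2eq)
  qed simp
 qed
 then show ?thesis using m(1) by simp
qed

lemma xp_sq: assumes "0 < R" "R <= 1" shows "sq (cube R) (xp 1) = R^5 * k0"
proof -
 have e: "sq (cube 1) (%x. 1 * xp 1 (R *R x)) = sq (cube 1) (%x. R * xp 1 x)"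
 proof (rule sq_cong)
  fix x assume x: "x \<in> cube 1"
  have "R *R x \<in> cube 1"
  proof -
   have "abs(R * x$i) < 1" for i using mult_le_one[of R "abs(x$i)"] cubeD[OF x, of i] assms
    by (metis abs_ge_zero abs_mult abs_of_pos less_eq_real_def mult_less_cancel_right2 not_less order_le_less_trans mult_left_le_one_le)
   then show ?thesis by (simp add: cube_def)
  qed
  then show "1 * xp 1 (R *R x) = R * xp 1 x" using x assms by (auto simp: xp_def max_def zero_le_mult_iff)
 qed
 have "R^2 * k0 = 1^2/R^3 * sq (cube R) (xp 1)"
  using sq_scale[OF assms(1), of 1 1 "xp 1"] e by (simp add: sq_cmult k0_def)
 then show ?thesis using assms(1) by (simp add: field_simps p2eq eval_nat_numeral)
qed

lemma sq_projection:
 assumes f: "l2 f" and p: "l2 p" and S: "S \<in> sets borel" and Q: "sq S p > 0"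
 defines "b \<equiv> (LL x. ind S x * (f x * p x))/sq S p"
 shows "sq S (%x. f x - b * p x) <= sq S (%x. f x - c * p x)" "(LL x. ind S x * ((f x - b * p x) * p x)) = 0"
proof -
 define T where "T = (LL x. ind S x * (f x * p x))"
 have iT: "integrable lborel (%x. ind S x * (f x * p x))" using l2_prod[OF l2_indicator[OF f S] p] by (simp add: mult.assoc)
 note i = iT sq_integrable[OF f S] sq_integrable[OF p S]
 have ex: "sq S (%x. f x - c * p x) = sq S f - 2 * c * T + c^2 * sq S p" for c
 proof -
  have "sq S (%x. f x - c * p x) = (LL x. ind S x * (f x)^2 - 2 * c * (ind S x * (f x * p x)) + c^2 * (ind S x * (p x)^2))"
   unfolding sq_def by (rule icong) (simp add: p2eq algebra_simps)
  also have "... = sq S f - 2 * c * T + c^2 * sq S p" unfolding sq_def T_def using i by simp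
  finally show ?thesis .
 qed
 have bQ: "b * sq S p = T" using Q unfolding b_def T_def by simp
 have "(sq S f - 2 * c * T + c^2 * sq S p) - (sq S f - 2 * b * T + b^2 * sq S p) = (c - b)^2 * sq S p"
  unfolding bQ[symmetric] by (simp add: p2eq algebra_simps)
 then show "sq S (%x. f x - b * p x) <= sq S (%x. f x - c * p x)"
  unfolding ex using mult_nonneg_nonneg[OF zero_le_power2[of "c - b"], of "sq S p"] Q by linarith
 have "(LL x. ind S x * ((f x - b * p x) * p x)) = (LL x. ind S x * (f x * p x) - b * (ind S x * (p x)^2))"
  by (rule icong) (simp add: p2eq algebra_simps)
 also have "... = T - b * sq S p" unfolding T_def sq_def using i by simp
 finally show "(LL x. ind S x * ((f x - b * p x) * p x)) = 0" using bQ by simp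
qed

text \<open>The L^2 projection onto the profile. The third coefficient is set to 0 because
  \<open>sol_minus\<close> admits only profiles with vanishing third component.\<close>

definition pb :: "real => (3 => real^3 => real) => 3 => real" where
 "pb R u k = (if k = 3 then 0 else (LL x. ind (cube R) x * (u k x * xp 1 x))/sq (cube R) (xp 1))"

definition exc :: "real => (3 => real^3 => real) => real" where
 "exc R u = mas R (%k x. u k x - pb R u k * xp 1 x)"

lemma exc_nonneg[simp]: "0 <= exc R u" by (simp add: exc_def)

lemma exc_le_mas:
 assumes u: "!!k. l2 (u k)" and R: "0 < R" "R <= 1" shows "exc R u <= mas R u"
 unfolding exc_def mas_def
proof (intro sum_mono)
 fix k
 have Q: "sq (cube R) (xp 1) > 0" unfolding xp_sq[OF R] using R k0_pos by simp
 show "sq (cube R) (%x. u k x - pb R u k * xp 1 x) <= sq (cube R) (u k)"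
  using sq_projection(1)[OF u xp_l2 cube_borel Q, of k 0] by (simp add: pb_def)
qed

lemma pb_orth:
 assumes u: "!!k. l2 (u k)" and R: "0 < R" "R <= 1" and k: "k ~= 3"
 shows "(LL x. ind (cube R) x * ((u k x - pb R u k * xp 1 x) * xp 1 x)) = 0"
proof -
 have Q: "sq (cube R) (xp 1) > 0" unfolding xp_sq[OF R] using R k0_pos by simp
 show ?thesis using sq_projection(2)[OF u xp_l2 cube_borel Q, of k] k by (simp add: pb_def)
qed

lemma pb_diff:
 assumes u: "!!k. l2 (u k)" and R: "0 < R" "R <= R'" "R' <= 1"
 shows "(pb R u k - pb R' u k)^2 * (R^5 * k0) <= 2 * exc R u + 2 * exc R' u"
proof -
 define v where "v r x = u k x - pb r u k * xp 1 x" for r x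
 have vl: "l2 (v r)" for r unfolding v_def by (intro l2_diff u l2_cmult xp_l2)
 have "(pb R u k - pb R' u k)^2 * (R^5 * k0) = sq (cube R) (%x. (pb R u k - pb R' u k) * xp 1 x)"
  unfolding sq_cmult using xp_sq[of R] R by simp
 also have "... = sq (cube R) (%x. v R' x - v R x)" by (rule sq_cong) (simp add: v_def algebra_simps)
 also have "... <= 2 * sq (cube R) (v R') + 2 * sq (cube R) (v R)" by (rule sq_diff_le[OF vl vl cube_borel])
 also have "sq (cube R) (v R') <= sq (cube R') (v R')" by (intro sq_mono vl cube_borel cube_mono R)
 also have "sq (cube R') (v R') <= exc R' u" unfolding exc_def v_def by (rule sq_le_mas)
 also have "sq (cube R) (v R) <= exc R u" unfolding exc_def v_def by (rule sq_le_mas)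
 finally show ?thesis by simp
qed

text \<open>The profile itself has mass of order R^5, so the factor 32^i turns the excess at radius
  2^-i into a squared slope.\<close>

definition EE :: "(3 => real^3 => real) => nat => real" where "EE u i = 32^i * exc (1/2^i) u"
definition bb :: "(3 => real^3 => real) => nat => 3 => real" where "bb u i k = pb (1/2^i) u k"
text \<open>The second term is sqrt (eps 2^i), the relative height of the roughness to the power
  1/2. The first decays by sqrt 2 per scale, so that going to a radius twice as large increases
  \<open>om\<close> by at most sqrt 2; hence growth 32 sqrt 2 for the blow-up.\<close>

definition om :: "real => nat => real" where "om eps i = (1/sqrt 2)^i + sqrt eps * sqrt 2^i"

lemma pow5: "((1::real)/2^i)^5 = 1/32^i"
proof -
 have "((2::real)^i)^5 = (2^5)^i" by (metis power_mult mult.commute)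
 then show ?thesis by (simp add: power_divide)
qed

lemma exc_EE: "exc (1/2^i) u = EE u i/32^i" by (simp add: EE_def)

lemma bb_step:
 assumes u: "!!k. l2 (u k)"
 shows "(bb u (Suc j) k - bb u j k)^2 <= (2 * EE u (Suc j) + 64 * EE u j)/k0"
proof -
 have "(bb u (Suc j) k - bb u j k)^2 * ((1/2^Suc j)^5 * k0) <= 2 * exc (1/2^Suc j) u + 2 * exc (1/2^j) u"
  unfolding bb_def by (rule pb_diff[OF u]) (auto simp: field_simps)
 then have "(bb u (Suc j) k - bb u j k)^2 * k0/32^Suc j <= (2 * EE u (Suc j) + 64 * EE u j)/32^Suc j"
  unfolding pow5 exc_EE by (simp add: field_simps)
 then show ?thesis using k0_pos by (simp add: divide_le_cancel pos_le_divide_eq)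
qed

lemma om_pos: "0 <= eps ==> 0 < om eps i" unfolding om_def by (intro add_pos_nonneg) auto
lemma om_le: assumes "0 <= eps" "eps * 2^i <= 1" shows "om eps i <= 2"
proof -
 have "sqrt eps * sqrt 2^i = sqrt (eps * 2^i)" by (simp add: real_sqrt_mult real_sqrt_power)
 also have "... <= 1" using assms by simp
 finally have "sqrt eps * sqrt 2^i <= 1" .
 moreover have "(1/sqrt 2)^i <= 1" by (rule power_le_one) auto
 ultimately show ?thesis unfolding om_def by linarith
qed
lemma om_Suc: assumes "0 <= eps" shows "om eps (Suc j) <= 2 * om eps j" "om eps j <= sqrt 2 * om eps (Suc j)"
proof -
 have s: "1 <= sqrt 2" "sqrt 2 <= 2" "sqrt 2 * sqrt 2 = 2" "sqrt 2 * (1/sqrt 2) = 1" using real_sqrt_le_iff[of 2 4] by auto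
 have "1/sqrt 2 <= 1/1" using s(1) by (intro divide_left_mono) auto
 then have s3: "1/sqrt 2 <= 2" by linarith
 have a: "(1/sqrt 2) * (1/sqrt 2)^j <= 2 * (1/sqrt 2)^j" "sqrt 2 * (sqrt eps * sqrt 2^j) <= 2 * (sqrt eps * sqrt 2^j)"
  using s s3 assms by (intro mult_right_mono; simp)+
 then show "om eps (Suc j) <= 2 * om eps j" unfolding om_def by (simp add: algebra_simps)
 have "sqrt eps * sqrt 2^j <= 2 * (sqrt eps * sqrt 2^j)" using assms by simp
 also have "... = sqrt 2 * (sqrt eps * sqrt 2^Suc j)" using s(3) by (metis mult.assoc mult.left_commute power_Suc)
 finally have "sqrt eps * sqrt 2^j <= sqrt 2 * (sqrt eps * sqrt 2^Suc j)" .
 moreover have "(1/sqrt 2)^j = sqrt 2 * (1/sqrt 2)^Suc j" using s(4) by (metis mult.assoc mult_1 power_Suc)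
 ultimately show "om eps j <= sqrt 2 * om eps (Suc j)" unfolding om_def distrib_left by linarith
qed

lemma om_back: assumes "0 <= eps" "m <= i" shows "om eps (i - m) <= sqrt 2^m * om eps i"
 using assms(2)
proof (induction m)
 case (Suc m)
 then have e: "Suc (i - Suc m) = i - m" by simp
 have "om eps (i - Suc m) <= sqrt 2 * om eps (i - m)" using om_Suc(2)[OF assms(1), of "i - Suc m"] unfolding e .
 also have "... <= sqrt 2 * (sqrt 2^m * om eps i)" using Suc by (intro mult_left_mono) auto
 finally show ?case by simp
qed simp

text \<open>The fourth root of 2: the ratio of consecutive bounds for the coefficients, because
  \<open>om\<close> bounds the squares of their increments.\<close>

definition qq :: real where "qq = sqrt (sqrt 2)"
lemma qq: "1 < qq" "qq^2 = sqrt 2" by (simp_all add: qq_def)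

text \<open>Starting at a given radius, the coefficients form an increasing geometric chain towards larger radii; along the whole
 range of radii the two geometric contributions of \<open>om\<close> are summable in opposite directions.\<close>
lemma chain_local:
 fixes \<beta> :: "nat => real"
 assumes st: "!!j. j < i ==> (\<beta> (Suc j) - \<beta> j)^2 <= c * om eps j" and c: "0 <= c" and e: "0 <= eps" and m: "m <= i"
 shows "(\<beta> (i - m) - \<beta> i)^2 <= c * om eps i * sqrt 2^m * (sqrt 2/(qq - 1)^2)"
proof -
 define w where "w = sqrt (c * om eps i)"
 have w0: "0 <= w" "w^2 = c * om eps i" unfolding w_def using c om_pos[OF e, of i] by auto
 have q1: "0 < qq - 1" using qq by simp
 have qp: "(qq^n)^2 = sqrt 2^n" for n unfolding qq(2)[symmetric] by (metis power_mult mult.commute)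
 have "abs(\<beta> (i - m) - \<beta> i) <= w * (qq^Suc m/(qq - 1))" using m
 proof (induction m)
  case 0 then show ?case using w0 qq by simp
 next
  case (Suc m)
  then have e1: "Suc (i - Suc m) = i - m" "i - Suc m < i" by auto
  have "(\<beta> (i - m) - \<beta> (i - Suc m))^2 <= c * om eps (i - Suc m)" using st[OF e1(2)] unfolding e1(1) .
  also have "... <= c * (sqrt 2^Suc m * om eps i)" by (intro mult_left_mono om_back c e) (use Suc in simp)
  also have "... = (w * qq^Suc m)^2" unfolding power_mult_distrib w0(2) qp by (simp add: mult_ac)
  finally have "abs(\<beta> (i - m) - \<beta> (i - Suc m))^2 <= (w * qq^Suc m)^2" by simp
  then have "abs(\<beta> (i - m) - \<beta> (i - Suc m)) <= w * qq^Suc m" by (rule power2_le_imp_le) (use w0(1) qq(1) in simp)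
  moreover have "abs(\<beta> (i - m) - \<beta> i) <= w * (qq^Suc m/(qq - 1))" using Suc by simp
  ultimately have "abs(\<beta> (i - Suc m) - \<beta> i) <= w * qq^Suc m + w * (qq^Suc m/(qq - 1))" by linarith
  also have "... = w * (qq^Suc (Suc m)/(qq - 1))" using q1 by (simp add: field_simps)
  finally show ?case .
 qed
 then have "(\<beta> (i - m) - \<beta> i)^2 <= (w * (qq^Suc m/(qq - 1)))^2"
  by (metis abs_ge_zero power2_abs power_mono)
 also have "... = c * om eps i * sqrt 2^m * (sqrt 2/(qq - 1)^2)"
  unfolding power_mult_distrib power_divide w0(2) qp by (simp add: mult_ac)
 finally show ?thesis .
qed

text \<open>The decreasing contribution is summed from the unit radius and the increasing one back
  from i; the last term of the latter is (eps 2^i)^(1/4) <= 1. Neither sum depends on i.\<close>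

lemma chain_global:
 fixes \<beta> :: "nat => real"
 assumes st: "!!j. j < i ==> (\<beta> (Suc j) - \<beta> j)^2 <= c * om eps j" and c: "0 <= c" and e: "0 <= eps" "eps * 2^i <= 1"
 shows "abs(\<beta> i - \<beta> 0) <= sqrt c * ((qq + 1)/(qq - 1))"
proof -
 have q1: "0 < qq - 1" "0 < qq" using qq by auto
 define d where "d = sqrt (sqrt eps)"
 have d0: "0 <= d" unfolding d_def using e by simp
 have so: "sqrt (om eps j) <= (1/qq)^j + d * qq^j" for j
 proof -
  have "sqrt (om eps j) <= sqrt ((1/sqrt 2)^j) + sqrt (sqrt eps * sqrt 2^j)" unfolding om_def using e by (intro sqrt_add_le_add_sqrt) auto
  also have "... = (1/qq)^j + d * qq^j" by (simp add: d_def qq_def real_sqrt_mult real_sqrt_power real_sqrt_divide)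
  finally show ?thesis .
 qed
 have dq: "d * qq^i <= 1"
 proof -
  have "d * qq^i = sqrt (sqrt (eps * 2^i))" by (simp add: d_def qq_def real_sqrt_mult real_sqrt_power)
  also have "... <= 1" using e by simp
  finally show ?thesis .
 qed
 have "abs(\<beta> i - \<beta> 0) = abs(\<Sum>j<i. \<beta> (Suc j) - \<beta> j)" unfolding sum_lessThan_telescope ..
 also have "... <= (\<Sum>j<i. abs(\<beta> (Suc j) - \<beta> j))" by (rule sum_abs)
 also have "... <= (\<Sum>j<i. sqrt c * ((1/qq)^j + d * qq^j))"
 proof (rule sum_mono)
  fix j assume "j \<in> {..<i}"
  then have "abs(\<beta> (Suc j) - \<beta> j) <= sqrt (c * om eps j)" using st[of j] by (intro real_le_rsqrt) simp
  also have "... <= sqrt c * ((1/qq)^j + d * qq^j)" unfolding real_sqrt_mult using so c by (intro mult_left_mono) auto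
  finally show "abs(\<beta> (Suc j) - \<beta> j) <= sqrt c * ((1/qq)^j + d * qq^j)" .
 qed
 also have "... = sqrt c * ((\<Sum>j<i. (1/qq)^j) + d * (\<Sum>j<i. qq^j))" by (simp add: sum_distrib_left sum.distrib distrib_left)
 also have "... <= sqrt c * (qq/(qq - 1) + 1/(qq - 1))"
 proof (intro mult_left_mono add_mono)
  have "(\<Sum>j<i. (1/qq)^j) = (1 - (1/qq)^i)/(1 - 1/qq)" using qq by (subst sum_gp_strict) auto
  also have "... <= 1/(1 - 1/qq)" using q1 by (intro divide_right_mono) auto
  also have "... = qq/(qq - 1)" using q1 by (simp add: field_simps)
  finally show "(\<Sum>j<i. (1/qq)^j) <= qq/(qq - 1)" .
  have "(\<Sum>j<i. qq^j) = (qq^i - 1)/(qq - 1)" using qq by (subst geometric_sum) auto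
  then have "d * (\<Sum>j<i. qq^j) = (d * qq^i - d)/(qq - 1)" by (simp add: right_diff_distrib)
  also have "... <= 1/(qq - 1)" using q1 dq d0 by (intro divide_right_mono) auto
  finally show "d * (\<Sum>j<i. qq^j) <= 1/(qq - 1)" .
 qed (use c in auto)
 also have "... = sqrt c * ((qq + 1)/(qq - 1))" by (simp add: add_divide_distrib)
 finally show ?thesis .
qed

text \<open>Maximizing E/w keeps the lower bound n and adds the comparison with all smaller indices,
  that is, with all larger radii. The latter controls the blow-up at infinity.\<close>

lemma pick_maximal_ratio:
 fixes E w :: "nat => real"
 assumes w: "!!j. w j > 0" and I: "n * w I < E I"
 shows "\<exists>i\<le>I. n * w i < E i & (\<forall>j\<le>i. E j * w i <= E i * w j)"
proof -
 define m where "m = Max ((%j. E j/w j) ` {..I})"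
 have "m \<in> (%j. E j/w j) ` {..I}" unfolding m_def by (rule Max_in) auto
 then obtain i where i: "i <= I" "m = E i/w i" by auto
 have le: "E j/w j <= E i/w i" if "j <= I" for j unfolding i(2)[symmetric] m_def using that by (intro Max_ge) auto
 have "n < E I/w I" using I w by (simp add: pos_less_divide_eq)
 then have "n < E i/w i" using le[of I] by simp
 then have "n * w i < E i" using w[of i] by (simp add: pos_less_divide_eq)
 moreover have "E j * w i <= E i * w j" if "j <= i" for j
  using le[of j] that i(1) w[of i] w[of j] by (simp add: field_simps)
 ultimately show ?thesis using i(1) by blast
qed

section \<open>Blow-up at the radius of maximal ratio\<close>

definition adm :: "real => (real^2 => real) => (3 => real^3 => real) => real => bool" where
 "adm M g u eps \<longleftrightarrow> (\<exists>G. sol 1 g u G (%_ _ _. 0)) & lipg M g & (\<forall>y. - eps <= g y & g y <= 0) & 0 < eps & mas 1 u <= 1"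

lemma adm_l2: "adm M g u eps ==> l2 (u k)" unfolding adm_def using solD(1) by blast

text \<open>In \<open>CB\<close> the 8 = 2 * 4 comes from the unit radius and 136 = 2 * 68 from the
  chain of increments; in \<open>CG\<close> below, 408 = 2 * 3 * 68 collects the three
  components.\<close>

definition CB :: real where "CB = (8 + 136 * ((qq + 1)/(qq - 1))^2)/k0"
definition CG :: real where "CG = 2 + 408 * (sqrt 2/(qq - 1)^2)"

text \<open>The first bound will control the flux, the second the growth of the rescaled solution.
  The number 68 = 2 * 2 + 64 combines \<open>bb_step\<close> with the doubling of
  \<open>om\<close>.\<close>

lemma bb_bounds:
 assumes a: "adm M g u eps" and N: "1 <= N" "!!j. j <= i ==> EE u j <= N * om eps j" and i: "eps * 2^i <= 1"
 shows "(bb u i k)^2 <= CB * N"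
  "m <= i ==> k0 * (bb u (i - m) k - bb u i k)^2 <= 68 * (N * om eps i) * sqrt 2^m * (sqrt 2/(qq - 1)^2)"
proof -
 have u: "l2 (u k)" for k using adm_l2[OF a] .
 have e: "0 <= eps" using a by (simp add: adm_def)
 have st: "(bb u (Suc j) k - bb u j k)^2 <= (68 * N/k0) * om eps j" if "j < i" for j
 proof -
  have "2 * EE u (Suc j) + 64 * EE u j <= 2 * (N * om eps (Suc j)) + 64 * (N * om eps j)" using N(2)[of "Suc j"] N(2)[of j] that by simp
  also have "... <= 2 * (N * (2 * om eps j)) + 64 * (N * om eps j)" using om_Suc(1)[OF e, of j] N(1) by simp
  finally have "2 * EE u (Suc j) + 64 * EE u j <= 68 * N * om eps j" by simp
  then have "(2 * EE u (Suc j) + 64 * EE u j)/k0 <= 68 * N * om eps j/k0" using k0_pos by (intro divide_right_mono) auto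
  then show ?thesis using bb_step[where u = u, OF u, of j k] by simp
 qed
 have c0: "0 <= 68 * N/k0" using N(1) k0_pos by simp
 show "k0 * (bb u (i - m) k - bb u i k)^2 <= 68 * (N * om eps i) * sqrt 2^m * (sqrt 2/(qq - 1)^2)" if "m <= i"
 proof -
  have "k0 * (bb u (i - m) k - bb u i k)^2 <= k0 * ((68 * N/k0) * om eps i * sqrt 2^m * (sqrt 2/(qq - 1)^2))"
   using chain_local[of i "%j. bb u j k", OF st c0 e that] k0_pos by (intro mult_left_mono) auto
  then show ?thesis using k0_pos by (simp add: mult_ac)
 qed
 have b0: "(bb u 0 k)^2 * k0 <= 4"
 proof -
  have "(bb u 0 k)^2 * k0 = sq (cube 1) (%x. pb 1 u k * xp 1 x)" unfolding sq_cmult k0_def by (simp add: bb_def)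
  also have "... = sq (cube 1) (%x. u k x - (u k x - pb 1 u k * xp 1 x))" by simp
  also have "... <= 2 * sq (cube 1) (u k) + 2 * sq (cube 1) (%x. u k x - pb 1 u k * xp 1 x)"
   by (intro sq_diff_le u l2_diff l2_cmult xp_l2 cube_borel)
  also have "sq (cube 1) (u k) <= mas 1 u" by (rule sq_le_mas)
  also have "sq (cube 1) (%x. u k x - pb 1 u k * xp 1 x) <= exc 1 u" unfolding exc_def by (rule sq_le_mas)
  also have "exc 1 u <= mas 1 u" by (rule exc_le_mas[where u = u, OF u]) auto
  finally show ?thesis using a by (simp add: adm_def)
 qed
 have "abs(bb u i k - bb u 0 k) <= sqrt (68 * N/k0) * ((qq + 1)/(qq - 1))"
  by (rule chain_global[of i "%j. bb u j k", OF st c0 e i])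
 then have "abs(bb u i k - bb u 0 k)^2 <= (sqrt (68 * N/k0) * ((qq + 1)/(qq - 1)))^2" by (intro power_mono) auto
 then have d: "(bb u i k - bb u 0 k)^2 <= (68 * N/k0) * ((qq + 1)/(qq - 1))^2" using c0 by (simp only: power_mult_distrib real_sqrt_pow2 power2_abs)
 have "(bb u i k)^2 <= 2 * (bb u i k - bb u 0 k)^2 + 2 * (bb u 0 k)^2"
 proof -
  have "2 * (x - y)^2 + 2 * y^2 - x^2 = (x - 2 * y)^2" for x y :: real by (simp add: p2eq algebra_simps)
  then show ?thesis using zero_le_power2[of "bb u i k - 2 * bb u 0 k"] by (smt (verit))
 qed
 also have "... <= 2 * ((68 * N/k0) * ((qq + 1)/(qq - 1))^2) + 2 * (4 * N/k0)"
 proof -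
  have "(bb u 0 k)^2 <= 4/k0" using b0 k0_pos by (simp add: pos_le_divide_eq)
  also have "... <= 4 * N/k0" using N(1) k0_pos by (intro divide_right_mono) auto
  finally show ?thesis using d by linarith
 qed
 also have "... = CB * N" unfolding CB_def by (simp add: add_divide_distrib algebra_simps)
 finally show "(bb u i k)^2 <= CB * N" .
qed

text \<open>At the larger radius 2^(m - i) the profile of radius 2^-i is not optimal; the price is
  the difference of the two coefficients, measured in the mass of the profile.\<close>

lemma mas_minus:
 assumes u: "!!k. l2 (u k)" and m: "m <= i"
 shows "mas (1/2^(i - m)) (%k x. u k x - bb u i k * xp 1 x) <= (2 * EE u (i - m) + 2 * (S3 k. k0 * (bb u (i - m) k - bb u i k)^2))/32^(i - m)"
proof -
 define r :: real where "r = 1/2^(i - m)"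
 have r: "0 < r" "r <= 1" by (auto simp: r_def)
 have "sq (cube r) (%x. u k x - bb u i k * xp 1 x) <= 2 * sq (cube r) (%x. u k x - bb u (i - m) k * xp 1 x) + 2 * (k0 * (bb u (i - m) k - bb u i k)^2/32^(i - m))" for k
 proof -
  have "sq (cube r) (%x. u k x - bb u i k * xp 1 x) = sq (cube r) (%x. (u k x - bb u (i - m) k * xp 1 x) + (bb u (i - m) k - bb u i k) * xp 1 x)"
   by (rule sq_cong) (simp add: algebra_simps)
  also have "... <= 2 * sq (cube r) (%x. u k x - bb u (i - m) k * xp 1 x) + 2 * sq (cube r) (%x. (bb u (i - m) k - bb u i k) * xp 1 x)"
   by (intro sq_add_le l2_diff l2_cmult u xp_l2 cube_borel)
  also have "sq (cube r) (%x. (bb u (i - m) k - bb u i k) * xp 1 x) = k0 * (bb u (i - m) k - bb u i k)^2/32^(i - m)"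
   unfolding sq_cmult xp_sq[OF r] unfolding r_def pow5 by simp
  finally show ?thesis .
 qed
 then have "mas r (%k x. u k x - bb u i k * xp 1 x) <= (S3 k. 2 * sq (cube r) (%x. u k x - bb u (i - m) k * xp 1 x) + 2 * (k0 * (bb u (i - m) k - bb u i k)^2/32^(i - m)))"
  unfolding mas_def by (rule sum_mono)
 also have "... = 2 * exc r u + 2 * ((S3 k. k0 * (bb u (i - m) k - bb u i k)^2)/32^(i - m))"
  by (simp add: sum.distrib sum_distrib_left sum_divide_distrib exc_def mas_def bb_def r_def)
 also have "... = (2 * EE u (i - m) + 2 * (S3 k. k0 * (bb u (i - m) k - bb u i k)^2))/32^(i - m)"
  unfolding r_def exc_EE by (simp add: add_divide_distrib)
 finally show ?thesis unfolding r_def .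
qed

text \<open>Everything the compactness argument needs about one rescaled solution: slow growth up to
  its own radius, flux of order n^(-1/4) in L^2, unit mass, and orthogonality to the
  profile.\<close>

definition zoomed where
 "zoomed M n i dl g z G F \<longleftrightarrow> sol (2^i) g z G F & lipg M g & (\<forall>y. - dl <= g y & g y <= 0) &
  (\<forall>k j. \<forall>x\<in>HC (2^i). F k j x = 0) & (\<forall>k. rep (2^i) (z k)) & (\<forall>m\<le>i. mas (2^m) z <= CG * (32 * sqrt 2)^m) &
  (\<forall>m. enr (2^m) F <= 12 * CB * 4^m/sqrt n) & mas 1 z = 1 &
  (\<forall>k. k ~= 3 --> (LL x. ind (cube 1) x * (z k x * xp 1 x)) = 0)"

text \<open>With N = E/om the maximality says that all larger radii satisfy
  \<open>EE u j <= N * om eps j\<close>, which feeds \<open>bb_bounds\<close>. Passing to the mean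
  value representative changes the solution only on a null set, so mass and orthogonality carry
  over.\<close>

lemma zoom:
 assumes a: "adm M g u eps" and n: "1 <= n" "n * om eps i < EE u i" "n * eps * 2^i <= 1"
  and mx: "!!j. j <= i ==> EE u j * om eps i <= EE u i * om eps j"
 shows "\<exists>g' z G' F'. zoomed M n i (eps * 2^i) g' z G' F'"
proof -
 have u: "l2 (u k)" for k using adm_l2[OF a] .
 have e: "0 < eps" "lipg M g" "!!y. - eps <= g y" "!!y. g y <= 0" using a by (auto simp: adm_def)
 obtain G where G: "sol 1 g u G (%_ _ _. 0)" using a by (auto simp: adm_def)
 have e1: "eps * 2^i <= 1"
 proof -
  have "1 * (eps * 2^i) <= n * (eps * 2^i)" using n(1) e(1) by (intro mult_right_mono) auto
  then show ?thesis using n(3) by (simp add: mult.assoc)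
 qed
 define E where "E = EE u i"
 define N where "N = E/om eps i"
 have op: "om eps j > 0" for j using om_pos e(1) by simp
 have N: "n <= N" "N * om eps i = E" using n(2) op[of i] by (simp_all add: N_def E_def pos_le_divide_eq)
 have N1: "1 <= N" using N(1) n(1) by simp
 have E0: "E > 0" using N1 N(2) op[of i] by (metis mult_pos_pos less_le_trans zero_less_one)
 have EN: "EE u j <= N * om eps j" if "j <= i" for j
 proof -
  have "EE u j * om eps i/om eps i <= E * om eps j/om eps i" using mx[OF that] op[of i] unfolding E_def by (intro divide_right_mono) auto
  then show ?thesis using op[of i] by (simp add: N_def)
 qed
 define b where "b = bb u i"
 have b3: "b 3 = 0" by (simp add: b_def bb_def pb_def)
 define r :: real where "r = 1/2^i"
 have r: "0 < r" "r <= 1" by (auto simp: r_def)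
 \<comment> \<open>Chosen so that \<open>lam^2/r^3 = 32^i/E\<close>, which normalizes the excess to
   mass 1 on the unit cube.\<close>
 define lam where "lam = 2^i/sqrt E"
 have lam2: "lam^2 = 4^i/E" using E0 by (simp add: lam_def power_divide power_mult_distrib[symmetric] p2eq)
 have p8: "r^3 = 1/8^i"
 proof -
  have "((2::real)^i)^3 = (2^3)^i" by (metis power_mult mult.commute)
  then show ?thesis by (simp add: r_def power_divide)
 qed
 have lr: "lam^2/r^3 = 32^i/E" unfolding lam2 p8 by (simp add: power_mult_distrib[symmetric])
 define v where "v k x = u k x - b k * xp 1 x" for k x
 have vl: "l2 (v k)" for k unfolding v_def by (intro l2_diff u l2_cmult xp_l2)
 define g' where "g' y = g (r *R y)/r" for y
 define z where "z k x = lam * v k (r *R x)" for k x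
 define G' where "G' k j x = lam * r * (G k j (r *R x) - b k * (if j = 3 then xd 1 (r *R x) else 0))" for k j x
 define F' where "F' k j x = lam * r * (0 + b k * (if j = 3 then xs 1 eps (r *R x) else 0))" for k j :: 3 and x
 have s0: "sol (1/r) g' z G' F'"
  using sol_scale[OF sol_minus[where a = b, OF G e(3,4) b3] r(1), of lam] unfolding g'_def[abs_def] z_def[abs_def] v_def G'_def[abs_def] F'_def[abs_def] .
 then have s: "sol (2^i) g' z G' F'" by (simp add: r_def)
 have mz: "mas (2^m) z = 32^i/E * mas (1/2^(i - m)) v" if "m <= i" for m
 proof -
  have "r * 2^m = 1/2^(i - m)" using that by (simp add: r_def power_diff)
  then show ?thesis unfolding mas_def z_def[abs_def] sq_scale[OF r(1)] lr by (simp add: sum_distrib_left)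
 qed
 have mz1: "mas 1 z = 1"
  using mz[of 0] E0 exc_EE[of i u] by (simp add: exc_def v_def[abs_def] b_def bb_def E_def)
 have mzm: "mas (2^m) z <= CG * (32 * sqrt 2)^m" if m: "m <= i" for m
 proof -
  define D where "D = sqrt 2/(qq - 1)^2"
  have "(\<Sum>k\<in>(UNIV::3 set). k0 * (bb u (i - m) k - bb u i k)^2) <= (\<Sum>k\<in>(UNIV::3 set). 68 * E * sqrt 2^m * D)"
   using bb_bounds(2)[OF a N1 EN e1 m] unfolding N(2) D_def by (intro sum_mono) auto
  then have 1: "(\<Sum>k\<in>(UNIV::3 set). k0 * (bb u (i - m) k - bb u i k)^2) <= 204 * E * sqrt 2^m * D" by (simp add: sum_3)
  have "EE u (i - m) <= N * om eps (i - m)" by (rule EN) simp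
  also have "... <= N * (sqrt 2^m * om eps i)" using om_back[of eps m i] e(1) m N1 by (intro mult_left_mono) auto
  also have "... = E * sqrt 2^m" using N(2) by (simp add: mult_ac)
  finally have 2: "EE u (i - m) <= E * sqrt 2^m" .
  have "mas (1/2^(i - m)) v <= (2 * EE u (i - m) + 2 * (S3 k. k0 * (bb u (i - m) k - bb u i k)^2))/32^(i - m)"
   unfolding v_def[abs_def] b_def by (rule mas_minus[where u = u, OF u m])
  also have "... <= (2 * (E * sqrt 2^m) + 2 * (204 * E * sqrt 2^m * D))/32^(i - m)"
   using 1 2 by (intro divide_right_mono add_mono mult_left_mono) auto
  also have "... = E * CG * sqrt 2^m/32^(i - m)" unfolding CG_def D_def by (simp add: algebra_simps)
  finally have "mas (2^m) z <= 32^i/E * (E * CG * sqrt 2^m/32^(i - m))" unfolding mz[OF m] using E0 by (intro mult_left_mono) auto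
  also have "... = CG * sqrt 2^m * (32^i/32^(i - m))" using E0 by simp
  also have "(32::real)^i/32^(i - m) = 32^m" using m by (simp add: power_diff)
  finally show ?thesis by (simp add: power_mult_distrib mult_ac)
 qed
 have g'b: "- (eps * 2^i) <= g' y" "g' y <= 0" for y
  using e(3)[of "r *R y"] e(4)[of "r *R y"] by (auto simp: g'_def r_def mult_right_mono mult_nonpos_nonneg)
   (metis mult_right_mono mult_minus_left zero_le_numeral zero_le_power)
 have F0: "F' k j x = 0" if "x \<in> HC (2^i)" for k j x
 proof -
  have "0 < (r *R x)$3" using that r by (simp add: HC_def)
  then show ?thesis by (simp add: F'_def xs_def)
 qed
 have FE: "enr (2^m) F' <= 12 * CB * 4^m/sqrt n" for m
 proof -
  define t where "t = 4 * (2^m/2^i)^2 * eps"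
  have xsb: "sq (cube (r * 2^m)) (xs 1 eps) <= t"
  proof -
   define S where "S = cube (r * 2^m) \<inter> {x::real^3. - eps <= x$3 & x$3 <= 0}"
   have S: "l2 (ind S)" "sq UNIV (ind S) <= 4 * (r * 2^m)^2 * (0 - (- eps))"
    unfolding S_def using slab_measure[of "r * 2^m" "- eps" 0] r e(1) by auto
   have "sq (cube (r * 2^m)) (xs 1 eps) <= sq (cube (r * 2^m)) (ind S)"
    by (rule sq_le[OF xs_l2 S(1) cube_borel]) (auto simp: xs_def S_def indicator_def)
   also have "... <= sq UNIV (ind S)" by (intro sq_mono S) auto
   also have "... <= t" using S(2) by (simp add: t_def r_def)
   finally show ?thesis .
  qed
  have t0: "0 <= t" unfolding t_def using e(1) by simp
  have F'eq: "F' k j = (%x. (if j = 3 then lam * r * b k else 0) * xs 1 eps (r *R x))" for k j by (auto simp: F'_def fun_eq_iff)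
  have "enr (2^m) F' = (S3 k. (lam * r * b k)^2/r^3 * sq (cube (r * 2^m)) (xs 1 eps))"
   unfolding enr_def F'eq sq_scale[OF r(1)] by (simp add: sum_3)
  also have "... <= (\<Sum>k\<in>(UNIV::3 set). (8^i/E * (CB * N)) * t)"
  proof (rule sum_mono)
   fix k :: 3
   have "(lam * r * b k)^2/r^3 = 8^i/E * (b k)^2"
    unfolding power_mult_distrib lam2 p8 by (simp add: r_def power_divide power_mult_distrib[symmetric] p2eq)
   also have "... <= 8^i/E * (CB * N)" using bb_bounds(1)[OF a N1 EN e1, of k] E0 unfolding b_def by (intro mult_left_mono) auto
   finally have 1: "(lam * r * b k)^2/r^3 <= 8^i/E * (CB * N)" .
   moreover have "0 <= (lam * r * b k)^2/r^3" using r by simp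
   ultimately show "(lam * r * b k)^2/r^3 * sq (cube (r * 2^m)) (xs 1 eps) <= (8^i/E * (CB * N)) * t"
    by (intro mult_mono xsb t0) auto
  qed
  also have "... = 12 * CB * 4^m * ((eps * 2^i) * (N/E))"
  proof -
   have "8^i * (2^m/2^i)^2 = 4^m * (2::real)^i"
   proof -
    have "(8::real)^i = (2^i)^2 * 2^i" by (simp add: p2eq power_mult_distrib[symmetric])
    moreover have "((2::real)^m)^2 = 4^m" by (simp add: p2eq power_mult_distrib[symmetric])
    ultimately show ?thesis by (simp add: power_divide)
   qed
   then have "8^i/E * (CB * N) * t = 4 * (4^m * 2^i) * eps * CB * N/E" unfolding t_def by (simp add: mult_ac)
   then show ?thesis by (simp add: sum_3 mult_ac)
  qed
  also have "... <= 12 * CB * 4^m * (1/sqrt n)"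
  proof (rule mult_left_mono)
   \<comment> \<open>The squared coefficients are of order N, and N/E = 1/om <= 1/q, so the square
     norm of the flux is of order q^2/q = q. The second term of \<open>om\<close> is made for this
     estimate.\<close>
   define q where "q = sqrt (eps * 2^i)"
   have q: "0 < q" "q^2 = eps * 2^i" unfolding q_def using e(1) by auto
   have "q = sqrt eps * sqrt 2^i" by (simp add: q_def real_sqrt_mult real_sqrt_power)
   then have "q <= om eps i" by (simp add: om_def)
   then have "N/E <= 1/q" using N(2) N1 op[of i] q(1) E0 by (simp add: N_def field_simps)
   then have "(eps * 2^i) * (N/E) <= q^2 * (1/q)" unfolding q(2)[symmetric] by (intro mult_left_mono) auto
   also have "... = q" using q(1) by (simp add: p2eq)
   also have "q <= sqrt (1/n)" unfolding q_def using n(1,3) by (intro real_sqrt_le_mono) (simp add: field_simps)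
   also have "... = 1/sqrt n" by (simp add: real_sqrt_divide)
   finally show "(eps * 2^i) * (N/E) <= 1/sqrt n" .
   show "0 <= 12 * CB * 4^m" unfolding CB_def using k0_pos by simp
  qed
  finally show ?thesis by simp
 qed
 obtain z' where z': "!!k. AE3 x. z k x = z' k x" "sol (2^i) g' z' G' F'" "!!k. rep (2^i) (z' k)"
  using rep_exists[OF _ s g'b(2) F0] by auto
 have mm: "mas q z' = mas q z" for q
 proof -
  have "AE3 x. x \<in> cube q --> z' k x = z k x" for k using z'(1)[of k] by eventually_elim simp
  then show ?thesis unfolding mas_def by (intro sum.cong refl sq_cong_AE solD(1)[OF s] solD(1)[OF z'(2)] cube_borel)
 qed
 have orth: "(LL x. ind (cube 1) x * (z' k x * xp 1 x)) = 0" if k: "k ~= 3" for k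
 proof -
  have ml: "l2 (%x. ind (cube 1) x * xp 1 x)" by (intro l2_indicator xp_l2 cube_borel)
  have "(LL x. ind (cube 1) x * (z' k x * xp 1 x)) = (LL x. ind (cube 1) x * (z k x * xp 1 x))"
  proof (rule integral_cong_AE)
   show "AE3 x. ind (cube 1) x * (z' k x * xp 1 x) = ind (cube 1) x * (z k x * xp 1 x)" using z'(1)[of k] by eventually_elim simp
   note [measurable] = l2_meas[OF solD(1)[OF z'(2)]] l2_meas[OF solD(1)[OF s]] l2_meas[OF xp_l2]
   show "(%x. ind (cube 1) x * (z' k x * xp 1 x)) \<in> borel_measurable lborel" "(%x. ind (cube 1) x * (z k x * xp 1 x)) \<in> borel_measurable lborel" by measurable
  qed
  also have "... = (LL x. (lam/r) * (ind (cube r) (r *R x) * (v k (r *R x) * xp 1 (r *R x))))"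
  proof (rule icong)
   fix x
   have "x \<in> cube 1 \<longleftrightarrow> r *R x \<in> cube r" using r(1) by (simp add: cube_def abs_mult)
   moreover have "xp 1 (r *R x) = r * xp 1 x" if "x \<in> cube 1"
   proof -
    have "r *R x \<in> cube r" using that r(1) by (simp add: cube_def abs_mult)
    then have "r *R x \<in> cube 1" using cube_mono[OF r(2)] by blast
    then show ?thesis using that r by (auto simp: xp_def max_def zero_le_mult_iff)
   qed
   ultimately show "ind (cube 1) x * (z k x * xp 1 x) = (lam/r) * (ind (cube r) (r *R x) * (v k (r *R x) * xp 1 (r *R x)))"
    using r(1) by (auto simp: indicator_def z_def)
  qed
  also have "... = (lam/r) * ((LL x. ind (cube r) x * (v k x * xp 1 x))/r^3)"
   using integral_affine3[of r "%x. ind (cube r) x * (v k x * xp 1 x)" 0] r(1) by simp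
  also have "(LL x. ind (cube r) x * (v k x * xp 1 x)) = 0"
   using pb_orth[where u = u, OF u r k] by (simp add: v_def b_def bb_def r_def)
  finally show ?thesis by simp
 qed
 show ?thesis unfolding zoomed_def
  by (intro exI[of _ g'] exI[of _ z'] exI[of _ G'] exI[of _ F'] conjI allI impI ballI)
   (use z' g'b lipg_scale[OF e(2) r(1)] F0 FE mm mz1 mzm orth in \<open>auto simp: g'_def[abs_def]\<close>)
qed

text \<open>The mass is at most 1, so \<open>EE u i <= 32^i\<close>, while the first term of
  \<open>om\<close> bounds the left side below by n 2^(-i/2). Hence n < 64^i, which forces the radii
  of the counterexamples to tend to zero.\<close>

lemma blowup_element:
 assumes a: "adm M g u eps" and n: "1 <= n" "n * om eps I < EE u I" "n * eps * 2^I <= 1"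
 shows "\<exists>i dl g' z G' F'. n < 64^i & n * dl <= 1 & zoomed M n i dl g' z G' F'"
proof -
 have e: "0 < eps" "mas 1 u <= 1" and u: "l2 (u k)" for k using a adm_l2[OF a] by (auto simp: adm_def)
 obtain i where i: "i <= I" "n * om eps i < EE u i" "!!j. j <= i ==> EE u j * om eps i <= EE u i * om eps j"
  using pick_maximal_ratio[of "om eps" n I "EE u"] om_pos e(1) n(2) by (meson less_imp_le)
 have "n * eps * 2^i <= n * eps * 2^I" using n(1) e(1) i(1) by (intro mult_left_mono power_increasing) auto
 then have ni: "n * eps * 2^i <= 1" using n(3) by linarith
 have "n < 64^i"
 proof -
  have "exc (1/2^i) u <= mas (1/2^i) u" by (rule exc_le_mas[where u = u, OF u]) auto
  also have "... <= mas 1 u" by (rule mas_mono[OF u]) simp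
  finally have "EE u i <= 32^i" unfolding EE_def using e(2) by simp
  moreover have "n * (1/sqrt 2)^i <= n * om eps i" unfolding om_def using n(1) e(1) by (intro mult_left_mono) auto
  ultimately have "n * (1/sqrt 2)^i < 32^i" using i(2) by linarith
  then have "n * (1/sqrt 2)^i * sqrt 2^i < 32^i * sqrt 2^i" by (intro mult_strict_right_mono) auto
  moreover have "(1/sqrt 2)^i * sqrt 2^i = 1" by (simp add: power_mult_distrib[symmetric])
  ultimately have "n < 32^i * sqrt 2^i" by (simp add: mult.assoc)
  also have "... <= 32^i * 2^i" using real_sqrt_le_iff[of 2 4] by (intro mult_left_mono power_mono) auto
  also have "... = 64^i" by (simp add: power_mult_distrib[symmetric])
  finally show ?thesis .
 qed
 moreover have "n * (eps * 2^i) <= 1" using ni by (simp add: mult.assoc)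
 ultimately show ?thesis using zoom[OF a n(1) i(2) ni i(3)] by blast
qed

text \<open>Counterexamples with constants n = 1, 2, ... are rescaled; the limit lives on the whole
  half space because i tends to infinity, and over a flat boundary without flux because
  \<open>dl\<close> and F tend to zero. The growth bound survives the limit, so the Liouville
  theorem applies.\<close>

lemma excess_bound:
 assumes M: "0 <= M"
 shows "\<exists>N\<ge>1. \<forall>g u eps i. adm M g u eps & N * eps * 2^i <= 1 --> EE u i <= N * om eps i"
proof (rule ccontr)
 assume "~?thesis"
 then have neg: "\<exists>g u eps i. adm M g u eps & N * eps * 2^i <= 1 & N * om eps i < EE u i" if "N >= 1" for N using that by (meson not_le)
 define n where "n m = real (Suc m)" for m
 have n1: "1 <= n m" for m by (simp add: n_def)
 have "\<exists>i dl g' z G' F'. n m < 64^i & n m * dl <= 1 & zoomed M (n m) i dl g' z G' F'" for m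
  using neg[OF n1[of m]] blowup_element[OF _ n1[of m]] by blast
 then obtain i dl g z G F where **: "!!m. n m < 64^i m & n m * dl m <= 1 & zoomed M (n m) (i m) (dl m) (g m) (z m) (G m) (F m)"
  by metis
 have *: "n m < 64^i m" "n m * dl m <= 1" "sol (2^i m) (g m) (z m) (G m) (F m)"
  "lipg M (g m)" "- dl m <= g m y" "g m y <= 0" "x \<in> HC (2^i m) ==> F m k l x = 0"
  "rep (2^i m) (z m k)" "j <= i m ==> mas (2^j) (z m) <= CG * (32 * sqrt 2)^j"
  "enr (2^j) (F m) <= 12 * CB * 4^j/sqrt (n m)" "mas 1 (z m) = 1"
  "k ~= 3 ==> (LL x. ind (cube 1) x * (z m k x * xp 1 x)) = 0" for m y x k l j
  using **[of m] unfolding zoomed_def by blast+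
 have zl: "l2 (z m k)" for m k using solD(1)[OF *(3)] .
 have il: "filterlim i at_top sequentially"
  unfolding filterlim_at_top eventually_sequentially
 proof (intro allI exI impI)
  fix B m :: nat assume "64^B <= m"
  then have "(64::real)^B <= real m" by (metis of_nat_le_iff of_nat_numeral of_nat_power)
  then have "(64::real)^B < 64^i m" using *(1)[of m] unfolding n_def of_nat_Suc by linarith
  then show "B <= i m" by simp
 qed
 have inv: "(%m. 1/n m) ~~> 0" using LIMSEQ_inverse_real_of_nat by (simp add: n_def inverse_eq_divide)
 have dpos: "0 <= dl m" for m using *(5)[of m 0] *(6)[of m 0] by linarith
 have dl: "dl ~~> 0"
 proof (rule Lim_null_comparison[OF _ inv])
  have "norm (dl m) <= 1/n m" for m using *(2)[of m] dpos[of m] n1[of m] by (simp add: field_simps)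
  then show "EV m. norm (dl m) <= 1/n m" by simp
 qed
 have Fl: "(%m. enr (2^l) (F m)) ~~> 0" for l
 proof (rule Lim_null_comparison)
  show "EV m. norm (enr (2^l) (F m)) <= 12 * CB * 4^l * sqrt (1/n m)" using *(10) by (simp add: real_sqrt_divide)
  show "(%m. 12 * CB * 4^l * sqrt (1/n m)) ~~> 0" using tendsto_mult[OF tendsto_const tendsto_real_sqrt[OF inv]] by simp
 qed
 have "\<exists>sg w. strict_mono sg & gsol w & (\<forall>j k. (%m. sq (cube (2^j)) (%x. z (sg m) k x - hz j w k x)) ~~> 0)"
  by (rule compactness[OF M *(3-6) dl *(7) il *(9) Fl *(8)])
 then obtain sg w where sg: "strict_mono sg" and w: "gsol w" and L: "!!j k. (%m. sq (cube (2^j)) (%x. z (sg m) k x - hz j w k x)) ~~> 0" by blast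
 have wl: "l2 (hz j w k)" for j k by (rule gsol_l2[OF w])
 have wb: "sq (cube (2^j)) (hz j w k) <= CG * (32 * sqrt 2)^j" for j k
 proof (rule sq_le_limit[OF wl cube_borel])
  fix e :: real assume "e > 0"
  have "EV m. j <= i (sg m)" using filterlim_compose[OF il filterlim_subseq[OF sg]] by (simp add: filterlim_at_top)
  then have "EV m. sq (cube (2^j)) (z (sg m) k) <= CG * (32 * sqrt 2)^j"
  proof eventually_elim
   case (elim m)
   then show ?case using *(9)[of j "sg m"] sq_le_mas[of "2^j" "z (sg m)" k] by linarith
  qed
  moreover have "EV m. sq (cube (2^j)) (%x. z (sg m) k x - hz j w k x) < e" by (rule order_tendstoD(2)[OF L \<open>e > 0\<close>])
  ultimately have "EV m. l2 (z (sg m) k) & sq (cube (2^j)) (z (sg m) k) <= CG * (32 * sqrt 2)^j & sq (cube (2^j)) (%x. z (sg m) k x - hz j w k x) < e"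
   by eventually_elim (simp add: zl)
  then show "\<exists>E. l2 E & sq (cube (2^j)) E <= CG * (32 * sqrt 2)^j & sq (cube (2^j)) (%x. E x - hz j w k x) < e"
   by (auto simp: eventually_sequentially)
 qed
 have "mas (2^j) (hz j w) <= (3 * CG) * (32 * sqrt 2)^j" for j
  unfolding mas_def using wb[of j 1] wb[of j 2] wb[of j 3] by (simp add: sum_3)
 moreover have "0 <= 3 * CG" by (simp add: CG_def)
 ultimately have gr: "growth (32 * sqrt 2) w" unfolding growth_def by blast
 obtain a where a: "a 3 = 0" "!!k x. 0 < x$3 ==> w k x = a k * x$3" using liouville[OF w gr] by blast
 have hx: "hz 0 w k x = a k * xp 1 x" for k x by (rule hz_linear[OF w a(2)])
 have xi: "ind (cube 1) x * xp 1 x = xp 1 x" for x by (simp add: xp_def indicator_def)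
 \<comment> \<open>The orthogonality to the profile passes to the limit, and the limit is a multiple
   of the profile.\<close>
 have a0: "a k = 0" for k
 proof (cases "k = 3")
  case False
  have "(%m. LL x. z (sg m) k x * xp 1 x) ~~> (LL x. hz 0 w k x * xp 1 x)"
   by (rule l2_weak_limit[OF zl wl xp_l2 _ cube_borel L]) (auto simp: xp_def indicator_def split: if_splits)
  moreover have "(LL x. z (sg m) k x * xp 1 x) = 0" for m
  proof -
   have "(LL x. z (sg m) k x * xp 1 x) = (LL x. ind (cube 1) x * (z (sg m) k x * xp 1 x))"
    by (rule icong) (auto simp: xp_def indicator_def)
   then show ?thesis using *(12) False by simp
  qed
  ultimately have "(LL x. hz 0 w k x * xp 1 x) = 0" using LIMSEQ_unique[OF tendsto_const] by fastforce
  moreover have "(LL x. hz 0 w k x * xp 1 x) = (LL x. a k * (ind (cube 1) x * (xp 1 x)^2))"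
   by (rule icong) (auto simp: hx xp_def indicator_def p2eq)
  ultimately show ?thesis using k0_pos by (simp add: k0_def sq_def)
 qed (use a in simp)
 have "(%m. S3 k. sq (cube (2^0)) (%x. z (sg m) k x - hz 0 w k x)) ~~> (\<Sum>k\<in>(UNIV::3 set). 0)" by (intro tendsto_sum L)
 then have "(%m. mas 1 (z (sg m))) ~~> 0" by (simp add: hx a0 mas_def)
 then show False using *(11) LIMSEQ_unique[OF tendsto_const] by fastforce
qed

text \<open>The solution is its projection plus the excess. Both are of the order of the profile,
  since \<open>om\<close> is at most 2 and the coefficients are bounded as long as N eps 2^i <=
  1.\<close>

theorem lipschitz_dyadic:
 assumes M: "0 <= M"
 shows "\<exists>N\<ge>1. \<exists>C\<ge>0. \<forall>g u eps i. adm M g u eps & N * eps * 2^i <= 1 --> mas (1/2^i) u <= C/32^i"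
proof -
 obtain N where N: "N >= 1" "!!g u eps i. adm M g u eps & N * eps * 2^i <= 1 ==> EE u i <= N * om eps i" using excess_bound[OF M] by blast
 have "mas (1/2^i) u <= (4 * N + 6 * (k0 * (CB * N)))/32^i" if a: "adm M g u eps" and i: "N * eps * 2^i <= 1" for g u eps i
 proof -
  have e: "0 < eps" and u: "l2 (u k)" for k using a adm_l2[OF a] by (auto simp: adm_def)
  have Ni: "N * eps * 2^j <= 1" if "j <= i" for j
  proof -
   have "N * eps * 2^j <= N * eps * 2^i" using N(1) e that by (intro mult_left_mono power_increasing) auto
   then show ?thesis using i by linarith
  qed
  have EN: "EE u j <= N * om eps j" if "j <= i" for j using N(2) a Ni[OF that] by blast
  have e1: "eps * 2^i <= 1"
  proof -
   have "1 * (eps * 2^i) <= N * (eps * 2^i)" using N(1) e by (intro mult_right_mono) auto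
   then show ?thesis using i by (simp add: mult.assoc)
  qed
  define r :: real where "r = 1/2^i"
  have r: "0 < r" "r <= 1" by (auto simp: r_def)
  have E: "EE u i <= N * 2" using EN[OF order_refl] om_le[OF _ e1] e N(1) by (meson less_imp_le mult_left_mono order_trans zero_le_one)
  have "sq (cube r) (u k) <= 2 * sq (cube r) (%x. u k x - pb r u k * xp 1 x) + 2 * (k0 * (CB * N)/32^i)" for k
  proof -
   have "sq (cube r) (u k) = sq (cube r) (%x. (u k x - pb r u k * xp 1 x) + pb r u k * xp 1 x)" by simp
   also have "... <= 2 * sq (cube r) (%x. u k x - pb r u k * xp 1 x) + 2 * sq (cube r) (%x. pb r u k * xp 1 x)"
    by (intro sq_add_le l2_diff l2_cmult u xp_l2 cube_borel)
   also have "sq (cube r) (%x. pb r u k * xp 1 x) = (pb r u k)^2 * (k0/32^i)" unfolding sq_cmult xp_sq[OF r] unfolding r_def pow5 by simp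
   also have "... <= (CB * N) * (k0/32^i)"
    using bb_bounds(1)[OF a N(1) EN e1, of k] k0_pos unfolding bb_def r_def by (intro mult_right_mono) auto
   finally show ?thesis by (simp add: mult_ac)
  qed
  then have "mas r u <= (S3 k. 2 * sq (cube r) (%x. u k x - pb r u k * xp 1 x) + 2 * (k0 * (CB * N)/32^i))"
   unfolding mas_def by (rule sum_mono)
  also have "... = 2 * exc r u + 6 * (k0 * (CB * N)/32^i)"
   by (simp add: sum.distrib sum_distrib_left exc_def mas_def)
  also have "... <= 2 * (N * 2/32^i) + 6 * (k0 * (CB * N)/32^i)"
   unfolding r_def exc_EE using E by (intro add_right_mono mult_left_mono divide_right_mono) auto
  also have "... = (4 * N + 6 * (k0 * (CB * N)))/32^i" by (simp add: add_divide_distrib)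
  finally show ?thesis unfolding r_def .
 qed
 moreover have "0 <= 4 * N + 6 * (k0 * (CB * N))" using N(1) k0_pos by (simp add: CB_def)
 ultimately show ?thesis using N(1) by blast
qed

section \<open>Transfer to the weak formulation\<close>

text \<open>Mollified test functions at scales below the distance to the complement show that the
  mollification of f vanishes, and it tends to f. The sets \<open>S n\<close> use
  \<open>infdist\<close>, which is 0 for an empty complement; hence Om is proper.\<close>

lemma du_bois_reymond:
 assumes f: "l2 f" and Om: "open Om" "Om ~= UNIV" and t: "!!ps. test_fun Om ps ==> (LL x. f x * ps x) = 0"
 shows "AE3 x. x \<in> Om --> f x = 0"
proof -
 define S where "S n = {x. 1/real (Suc n) <= infdist x (- Om)}" for n
 have Sb: "S n \<in> sets borel" for n
  unfolding S_def by (intro borel_closed closed_Collect_le continuous_intros)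
 have "AE3 x. x \<in> S n --> f x = 0" for n
 proof -
  define d0 where "d0 = 1/real (Suc n)"
  have d0: "d0 > 0" by (simp add: d0_def)
  have "sq (S n) f <= 0 + e" if e: "e > 0" for e
  proof -
   obtain d where d: "d > 0" "!!s. 0 < s & s < d ==> sq UNIV (%x. conv f (ks s (kap 0)) x - f x) < e"
    using conv_ks_tendsto[OF f kap_csm kap_int e] by blast
   define s where "s = min d d0/4"
   have s: "0 < s" "s < d" "3 * s < d0" using d(1) d0 by (auto simp: s_def)
   have c: "csm (ks s (kap 0))" by (rule csm_ks[OF kap_csm s(1)])
   have z: "conv f (ks s (kap 0)) x = 0" if x: "x \<in> S n" for x
   proof -
    have "test_fun Om (%y. ks s (kap 0) (x - y))"
    proof (rule test_fun_refl[OF c closed_cball])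
     show "cball x (3 * s) \<subseteq> Om"
     proof (rule ccontr)
      assume "~cball x (3 * s) \<subseteq> Om"
      then have "\<exists>y\<in>cball x (3 * s). y \<notin> Om" by blast
      then obtain y where y: "dist x y <= 3 * s" "y \<in> - Om" by auto
      show False using infdist_le[OF y(2), of x] x y(1) s(3) by (simp add: S_def d0_def)
     qed
     show "x - p \<in> cball x (3 * s)" if "ks s (kap 0) p ~= 0" for p
      using norm3_le[of p] ks_kap_box[OF s(1) that, of 1] ks_kap_box[OF s(1) that, of 2] ks_kap_box[OF s(1) that, of 3] by (simp add: dist_norm)
    qed
    from t[OF this] show ?thesis by (simp add: conv_def mult.commute)
   qed
   have "sq (S n) f = sq (S n) (%x. conv f (ks s (kap 0)) x - f x)" unfolding sq_def
    by (rule icong) (simp add: z indicator_def)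
   also have "... <= sq UNIV (%x. conv f (ks s (kap 0)) x - f x)" by (intro sq_mono l2_diff csm_conv_l2 c f Sb) auto
   finally show ?thesis using d(2)[of s] s by simp
  qed
  then have "sq (S n) f <= 0" by (rule field_le_epsilon)
  then have "sq (S n) f = 0" using sq_nonneg[of "S n" f] by (simp add: antisym)
  from sq_zero_AE[OF f Sb this] show ?thesis .
 qed
 then have "AE3 x. \<forall>n. x \<in> S n --> f x = 0" unfolding AE_all_countable by (rule allI)
 then show ?thesis
 proof eventually_elim
  case (elim x)
  show ?case
  proof
   assume "x \<in> Om"
   then have "infdist x (- Om) > 0" using Om by (subst infdist_pos_not_in_closed) auto
   then obtain n :: nat where "1/real (Suc n) < infdist x (- Om)" using nat_approx_posE by blast
   then show "f x = 0" using elim[rule_format, of n] by (simp add: S_def)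
  qed
 qed
qed

text \<open>The graph is a Lipschitz image of a coordinate hyperplane.\<close>

lemma graph_null:
 assumes g: "lipg M g" "0 <= M" shows "AE3 x. x$3 ~= g (hor x)"
proof -
 define f :: "real^3 => real^3" where "f y = (\<chi> i. if i = 3 then g (hor y) else y$i)" for y
 have "negligible (f ` {x. x$3 = 0})"
 proof (rule negligible_locally_Lipschitz_image)
  show "negligible {x::real^3. x$3 = 0}" by (rule negligible_standard_hyperplane_cart)
  fix x :: "real^3"
  have "norm (f y - f x) <= (2 + 2 * M) * norm (y - x)" for y
  proof -
   have a: "abs(y$i - x$i) <= norm (y - x)" for i using component_le_norm_cart[of "y - x" i] by simp
   have "abs(g (hor y) - g (hor x)) <= M * (abs(y$1 - x$1) + abs(y$2 - x$2))" by (rule lipg_hor[OF g])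
   also have "... <= M * (norm (y - x) + norm (y - x))" using a g(2) by (intro mult_left_mono add_mono) auto
   finally show ?thesis using norm3_le[of "f y - f x"] a[of 1] a[of 2] by (simp add: f_def algebra_simps)
  qed
  then show "\<exists>T B. open T & x \<in> T & (\<forall>y\<in>{x. x$3 = 0} \<inter> T. norm (f y - f x) <= B * norm (y - x))"
   by (intro exI[of _ UNIV] exI[of _ "2 + 2 * M"]) auto
 qed simp
 then have "f ` {x. x$3 = 0} \<in> null_sets lebesgue" by (simp add: negligible_iff_null_sets)
 then have "AE x in lebesgue. x \<notin> f ` {x. x$3 = 0}" by (rule AE_not_in)
 then have "AE3 x. x \<notin> f ` {x. x$3 = 0}" by (simp add: AE_completion_iff)
 then show ?thesis
 proof eventually_elim
  case (elim x)
  show ?case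
  proof
   assume x: "x$3 = g (hor x)"
   define y where "y = (\<chi> i. if i = 3 then 0 else x$i)"
   have y: "hor y = hor x" "y$3 = 0" by (simp_all add: hor_def y_def vec_eq_iff)
   have "x$i = f y$i" for i using x y(1) by (cases "i = 3") (simp_all add: f_def, simp add: y_def)
   then have "x = f y" by (simp add: vec_eq_iff)
   then show False using elim y(2) by blast
  qed
 qed
qed

section \<open>Borel representatives of Lebesgue measurable data\<close>

lemma borel_lebesgue: "(f :: real^3 => real) \<in> BM ==> f \<in> borel_measurable lebesgue"
 by (rule measurable_completion) simp

text \<open>\<open>L2\<close> is a notion of Lebesgue measurability on a set, while
  \<open>l2\<close> concerns Borel functions on the whole space; this selects a Borel function that
  agrees almost everywhere with the extension by zero.\<close>

definition brl :: "(real^3) set => (real^3 => real) => real^3 => real" where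
 "brl Om v = (SOME w. w \<in> borel_measurable lborel & (AE3 x. ind Om x * v x = w x))"

lemma brl:
 assumes "L2 Om v"
 shows "l2 (brl Om v)" "AE3 x. ind Om x * v x = brl Om v x"
  "ps \<in> BM ==> (LINT x:Om|lebesgue. v x * ps x) = (LL x. brl Om v x * ps x)"
proof -
 define w where "w = brl Om v"
 have m: "(%x. ind Om x * v x) \<in> borel_measurable lebesgue" using assms by (simp add: L2_def set_borel_measurable_def)
 have "\<exists>w. w \<in> borel_measurable lborel & (AE3 x. ind Om x * v x = w x)"
  using completion_ex_borel_measurable_real[OF m] by blast
 from someI_ex[OF this] have w: "w \<in> borel_measurable lborel" and e: "AE3 x. ind Om x * v x = w x"
  unfolding w_def brl_def by blast+
 have e': "AE x in lebesgue. ind Om x * v x = w x" using e by (rule AE_completion)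
 have wl: "w \<in> borel_measurable lebesgue" using measurable_completion[OF w] .
 have "integrable lebesgue (%x. ind Om x *R (v x)^2)" using assms by (simp add: L2_def set_integrable_def)
 then have "integrable lebesgue (%x. (w x)^2)"
 proof (rule integrable_cong_AE_imp)
  show "AE x in lebesgue. ind Om x *R (v x)^2 = (w x)^2" using e' by eventually_elim (auto simp: indicator_def split: if_splits)
 qed (intro borel_measurable_power wl)
 then show "l2 (brl Om v)" using w unfolding w_def by (simp add: l2_def integrable_completion)
 show "AE3 x. ind Om x * v x = brl Om v x" using e unfolding w_def .
 assume p: "ps \<in> BM"
 have pl: "ps \<in> borel_measurable lebesgue" by (rule borel_lebesgue[OF p])
 have "(LINT x:Om|lebesgue. v x * ps x) = (LINT x|lebesgue. w x * ps x)"
  unfolding set_lebesgue_integral_def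
 proof (rule integral_cong_AE)
  show "AE x in lebesgue. ind Om x *R (v x * ps x) = w x * ps x" using e' by eventually_elim (auto simp: indicator_def split: if_splits)
  show "(%x. ind Om x *R (v x * ps x)) \<in> borel_measurable lebesgue" using borel_measurable_times[OF m pl] by (simp add: mult.assoc)
 qed (intro borel_measurable_times wl pl)
 also have "... = (LL x. w x * ps x)" by (rule integral_completion) (use borel_measurable_times[of w borel ps] w p in simp)
 finally show "(LINT x:Om|lebesgue. v x * ps x) = (LL x. brl Om v x * ps x)" unfolding w_def .
qed

text \<open>The zero trace supplies a gradient H across the graph, but the divergence is known to
  vanish only above it. The trace of H is zero above the graph since it agrees there with the
  interior gradient D, and below it since the extension is zero; the graph itself is a null set. The
  half-width 1/2 ensures that the cube stays under the top of the domain.\<close>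

lemma weak_stokes_sol_imp_sol:
 assumes s: "weak_stokes_sol eps \<gamma> u" and g: "!!y. g y = eps * \<gamma> ((1/eps) *R y)" and lip: "lipg M g" "0 <= M"
  and gb: "!!y. - (1/2) < g y" "!!y. g y < 0"
 obtains U G where "sol (1/2) g U G (%_ _ _. 0)" "!!k. AE3 x. ind (Bplus eps \<gamma> 1) x * u x$k = U k x"
proof -
 define B where "B = Bplus eps \<gamma> 1"
 define E where "E = Bext eps \<gamma>"
 define Om where "Om = cube (1/2) \<inter> above g"
 have gc: "continuous_on S (%x::real^3. g (hor x))" for S using lipg_cont[OF lip] continuous_on_subset by blast
 have cE: "cube (1/2) \<subseteq> E"
 proof
  fix x assume "x \<in> cube (1/2)"
  then have "abs(x$i) < 1/2" for i by (rule cubeD)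
  from this[of 1] this[of 2] this[of 3] show "x \<in> E" using gb(1)[of "hor x"] unfolding E_def Bext_def mem_Collect_eq g[symmetric] by linarith
 qed
 have OB: "Om \<subseteq> B"
 proof
  fix x assume x: "x \<in> Om"
  then have "x \<in> cube (1/2)" "g (hor x) < x$3" by (simp_all add: Om_def above_def)
  then show "x \<in> B" using gb(1)[of "hor x"] cubeD[of x "1/2" 1] cubeD[of x "1/2" 2] cubeD[of x "1/2" 3]
   unfolding B_def Bplus_def mem_Collect_eq g[symmetric] by linarith
 qed
 have BE: "B \<subseteq> E"
 proof
  fix x assume "x \<in> B"
  then show "x \<in> E" using gb(1)[of "hor x"] unfolding B_def Bplus_def E_def Bext_def mem_Collect_eq g[symmetric] by linarith
 qed
 have Oo: "open Om" unfolding Om_def above_def by (intro open_Int cube_open open_Collect_less gc continuous_intros)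
 have ab: "above g \<in> sets borel" unfolding above_def by (intro borel_open open_Collect_less gc continuous_intros)
 obtain G where LB': "\<forall>k. L2 B (%x. u x$k)" and G': "\<forall>k j. L2 B (G k j) & weak_deriv B j (%x. u x$k) (G k j)"
  and G3: "AE x in lebesgue. x \<in> B --> (S3 k. G k k x) = 0" and G4: "\<forall>k. H1 E (%x. if x \<in> B then u x$k else 0)"
  and G5: "\<forall>ph. test_vfun B ph --> (\<forall>x. (S3 k. pd k (%y. ph y$k) x) = 0) -->
      (LINT x:B|lebesgue. (S3 k. S3 j. G k j x * pd j (%y. ph y$k) x)) = 0"
  using s unfolding weak_stokes_sol_def Let_def B_def[symmetric] E_def[symmetric] by (elim exE conjE) (rule that)
 have LB: "L2 B (%x. u x$k)" and G: "L2 B (G k j)" "weak_deriv B j (%x. u x$k) (G k j)" for k j using LB' G' by blast+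
 have hex: "\<exists>h. L2 E h & weak_deriv E j (%x. if x \<in> B then u x$k else 0) h" for k j using G4 by (simp add: H1_def)
 define h where "h k j = (SOME h. L2 E h & weak_deriv E j (%x. if x \<in> B then u x$k else 0) h)" for k j
 have h: "L2 E (h k j)" "weak_deriv E j (%x. if x \<in> B then u x$k else 0) (h k j)" for k j
  using someI_ex[OF hex[of j k]] unfolding h_def by blast+
 define w where "w k = brl B (%x. u x$k)" for k
 note w = brl[OF LB, folded w_def]
 define H where "H k j = brl E (h k j)" for k j
 note H = brl[OF h(1), folded H_def]
 define D where "D k j = brl B (G k j)" for k j
 note D = brl[OF G(1), folded D_def]
 define U where "U k x = ind (above g) x * w k x" for k x
 have Ul: "l2 (U k)" for k unfolding U_def by (intro l2_indicator w ab)
 have BA: "x \<in> above g" if "x \<in> B" for x using that by (simp add: B_def Bplus_def above_def g)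
 have UA: "AE3 x. ind B x * u x$k = U k x" for k using w(2)[of k]
 proof eventually_elim
  case (elim x)
  then show ?case using BA[of x] by (cases "x \<in> B") (auto simp: U_def indicator_def)
 qed
 have UI: "(LINT x:S|lebesgue. v x * ps x) = (LL x. U k x * ps x)"
  if v: "!!x. ind S x * v x = ind B x * u x$k" and p: "ps \<in> BM" for S v k ps
 proof -
  have "ind S x *R (v x * ps x) = ind B x *R (u x$k * ps x)" for x using v[of x] by (simp add: mult.assoc[symmetric])
  then have "(LINT x:S|lebesgue. v x * ps x) = (LINT x:B|lebesgue. u x$k * ps x)" unfolding set_lebesgue_integral_def by (rule icong)
  also have "... = (LL x. w k x * ps x)" by (rule w(3)[OF p])
  also have "... = (LL x. U k x * ps x)"
  proof (rule integral_cong_AE)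
   show "AE3 x. w k x * ps x = U k x * ps x" using UA[of k] w(2)[of k] by eventually_elim simp
   show "(%x. w k x * ps x) \<in> borel_measurable lborel" "(%x. U k x * ps x) \<in> borel_measurable lborel"
    using borel_measurable_times[OF l2_meas[OF w(1)] p] borel_measurable_times[OF l2_meas[OF Ul] p] by simp_all
  qed
  finally show ?thesis .
 qed
 have pm: "ps \<in> BM" "pd j ps \<in> BM" if "test_fun S ps" for S ps j
  using l2_meas[OF csm_l2[OF test_fun_csm[OF that]]] l2_meas[OF csm_l2[OF csm_pd[OF test_fun_csm[OF that]]]] by auto
 have W1: "(LL x. U k x * pd j ps x) = - (LL x. H k j x * ps x)" if t: "test_fun (cube (1/2)) ps" for k j ps
 proof -
  have tE: "test_fun E ps" by (rule test_fun_mono[OF t cE])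
  have "(LL x. U k x * pd j ps x) = (LINT x:E|lebesgue. (if x \<in> B then u x$k else 0) * pd j ps x)"
   by (rule UI[symmetric]) (use BE pm[OF t] in \<open>auto simp: indicator_def\<close>)
  also have "... = - (LINT x:E|lebesgue. h k j x * ps x)" using h(2) tE by (simp add: weak_deriv_def)
  finally show ?thesis using H(3)[OF pm(1)[OF t]] by simp
 qed
 have W2: "(LL x. U k x * pd j ps x) = - (LL x. D k j x * ps x)" if t: "test_fun B ps" for k j ps
 proof -
  have "(LL x. U k x * pd j ps x) = (LINT x:B|lebesgue. u x$k * pd j ps x)"
   by (rule UI[symmetric]) (use pm[OF t] in auto)
  also have "... = - (LINT x:B|lebesgue. G k j x * ps x)" using G(2) t by (simp add: weak_deriv_def)
  finally show ?thesis using D(3)[OF pm(1)[OF t]] by simp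
 qed
 define f where "f x = (S3 k. H k k x)" for x
 have fl: "l2 f" unfolding f_def by (intro l2_sum H)
 have fI: "(LL x. f x * ps x) = - (S3 k. LL x. U k x * pd k ps x)" if t: "test_fun (cube (1/2)) ps" for ps
 proof -
  have "(LL x. f x * ps x) = (S3 k. LL x. H k k x * ps x)"
   unfolding f_def sum_distrib_right by (rule LLsum) (intro l2_prod H csm_l2 test_fun_csm[OF t])
  then show ?thesis unfolding W1[OF t] by (simp add: sum_negf)
 qed
 have nU: "S ~= UNIV" if "S \<subseteq> cube (1/2)" for S
 proof
  assume "S = UNIV"
  then have "(\<chi> i. 1) \<in> cube (1/2)" using that by blast
  from cubeD[OF this, of 1] show False by simp
 qed
 have f1: "AE3 x. x \<in> Om --> f x = 0"
 proof (rule du_bois_reymond[OF fl Oo nU])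
  fix ps assume t: "test_fun Om ps"
  have tB: "test_fun B ps" by (rule test_fun_mono[OF t OB])
  have tc: "test_fun (cube (1/2)) ps" by (rule test_fun_mono[OF t]) (simp add: Om_def)
  have c: "csm ps" by (rule test_fun_csm[OF t])
  have "(LL x. f x * ps x) = (S3 k. LL x. D k k x * ps x)" unfolding fI[OF tc] W2[OF tB] by (simp add: sum_negf)
  also have "... = (LL x. (S3 k. D k k x * ps x))"
   by (rule LLsum[symmetric]) (intro l2_prod D csm_l2 c)
  also have "... = (LL x::real^3. 0)"
  proof (rule integral_cong_AE)
   have A: "AE3 x. x \<in> B --> (S3 k. G k k x) = 0" using G3 by (simp add: AE_completion_iff)
   have "AE3 x. \<forall>k\<in>UNIV. ind B x * G k k x = D k k x" by (rule AE_finite_allI) (use D(2) in auto)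
   then show "AE3 x. (S3 k. D k k x * ps x) = 0" using A
   proof eventually_elim
    case (elim x)
    have "(S3 k. D k k x * ps x) = ind B x * (S3 k. G k k x) * ps x"
     using elim(1) by (simp add: sum_distrib_left sum_distrib_right)
    then show ?case using elim(2) by (simp add: indicator_def)
   qed
   note [measurable] = l2_meas[OF D(1)] l2_meas[OF csm_l2[OF c]]
   show "(%x. S3 k. D k k x * ps x) \<in> borel_measurable lborel" by measurable
  qed simp
  finally show "(LL x. f x * ps x) = 0" by simp
 qed (simp add: Om_def)
 define Om' where "Om' = cube (1/2) \<inter> {x. x$3 < g (hor x)}"
 have f2: "AE3 x. x \<in> Om' --> f x = 0"
 proof (rule du_bois_reymond[OF fl _ nU])
  show "open Om'" unfolding Om'_def by (intro open_Int cube_open open_Collect_less gc continuous_intros)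
  fix ps assume t: "test_fun Om' ps"
  have tc: "test_fun (cube (1/2)) ps" by (rule test_fun_mono[OF t]) (simp add: Om'_def)
  have "(LL x. U k x * pd k ps x) = (LL x::real^3. 0)" for k
  proof (rule icong)
   fix x show "U k x * pd k ps x = 0"
    using test_fun_support[OF test_fun_pd[OF t], of k x] by (cases "pd k ps x = 0") (auto simp: U_def Om'_def above_def)
  qed
  then show "(LL x. f x * ps x) = 0" unfolding fI[OF tc] by simp
 qed (simp add: Om'_def)
 have "sol (1/2) g U H (%_ _ _. 0)"
  unfolding sol_def
 proof (intro conjI allI impI)
  fix ps assume t: "test_fun (cube (1/2)) ps"
  have "(LL x. f x * ps x) = (LL x::real^3. 0)"
  proof (rule integral_cong_AE)
   show "AE3 x. f x * ps x = 0" using f1 f2 graph_null[OF lip]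
   proof eventually_elim
    case (elim x)
    then show ?case using test_fun_support[OF t, of x] by (cases "ps x = 0") (auto simp: Om_def Om'_def above_def)
   qed
   show "(%x. f x * ps x) \<in> borel_measurable lborel" using borel_measurable_times[OF l2_meas[OF fl] pm(1)[OF t]] by simp
  qed simp
  then show "(S3 k. LL x. U k x * pd k ps x) = 0" using fI[OF t] by simp
 next
  fix ph :: "3 => real^3 => real"
  assume a: "(\<forall>k. test_fun (cube (1/2) \<inter> above g) (ph k)) & (\<forall>x. (S3 k. pd k (ph k) x) = 0)"
  have t: "test_fun Om (ph k)" for k using a by (simp add: Om_def)
  have tB: "test_fun B (ph k)" "test_fun (cube (1/2)) (ph k)" for k using test_fun_mono[OF t OB] test_fun_mono[OF t, where Om' = "cube (1/2)"] by (auto simp: Om_def)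
  have HD: "(LL x. H k j x * ps x) = (LL x. D k j x * ps x)" if "ps = pd j (ph k)" for k j ps
   using W1[OF test_fun_pd[OF tB(2)], of k j j k] W2[OF test_fun_pd[OF tB(1)], of k j j k] that by simp
  define v where "v = (%x. \<chi> k. ph k x)"
  have vk: "(%y. v y$k) = ph k" for k by (simp add: v_def)
  have c: "l2 (pd j (ph k))" for j k by (intro csm_l2 csm_pd test_fun_csm[OF t])
  have "(LINT x:B|lebesgue. (S3 k. S3 j. G k j x * pd j (ph k) x)) = 0"
   using G5[rule_format, of v] tB(1) a unfolding test_vfun_def vk by simp
  moreover have "(LINT x:B|lebesgue. (S3 k. S3 j. G k j x * pd j (ph k) x)) = (LL x. (S3 k. S3 j. D k j x * pd j (ph k) x))"
  proof -
   have m: "(%x. ind B x * G k j x) \<in> borel_measurable lebesgue" for k j using G(1)[of k j] by (simp add: L2_def set_borel_measurable_def)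
   have pl: "pd j (ph k) \<in> borel_measurable lebesgue" for k j by (rule borel_lebesgue[OF l2_meas[OF c]])
   note [measurable] = l2_meas[OF D(1)] l2_meas[OF c]
   have Dm: "(%x. S3 k. S3 j. D k j x * pd j (ph k) x) \<in> borel_measurable lborel" by measurable
   have "(LINT x:B|lebesgue. (S3 k. S3 j. G k j x * pd j (ph k) x)) = (LINT x|lebesgue. (S3 k. S3 j. (ind B x * G k j x) * pd j (ph k) x))"
    unfolding set_lebesgue_integral_def by (simp add: sum_distrib_left mult.assoc)
   also have "... = (LINT x|lebesgue. (S3 k. S3 j. D k j x * pd j (ph k) x))"
   proof (rule integral_cong_AE)
    have "AE3 x. \<forall>k\<in>UNIV. \<forall>j\<in>UNIV. ind B x * G k j x = D k j x" by (intro AE_finite_allI finite_UNIV) (use D(2) in auto)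
    then have "AE3 x. (S3 k. S3 j. (ind B x * G k j x) * pd j (ph k) x) = (S3 k. S3 j. D k j x * pd j (ph k) x)"
     by eventually_elim simp
    then show "AE x in lebesgue. (S3 k. S3 j. (ind B x * G k j x) * pd j (ph k) x) = (S3 k. S3 j. D k j x * pd j (ph k) x)"
     by (rule AE_completion)
    show "(%x. S3 k. S3 j. (ind B x * G k j x) * pd j (ph k) x) \<in> borel_measurable lebesgue" by (intro borel_measurable_sum borel_measurable_times m pl)
   qed (rule measurable_completion[OF Dm])
   also have "... = (LL x. (S3 k. S3 j. D k j x * pd j (ph k) x))" by (rule integral_completion[OF Dm])
   finally show ?thesis .
  qed
  moreover have "(LL x. (S3 k. S3 j. D k j x * pd j (ph k) x)) = (S3 k. S3 j. LL x. D k j x * pd j (ph k) x)"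
   by (simp add: LLsum l2_prod D c)
  ultimately show "(S3 k. S3 j. LL x. (H k j x - 0) * pd j (ph k) x) = 0" by (simp add: HD)
 qed (use Ul H(1) W1 in \<open>auto simp: U_def\<close>)
 then show ?thesis using that UA unfolding B_def by blast
qed

text \<open>Dilation by 2 and division by the root of the mass produce an admissible solution on the
  unit cube; linearity gives the bound back.\<close>

lemma dyadic_decay:
 assumes M: "0 <= M"
 shows "\<exists>N\<ge>1. \<exists>C\<ge>0. \<forall>g U G eps j. sol (1/2) g U G (%_ _ _. 0) & lipg M g & (\<forall>y. - eps <= g y & g y <= 0) & 0 < eps & N * eps * 2^Suc j <= 1
  --> mas (1/2^Suc j) U <= C/32^j * mas (1/2) U"
proof -
 obtain N C where NC: "N >= 1" "C >= 0" "!!g u eps i. adm M g u eps ==> N * eps * 2^i <= 1 ==> mas (1/2^i) u <= C/32^i"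
  using lipschitz_dyadic[OF M] by blast
 have "mas (1/2^Suc j) U <= C/32^j * mas (1/2) U"
  if s: "sol (1/2) g U G (%_ _ _. 0)" and lip: "lipg M g" and g: "!!y. - eps <= g y" "!!y. g y <= 0" and e: "0 < eps" "N * eps * 2^Suc j <= 1" for g U G eps j
 proof (rule field_le_epsilon)
  fix e' :: real assume e': "e' > 0"
  define m where "m = mas (1/2) U"
  define d where "d = e'/(C + 1)"
  have d: "d > 0" "C * d <= e'" using e' NC(2) by (auto simp: d_def field_simps)
  have m0: "0 <= m" by (simp add: m_def)
  \<comment> \<open>The 8 is the Jacobian of the dilation; d > 0 permits zero mass and is removed at
    the end.\<close>
  define c where "c = 1/sqrt (8 * (m + d))"
  have c: "c^2 = 1/(8 * (m + d))" using m0 d by (simp add: c_def power_divide)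
  define v where "v k x = c * U k ((1/2) *R x)" for k x
  have "sol ((1/2)/(1/2)) (%y. g ((1/2) *R y)/(1/2)) v (%k j x. c * (1/2) * G k j ((1/2) *R x)) (%k j x. c * (1/2) * 0)"
   using sol_scale[OF s, of "1/2" c] unfolding v_def by simp
  then have sv: "sol 1 (%y. g ((1/2) *R y)/(1/2)) v (%k j x. c * (1/2) * G k j ((1/2) *R x)) (%_ _ _. 0)" by simp
  have mv: "mas q v = mas (1/2 * q) U/(m + d)" for q
  proof -
   have "c^2/(1/2)^3 = 1/(m + d)" unfolding c using mult_divide_mult_cancel_left[of 8 1 "m + d"] by (simp add: power3_eq_cube)
   moreover have "mas q v = c^2/(1/2)^3 * mas (1/2 * q) U"
    unfolding mas_def v_def[abs_def] sum_distrib_left by (intro sum.cong refl sq_scale) simp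
   ultimately show ?thesis by simp
  qed
  have "adm M (%y. g ((1/2) *R y)/(1/2)) v (2 * eps)"
   unfolding adm_def
  proof (intro conjI exI allI)
   show "mas 1 v <= 1" unfolding mv using m0 d by (simp add: m_def[symmetric])
   show "- (2 * eps) <= g ((1/2) *R y)/(1/2)" "g ((1/2) *R y)/(1/2) <= 0" for y using g[of "(1/2) *R y"] by auto
  qed (use sv lipg_scale[OF lip, of "1/2"] e in auto)
  from NC(3)[OF this, of j] have "mas (1/2^j) v <= C/32^j" using e(2) by (simp add: mult_ac)
  then have "mas (1/2^Suc j) U/(m + d) <= C/32^j" unfolding mv by simp
  then have "mas (1/2^Suc j) U <= C/32^j * (m + d)" using m0 d by (simp add: pos_divide_le_eq)
  also have "... = C/32^j * m + C * d/32^j" by (simp add: distrib_left)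
  also have "C * d/32^j <= C * d/1" using NC(2) d(1) by (intro divide_left_mono) auto
  finally show "mas (1/2^Suc j) U <= C/32^j * mas (1/2) U + e'" using d(2) by (simp add: m_def)
 qed
 then show ?thesis using NC(1,2) by blast
qed

lemma dyadic_radius:
 fixes r :: real assumes "0 < r" "r <= 1/2"
 obtains j where "r <= 1/2^Suc j" "1/2^Suc j < 2 * r"
proof -
 define P where "P i \<longleftrightarrow> (1/2::real)^i < r" for i
 have "\<exists>i. P i" unfolding P_def using real_arch_pow_inv[of r "1/2"] assms(1) by simp
 then have P: "P (LEAST i. P i)" "!!i. i < (LEAST i. P i) ==> ~P i" by (auto intro: LeastI_ex dest: not_less_Least)
 define i where "i = (LEAST i. P i)"
 have Pi: "(1/2)^i < r" using P(1)[folded i_def] by (simp add: P_def)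
 have "i ~= 0" "i ~= 1" using Pi assms(2) by (intro notI; simp)+
 then obtain j where j: "i = Suc (Suc j)" by (metis One_nat_def not0_implies_Suc)
 show ?thesis
 proof (rule that[of j])
  show "r <= 1/2^Suc j" using P(2)[folded i_def, of "Suc j"] unfolding j P_def by (simp add: power_one_over)
  show "1/2^Suc j < 2 * r" using Pi unfolding j by (simp add: power_one_over)
 qed
qed

theorem theorem4p1:
  fixes M :: real
  assumes "M > 0"
  shows "\<exists>\<epsilon>3 C. 0 < \<epsilon>3 \<and> \<epsilon>3 < 1 \<and>
    (\<forall>\<gamma> :: real^2 \<Rightarrow> real.
       (\<forall>y. -1 < \<gamma> y \<and> \<gamma> y < 0) \<and>
       (\<forall>y. \<bar>\<gamma> y\<bar> \<le> M) \<and> (\<forall>a b. \<bar>\<gamma> a - \<gamma> b\<bar> \<le> M * dist a b) \<longrightarrow>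
       (\<forall>\<epsilon> r u. 0 < \<epsilon> \<and> \<epsilon> \<le> \<epsilon>3 \<and> \<epsilon> / \<epsilon>3 \<le> r \<and> r \<le> 1 \<and>
          weak_stokes_sol \<epsilon> \<gamma> u \<longrightarrow>
          mean_L2 (Bplus \<epsilon> \<gamma> r) u \<le> C * r * mean_L2 (Bplus \<epsilon> \<gamma> 1) u))"
proof -
 have M0: "0 <= M" using assms by simp
 obtain N C where NC: "N >= 1" "C >= 0"
  "!!g U G eps j. sol (1/2) g U G (%_ _ _. 0) & lipg M g & (\<forall>y. - eps <= g y & g y <= 0) & 0 < eps & N * eps * 2^Suc j <= 1
   ==> mas (1/2^Suc j) U <= C/32^j * mas (1/2) U"
  using dyadic_decay[OF M0] by blast
 \<comment> \<open>Below 1/2, so that the graph stays above -1/2, and with N e3 <= 1, so that eps <=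
   e3 r makes the dyadic radius next to r admissible.\<close>
 define e3 where "e3 = 1/(2 * N + 1)"
 \<comment> \<open>For r <= 1/2 the factor is 1024 = 32 * 2^5: 32 from the index shift by one in the
   dyadic estimate and 2^5 from t < 2 r. For r > 1/2 the summand 32 suffices, since then 32 r^5 >=
   1.\<close>
 define K where "K = 1024 * C + 32"
 have e3: "0 < e3" "e3 < 1/2" "N * e3 <= 1" using NC(1) by (auto simp: e3_def field_simps)
 have K: "0 <= K" using NC(2) by (simp add: K_def)
 have "mean_L2 (Bplus eps \<gamma> r) u <= sqrt (4 * K) * r * mean_L2 (Bplus eps \<gamma> 1) u"
  if \<gamma>: "!!y. -1 < \<gamma> y & \<gamma> y < 0" "!!a b. abs(\<gamma> a - \<gamma> b) <= M * dist a b"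
   and eps: "0 < eps" "eps <= e3" and r: "eps/e3 <= r" "r <= 1" and ws: "weak_stokes_sol eps \<gamma> u" for \<gamma> eps r u
 proof -
  define g where "g y = eps * \<gamma> ((1/eps) *R y)" for y
  have gb: "- eps < g y" "g y < 0" for y
   using \<gamma>(1)[of "(1/eps) *R y"] eps(1) mult_strict_left_mono[of "-1" "\<gamma> ((1/eps) *R y)" eps] by (auto simp: g_def mult_pos_neg)
  have er: "eps <= e3 * r" using r(1) e3(1) by (simp add: pos_divide_le_eq mult.commute)
  have r0: "0 < r" using r(1) eps(1) e3(1) by (smt (verit) divide_pos_pos)
  have "e3 * r <= (1/2) * r" using e3(2) r0 by (intro mult_right_mono) auto
  then have er2: "eps <= r/2" using er by linarith
  have lip: "lipg M g" unfolding lipg_def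
  proof (intro allI)
   fix a b :: "real^2"
   have "abs(g a - g b) = eps * abs(\<gamma> ((1/eps) *R a) - \<gamma> ((1/eps) *R b))" unfolding g_def right_diff_distrib[symmetric] using eps(1) by (simp add: abs_mult)
   also have "... <= eps * (M * dist ((1/eps) *R a) ((1/eps) *R b))" using \<gamma>(2) eps(1) by (intro mult_left_mono) auto
   also have "... = M * dist a b" using eps(1) by (simp add: dist_norm scaleR_diff_right[symmetric])
   finally show "abs(g a - g b) <= M * dist a b" .
  qed
  define B where "B q = Bplus eps \<gamma> q" for q
  have Bd: "x \<in> B q \<longleftrightarrow> abs(x$1) < q & abs(x$2) < q & g (hor x) < x$3 & x$3 < g (hor x) + q" for x q by (simp add: B_def Bplus_def g_def)
  have "- (1/2) < g y" for y using gb(1)[of y] eps(2) e3(2) by linarith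
  then obtain U G where s: "sol (1/2) g U G (%_ _ _. 0)" and UA: "!!k. AE3 x. ind (B 1) x * u x$k = U k x"
   using weak_stokes_sol_imp_sol[OF ws g_def lip M0 _ gb(2)] unfolding B_def by blast
  have Ul: "l2 (U k)" for k using solD(1)[OF s] .
  have Bb: "B q \<in> sets borel" for q
  proof -
   have gc: "continuous_on UNIV (%x::real^3. g (hor x))" by (rule lipg_cont[OF lip M0])
   have "open {x. abs(x$1) < q & abs(x$2) < q & g (hor x) < x$3 & x$3 < g (hor x) + q}"
    by (intro open_Collect_conj open_Collect_less gc continuous_intros)
   moreover have "B q = {x. abs(x$1) < q & abs(x$2) < q & g (hor x) < x$3 & x$3 < g (hor x) + q}" using Bd by blast
   ultimately show ?thesis by simp
  qed
  have Bm: "B q \<subseteq> B 1" if "q <= 1" for q using that by (auto simp: Bd)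
  have Bc: "B q \<subseteq> cube q" if "eps <= q" for q
  proof
   fix x assume "x \<in> B q"
   then show "x \<in> cube q" using gb[of "hor x"] that by (intro cubeI3) (auto simp: Bd)
  qed
  define S where "S q = (LINT x:B q|lebesgue. (norm (u x))^2)" for q
  have S: "S q = (S3 k. sq (B q) (U k))" if q: "q <= 1" for q
  proof -
   have Um: "(%x. S3 k. ind (B q) x * (U k x)^2) \<in> borel_measurable lborel"
    using borel_measurable_integrable[OF sq_integrable[OF Ul Bb]] by (intro borel_measurable_sum)
   have "AE3 x. \<forall>k\<in>UNIV. ind (B 1) x * u x$k = U k x" by (rule AE_finite_allI) (use UA in auto)
   then have A: "AE3 x. ind (B q) x *R (norm (u x))^2 = (S3 k. ind (B q) x * (U k x)^2)"
   proof eventually_elim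
    case (elim x)
    show ?case
    proof (cases "x \<in> B q")
     case True
     then have "U k x = u x$k" for k using elim Bm[OF q] by (metis UNIV_I indicator_simps(1) mult_1 subsetD)
     then show ?thesis using True by (simp add: norm_sq3)
    qed simp
   qed
   have "S q = (LINT x|lebesgue. (S3 k. ind (B q) x * (U k x)^2))"
    unfolding S_def set_lebesgue_integral_def
   proof (rule integral_cong_AE[OF _ measurable_completion[OF Um] AE_completion[OF A]])
    have m: "(%x. ind (B 1) x * u x$k) \<in> borel_measurable lebesgue" for k
     using ws unfolding weak_stokes_sol_def Let_def B_def by (auto simp: L2_def set_borel_measurable_def)
    have "ind (B q) x *R (norm (u x))^2 = (S3 k. ind (B q) x * (ind (B 1) x * u x$k)^2)" for x
     using Bm[OF q] by (auto simp: indicator_def norm_sq3)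
    moreover have "(%x. S3 k. ind (B q) x * (ind (B 1) x * u x$k)^2) \<in> borel_measurable lebesgue"
     by (intro borel_measurable_sum borel_measurable_times borel_measurable_power m borel_measurable_indicator) (use Bb in simp)
    ultimately show "(%x. ind (B q) x *R (norm (u x))^2) \<in> borel_measurable lebesgue" by simp
   qed
   also have "... = (LL x. (S3 k. ind (B q) x * (U k x)^2))" by (rule integral_completion[OF Um])
   also have "... = (S3 k. sq (B q) (U k))" unfolding sq_def by (rule LLsum) (rule sq_integrable[OF Ul Bb])
   finally show ?thesis .
  qed
  have S0: "0 <= S 1" unfolding S[OF order_refl] by (intro sum_nonneg) auto
  have mS: "mas (1/2) U <= S 1"
   unfolding S[OF order_refl] mas_def
  proof (rule sum_mono)
   fix k
   have "sq (cube (1/2)) (U k) <= sq UNIV (U k)" by (intro sq_mono Ul) auto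
   also have "... = sq (B 1) (U k)"
    unfolding sq_def
   proof (rule integral_cong_AE)
    show "AE3 x. ind UNIV x * (U k x)^2 = ind (B 1) x * (U k x)^2" using UA[of k]
     by eventually_elim (auto simp: indicator_def split: if_splits)
   qed (use borel_measurable_integrable[OF sq_integrable[OF Ul Bb]] borel_measurable_integrable[OF sq_integrable[OF Ul, of UNIV]] in auto)
   finally show "sq (cube (1/2)) (U k) <= sq (B 1) (U k)" .
  qed
  have main: "S r <= K * r^5 * S 1"
  proof (cases "r <= 1/2")
   case True
   obtain j where j: "r <= 1/2^Suc j" "1/2^Suc j < 2 * r" using dyadic_radius[OF r0 True] by blast
   define t :: real where "t = 1/2^Suc j"
   have "N * eps * 2^Suc j <= 1"
   proof -
    have "N * eps <= N * (e3 * r)" using er NC(1) by (intro mult_left_mono) auto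
    also have "... = (N * e3) * r" by simp
    also have "... <= 1 * r" using e3(3) r0 by (intro mult_right_mono) auto
    also have "... <= 1/2^Suc j" using j(1) by simp
    finally show ?thesis by (simp add: pos_le_divide_eq)
   qed
   then have D: "mas t U <= C/32^j * mas (1/2) U"
    unfolding t_def using s lip gb eps(1) by (intro NC(3)[where g = g and G = G and eps = eps]) (auto intro: less_imp_le)
   have "B r \<subseteq> cube t" using Bc[of r] cube_mono[OF j(1)] er2 r0 unfolding t_def by force
   then have "S r <= mas t U" unfolding S[OF r(2)] mas_def by (intro sum_mono sq_mono Ul Bb cube_borel)
   also have "... <= C/32^j * S 1" using D mS NC(2) by (meson divide_nonneg_pos mult_left_mono order_trans zero_less_numeral zero_less_power)
   also have "C/32^j = 32 * C * t^5" unfolding t_def pow5 by simp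
   also have "32 * C * t^5 * S 1 <= 32 * C * (2 * r)^5 * S 1"
    using j(2) NC(2) S0 unfolding t_def by (intro mult_right_mono mult_left_mono power_mono) auto
   also have "... = 1024 * C * r^5 * S 1" by (simp add: power_mult_distrib)
   also have "... <= K * r^5 * S 1" using r0 S0 unfolding K_def by (intro mult_right_mono) auto
   finally show ?thesis .
  next
   case False
   have "S r <= S 1" unfolding S[OF r(2)] S[OF order_refl] by (intro sum_mono sq_mono Ul Bb Bm r)
   also have "... <= (32 * r^5) * S 1"
   proof -
    have "(1/2)^5 <= r^5" using False by (intro power_mono) auto
    then have "1 <= 32 * r^5" by (simp add: power_one_over)
    then show ?thesis using mult_right_mono[OF _ S0] by fastforce
   qed
   also have "... <= K * r^5 * S 1" using r0 S0 NC(2) unfolding K_def by (intro mult_right_mono) auto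
   finally show ?thesis .
  qed
  have fm: "B q \<in> fmeasurable lborel" if "eps <= q" for q
   using bounded_subset[OF cube_bounded Bc[OF that]] Bb by (intro fmeasurableI emeasure_bounded_finite) auto
  have ml: "measure lebesgue (B q) = measure lborel (B q)" for q using Bb by (simp add: measure_completion)
  \<comment> \<open>The slab between the plane and height r/2 lies in the domain because eps <= r/2.
    Dividing r^5 by this volume leaves r^2, that is, the factor r after taking the root.\<close>
  have mr: "2 * r^3 <= measure lebesgue (B r)"
  proof -
   define L where "L = cube r \<inter> {x::real^3. 0 < x$3 & x$3 < r/2}"
   have "(LL x. ind L x) = 4 * r^2 * (r/2 - 0)" unfolding L_def by (rule slab_integral(1)) (use r0 in auto)
   then have "2 * r^3 = measure lborel L" by (simp add: p2eq power3_eq_cube)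
   also have "... <= measure lborel (B r)"
   proof (rule measure_mono_fmeasurable[OF _ _ fm])
    show "L \<subseteq> B r"
    proof
     fix x assume "x \<in> L"
     then show "x \<in> B r" using gb[of "hor x"] er2 cubeD[of x r 1] cubeD[of x r 2] unfolding Bd L_def by auto
    qed
    have "{x::real^3. 0 < x$3 & x$3 < r/2} \<in> sets borel" by (intro borel_open open_Collect_conj open_Collect_less continuous_intros)
    then show "L \<in> sets lborel" unfolding L_def by simp
    show "eps <= r" using er2 r0 by simp
   qed
   finally show ?thesis unfolding ml .
  qed
  have m1: "measure lebesgue (B 1) <= 8"
  proof -
   have e1: "eps <= 1" using eps(2) e3(2) by simp
   have cu: "cube 1 = cube 1 \<inter> {x. - 1 < x$3 & x$3 < 1}" using cubeD[of _ 1 3] by (fastforce simp: abs_less_iff)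
   have "(LL x. ind (cube 1) x) = 4 * 1^2 * (1 - (- 1 :: real))" by (subst cu, rule slab_integral(1)) auto
   then have "measure lborel (cube 1) = 8" by simp
   moreover have "measure lborel (B 1) <= measure lborel (cube 1)"
    using Bc[OF e1] Bb by (intro measure_mono_fmeasurable fmeasurableI emeasure_bounded_finite cube_bounded) auto
   ultimately show ?thesis unfolding ml by simp
  qed
  have m1p: "0 < measure lebesgue (B 1)"
  proof -
   have "0 < 2 * r^3" using r0 by simp
   also have "... <= measure lborel (B r)" using mr unfolding ml .
   also have "... <= measure lborel (B 1)" using Bb by (intro measure_mono_fmeasurable Bm r fm) (use eps(2) e3(2) in auto)
   finally show ?thesis unfolding ml .
  qed
  have "(1/measure lebesgue (B r)) * S r <= (1/(2 * r^3)) * (K * r^5 * S 1)"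
  proof (rule mult_mono[OF _ main])
   have "0 < 2 * r^3" using r0 by simp
   moreover have "0 < measure lebesgue (B r)" using mr calculation by linarith
   ultimately show "1/measure lebesgue (B r) <= 1/(2 * r^3)" using mr by (intro divide_left_mono mult_pos_pos) auto
   show "0 <= S r" unfolding S[OF r(2)] by (intro sum_nonneg) auto
  qed (use r0 in auto)
  also have "... = (4 * K) * r^2 * ((1/8) * S 1)" using r0 by (simp add: p2eq power3_eq_cube eval_nat_numeral)
  also have "... <= (4 * K) * r^2 * ((1/measure lebesgue (B 1)) * S 1)"
   using m1 m1p K S0 by (intro mult_left_mono mult_right_mono divide_left_mono) auto
  finally have "sqrt ((1/measure lebesgue (B r)) * S r) <= sqrt ((4 * K) * r^2 * ((1/measure lebesgue (B 1)) * S 1))" by (rule real_sqrt_le_mono)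
  also have "... = sqrt (4 * K) * r * sqrt ((1/measure lebesgue (B 1)) * S 1)" using r0 by (simp only: real_sqrt_mult real_sqrt_abs)
  finally show ?thesis unfolding mean_L2_def S_def B_def .
 qed
 then show ?thesis using e3 by (intro exI[of _ e3] exI[of _ "sqrt (4 * K)"]) auto
qed

end
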